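(* Assume that $u(0)=\phi_0^\sharp\in \mathcal C^{3/2-\epsilon}$. There exists $T^\ast>0$ such that for all $T<T^\ast$ the equation $$\mathcal L u = \Bigl(-3V+9\bigl(|\nabla V|^2-\tfrac b3\bigr)\Bigr)(u+Y)-6\nabla V\cdot\nabla u-6\bigl(\nabla V\cdot\nabla Y-b\,e^{3V}W\bigr)-e^{3V}\Bigl[3Z\bigl(e^{-3V}(u+Y)-W\bigr)^2+\bigl(e^{-3V}(u+Y)-W\bigr)^3\Bigr],$$ with $u(0)=\phi_0^\sharp$, equivalently $$\mathcal L u=-6\nabla V\cdot\nabla u-e^{-6V}u^3+Z_2u^2+Z_1u+Z_0,\qquad u(0)=\phi_0^\sharp,$$ has a unique solution $u\in C_T\mathcal C^{3/2-\epsilon}$, and this solution depends continuously on $$\mathbb Z=(V,Z_0,Z_1,Z_2)\in\bigcap_{\epsilon'>0}\bigl(C_T\mathcal C^{1-\epsilon'}\times (C_T\mathcal C^{-1/2-\epsilon'})^3\bigr)$$ and on $\phi_0^\sharp\in\mathcal C^{3/2-\epsilon}$. Thus, in particular, its limit as the mollification parameter $\eta\to0$ exists and is independent of the specific mollification used for $\xi_\eta$. Moreover, if $T^\ast<\infty$, then $\lim_{t\uparrow T^\ast}\|u(t)\|_{\mathcal C^{3/2-\epsilon}}=\infty$.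
   Context: Function spaces. $\mathbb T^3=(\mathbb R/\mathbb Z)^3$; $(\Delta_j)_{j\ge-1}$ are the Littlewood–Paley blocks on $\mathbb T^3$; $\|u\|_{\mathcal C^\alpha}=\sup_{j\ge-1}2^{j\alpha}\|\Delta_ju\|_{L^\infty}$ for $\alpha\in\mathbb R$ (Hölder–Besov space $\mathcal C^\alpha$); $C_T\mathcal C^\alpha=C([0,T],\mathcal C^\alpha)$ with the norm $\max_{t\in[0,T]}\|u(t)\|_{\mathcal C^\alpha}$. $\epsilon>0$ is fixed and sufficiently small ($\epsilon<1/6$ suffices). Products of elements of $\mathcal C^\alpha$ and $\mathcal C^\beta$ with $\alpha+\beta>0$ are the canonical continuous extensions of the pointwise product. Solutions are understood in the mild sense with respect to the semigroup $(P_t)_{t\ge0}$ generated by $\Delta-1$ (i.e. $P_t=e^{t(\Delta-1)}$). Resonant product: $u\circ v=\sum_{|i-j|\le1}\Delta_iu\,\Delta_jv$. Noise terms. Let $\mathcal L=\partial_t-\Delta+1$, let $\xi$ be a space-time white noise on $\mathbb R\times\mathbb T^3$, and let $\xi_\eta$ ($\eta>0$) be a suitable mollification of $\xi$. All the following objects depend on $\eta$, which is suppressed from the notation: $Z$ is the stationary solution of $\mathcal LZ=\xi_\eta$; $a=a_\eta$, $b=b_\eta$ are suitable deterministic constants (diverging as $\eta\to0$); $\llbracket Z^2\rrbracket=Z^2-a$; $V$ solves $\mathcal LV=\llbracket Z^2\rrbracket$, $V(0)=0$; $W$ solves $\mathcal LW=Z^3-3aZ$, $W(0)=0$; $Y$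 solves $\mathcal LY=3e^{3V}\bigl(W\llbracket Z^2\rrbracket-b(Z+W)\bigr)$, $Y(0)=0$. The constants $a,b$ are such that, as $\eta\to0$, the following terms converge, for every $\epsilon'>0$ and $T>0$, to limits not depending on the mollification: $Z$ in $C_T\mathcal C^{-1/2-\epsilon'}$, $\llbracket Z^2\rrbracket$ in $C_T\mathcal C^{-1-\epsilon'}$, $W$ in $C_T\mathcal C^{1/2-\epsilon'}$, $V$ in $C_T\mathcal C^{1-\epsilon'}$, $W\circ Z$, $V\circ\llbracket Z^2\rrbracket-\frac b3$ and $|\nabla V|^2-\frac b3$ in $C_T\mathcal C^{-\epsilon'}$, and $W\circ\llbracket Z^2\rrbracket-bZ$ in $C_T\mathcal C^{-1/2-\epsilon'}$. Also $Y$ converges in $C_T\mathcal C^{1-\epsilon'}$ and $\nabla V\cdot\nabla Y-b\,e^{3V}W$ converges in $C_T\mathcal C^{-\epsilon'}$ (these facts are taken as given). With $p=e^{-3V}Y-W$, set $$Z_2=-3e^{-3V}(Z+p),\qquad Z_1=-3V+9\bigl(|\nabla V|^2-\tfrac b3\bigr)-6Zp-3p^2,$$ $$Z_0=\Bigl(-3V+9\bigl(|\nabla V|^2-\tfrac b3\bigr)\Bigr)Y-6\bigl(\nabla V\cdot\nabla Y-b\,e^{3V}W\bigr)-e^{3V}(3Zp^2+p^3);$$ these are the coefficients obtained by expanding the nonlinearity, and $Z_0,Z_1,Z_2\in C_T\mathcal C^{-1/2-\epsilon'}$ for every $T,\epsilon'>0$, converging in these spaces as $\eta\to0$. Convention: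 every equation or inequality is understood for all $\eta>0$ with constants independent of $\eta$, and in the limit $\eta\to0$ via the limiting objects; everything is pathwise, for a realization of the noise for which, as $\eta\to0$ and for every $\epsilon'>0$ and $T>0$, $Z$, $W\circ\llbracket Z^2\rrbracket-bZ$, $Z_0$, $Z_1$ and $Z_2$ converge in $C_T\mathcal C^{-1/2-\epsilon'}$, $\llbracket Z^2\rrbracket$ converges in $C_T\mathcal C^{-1-\epsilon'}$, $W$ converges in $C_T\mathcal C^{1/2-\epsilon'}$, $V$ and $Y$ converge in $C_T\mathcal C^{1-\epsilon'}$, and $W\circ Z$, $V\circ\llbracket Z^2\rrbracket-\frac b3$, $|\nabla V|^2-\frac b3$ and $\nabla V\cdot\nabla Y-b\,e^{3V}W$ converge in $C_T\mathcal C^{-\epsilon'}$. (The original unknown is $\phi$ solving $\mathcal L\phi=-\phi^3+(3a-3b)\phi+\xi_\eta$, $\phi(0)=Z(0)+\phi_0^\sharp$, related to $u$ by $u=e^{3V}(\phi-Z+W)-Y$.)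
   Formalization: The space C^α is taken as the closure of the smooth functions in the stated norm; for initial values of finite norm outside this closure, no solution continuous in time with values in C^{3/2-ε} exists, since P_tφ does not converge to φ in norm as t→0. *)

theory Defs
  imports "HOL-Probability.Probability"
begin

section \<open>Smooth functions, the torus, Fourier coefficients\<close>

primrec Ck :: "nat \<Rightarrow> ('a::euclidean_space \<Rightarrow> real) \<Rightarrow> bool" where
  "Ck 0 f \<longleftrightarrow> continuous_on UNIV f"
| "Ck (Suc n) f \<longleftrightarrow> f differentiable_on UNIV \<and>
     (\<forall>b\<in>Basis. Ck n (\<lambda>x. frechet_derivative f (at x) b))"

definition smooth :: "('a::euclidean_space \<Rightarrow> real) \<Rightarrow> bool" where
  "smooth f \<longleftrightarrow> (\<forall>n. Ck n f)"

text \<open>All partial derivatives of order at most \<open>n\<close> are bounded by \<open>B\<close>.\<close>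
primrec Ck_bounded :: "nat \<Rightarrow> real \<Rightarrow> ('a::euclidean_space \<Rightarrow> real) \<Rightarrow> bool" where
  "Ck_bounded 0 B f \<longleftrightarrow> (\<forall>x. \<bar>f x\<bar> \<le> B)"
| "Ck_bounded (Suc n) B f \<longleftrightarrow> (\<forall>x. \<bar>f x\<bar> \<le> B) \<and>
     (\<forall>b\<in>Basis. Ck_bounded n B (\<lambda>x. frechet_derivative f (at x) b))"

definition grad :: "(real^3 \<Rightarrow> real) \<Rightarrow> real^3 \<Rightarrow> real^3" where
  "grad f x = (\<chi> i. frechet_derivative f (at x) (axis i 1))"

text \<open>Functions on the torus \<open>(\<real>/\<int>)\<^sup>3\<close> are functions on \<open>\<real>\<^sup>3\<close> with period 1 in every coordinate.\<close>
definition periodic :: "(real^3 \<Rightarrow> real) \<Rightarrow> bool" where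
  "periodic f \<longleftrightarrow> (\<forall>x i. f (x + axis i 1) = f x)"

definition smooth_torus :: "(real^3 \<Rightarrow> real) \<Rightarrow> bool" where
  "smooth_torus f \<longleftrightarrow> smooth f \<and> periodic f"

definition unit_cube :: "(real^3) set" where
  "unit_cube = cbox 0 One"

definition freq :: "int^3 \<Rightarrow> real^3" where
  "freq k = (\<chi> i. real_of_int (k $ i))"

text \<open>A distribution on the torus is represented by the family of its Fourier coefficients
  \<open>u k = \<langle>u, exp(-2\<pi>i k\<cdot>x)\<rangle>\<close>; the families which occur are exactly those of polynomial growth, and
  the distribution is real-valued iff the coefficients are Hermitian.\<close>
type_synonym coeffs = "int^3 \<Rightarrow> complex"

definition torus_distr :: "coeffs \<Rightarrow> bool" where
  "torus_distr u \<longleftrightarrow> (\<forall>k. u (- k) = cnj (u k)) \<and>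
     (\<exists>C N. \<forall>k. cmod (u k) \<le> C * (1 + norm (freq k)) ^ N)"

text \<open>The distribution given by a continuous function on the torus.\<close>
definition fcoef :: "(real^3 \<Rightarrow> real) \<Rightarrow> coeffs" where
  "fcoef f k = integral unit_cube (\<lambda>x. of_real (f x) * cis (- 2 * pi * (freq k \<bullet> x)))"

definition dpartial :: "3 \<Rightarrow> coeffs \<Rightarrow> coeffs" where
  "dpartial i u k = 2 * of_real pi * \<i> * of_int (k $ i) * u k"

text \<open>\<open>P\<^sub>t = exp(t(\<Delta> - 1))\<close>\<close>
definition heat :: "real \<Rightarrow> coeffs \<Rightarrow> coeffs" where
  "heat t u k = of_real (exp (- t * (1 + 4 * pi\<^sup>2 * (norm (freq k))\<^sup>2))) * u k"

text \<open>\<open>u(t) = P\<^sub>t u\<^sub>0 + \<integral>\<^sub>0\<^sup>t P\<^sub>t\<^sub>-\<^sub>s F(s) ds\<close> on \<open>[0,T]\<close>, i.e. \<open>u\<close> solves \<open>(\<partial>\<^sub>t - \<Delta> + 1) u = F\<close>, \<open>u(0) = u\<^sub>0\<close>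
  in the mild sense. The integral of distributions is taken Fourier mode by Fourier mode.\<close>
definition mild :: "real \<Rightarrow> coeffs \<Rightarrow> (real \<Rightarrow> coeffs) \<Rightarrow> (real \<Rightarrow> coeffs) \<Rightarrow> bool" where
  "mild T u0 F u \<longleftrightarrow> (\<forall>t\<in>{0..T}. \<forall>k.
     ((\<lambda>s. heat (t - s) (F s) k) has_integral (u t k - heat t u0 k)) {0..t})"

section \<open>Littlewood--Paley blocks, Hoelder--Besov spaces, products\<close>

text \<open>\<open>\<theta> j\<close>, for \<open>j \<ge> -1\<close>, is the symbol of the Littlewood--Paley block \<open>\<Delta>\<^sub>j\<close>.\<close>
definition dyadic_partition :: "(int \<Rightarrow> real^3 \<Rightarrow> real) \<Rightarrow> bool" where
  "dyadic_partition \<theta> \<longleftrightarrow> (\<exists>\<chi>0 \<rho> r R.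
     smooth \<chi>0 \<and> smooth \<rho> \<and> (\<forall>x. 0 \<le> \<chi>0 x \<and> 0 \<le> \<rho> x) \<and>
     (\<forall>x y. norm x = norm y \<longrightarrow> \<chi>0 x = \<chi>0 y \<and> \<rho> x = \<rho> y) \<and>
     0 < r \<and> r < R \<and>
     (\<forall>x. \<chi>0 x \<noteq> 0 \<longrightarrow> norm x \<le> R) \<and> (\<forall>x. \<rho> x \<noteq> 0 \<longrightarrow> r \<le> norm x \<and> norm x \<le> R) \<and>
     \<theta> (- 1) = \<chi>0 \<and> (\<forall>j::nat. \<theta> (int j) = (\<lambda>x. \<rho> (x /\<^sub>R 2 ^ j))) \<and>
     (\<forall>x. (\<lambda>j::nat. \<theta> (int j) x) sums (1 - \<theta> (- 1) x)) \<and>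
     (\<forall>i\<ge>-1. \<forall>j\<ge>-1. 1 < \<bar>i - j\<bar> \<longrightarrow>
        closure {x. \<theta> i x \<noteq> 0} \<inter> closure {x. \<theta> j x \<noteq> 0} = {}))"

text \<open>\<open>\<Delta>\<^sub>j u\<close>, a trigonometric polynomial. For Hermitian \<open>u\<close> the sum is real, because the symbols are even.\<close>
definition LP :: "(int \<Rightarrow> real^3 \<Rightarrow> real) \<Rightarrow> int \<Rightarrow> coeffs \<Rightarrow> real^3 \<Rightarrow> real" where
  "LP \<theta> j u x = Re (\<Sum>k\<in>{k. \<theta> j (freq k) \<noteq> 0}.
     of_real (\<theta> j (freq k)) * u k * cis (2 * pi * (freq k \<bullet> x)))"

definition lowfreq :: "(int \<Rightarrow> real^3 \<Rightarrow> real) \<Rightarrow> nat \<Rightarrow> coeffs \<Rightarrow> real^3 \<Rightarrow> real" where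
  "lowfreq \<theta> n u x = (\<Sum>j\<in>{-1..int n}. LP \<theta> j u x)"

text \<open>Value at \<open>x\<close> of a distribution of positive regularity, \<open>u(x) = \<Sum>\<^sub>j \<Delta>\<^sub>j u(x)\<close>.\<close>
definition pval :: "(int \<Rightarrow> real^3 \<Rightarrow> real) \<Rightarrow> coeffs \<Rightarrow> real^3 \<Rightarrow> real" where
  "pval \<theta> u x = lim (\<lambda>n. lowfreq \<theta> n u x)"

text \<open>The product \<open>uv = \<Sum>\<^sub>i\<^sub>,\<^sub>j \<Delta>\<^sub>i u \<Delta>\<^sub>j v\<close>, as the distributional limit of the pointwise products of the
  truncations \<open>\<Sum>\<^sub>j\<^sub>\<le>\<^sub>n \<Delta>\<^sub>j u\<close> and \<open>\<Sum>\<^sub>j\<^sub>\<le>\<^sub>n \<Delta>\<^sub>j v\<close>. It exists if the regularities of \<open>u\<close> and \<open>v\<close> have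
  positive sum, and is then the continuous extension of the pointwise product.\<close>
definition dprod :: "(int \<Rightarrow> real^3 \<Rightarrow> real) \<Rightarrow> coeffs \<Rightarrow> coeffs \<Rightarrow> coeffs" where
  "dprod \<theta> u v k = lim (\<lambda>n. fcoef (\<lambda>x. lowfreq \<theta> n u x * lowfreq \<theta> n v x) k)"

definition resonant :: "(int \<Rightarrow> real^3 \<Rightarrow> real) \<Rightarrow> coeffs \<Rightarrow> coeffs \<Rightarrow> coeffs" where
  "resonant \<theta> u v k = lim (\<lambda>n::nat. fcoef (\<lambda>x.
     \<Sum>(i,j)\<in>{(i,j). i \<in> {-1..int n} \<and> j \<in> {-1..int n} \<and> \<bar>i - j\<bar> \<le> 1}.
       LP \<theta> i u x * LP \<theta> j v x) k)"

definition block_norm :: "(int \<Rightarrow> real^3 \<Rightarrow> real) \<Rightarrow> real \<Rightarrow> coeffs \<Rightarrow> int \<Rightarrow> real" where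
  "block_norm \<theta> \<alpha> u j = 2 powr (real_of_int j * \<alpha>) * (SUP x. \<bar>LP \<theta> j u x\<bar>)"

definition hnorm :: "(int \<Rightarrow> real^3 \<Rightarrow> real) \<Rightarrow> real \<Rightarrow> coeffs \<Rightarrow> real" where
  "hnorm \<theta> \<alpha> u = (SUP j\<in>{-1..}. block_norm \<theta> \<alpha> u j)"

text \<open>\<open>\<C>\<^sup>\<alpha>\<close> is the closure of the smooth functions in the norm \<^const>\<open>hnorm\<close>. On the space of
  all distributions of finite norm, smooth functions are not dense (so continuous extensions from them are
  not determined) and the heat semigroup is not strongly continuous at time 0 (so for some initial
  values there is no mild solution that is continuous in time with values in that space).\<close>
definition Hoelder :: "(int \<Rightarrow> real^3 \<Rightarrow> real) \<Rightarrow> real \<Rightarrow> coeffs set" where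
  "Hoelder \<theta> \<alpha> = {u. torus_distr u \<and> bdd_above (block_norm \<theta> \<alpha> u ` {-1..}) \<and>
     (\<forall>\<delta>>0. \<exists>f. smooth_torus f \<and> hnorm \<theta> \<alpha> (u - fcoef f) < \<delta>)}"

definition CT :: "(int \<Rightarrow> real^3 \<Rightarrow> real) \<Rightarrow> real \<Rightarrow> real \<Rightarrow> (real \<Rightarrow> coeffs) set" where
  "CT \<theta> \<alpha> T = {u. (\<forall>t\<in>{0..T}. u t \<in> Hoelder \<theta> \<alpha>) \<and>
     (\<forall>t\<in>{0..T}. ((\<lambda>s. hnorm \<theta> \<alpha> (u s - u t)) \<longlongrightarrow> 0) (at t within {0..T}))}"

definition CT_norm :: "(int \<Rightarrow> real^3 \<Rightarrow> real) \<Rightarrow> real \<Rightarrow> real \<Rightarrow> (real \<Rightarrow> coeffs) \<Rightarrow> real" where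
  "CT_norm \<theta> \<alpha> T u = (SUP t\<in>{0..T}. hnorm \<theta> \<alpha> (u t))"

section \<open>The equation\<close>

text \<open>The data \<open>(V, Z\<^sub>0, Z\<^sub>1, Z\<^sub>2)\<close> of the equation, as functions of time.\<close>
type_synonym zdata =
  "(real \<Rightarrow> coeffs) \<times> (real \<Rightarrow> coeffs) \<times> (real \<Rightarrow> coeffs) \<times> (real \<Rightarrow> coeffs)"

definition zspace :: "(int \<Rightarrow> real^3 \<Rightarrow> real) \<Rightarrow> real \<Rightarrow> zdata set" where
  "zspace \<theta> T = {(V, Z0, Z1, Z2). \<forall>\<epsilon>'>0. V \<in> CT \<theta> (1 - \<epsilon>') T \<and>
     Z0 \<in> CT \<theta> (- 1/2 - \<epsilon>') T \<and> Z1 \<in> CT \<theta> (- 1/2 - \<epsilon>') T \<and> Z2 \<in> CT \<theta> (- 1/2 - \<epsilon>') T}"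

text \<open>The distances, for \<open>\<epsilon>' > 0\<close>, generating the topology of \<^const>\<open>zspace\<close>. Up to constants they
  increase as \<open>\<epsilon>'\<close> decreases, so the balls for single \<open>\<epsilon>'\<close> form a neighbourhood base.\<close>
fun zdist :: "(int \<Rightarrow> real^3 \<Rightarrow> real) \<Rightarrow> real \<Rightarrow> real \<Rightarrow> zdata \<Rightarrow> zdata \<Rightarrow> real" where
  "zdist \<theta> \<epsilon>' T (V, Z0, Z1, Z2) (V', Z0', Z1', Z2') =
     CT_norm \<theta> (1 - \<epsilon>') T (\<lambda>t. V t - V' t) +
     CT_norm \<theta> (- 1/2 - \<epsilon>') T (\<lambda>t. Z0 t - Z0' t) +
     CT_norm \<theta> (- 1/2 - \<epsilon>') T (\<lambda>t. Z1 t - Z1' t) +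
     CT_norm \<theta> (- 1/2 - \<epsilon>') T (\<lambda>t. Z2 t - Z2' t)"

text \<open>\<open>- 6 \<nabla>V\<cdot>\<nabla>u - e\<^sup>-\<^sup>6\<^sup>V u\<^sup>3 + Z\<^sub>2 u\<^sup>2 + Z\<^sub>1 u + Z\<^sub>0\<close>\<close>
definition rhs :: "(int \<Rightarrow> real^3 \<Rightarrow> real) \<Rightarrow> coeffs \<Rightarrow> coeffs \<Rightarrow> coeffs \<Rightarrow> coeffs \<Rightarrow> coeffs \<Rightarrow> coeffs" where
  "rhs \<theta> V Z0 Z1 Z2 u k =
     - 6 * (\<Sum>i\<in>UNIV. dprod \<theta> (dpartial i V) (dpartial i u) k)
     - fcoef (\<lambda>x. exp (- 6 * pval \<theta> V x) * (pval \<theta> u x) ^ 3) k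
     + dprod \<theta> Z2 (fcoef (\<lambda>x. (pval \<theta> u x)\<^sup>2)) k
     + dprod \<theta> Z1 u k
     + Z0 k"

fun solution :: "(int \<Rightarrow> real^3 \<Rightarrow> real) \<Rightarrow> real \<Rightarrow> real \<Rightarrow> zdata \<Rightarrow> coeffs \<Rightarrow> (real \<Rightarrow> coeffs) \<Rightarrow> bool" where
  "solution \<theta> \<epsilon> T (V, Z0, Z1, Z2) \<phi> u \<longleftrightarrow>
     u \<in> CT \<theta> (3/2 - \<epsilon>) T \<and> u 0 = \<phi> \<and>
     mild T \<phi> (\<lambda>t. rhs \<theta> (V t) (Z0 t) (Z1 t) (Z2 t) (u t)) u"

definition unique_solution ::
    "(int \<Rightarrow> real^3 \<Rightarrow> real) \<Rightarrow> real \<Rightarrow> real \<Rightarrow> zdata \<Rightarrow> coeffs \<Rightarrow> (real \<Rightarrow> coeffs) \<Rightarrow> bool" where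
  "unique_solution \<theta> \<epsilon> T \<Z> \<phi> u \<longleftrightarrow> solution \<theta> \<epsilon> T \<Z> \<phi> u \<and>
     (\<forall>v. solution \<theta> \<epsilon> T \<Z> \<phi> v \<longrightarrow> (\<forall>t\<in>{0..T}. v t = u t))"

text \<open>The unexpanded equation, for smooth \<open>Z, V, W, Y\<close>:
  \<open>(-3V + 9(|\<nabla>V|\<^sup>2 - b/3))(u + Y) - 6 \<nabla>V\<cdot>\<nabla>u - 6 (\<nabla>V\<cdot>\<nabla>Y - b e\<^sup>3\<^sup>V W)
    - e\<^sup>3\<^sup>V (3 Z (e\<^sup>-\<^sup>3\<^sup>V (u + Y) - W)\<^sup>2 + (e\<^sup>-\<^sup>3\<^sup>V (u + Y) - W)\<^sup>3)\<close>\<close>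
definition rhs_unexpanded :: "(int \<Rightarrow> real^3 \<Rightarrow> real) \<Rightarrow> real \<Rightarrow> (real^3 \<Rightarrow> real) \<Rightarrow> (real^3 \<Rightarrow> real) \<Rightarrow>
    (real^3 \<Rightarrow> real) \<Rightarrow> (real^3 \<Rightarrow> real) \<Rightarrow> coeffs \<Rightarrow> real^3 \<Rightarrow> real" where
  "rhs_unexpanded \<theta> b Z V W Y u x =
     (- 3 * V x + 9 * (grad V x \<bullet> grad V x - b / 3)) * (pval \<theta> u x + Y x)
     - 6 * (\<Sum>i\<in>UNIV. grad V x $ i * pval \<theta> (dpartial i u) x)
     - 6 * (grad V x \<bullet> grad Y x - b * exp (3 * V x) * W x)
     - exp (3 * V x) *
       (3 * Z x * (exp (- 3 * V x) * (pval \<theta> u x + Y x) - W x)\<^sup>2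
        + (exp (- 3 * V x) * (pval \<theta> u x + Y x) - W x) ^ 3)"

definition solution_unexpanded :: "(int \<Rightarrow> real^3 \<Rightarrow> real) \<Rightarrow> real \<Rightarrow> real \<Rightarrow> real \<Rightarrow>
    (real \<Rightarrow> real^3 \<Rightarrow> real) \<Rightarrow> (real \<Rightarrow> real^3 \<Rightarrow> real) \<Rightarrow> (real \<Rightarrow> real^3 \<Rightarrow> real) \<Rightarrow>
    (real \<Rightarrow> real^3 \<Rightarrow> real) \<Rightarrow> coeffs \<Rightarrow> (real \<Rightarrow> coeffs) \<Rightarrow> bool" where
  "solution_unexpanded \<theta> \<epsilon> T b Z V W Y \<phi> u \<longleftrightarrow>
     u \<in> CT \<theta> (3/2 - \<epsilon>) T \<and> u 0 = \<phi> \<and>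
     mild T \<phi> (\<lambda>t. fcoef (rhs_unexpanded \<theta> b (Z t) (V t) (W t) (Y t) (u t))) u"

definition pfun :: "(real^3 \<Rightarrow> real) \<Rightarrow> (real^3 \<Rightarrow> real) \<Rightarrow> (real^3 \<Rightarrow> real) \<Rightarrow> real^3 \<Rightarrow> real" where
  "pfun V W Y x = exp (- 3 * V x) * Y x - W x"

definition Z2fun :: "(real^3 \<Rightarrow> real) \<Rightarrow> (real^3 \<Rightarrow> real) \<Rightarrow> (real^3 \<Rightarrow> real) \<Rightarrow> (real^3 \<Rightarrow> real) \<Rightarrow>
    real^3 \<Rightarrow> real" where
  "Z2fun Z V W Y x = - 3 * exp (- 3 * V x) * (Z x + pfun V W Y x)"

definition Z1fun :: "real \<Rightarrow> (real^3 \<Rightarrow> real) \<Rightarrow> (real^3 \<Rightarrow> real) \<Rightarrow> (real^3 \<Rightarrow> real) \<Rightarrow> (real^3 \<Rightarrow> real) \<Rightarrow>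
    real^3 \<Rightarrow> real" where
  "Z1fun b Z V W Y x = - 3 * V x + 9 * (grad V x \<bullet> grad V x - b / 3)
     - 6 * Z x * pfun V W Y x - 3 * (pfun V W Y x)\<^sup>2"

definition Z0fun :: "real \<Rightarrow> (real^3 \<Rightarrow> real) \<Rightarrow> (real^3 \<Rightarrow> real) \<Rightarrow> (real^3 \<Rightarrow> real) \<Rightarrow> (real^3 \<Rightarrow> real) \<Rightarrow>
    real^3 \<Rightarrow> real" where
  "Z0fun b Z V W Y x = (- 3 * V x + 9 * (grad V x \<bullet> grad V x - b / 3)) * Y x
     - 6 * (grad V x \<bullet> grad Y x - b * exp (3 * V x) * W x)
     - exp (3 * V x) * (3 * Z x * (pfun V W Y x)\<^sup>2 + (pfun V W Y x) ^ 3)"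

section \<open>The noise\<close>

text \<open>Test functions on \<open>\<real> \<times> \<T>\<^sup>3\<close>.\<close>
definition st_test :: "(real \<times> (real^3) \<Rightarrow> real) \<Rightarrow> bool" where
  "st_test f \<longleftrightarrow> smooth f \<and> (\<forall>t. periodic (\<lambda>x. f (t, x))) \<and>
     (\<exists>R. \<forall>t x. R < \<bar>t\<bar> \<longrightarrow> f (t, x) = 0)"

definition st_distr :: "((real \<times> (real^3) \<Rightarrow> real) \<Rightarrow> real) \<Rightarrow> bool" where
  "st_distr L \<longleftrightarrow>
     (\<forall>f g. st_test f \<longrightarrow> st_test g \<longrightarrow> L (\<lambda>z. f z + g z) = L f + L g) \<and>
     (\<forall>c f. st_test f \<longrightarrow> L (\<lambda>z. c * f z) = c * L f) \<and>
     (\<forall>R. \<exists>C N. \<forall>f B. st_test f \<longrightarrow> (\<forall>t x. R < \<bar>t\<bar> \<longrightarrow> f (t, x) = 0) \<longrightarrow>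
        Ck_bounded N B f \<longrightarrow> \<bar>L f\<bar> \<le> C * B)"

definition st_integral :: "(real \<times> (real^3) \<Rightarrow> real) \<Rightarrow> real" where
  "st_integral f = set_lebesgue_integral lborel (UNIV \<times> unit_cube) f"

text \<open>\<open>\<xi>(f)\<close> is linear in \<open>f\<close>, so that prescribing the one-dimensional laws \<open>N(0, \<parallel>f\<parallel>\<^sup>2)\<close> (in \<open>L\<^sup>2\<close>)
  is the same as requiring a centred Gaussian family with covariance \<open>\<langle>f, g\<rangle>\<close>.\<close>
definition white_noise :: "'w measure \<Rightarrow> ('w \<Rightarrow> (real \<times> (real^3) \<Rightarrow> real) \<Rightarrow> real) \<Rightarrow> bool" where
  "white_noise M \<xi> \<longleftrightarrow> (\<forall>\<omega>\<in>space M. st_distr (\<xi> \<omega>)) \<and>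
     (\<forall>f. st_test f \<longrightarrow> f \<noteq> (\<lambda>_. 0) \<longrightarrow>
        distributed M lborel (\<lambda>\<omega>. \<xi> \<omega> f) (normal_density 0 (sqrt (st_integral (\<lambda>z. (f z)\<^sup>2)))))"

text \<open>Smooth approximations of the identity on \<open>\<real> \<times> \<T>\<^sup>3\<close>, with support shrinking to the origin.\<close>
definition mollifier :: "(real \<Rightarrow> real \<times> (real^3) \<Rightarrow> real) \<Rightarrow> bool" where
  "mollifier \<kappa> \<longleftrightarrow> (\<forall>\<eta>>0. st_test (\<kappa> \<eta>) \<and> st_integral (\<kappa> \<eta>) = 1) \<and>
     (\<exists>C. \<forall>\<eta>>0. st_integral (\<lambda>z. \<bar>\<kappa> \<eta> z\<bar>) \<le> C) \<and>
     (\<forall>r>0. \<forall>\<^sub>F \<eta> in at_right 0. \<forall>t x. \<kappa> \<eta> (t, x) \<noteq> 0 \<longrightarrow>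
        \<bar>t\<bar> \<le> r \<and> (\<exists>m. norm (x - freq m) \<le> r))"

definition mollify :: "(real \<times> (real^3) \<Rightarrow> real) \<Rightarrow> ((real \<times> (real^3) \<Rightarrow> real) \<Rightarrow> real) \<Rightarrow>
    real \<Rightarrow> real^3 \<Rightarrow> real" where
  "mollify \<kappa> L t x = L (\<lambda>z. \<kappa> (t - fst z, x - snd z))"

text \<open>\<open>X\<close> is a process on \<open>\<real> \<times> \<T>\<^sup>3\<close>, stationary in time, that solves \<open>(\<partial>\<^sub>t - \<Delta> + 1) X = F\<close> in the
  mild sense from every starting time.\<close>
definition stationary_solution :: "'w measure \<Rightarrow> ('w \<Rightarrow> real \<Rightarrow> real^3 \<Rightarrow> real) \<Rightarrow>
    ('w \<Rightarrow> real \<Rightarrow> real^3 \<Rightarrow> real) \<Rightarrow> bool" where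
  "stationary_solution M F X \<longleftrightarrow>
     (\<forall>\<omega>\<in>space M. (\<forall>t. smooth_torus (X \<omega> t)) \<and>
        (\<forall>s. \<forall>T>0. mild T (fcoef (X \<omega> s)) (\<lambda>t. fcoef (F \<omega> (s + t))) (\<lambda>t. fcoef (X \<omega> (s + t))))) \<and>
     (\<forall>t x. (\<lambda>\<omega>. X \<omega> t x) \<in> borel_measurable M) \<and>
     (\<forall>h I. finite I \<longrightarrow>
        distr M (Pi\<^sub>M I (\<lambda>_. borel)) (\<lambda>\<omega>. \<lambda>p\<in>I. X \<omega> (fst p + h) (snd p)) =
        distr M (Pi\<^sub>M I (\<lambda>_. borel)) (\<lambda>\<omega>. \<lambda>p\<in>I. X \<omega> (fst p) (snd p)))"

text \<open>A mollification (with kernel \<open>kern \<eta>\<close>), the renormalisation constants \<open>a\<^sub>\<eta>, b\<^sub>\<eta>\<close>, and the fields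
  \<open>Z, V, W, Y\<close>, as functions of \<open>\<eta>\<close>, of the realization of the noise, of time and of space.\<close>
record 'w scheme =
  kern :: "real \<Rightarrow> real \<times> (real^3) \<Rightarrow> real"
  ca :: "real \<Rightarrow> real"
  cb :: "real \<Rightarrow> real"
  fZ :: "real \<Rightarrow> 'w \<Rightarrow> real \<Rightarrow> real^3 \<Rightarrow> real"
  fV :: "real \<Rightarrow> 'w \<Rightarrow> real \<Rightarrow> real^3 \<Rightarrow> real"
  fW :: "real \<Rightarrow> 'w \<Rightarrow> real \<Rightarrow> real^3 \<Rightarrow> real"
  fY :: "real \<Rightarrow> 'w \<Rightarrow> real \<Rightarrow> real^3 \<Rightarrow> real"

text \<open>\<open>V, W, Y\<close> with zero initial value and right-hand sides \<open>Z\<^sup>2 - a\<close>, \<open>Z\<^sup>3 - 3aZ\<close> and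
  \<open>3 e\<^sup>3\<^sup>V (W (Z\<^sup>2 - a) - b (Z + W))\<close>.\<close>
definition tree_equations :: "real \<Rightarrow> real \<Rightarrow> (real \<Rightarrow> real^3 \<Rightarrow> real) \<Rightarrow> (real \<Rightarrow> real^3 \<Rightarrow> real) \<Rightarrow>
    (real \<Rightarrow> real^3 \<Rightarrow> real) \<Rightarrow> (real \<Rightarrow> real^3 \<Rightarrow> real) \<Rightarrow> bool" where
  "tree_equations a b Z V W Y \<longleftrightarrow>
     (\<forall>t\<ge>0. smooth_torus (V t) \<and> smooth_torus (W t) \<and> smooth_torus (Y t)) \<and>
     (\<forall>T>0.
        mild T (\<lambda>_. 0) (\<lambda>t. fcoef (\<lambda>x. (Z t x)\<^sup>2 - a)) (\<lambda>t. fcoef (V t)) \<and>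
        mild T (\<lambda>_. 0) (\<lambda>t. fcoef (\<lambda>x. (Z t x) ^ 3 - 3 * a * Z t x)) (\<lambda>t. fcoef (W t)) \<and>
        mild T (\<lambda>_. 0)
          (\<lambda>t. fcoef (\<lambda>x. 3 * exp (3 * V t x) *
             (W t x * ((Z t x)\<^sup>2 - a) - b * (Z t x + W t x)))) (\<lambda>t. fcoef (Y t)))"

definition noise_scheme :: "'w measure \<Rightarrow> ('w \<Rightarrow> (real \<times> (real^3) \<Rightarrow> real) \<Rightarrow> real) \<Rightarrow> 'w scheme \<Rightarrow> bool" where
  "noise_scheme M \<xi> S \<longleftrightarrow> mollifier (kern S) \<and>
     (\<forall>\<eta>>0. stationary_solution M (\<lambda>\<omega>. mollify (kern S \<eta>) (\<xi> \<omega>)) (fZ S \<eta>) \<and>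
        (\<forall>\<omega>\<in>space M. tree_equations (ca S \<eta>) (cb S \<eta>) (fZ S \<eta> \<omega>) (fV S \<eta> \<omega>) (fW S \<eta> \<omega>) (fY S \<eta> \<omega>)))"

definition scheme_Z0 :: "'w scheme \<Rightarrow> real \<Rightarrow> 'w \<Rightarrow> real \<Rightarrow> coeffs" where
  "scheme_Z0 S \<eta> \<omega> t = fcoef (Z0fun (cb S \<eta>) (fZ S \<eta> \<omega> t) (fV S \<eta> \<omega> t) (fW S \<eta> \<omega> t) (fY S \<eta> \<omega> t))"

definition scheme_Z1 :: "'w scheme \<Rightarrow> real \<Rightarrow> 'w \<Rightarrow> real \<Rightarrow> coeffs" where
  "scheme_Z1 S \<eta> \<omega> t = fcoef (Z1fun (cb S \<eta>) (fZ S \<eta> \<omega> t) (fV S \<eta> \<omega> t) (fW S \<eta> \<omega> t) (fY S \<eta> \<omega> t))"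

definition scheme_Z2 :: "'w scheme \<Rightarrow> real \<Rightarrow> 'w \<Rightarrow> real \<Rightarrow> coeffs" where
  "scheme_Z2 S \<eta> \<omega> t = fcoef (Z2fun (fZ S \<eta> \<omega> t) (fV S \<eta> \<omega> t) (fW S \<eta> \<omega> t) (fY S \<eta> \<omega> t))"

definition scheme_zdata :: "'w scheme \<Rightarrow> real \<Rightarrow> 'w \<Rightarrow> zdata" where
  "scheme_zdata S \<eta> \<omega> =
     (\<lambda>t. fcoef (fV S \<eta> \<omega> t), scheme_Z0 S \<eta> \<omega>, scheme_Z1 S \<eta> \<omega>, scheme_Z2 S \<eta> \<omega>)"

text \<open>Convergence of \<open>f\<^sub>\<eta>\<close> to \<open>g\<close> in \<open>C\<^sub>T \<C>\<^sup>\<alpha>\<^sup>-\<^sup>\<epsilon>'\<close> as \<open>\<eta> \<rightarrow> 0\<close>, for all \<open>\<epsilon>', T > 0\<close>.\<close>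
definition converges :: "(int \<Rightarrow> real^3 \<Rightarrow> real) \<Rightarrow> real \<Rightarrow> (real \<Rightarrow> real \<Rightarrow> coeffs) \<Rightarrow>
    (real \<Rightarrow> coeffs) \<Rightarrow> bool" where
  "converges \<theta> \<alpha> f g \<longleftrightarrow> (\<forall>\<epsilon>'>0. \<forall>T>0.
     (\<forall>\<eta>>0. f \<eta> \<in> CT \<theta> (\<alpha> - \<epsilon>') T) \<and> g \<in> CT \<theta> (\<alpha> - \<epsilon>') T \<and>
     ((\<lambda>\<eta>. CT_norm \<theta> (\<alpha> - \<epsilon>') T (\<lambda>t. f \<eta> t - g t)) \<longlongrightarrow> 0) (at_right 0))"

text \<open>The limits of \<open>Z\<close>, \<open>Z\<^sup>2 - a\<close>, \<open>W\<close>, \<open>V\<close>, \<open>Y\<close>, \<open>W \<circ> Z\<close>, \<open>V \<circ> (Z\<^sup>2 - a) - b/3\<close>, \<open>|\<nabla>V|\<^sup>2 - b/3\<close>,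
  \<open>W \<circ> (Z\<^sup>2 - a) - bZ\<close>, \<open>\<nabla>V\<cdot>\<nabla>Y - b e\<^sup>3\<^sup>V W\<close>, \<open>Z\<^sub>0\<close>, \<open>Z\<^sub>1\<close>, \<open>Z\<^sub>2\<close>.\<close>
record limit_terms =
  lZ :: "real \<Rightarrow> coeffs"
  lZZ :: "real \<Rightarrow> coeffs"
  lW :: "real \<Rightarrow> coeffs"
  lV :: "real \<Rightarrow> coeffs"
  lY :: "real \<Rightarrow> coeffs"
  lWZ :: "real \<Rightarrow> coeffs"
  lVZZ :: "real \<Rightarrow> coeffs"
  lVV :: "real \<Rightarrow> coeffs"
  lWZZ :: "real \<Rightarrow> coeffs"
  lVY :: "real \<Rightarrow> coeffs"
  lZ0 :: "real \<Rightarrow> coeffs"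
  lZ1 :: "real \<Rightarrow> coeffs"
  lZ2 :: "real \<Rightarrow> coeffs"

definition limit_zdata :: "limit_terms \<Rightarrow> zdata" where
  "limit_zdata L = (lV L, lZ0 L, lZ1 L, lZ2 L)"

definition convergent_realization :: "(int \<Rightarrow> real^3 \<Rightarrow> real) \<Rightarrow> 'w scheme \<Rightarrow> 'w \<Rightarrow> limit_terms \<Rightarrow> bool" where
  "convergent_realization \<theta> S \<omega> L \<longleftrightarrow>
     (let a = ca S; b = cb S;
          Z = (\<lambda>\<eta>. fZ S \<eta> \<omega>); V = (\<lambda>\<eta>. fV S \<eta> \<omega>); W = (\<lambda>\<eta>. fW S \<eta> \<omega>); Y = (\<lambda>\<eta>. fY S \<eta> \<omega>);
          ZZ = (\<lambda>\<eta> t. fcoef (\<lambda>x. (Z \<eta> t x)\<^sup>2 - a \<eta>))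
      in converges \<theta> (- 1/2) (\<lambda>\<eta> t. fcoef (Z \<eta> t)) (lZ L) \<and>
         converges \<theta> (- 1) ZZ (lZZ L) \<and>
         converges \<theta> (1/2) (\<lambda>\<eta> t. fcoef (W \<eta> t)) (lW L) \<and>
         converges \<theta> 1 (\<lambda>\<eta> t. fcoef (V \<eta> t)) (lV L) \<and>
         converges \<theta> 1 (\<lambda>\<eta> t. fcoef (Y \<eta> t)) (lY L) \<and>
         converges \<theta> 0 (\<lambda>\<eta> t. resonant \<theta> (fcoef (W \<eta> t)) (fcoef (Z \<eta> t))) (lWZ L) \<and>
         converges \<theta> 0 (\<lambda>\<eta> t. resonant \<theta> (fcoef (V \<eta> t)) (ZZ \<eta> t) - fcoef (\<lambda>_. b \<eta> / 3)) (lVZZ L) \<and>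
         converges \<theta> 0 (\<lambda>\<eta> t. fcoef (\<lambda>x. grad (V \<eta> t) x \<bullet> grad (V \<eta> t) x - b \<eta> / 3)) (lVV L) \<and>
         converges \<theta> (- 1/2)
           (\<lambda>\<eta> t. resonant \<theta> (fcoef (W \<eta> t)) (ZZ \<eta> t) - fcoef (\<lambda>x. b \<eta> * Z \<eta> t x)) (lWZZ L) \<and>
         converges \<theta> 0
           (\<lambda>\<eta> t. fcoef (\<lambda>x. grad (V \<eta> t) x \<bullet> grad (Y \<eta> t) x - b \<eta> * exp (3 * V \<eta> t x) * W \<eta> t x))
           (lVY L) \<and>
         converges \<theta> (- 1/2) (\<lambda>\<eta>. scheme_Z0 S \<eta> \<omega>) (lZ0 L) \<and>
         converges \<theta> (- 1/2) (\<lambda>\<eta>. scheme_Z1 S \<eta> \<omega>) (lZ1 L) \<and>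
         converges \<theta> (- 1/2) (\<lambda>\<eta>. scheme_Z2 S \<eta> \<omega>) (lZ2 L))"

end

theory Submission
  imports Defs "HOL-Real_Asymp.Real_Asymp"
begin

text \<open>
The equation is a semilinear heat equation whose coefficients have negative regularity, but only
so little of it that every product is well defined, and it is solved by a fixed point argument.
Write \<open>\<kappa> = \<epsilon>/2\<close>, \<open>\<beta> = 3/2 - \<epsilon>\<close> and \<open>\<gamma> = -1/2 - \<kappa>\<close>. If \<open>u\<close> has regularity \<open>\<beta>\<close>, \<open>V\<close> has regularity \<open>1 - \<kappa>\<close>
and \<open>Z\<^sub>0, Z\<^sub>1, Z\<^sub>2\<close> have regularity \<open>\<gamma>\<close>, then \<open>\<nabla>V\<cdot>\<nabla>u\<close> pairs the regularities \<open>-\<kappa>\<close> and \<open>1/2 - \<epsilon>\<close>, and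
\<open>Z\<^sub>2 u\<^sup>2\<close> and \<open>Z\<^sub>1 u\<close> pair \<open>\<gamma>\<close> and \<open>\<beta>\<close>; both sums are positive, and the cubic term is a bounded
function. Hence the right-hand side is a locally Lipschitz map from regularity \<open>\<beta>\<close> to regularity
\<open>\<gamma>\<close>, jointly in \<open>u\<close> and in the data (\<open>rhs_lipschitz\<close>). The heat semigroup regains up to two
derivatives after integration in time, and \<open>\<beta> = \<gamma> + 2\<sigma>\<close> with \<open>\<sigma> = 1 - \<epsilon>/4 < 1\<close>; the remaining
power of time makes the integral operator small in the norm weighted by \<open>exp (- \<mu> t)\<close>, for \<open>\<mu>\<close>
large (\<open>besov_duhamel\<close>).

To avoid restarting a local solution over and over, the unknown is radially clipped at norm
\<open>M\<close>. The clipped equation is globally Lipschitz, so on every bounded time interval it has exactly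
one solution, which depends on the data in a Lipschitz way (\<open>trunc_exists\<close>, \<open>trunc_unique\<close>,
\<open>trunc_stability\<close>). A curve bounded by \<open>M\<close> solves the original equation iff it solves the clipped
one, so everything is transferred by taking \<open>M\<close> larger than the solution under consideration:
uniqueness, local existence, and the persistence of a solution on \<open>[0,T]\<close> under small
perturbations of the data (\<open>dependence\<close>). The lifetime is the supremum of the times up to which a
solution exists. If the norm did not tend to infinity at a finite lifetime, it would be below
some \<open>R\<close> at times arbitrarily close to it; since it can only grow by \<open>1/4\<close> in a time that depends on
\<open>R\<close> (\<open>slow_growth\<close>), it would be bounded up to the lifetime, and the clipped equation would continue
the solution (\<open>blow_up\<close>). For the noise, the coefficients converge by hypothesis in the space of the
data, so the last part is continuous dependence together with an algebraic identity between the
two forms of the equation (\<open>nonlinearity_expansion\<close>, \<open>rhs_expand\<close>).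

The Littlewood--Paley analysis is done without kernels on \<open>\<real>\<^sup>3\<close>. Distributions are families of
Fourier coefficients, blocks are trigonometric polynomials, and the only tool is a supremum norm
bound for Fourier multipliers. The basic multipliers are Fejer's, which have norm 1 because Fejer's
kernel is a probability density. Convex decreasing sequences are averages of Fejer multipliers
(\<open>multiplier_polya\<close>), which gives the decay \<open>exp (- c 4\<^sup>n t)\<close> of the heat semigroup on the \<open>n\<close>-th block
(\<open>heat_annulus\<close>), and summation by parts in each coordinate writes the symbol of a Littlewood--Paley
block as a combination of Fejer multipliers with bounded total weight (\<open>multiplier_dilate\<close>).
\<close>

section \<open>Fourier coefficients on the torus\<close>

definition mode :: "int^3 \<Rightarrow> real^3 \<Rightarrow> complex" where
  "mode k x = cis (2 * pi * (freq k \<bullet> x))"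

lemma freq_simps [simp]:
  "freq (k + l) = freq k + freq l" "freq (- k) = - freq k" "freq (k - l) = freq k - freq l"
  "freq 0 = 0" "freq (axis i n) = axis i (real_of_int n)"
  by (simp_all add: freq_def vec_eq_iff axis_def)

lemma freq_nth [simp]: "freq k $ i = real_of_int (k $ i)"
  by (simp add: freq_def)

lemma mode_add: "mode (k + l) x = mode k x * mode l x"
  by (simp add: mode_def inner_add_left cis_mult ring_distribs)

lemma mode_minus: "mode (- k) x = cnj (mode k x)"
  by (simp add: mode_def cis_cnj)

lemma mode_diff: "mode (k - l) x = mode k x * cnj (mode l x)"
  using mode_add[of k "- l" x] by (simp add: mode_minus)

lemma mode_shift: "mode k (x + y) = mode k x * mode k y"
  by (simp add: mode_def inner_add_right cis_mult ring_distribs)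

lemma mode_uminus_arg: "mode k (- y) = mode (- k) y"
  by (simp add: mode_def)

lemma mode_diff_arg: "mode k (x - y) = mode k x * mode (- k) y"
  using mode_shift[of k x "- y"] by (simp add: mode_uminus_arg)

lemma mode_zero [simp]: "mode 0 x = 1" "mode k 0 = 1"
  by (simp_all add: mode_def)

lemma norm_mode [simp]: "cmod (mode k x) = 1"
  by (simp add: mode_def)

lemma mode_lattice: "mode k (freq m) = 1"
proof -
  have "freq k \<bullet> freq m = real_of_int (\<Sum>i\<in>UNIV. k $ i * m $ i)"
    by (simp add: inner_vec_def)
  then show ?thesis unfolding mode_def
    by (metis cis_multiple_2pi Ints_of_int)
qed

lemma mode_periodic: "mode k (x + freq m) = mode k x"
  by (simp add: mode_shift mode_lattice)

lemma continuous_on_mode [continuous_intros]: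
  "continuous_on S g \<Longrightarrow> continuous_on S (\<lambda>x. mode k (g x))"
  unfolding mode_def cis_conv_exp by (intro continuous_intros)

lemma mem_unit_cube: "x \<in> unit_cube \<longleftrightarrow> (\<forall>b\<in>Basis. 0 \<le> x \<bullet> b \<and> x \<bullet> b \<le> 1)"
proof -
  have "(One::real^3) \<bullet> b = 1" if "b \<in> Basis" for b
    using that by (simp add: inner_sum_left inner_Basis)
  then show ?thesis by (auto simp: unit_cube_def mem_box)
qed

lemma unit_cube_facts:
  shows "compact unit_cube" "0 \<in> unit_cube"
    and "integral unit_cube (\<lambda>_. c::complex) = c"
proof -
  show "compact unit_cube" by (simp add: unit_cube_def)
  show "0 \<in> unit_cube" by (simp add: mem_unit_cube)
  show "integral unit_cube (\<lambda>_. c::complex) = c" by (simp add: unit_cube_def)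
qed

lemma integrable_cube:
  fixes f :: "real^3 \<Rightarrow> 'b::banach"
  assumes "continuous_on UNIV f" shows "f integrable_on unit_cube"
  unfolding unit_cube_def by (rule integrable_continuous) (rule continuous_on_subset[OF assms], simp)

lemma norm_integral_cube_le:
  fixes f :: "real^3 \<Rightarrow> complex"
  assumes "continuous_on UNIV f" "\<And>x. x \<in> unit_cube \<Longrightarrow> cmod (f x) \<le> A"
  shows "cmod (integral unit_cube f) \<le> A"
proof -
  have "(f has_integral (integral unit_cube f)) (cbox 0 One)"
    using integrable_cube[OF assms(1)] by (simp add: integrable_integral unit_cube_def)
  moreover have "0 \<le> A" using assms(2)[OF unit_cube_facts(2)] norm_ge_zero order_trans by blast
  ultimately have "cmod (integral unit_cube f) \<le> A * measure lborel (cbox 0 (One::real^3))"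
    using assms(2) by (intro has_integral_bound) (auto simp: unit_cube_def)
  then show ?thesis by (simp only: content_unit mult_1_right)
qed

lemma cis_sum: "finite A \<Longrightarrow> cis (sum f A) = (\<Prod>a\<in>A. cis (f a))"
  by (induction rule: finite_induct) (auto simp: cis_mult[symmetric])

text \<open>The antiderivative \<open>cis (2\<pi> m s) / (2\<pi> \<i> m)\<close> takes the same value at both end points.\<close>
lemma integral_cis_interval:
  "integral {0..1} (\<lambda>s. cis (2 * pi * (real_of_int m * s))) = (if m = 0 then 1 else 0)"
proof (cases "m = 0")
  case True then show ?thesis by simp
next
  case False
  define a where "a = 2 * pi * real_of_int m"
  have a: "a \<noteq> 0" using False by (simp add: a_def)
  have "((\<lambda>s. cis (a * s)) has_integral (cis (a * 1) / (\<i> * a) - cis (a * 0) / (\<i> * a))) {0..1}"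
  proof (rule fundamental_theorem_of_calculus)
    fix x :: real assume "x \<in> {0..1}"
    have "((\<lambda>s. exp (\<i> * of_real a * of_real s)) has_vector_derivative \<i> * of_real a * exp (\<i> * of_real a * of_real x)) (at x within {0..1})"
      by (rule has_vector_derivative_real_field) (auto intro!: derivative_eq_intros)
    then have "((\<lambda>s. exp (\<i> * of_real a * of_real s) / (\<i> * a)) has_vector_derivative (\<i> * of_real a * exp (\<i> * of_real a * of_real x)) / (\<i> * a)) (at x within {0..1})"
      by (rule has_vector_derivative_divide)
    then show "((\<lambda>s. cis (a * s) / (\<i> * a)) has_vector_derivative cis (a * x)) (at x within {0..1})"
      using a by (simp add: cis_conv_exp mult.assoc)
  qed simp
  moreover have "cis a = 1" unfolding a_def
    by (metis cis_multiple_2pi Ints_of_int mult.commute mult.left_commute)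
  ultimately have "((\<lambda>s. cis (a * s)) has_integral 0) {0..1}" by simp
  then show ?thesis using False by (simp add: a_def integral_unique mult.assoc)
qed

text \<open>Fubini's theorem for functions of product form, which factorizes the integral of a character
  over the unit cube.\<close>
lemma lborel_integral_prod:
  fixes g :: "'a::euclidean_space \<Rightarrow> real \<Rightarrow> complex"
  assumes "\<And>b. b \<in> Basis \<Longrightarrow> integrable lborel (g b)"
  shows "(LINT x|lborel. (\<Prod>b\<in>Basis. g b (x \<bullet> b))) = (\<Prod>b\<in>Basis. LINT s|lborel. g b s)"
proof -
  interpret product_sigma_finite "\<lambda>_::'a. lborel :: real measure" ..
  have [measurable]: "b \<in> Basis \<Longrightarrow> g b \<in> borel_measurable borel" for b
    using assms[of b] by (auto dest!: borel_measurable_integrable)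
  have "(LINT x|lborel. (\<Prod>b\<in>Basis. g b (x \<bullet> b))) =
     (LINT f|(\<Pi>\<^sub>M b\<in>(Basis::'a set). lborel). (\<Prod>b\<in>Basis. g b ((\<Sum>b\<in>Basis. f b *\<^sub>R b) \<bullet> b)))"
    by (subst lborel_eq, subst integral_distr) auto
  also have "\<dots> = (LINT f|(\<Pi>\<^sub>M b\<in>(Basis::'a set). lborel). (\<Prod>b\<in>Basis. g b (f b)))"
    by (intro Bochner_Integration.integral_cong prod.cong arg_cong2[where f=g] refl) auto
  also have "\<dots> = (\<Prod>b\<in>Basis. LINT s|lborel. g b s)"
    by (rule product_integral_prod) (use assms in auto)
  finally show ?thesis .
qed

lemma integral_mode: "integral unit_cube (mode k) = (if k = 0 then 1 else 0)"
proof -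
  define g where "g = (\<lambda>b s. indicat_real {0..1} s *\<^sub>R cis (2 * pi * ((freq k \<bullet> b) * s)))"
  have int: "integrable lborel (g b)" for b
  proof -
    have "set_integrable lborel {0..1} (\<lambda>s. cis (2 * pi * ((freq k \<bullet> b) * s)))"
      by (rule borel_integrable_atLeastAtMost') (auto simp: cis_conv_exp intro!: continuous_intros)
    then show ?thesis by (simp add: set_integrable_def g_def)
  qed
  have val: "(LINT s|lborel. g (axis i 1) s) = (if k $ i = 0 then 1 else 0)" for i
  proof -
    have "set_integrable lborel {0..1} (\<lambda>s. cis (2 * pi * ((freq k \<bullet> axis i 1) * s)))"
      using int[of "axis i 1"] by (simp add: set_integrable_def g_def)
    from set_borel_integral_eq_integral(2)[OF this] show ?thesis
      using integral_cis_interval[of "k $ i"]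
      by (simp add: set_lebesgue_integral_def g_def inner_axis)
  qed
  have eq: "(\<Prod>b\<in>Basis. g b (x \<bullet> b)) = indicat_real unit_cube x *\<^sub>R mode k x" for x
  proof -
    have "(\<Prod>b\<in>Basis. g b (x \<bullet> b)) = (\<Prod>b\<in>Basis. of_real (indicat_real {0..1} (x \<bullet> b))) *
       (\<Prod>b\<in>Basis. cis (2 * pi * ((freq k \<bullet> b) * (x \<bullet> b))))"
      unfolding g_def by (simp add: scaleR_conv_of_real prod.distrib)
    also have "(\<Prod>b\<in>Basis. cis (2 * pi * ((freq k \<bullet> b) * (x \<bullet> b)))) = mode k x"
      by (simp add: mode_def cis_sum[symmetric] euclidean_inner[of "freq k" x] sum_distrib_left)
    also have "(\<Prod>b\<in>Basis. complex_of_real (indicat_real {0..1} (x \<bullet> b))) = of_real (indicat_real unit_cube x)"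
    proof (cases "x \<in> unit_cube")
      case True then show ?thesis
        by (auto simp: mem_unit_cube intro!: prod.neutral)
    next
      case False
      then obtain b where "b \<in> Basis" "x \<bullet> b \<notin> {0..1}"
        by (auto simp: mem_unit_cube)
      then have "\<exists>b\<in>Basis. complex_of_real (indicat_real {0..1} (x \<bullet> b)) = 0" by (auto simp: indicator_def)
      then show ?thesis using False by (simp add: prod_zero)
    qed
    finally show ?thesis by (simp add: scaleR_conv_of_real)
  qed
  have "integral unit_cube (mode k) = (LINT x : unit_cube | lborel. mode k x)"
  proof (rule set_borel_integral_eq_integral(2)[symmetric])
    show "set_integrable lborel unit_cube (mode k)"
      unfolding unit_cube_def set_integrable_def by (rule borel_integrable_compact) (auto intro!: continuous_intros)
  qed
  also have "\<dots> = (\<Prod>b\<in>Basis. LINT s|lborel. g b s)"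
    unfolding set_lebesgue_integral_def eq[symmetric] by (rule lborel_integral_prod) (rule int)
  also have "\<dots> = (\<Prod>i\<in>UNIV. LINT s|lborel. g (axis i 1) s)"
  proof -
    have B: "(Basis :: (real^3) set) = (\<lambda>i. axis i 1) ` UNIV" by (auto simp: Basis_vec_def)
    show ?thesis unfolding B by (subst prod.reindex) (auto simp: inj_on_def axis_eq_axis)
  qed
  also have "\<dots> = (if k = 0 then 1 else 0)"
    by (auto simp: val vec_eq_iff)
  finally show ?thesis .
qed

definition cfc :: "(real^3 \<Rightarrow> complex) \<Rightarrow> coeffs" where
  "cfc f k = integral unit_cube (\<lambda>x. f x * mode (- k) x)"

lemma fcoef_eq_cfc: "fcoef f = cfc (\<lambda>x. of_real (f x))"
  by (simp add: fcoef_def cfc_def mode_def fun_eq_iff)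

abbreviation finsupp :: "coeffs \<Rightarrow> bool" where
  "finsupp c \<equiv> finite {k. c k \<noteq> 0}"

text \<open>For coefficients of infinite support the value is 0, by the convention for infinite sums.\<close>
definition tp :: "coeffs \<Rightarrow> real^3 \<Rightarrow> complex" where
  "tp c x = (\<Sum>k\<in>{k. c k \<noteq> 0}. c k * mode k x)"

lemma tp_eq: "finite S \<Longrightarrow> (\<And>k. c k \<noteq> 0 \<Longrightarrow> k \<in> S) \<Longrightarrow> tp c x = (\<Sum>k\<in>S. c k * mode k x)"
  unfolding tp_def by (rule sum.mono_neutral_left) auto

lemma tp_add: "finsupp c \<Longrightarrow> finsupp d \<Longrightarrow> tp (\<lambda>k. c k + d k) x = tp c x + tp d x"
  by (subst (1 2 3) tp_eq[where S = "{k. c k \<noteq> 0} \<union> {k. d k \<noteq> 0}"])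
     (auto simp: sum.distrib algebra_simps)

lemma tp_scale: "tp (\<lambda>k. a * c k) x = a * tp c x"
  by (cases "a = 0") (auto simp: tp_def sum_distrib_left mult.assoc)

lemma tp_diff: "finsupp c \<Longrightarrow> finsupp d \<Longrightarrow> tp (\<lambda>k. c k - d k) x = tp c x - tp d x"
  by (subst (1 2 3) tp_eq[where S = "{k. c k \<noteq> 0} \<union> {k. d k \<noteq> 0}"])
     (auto simp: sum_subtractf algebra_simps)

lemma finsupp_mult: "finsupp c \<Longrightarrow> finsupp (\<lambda>k. m k * c k)" "finsupp m \<Longrightarrow> finsupp (\<lambda>k. m k * c k)"
  by (auto elim: rev_finite_subset)

lemma finsupp_sum: "finite I \<Longrightarrow> (\<And>i. i \<in> I \<Longrightarrow> finsupp (c i)) \<Longrightarrow> finsupp (\<lambda>k. \<Sum>i\<in>I. c i k)"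
  by (rule finite_subset[of _ "\<Union>i\<in>I. {k. c i k \<noteq> 0}"]) (auto dest: sum.not_neutral_contains_not_neutral)

lemma tp_sum: "finite I \<Longrightarrow> (\<And>i. i \<in> I \<Longrightarrow> finsupp (c i)) \<Longrightarrow> tp (\<lambda>k. \<Sum>i\<in>I. c i k) x = (\<Sum>i\<in>I. tp (c i) x)"
proof (induction rule: finite_induct)
  case empty then show ?case by (simp add: tp_def)
next
  case (insert i I) then show ?case by (simp add: tp_add finsupp_sum)
qed

lemma continuous_on_tp: "continuous_on S (tp c)"
  unfolding tp_def by (intro continuous_intros)

lemma tp_periodic: "tp c (x + freq m) = tp c x"
  by (simp add: tp_def mode_periodic)

lemma cfc_sum: "finite I \<Longrightarrow> (\<And>i. i \<in> I \<Longrightarrow> continuous_on UNIV (f i)) \<Longrightarrow>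
  cfc (\<lambda>x. \<Sum>i\<in>I. f i x) k = (\<Sum>i\<in>I. cfc (f i) k)"
  unfolding cfc_def sum_distrib_right
  by (rule integral_sum) (auto intro!: integrable_cube continuous_intros)

lemma cfc_scale: "cfc (\<lambda>x. a * f x) k = a * cfc f k"
  by (simp add: cfc_def mult.assoc)

lemma cfc_diff: "continuous_on UNIV f \<Longrightarrow> continuous_on UNIV g \<Longrightarrow> cfc (\<lambda>x. f x - g x) k = cfc f k - cfc g k"
  unfolding cfc_def left_diff_distrib
  by (rule integral_diff) (auto intro!: integrable_cube continuous_intros)

lemma cfc_add: "continuous_on UNIV f \<Longrightarrow> continuous_on UNIV g \<Longrightarrow> cfc (\<lambda>x. f x + g x) k = cfc f k + cfc g k"
  unfolding cfc_def distrib_right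
  by (rule integral_add) (auto intro!: integrable_cube continuous_intros)

lemma cfc_mode: "cfc (mode l) k = (if k = l then 1 else 0)"
proof -
  have "cfc (mode l) k = integral unit_cube (mode (l - k))"
    by (simp add: cfc_def mode_diff[abs_def] mode_minus)
  then show ?thesis by (simp add: integral_mode)
qed

lemma cfc_tp: assumes "finsupp c" shows "cfc (tp c) = c"
proof
  fix k
  have "cfc (tp c) k = (\<Sum>l\<in>{l. c l \<noteq> 0}. c l * cfc (mode l) k)"
    unfolding tp_def[abs_def] by (subst cfc_sum) (auto simp: assms cfc_scale intro!: continuous_intros)
  also have "\<dots> = c k" using assms by (simp add: cfc_mode if_distrib[of "\<lambda>z. _ * z"] sum.delta' cong: if_cong)
  finally show "cfc (tp c) k = c k" .
qed

lemma norm_cfc_le: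
  assumes "continuous_on UNIV f" "\<And>x. x \<in> unit_cube \<Longrightarrow> cmod (f x) \<le> A"
  shows "cmod (cfc f k) \<le> A"
  unfolding cfc_def
  by (rule norm_integral_cube_le) (auto simp: norm_mult assms intro!: continuous_intros)

lemma norm_coeff_le: "finsupp c \<Longrightarrow> (\<And>x. cmod (tp c x) \<le> A) \<Longrightarrow> cmod (c k) \<le> A"
  using norm_cfc_le[OF continuous_on_tp, of c A k] by (simp add: cfc_tp)

section \<open>Fejer kernels\<close>

text \<open>The normalized autocorrelation of \<open>B\<close>. These are the Fourier coefficients of the nonnegative
  kernel \<open>kern_sq B / card B\<close>, which has integral 1.\<close>
definition corr :: "(int^3) set \<Rightarrow> int^3 \<Rightarrow> complex" where
  "corr B k = of_nat (card {m\<in>B. m + k \<in> B}) / of_nat (card B)"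

definition kern_sq :: "(int^3) set \<Rightarrow> real^3 \<Rightarrow> real" where
  "kern_sq B x = (cmod (\<Sum>n\<in>B. mode n x))\<^sup>2"

lemma corr_finsupp: assumes "finite B" shows "finsupp (corr B)"
proof (rule finite_subset)
  show "{k. corr B k \<noteq> 0} \<subseteq> (\<lambda>(n,m). n - m) ` (B \<times> B)"
  proof
    fix k assume "k \<in> {k. corr B k \<noteq> 0}"
    then have "{m\<in>B. m + k \<in> B} \<noteq> {}" by (metis (mono_tags, lifting) card.empty corr_def div_0 mem_Collect_eq of_nat_0)
    then obtain m where "m \<in> B" "m + k \<in> B" by auto
    then show "k \<in> (\<lambda>(n,m). n - m) ` (B \<times> B)" by (intro image_eqI[of _ _ "(m + k, m)"]) auto
  qed
qed (use assms in auto)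

text \<open>The autocorrelation counts how often \<open>k\<close> is a difference of two points of \<open>B\<close>.\<close>
lemma sum_differences:
  fixes g :: "int^3 \<Rightarrow> complex"
  assumes "finite B" "B \<noteq> {}"
  shows "(\<Sum>n\<in>B. \<Sum>m\<in>B. g (n - m)) = of_nat (card B) * (\<Sum>k\<in>{k. corr B k \<noteq> 0}. corr B k * g k)"
proof -
  let ?D = "(\<lambda>(n,m). n - m) ` (B \<times> B)"
  have sub: "{k. corr B k \<noteq> 0} \<subseteq> ?D"
  proof
    fix k assume "k \<in> {k. corr B k \<noteq> 0}"
    then have "{m\<in>B. m + k \<in> B} \<noteq> {}" by (metis (mono_tags, lifting) card.empty corr_def div_0 mem_Collect_eq of_nat_0)
    then obtain m where "m \<in> B" "m + k \<in> B" by auto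
    then show "k \<in> ?D" by (intro image_eqI[of _ _ "(m + k, m)"]) auto
  qed
  have "(\<Sum>n\<in>B. \<Sum>m\<in>B. g (n - m)) = (\<Sum>p\<in>B \<times> B. g (fst p - snd p))"
    by (simp add: sum.cartesian_product case_prod_beta)
  also have "\<dots> = (\<Sum>k\<in>?D. \<Sum>p\<in>{p\<in>B \<times> B. fst p - snd p = k}. g (fst p - snd p))"
    using assms by (subst sum.image_gen[where g = "\<lambda>(n,m). n - m"]) (auto simp: case_prod_beta)
  also have "\<dots> = (\<Sum>k\<in>?D. of_nat (card {m\<in>B. m + k \<in> B}) * g k)"
  proof (rule sum.cong[OF refl])
    fix k
    have "bij_betw snd {p\<in>B \<times> B. fst p - snd p = k} {m\<in>B. m + k \<in> B}"
      by (rule bij_betw_byWitness[where f' = "\<lambda>m. (m + k, m)"]) (auto simp: algebra_simps)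
    then have "card {p\<in>B \<times> B. fst p - snd p = k} = card {m\<in>B. m + k \<in> B}" by (rule bij_betw_same_card)
    then show "(\<Sum>p\<in>{p\<in>B \<times> B. fst p - snd p = k}. g (fst p - snd p)) = of_nat (card {m\<in>B. m + k \<in> B}) * g k"
      by simp
  qed
  also have "\<dots> = (\<Sum>k\<in>?D. of_nat (card B) * (corr B k * g k))"
    using assms by (simp add: corr_def)
  also have "\<dots> = (\<Sum>k\<in>{k. corr B k \<noteq> 0}. of_nat (card B) * (corr B k * g k))"
    using sub assms by (intro sum.mono_neutral_right) auto
  finally show ?thesis by (simp add: sum_distrib_left)
qed

lemma kern_sq_eq:
  "of_real (kern_sq B z) = (\<Sum>n\<in>B. \<Sum>m\<in>B. mode (n - m) z)"
  unfolding kern_sq_def complex_norm_square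
  by (simp add: sum_product mode_diff)

lemma continuous_on_kern_sq [continuous_intros]: "continuous_on S g \<Longrightarrow> continuous_on S (\<lambda>x. kern_sq B (g x))"
  unfolding kern_sq_def by (intro continuous_intros)

text \<open>Multiplication of the Fourier coefficients by the autocorrelation is convolution with the
  kernel.\<close>
lemma kern_conv:
  assumes "finite B" "B \<noteq> {}" "continuous_on UNIV f"
  shows "of_nat (card B) * tp (\<lambda>k. corr B k * cfc f k) x = integral unit_cube (\<lambda>y. f y * of_real (kern_sq B (x - y)))"
proof -
  have e: "cfc f k * mode k x = integral unit_cube (\<lambda>y. f y * mode k (x - y))" for k
    unfolding cfc_def mode_diff_arg by (subst integral_mult_left[symmetric]) (simp add: mult_ac)
  have "tp (\<lambda>k. corr B k * cfc f k) x = (\<Sum>k\<in>{k. corr B k \<noteq> 0}. corr B k * (cfc f k * mode k x))"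
    using corr_finsupp[OF assms(1)] by (subst tp_eq[where S="{k. corr B k \<noteq> 0}"]) (auto simp: mult.assoc)
  then have "of_nat (card B) * tp (\<lambda>k. corr B k * cfc f k) x
     = (\<Sum>n\<in>B. \<Sum>m\<in>B. integral unit_cube (\<lambda>y. f y * mode (n - m) (x - y)))"
    using sum_differences[OF assms(1,2), of "\<lambda>k. integral unit_cube (\<lambda>y. f y * mode k (x - y))"] by (simp only: e)
  also have "\<dots> = integral unit_cube (\<lambda>y. \<Sum>n\<in>B. \<Sum>m\<in>B. f y * mode (n - m) (x - y))"
    using assms by (subst integral_sum, simp, force intro!: integrable_cube continuous_intros,
      intro sum.cong refl integral_sum[symmetric]) (auto intro!: integrable_cube continuous_intros)
  finally show ?thesis by (simp add: kern_sq_eq sum_distrib_left)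
qed

lemma integral_kern_mode:
  assumes "finite B" "B \<noteq> {}"
  shows "integral unit_cube (\<lambda>y. mode l y * of_real (kern_sq B (x - y))) = of_nat (card B) * (corr B l * mode l x)"
proof -
  have "tp (\<lambda>k. corr B k * cfc (mode l) k) x = (\<Sum>k\<in>{l}. corr B k * cfc (mode l) k * mode k x)"
    by (rule tp_eq) (auto simp: cfc_mode split: if_splits)
  then show ?thesis using kern_conv[OF assms continuous_on_mode[OF continuous_on_id], of l x]
    by (simp add: cfc_mode)
qed

lemma corr_0: "finite B \<Longrightarrow> B \<noteq> {} \<Longrightarrow> corr B 0 = 1"
  by (simp add: corr_def)

lemma integral_kern:
  assumes "finite B" "B \<noteq> {}"
  shows "integral unit_cube (\<lambda>y. kern_sq B (x - y)) = card B"
proof -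
  have "complex_of_real (integral unit_cube (\<lambda>y. kern_sq B (x - y))) = integral unit_cube (\<lambda>y. of_real (kern_sq B (x - y)))"
    by (subst integral_linear[OF _ bounded_linear_of_real, symmetric, unfolded o_def])
      (auto intro!: integrable_cube continuous_intros)
  also have "\<dots> = of_real (card B)"
    using integral_kern_mode[OF assms, of 0 x] by (simp add: corr_0 assms)
  finally show ?thesis by (simp only: of_real_eq_iff)
qed

lemma kern_bound_aux:
  assumes "finite B" "B \<noteq> {}" "continuous_on UNIV f" "continuous_on UNIV h"
    and le: "\<And>y. y \<in> unit_cube \<Longrightarrow> cmod (f y) \<le> h y"
  shows "of_nat (card B) * cmod (tp (\<lambda>k. corr B k * cfc f k) x) \<le> integral unit_cube (\<lambda>y. h y * kern_sq B (x - y))"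
proof -
  have "of_nat (card B) * cmod (tp (\<lambda>k. corr B k * cfc f k) x) = cmod (integral unit_cube (\<lambda>y. f y * of_real (kern_sq B (x - y))))"
    by (simp add: kern_conv[OF assms(1-3), symmetric] norm_mult)
  also have "\<dots> \<le> integral unit_cube (\<lambda>y. h y * kern_sq B (x - y))"
    using assms by (intro integral_norm_bound_integral integrable_cube continuous_intros)
      (auto simp: norm_mult kern_sq_def norm_power intro!: mult_right_mono)
  finally show ?thesis .
qed

text \<open>Averaging against a probability density does not increase the supremum.\<close>
lemma corr_bound:
  assumes "finite B" "B \<noteq> {}" "continuous_on UNIV f" "\<And>y. y \<in> unit_cube \<Longrightarrow> cmod (f y) \<le> A"
  shows "cmod (tp (\<lambda>k. corr B k * cfc f k) x) \<le> A"
proof -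
  have "of_nat (card B) * cmod (tp (\<lambda>k. corr B k * cfc f k) x) \<le> integral unit_cube (\<lambda>y. A * kern_sq B (x - y))"
    using assms by (intro kern_bound_aux) auto
  also have "\<dots> = A * card B" using integral_kern[OF assms(1,2)] by (simp add: mult.commute)
  finally show ?thesis using assms by (simp add: mult.commute card_gt_0_iff)
qed

lemma card_vec_box:
  fixes A :: "3 \<Rightarrow> int set"
  shows "card {x::int^3. \<forall>i. x $ i \<in> A i} = (\<Prod>i\<in>UNIV. card (A i))"
proof -
  have "bij_betw (\<lambda>x i. x $ i) {x::int^3. \<forall>i. x $ i \<in> A i} (PiE UNIV A)"
    by (rule bij_betw_byWitness[where f' = "\<lambda>f. \<chi> i. f i"]) (auto simp: vec_eq_iff)
  then show ?thesis by (simp add: bij_betw_same_card card_PiE)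
qed

definition tent :: "nat \<Rightarrow> int \<Rightarrow> real" where
  "tent N n = max 0 (1 - \<bar>real_of_int n\<bar> / real N)"

definition box3 :: "(3 \<Rightarrow> nat) \<Rightarrow> (int^3) set" where
  "box3 N = {x. \<forall>i. x $ i \<in> {0..<int (N i)}}"

lemma box3_facts:
  assumes "\<And>i. 0 < N i"
  shows "finite (box3 N)" "box3 N \<noteq> {}" "card (box3 N) = (\<Prod>i\<in>UNIV. N i)"
proof -
  show c: "card (box3 N) = (\<Prod>i\<in>UNIV. N i)" unfolding box3_def by (subst card_vec_box) simp
  have "card (box3 N) > 0" unfolding c by (rule prod_pos) (simp add: assms)
  then show "finite (box3 N)" "box3 N \<noteq> {}" by (auto simp: card_gt_0_iff)
qed

text \<open>In one dimension an interval of \<open>N\<close> integers meets its translate by \<open>n\<close> in \<open>N - \<bar>n\<bar>\<close> points;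
  the autocorrelation of a box is the product over the coordinates.\<close>
lemma corr_box3:
  assumes N: "\<And>i. 0 < N i"
  shows "corr (box3 N) k = of_real (\<Prod>i\<in>UNIV. tent (N i) (k $ i))"
proof -
  have "{m\<in>box3 N. m + k \<in> box3 N} = {x. \<forall>i. x $ i \<in> {max 0 (- (k $ i))..<min (int (N i)) (int (N i) - k $ i)}}"
    unfolding box3_def by (auto simp: less_diff_eq) (smt (verit))+
  then have "card {m\<in>box3 N. m + k \<in> box3 N} = (\<Prod>i\<in>UNIV. nat (min (int (N i)) (int (N i) - k $ i) - max 0 (- (k $ i))))"
    by (simp only: card_vec_box card_atLeastLessThan_int)
  then have "corr (box3 N) k = of_real (\<Prod>i\<in>UNIV. real (nat (min (int (N i)) (int (N i) - k $ i) - max 0 (- (k $ i)))) / real (N i))"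
    by (simp add: corr_def box3_facts[OF N] prod_dividef)
  also have "(\<Prod>i\<in>UNIV. real (nat (min (int (N i)) (int (N i) - k $ i) - max 0 (- (k $ i)))) / real (N i)) = (\<Prod>i\<in>UNIV. tent (N i) (k $ i))"
  proof (rule prod.cong[OF refl])
    fix i
    have p: "real (N i) > 0" using N[of i] by simp
    have "real (nat (min (int (N i)) (int (N i) - k $ i) - max 0 (- (k $ i)))) = max 0 (real (N i) - \<bar>real_of_int (k $ i)\<bar>)"
      by (simp add: of_nat_nat min_def max_def)
    also have "\<dots> / real (N i) = tent (N i) (k $ i)"
      using p by (simp add: tent_def max_def field_simps)
    finally show "real (nat (min (int (N i)) (int (N i) - k $ i) - max 0 (- (k $ i)))) / real (N i) = tent (N i) (k $ i)" .
  qed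
  finally show ?thesis .
qed

definition cube_box :: "nat \<Rightarrow> (int^3) set" where "cube_box N = box3 (\<lambda>_. Suc N)"

lemma cube_box_facts: "finite (cube_box N)" "cube_box N \<noteq> {}"
  unfolding cube_box_def by (rule box3_facts; simp)+

lemma tent_lim: "(\<lambda>N. tent (Suc N) n) \<longlonglongrightarrow> 1"
proof -
  have "(\<lambda>N. max 0 (1 - \<bar>real_of_int n\<bar> * inverse (real (Suc N)))) \<longlonglongrightarrow> max 0 (1 - \<bar>real_of_int n\<bar> * 0)"
    by (intro tendsto_intros LIMSEQ_inverse_real_of_nat)
  then show ?thesis by (simp add: tent_def divide_inverse)
qed

lemma corr_cube_lim: "(\<lambda>N. corr (cube_box N) k) \<longlonglongrightarrow> 1"
proof -
  have "(\<lambda>N. complex_of_real (\<Prod>i\<in>UNIV. tent (Suc N) (k $ i))) \<longlonglongrightarrow> of_real (\<Prod>i\<in>(UNIV::3 set). 1)"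
    by (intro tendsto_of_real tendsto_prod tent_lim)
  then show ?thesis by (simp add: cube_box_def corr_box3)
qed

definition per :: "(real^3 \<Rightarrow> 'a) \<Rightarrow> bool" where
  "per f \<longleftrightarrow> (\<forall>x m. f (x + freq m) = f x)"

lemma per_norm_bounded:
  fixes f :: "real^3 \<Rightarrow> complex"
  assumes "continuous_on UNIV f" "per f"
  obtains M where "\<And>x. cmod (f x) \<le> M" "M \<ge> 0"
proof -
  have "compact (f ` unit_cube)"
    by (intro compact_continuous_image unit_cube_facts continuous_on_subset[OF assms(1)]) auto
  then obtain M where M: "\<And>y. y \<in> f ` unit_cube \<Longrightarrow> norm y \<le> M" using compact_imp_bounded bounded_iff by metis
  have "cmod (f x) \<le> M" for x
  proof -
    define m :: "int^3" where "m = (\<chi> i. - \<lfloor>x $ i\<rfloor>)"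
    have "x + freq m \<in> unit_cube"
      unfolding mem_unit_cube by (auto simp: Basis_vec_def inner_axis m_def) linarith+
    then show ?thesis using M[of "f (x + freq m)"] assms(2) by (auto simp: per_def)
  qed
  moreover have "M \<ge> 0" using calculation[of 0] norm_ge_zero order_trans by blast
  ultimately show ?thesis using that by blast
qed

text \<open>A modulus of continuity that is itself a trigonometric polynomial, so that it can be integrated
  exactly against Fejer's kernel. Where \<open>x\<close> and \<open>y\<close> are far apart modulo the lattice, the trigonometric
  term is bounded below and dominates \<open>2 sup |f|\<close>.\<close>
lemma per_modulus:
  fixes f :: "real^3 \<Rightarrow> complex"
  assumes f: "continuous_on UNIV f" "per f" and e: "e > 0"
  obtains C where "C \<ge> 0" "\<And>x y. cmod (f y - f x) \<le> e + C * (\<Sum>i\<in>UNIV. 2 - 2 * cos (2 * pi * (x $ i - y $ i)))"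
proof -
  obtain M where M: "\<And>x. cmod (f x) \<le> M" "M \<ge> 0" using per_norm_bounded[OF f] by blast
  let ?K = "cbox (\<chi> i. - 1) (\<chi> i. 2) :: (real^3) set"
  have "uniformly_continuous_on ?K f"
    by (intro compact_uniformly_continuous continuous_on_subset[OF f(1)]) auto
  then obtain d0 where d0: "d0 > 0" "\<And>x y. x \<in> ?K \<Longrightarrow> y \<in> ?K \<Longrightarrow> dist y x < d0 \<Longrightarrow> dist (f y) (f x) < e"
    using e unfolding uniformly_continuous_on_def by metis
  define d where "d = min d0 1"
  have d: "d > 0" "d \<le> 1" "d \<le> d0" using d0 by (auto simp: d_def)
  define \<eta> where "\<eta> = 2 - 2 * cos (2 * pi * (d / 3))"
  have "cos (2 * pi * (d / 3)) < cos 0"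
    using d by (intro cos_monotone_0_pi) (auto simp: field_simps)
  then have eta: "\<eta> > 0" by (simp add: \<eta>_def)
  define C where "C = 2 * M / \<eta>"
  have C: "C \<ge> 0" using M(2) eta by (simp add: C_def)
  have nn: "2 - 2 * cos t \<ge> 0" for t :: real using cos_le_one[of t] by linarith
  have "cmod (f y - f x) \<le> e + C * (\<Sum>i\<in>UNIV. 2 - 2 * cos (2 * pi * (x $ i - y $ i)))" for x y
  proof -
    (* Lattice translates: x is moved to the unit cube, and y to within 1/2 of it in each coordinate. *)
    define m :: "int^3" where "m = (\<chi> i. - \<lfloor>x $ i\<rfloor>)"
    define x' where "x' = x + freq m"
    define n :: "int^3" where "n = (\<chi> i. - round (y $ i - x' $ i))"
    define y' where "y' = y + freq n"
    have x': "0 \<le> x' $ i" "x' $ i \<le> 1" for i by (auto simp: x'_def m_def) linarith+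
    have xy: "\<bar>x' $ i - y' $ i\<bar> \<le> 1/2" for i
      using of_int_round_abs_le[of "y $ i - x' $ i"] by (simp add: y'_def n_def abs_le_iff) argo
    have "- 1 \<le> y' $ i \<and> y' $ i \<le> 2" for i using x'[of i] xy[of i] unfolding abs_le_iff by argo
    then have K: "x' \<in> ?K" "y' \<in> ?K" using x' by (auto simp: mem_box_cart intro: order_trans[of _ 0] order_trans[of _ 1])
    have ff: "f x' = f x" "f y' = f y" using f(2) by (auto simp: x'_def y'_def per_def)
    (* The trigonometric term does not see lattice translations. *)
    have cc: "cos (2 * pi * (x $ i - y $ i)) = cos (2 * pi * (x' $ i - y' $ i))" for i
    proof -
      have "x' $ i - y' $ i = x $ i - y $ i + of_int (m $ i - n $ i)"
        by (simp add: x'_def y'_def)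
      then have "2 * pi * (x' $ i - y' $ i) = 2 * pi * (x $ i - y $ i) + (2 * pi) * of_int (m $ i - n $ i)"
        by (simp only: ring_distribs)
      then show ?thesis by (simp only: cos_add cos_int_2pin sin_int_2pin mult_1_right mult_zero_right diff_zero)
    qed
    show ?thesis
    proof (cases "dist y' x' < d0")
      case True
      then have "cmod (f y - f x) \<le> e" using d0(2)[OF K] ff by (simp add: dist_norm)
      then show ?thesis using C nn by (smt (verit) mult_nonneg_nonneg sum_nonneg)
    next
      case False
      have "\<exists>i. d / 3 \<le> \<bar>x' $ i - y' $ i\<bar>"
      proof (rule ccontr)
        assume "\<nexists>i. d / 3 \<le> \<bar>x' $ i - y' $ i\<bar>"
        then have "(\<Sum>i\<in>UNIV. \<bar>(y' - x') $ i\<bar>) < (\<Sum>i\<in>(UNIV::3 set). d / 3)"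
          by (intro sum_strict_mono) (auto simp: not_le abs_minus_commute)
        then have "dist y' x' < d" using norm_le_l1_cart[of "y' - x'"] by (simp add: dist_norm)
        then show False using False d by linarith
      qed
      then obtain i where i: "d / 3 \<le> \<bar>x' $ i - y' $ i\<bar>" by blast
      have "cos (2 * pi * \<bar>x' $ i - y' $ i\<bar>) \<le> cos (2 * pi * (d / 3))"
        using d i xy[of i] by (intro cos_monotone_0_pi_le) (auto simp: field_simps)
      moreover have "cos (2 * pi * \<bar>x' $ i - y' $ i\<bar>) = cos (2 * pi * (x' $ i - y' $ i))"
        using cos_abs_real[of "2 * pi * (x' $ i - y' $ i)"] by (simp add: abs_mult)
      ultimately have "\<eta> \<le> 2 - 2 * cos (2 * pi * (x $ i - y $ i))" by (simp add: \<eta>_def cc)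
      also have "\<dots> \<le> (\<Sum>i\<in>UNIV. 2 - 2 * cos (2 * pi * (x $ i - y $ i)))"
        by (rule member_le_sum) (auto intro: nn)
      finally have "C * \<eta> \<le> C * (\<Sum>i\<in>UNIV. 2 - 2 * cos (2 * pi * (x $ i - y $ i)))"
        using C by (rule mult_left_mono)
      moreover have "C * \<eta> = 2 * M" using eta by (simp add: C_def)
      moreover have "cmod (f y - f x) \<le> 2 * M" using M(1)[of x] M(1)[of y] norm_triangle_ineq4[of "f y" "f x"] by linarith
      ultimately show ?thesis using e by linarith
    qed
  qed
  with C show ?thesis using that by blast
qed

text \<open>Fejer's theorem. The error is an average of \<open>f y - f x\<close> over Fejer's kernel; the modulus of
  continuity bounds it by \<open>e/2\<close> plus a multiple of \<open>\<Sum>\<^sub>i (2 - 2 cos (2\<pi> (x\<^sub>i - y\<^sub>i)))\<close>, whose average is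
  \<open>6 / (N + 1)\<close> because the first Fourier coefficient of the kernel is \<open>1 - 1 / (N + 1)\<close>.\<close>
lemma fejer_converges:
  fixes f :: "real^3 \<Rightarrow> complex"
  assumes f: "continuous_on UNIV f" "per f" and e: "e > 0"
  shows "\<forall>\<^sub>F N in sequentially. \<forall>x. cmod (tp (\<lambda>k. corr (cube_box N) k * cfc f k) x - f x) \<le> e"
proof -
  obtain C where C: "C \<ge> 0" "\<And>x y. cmod (f y - f x) \<le> e/2 + C * (\<Sum>i\<in>UNIV. 2 - 2 * cos (2 * pi * (x $ i - y $ i)))"
    using per_modulus[OF f, of "e/2"] e by auto
  have main: "cmod (tp (\<lambda>k. corr (cube_box N) k * cfc f k) x - f x) \<le> e/2 + C * (6 / real (Suc N))" for N x
  proof -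
    let ?B = "cube_box N" and ?g = "\<lambda>y. f y - f x"
    note B = cube_box_facts[of N]
    have cont: "continuous_on UNIV (\<lambda>y. f x * mode 0 y)" by simp
    have "tp (\<lambda>k. corr ?B k * cfc ?g k) x = tp (\<lambda>k. corr ?B k * cfc f k - f x * (corr ?B k * cfc (mode 0) k)) x"
    proof -
      have "cfc ?g k = cfc f k - f x * cfc (mode 0) k" for k
        using cfc_diff[OF f(1) cont, of k] cfc_scale[of "f x" "mode 0" k] by simp
      then have "corr ?B k * cfc ?g k = corr ?B k * cfc f k - f x * (corr ?B k * cfc (mode 0) k)" for k
        by (simp only: right_diff_distrib mult.left_commute)
      then show ?thesis by simp
    qed
    also have "\<dots> = tp (\<lambda>k. corr ?B k * cfc f k) x - f x * tp (\<lambda>k. corr ?B k * cfc (mode 0) k) x"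
      by (subst tp_diff) (auto simp: tp_scale intro!: finsupp_mult corr_finsupp B)
    also have "tp (\<lambda>k. corr ?B k * cfc (mode 0) k) x = 1"
      by (subst tp_eq[where S = "{0}"]) (auto simp: cfc_mode corr_0 B split: if_splits)
    finally have eq: "tp (\<lambda>k. corr ?B k * cfc f k) x - f x = tp (\<lambda>k. corr ?B k * cfc ?g k) x" by simp
    let ?h = "\<lambda>y. e/2 + C * (\<Sum>i\<in>UNIV. 2 - 2 * cos (2 * pi * (x $ i - y $ i)))"
    have "of_nat (card ?B) * cmod (tp (\<lambda>k. corr ?B k * cfc ?g k) x) \<le> integral unit_cube (\<lambda>y. ?h y * kern_sq ?B (x - y))"
      by (rule kern_bound_aux[OF B]) (use C in \<open>auto intro!: continuous_intros f\<close>)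
    also have "\<dots> = of_nat (card ?B) * (e/2 + C * (6 / real (Suc N)))"
    proof -
      have cosint: "integral unit_cube (\<lambda>y. cos (2 * pi * (x $ i - y $ i)) * kern_sq ?B (x - y)) = card ?B * (1 - 1 / real (Suc N))" for i
      proof -
        let ?l = "axis i 1 :: int^3"
        have cr: "corr ?B (- ?l) = of_real (1 - 1 / real (Suc N))"
        proof -
          have "(\<Prod>j\<in>UNIV. tent (Suc N) ((- ?l) $ j)) = (\<Prod>j\<in>UNIV. if j = i then 1 - 1 / real (Suc N) else 1)"
            by (rule prod.cong) (auto simp: tent_def axis_def)
          then show ?thesis by (simp add: cube_box_def corr_box3)
        qed
        have "integral unit_cube (\<lambda>y. mode ?l x * (mode (- ?l) y * of_real (kern_sq ?B (x - y)))) = of_real (card ?B * (1 - 1 / real (Suc N)))"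
          by (subst integral_mult_right, subst integral_kern_mode[OF B], unfold cr)
            (simp add: mode_minus field_simps complex_norm_square[symmetric])
        then have "Re (integral unit_cube (\<lambda>y. mode ?l (x - y) * of_real (kern_sq ?B (x - y)))) = card ?B * (1 - 1 / real (Suc N))"
          by (simp only: mode_diff_arg mult.assoc Re_complex_of_real)
        moreover have "Re (integral unit_cube (\<lambda>y. mode ?l (x - y) * of_real (kern_sq ?B (x - y)))) = integral unit_cube (\<lambda>y. Re (mode ?l (x - y) * of_real (kern_sq ?B (x - y))))"
          by (rule integral_linear[OF _ bounded_linear_Re, symmetric, unfolded o_def]) (auto intro!: integrable_cube continuous_intros)
        ultimately show ?thesis by (simp add: mode_def inner_axis' cis.simps)
      qed
      have i1: "integral unit_cube (\<lambda>y. e/2 * kern_sq ?B (x - y)) = e/2 * card ?B"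
        by (subst integral_mult_right) (simp add: integral_kern[OF B])
      have i2: "integral unit_cube (\<lambda>y. (2 - 2 * cos (2 * pi * (x $ i - y $ i))) * kern_sq ?B (x - y)) = card ?B * (2 / real (Suc N))" for i
      proof -
        have "integral unit_cube (\<lambda>y. 2 * kern_sq ?B (x - y) - 2 * (cos (2 * pi * (x $ i - y $ i)) * kern_sq ?B (x - y)))
           = 2 * card ?B - 2 * (card ?B * (1 - 1 / real (Suc N)))"
          by (subst integral_diff) (auto intro!: integrable_cube continuous_intros simp: cosint integral_kern[OF B])
        then show ?thesis by (simp add: algebra_simps)
      qed
      have i3: "integral unit_cube (\<lambda>y. \<Sum>i\<in>UNIV. (2 - 2 * cos (2 * pi * (x $ i - y $ i))) * kern_sq ?B (x - y)) =
          (\<Sum>i\<in>(UNIV::3 set). card ?B * (2 / real (Suc N)))"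

      proof -
        have "integral unit_cube (\<lambda>y. \<Sum>i\<in>UNIV. (2 - 2 * cos (2 * pi * (x $ i - y $ i))) * kern_sq ?B (x - y)) =
          (\<Sum>i\<in>(UNIV::3 set). integral unit_cube (\<lambda>y. (2 - 2 * cos (2 * pi * (x $ i - y $ i))) * kern_sq ?B (x - y)))"
          by (rule integral_sum) (intro finite integrable_cube continuous_intros)+
        then show ?thesis by (simp only: i2)
      qed
      have i4: "integral unit_cube (\<lambda>y. C * (\<Sum>i\<in>UNIV. (2 - 2 * cos (2 * pi * (x $ i - y $ i))) * kern_sq ?B (x - y))) =
          C * (\<Sum>i\<in>(UNIV::3 set). card ?B * (2 / real (Suc N)))"
        by (subst integral_mult_right) (simp only: i3)
      have "integral unit_cube (\<lambda>y. ?h y * kern_sq ?B (x - y)) =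
         integral unit_cube (\<lambda>y. e/2 * kern_sq ?B (x - y) + C * (\<Sum>i\<in>UNIV. (2 - 2 * cos (2 * pi * (x $ i - y $ i))) * kern_sq ?B (x - y)))"
        by (intro integral_cong) (simp add: distrib_right sum_distrib_right mult.assoc)
      also have "\<dots> = e/2 * card ?B + C * (\<Sum>i\<in>(UNIV::3 set). card ?B * (2 / real (Suc N)))"
      proof -
        have A: "(\<lambda>y. e/2 * kern_sq ?B (x - y)) integrable_on unit_cube"
          by (intro integrable_cube continuous_intros)
        have B: "(\<lambda>y. C * (\<Sum>i\<in>UNIV. (2 - 2 * cos (2 * pi * (x $ i - y $ i))) * kern_sq ?B (x - y))) integrable_on unit_cube"
          by (intro integrable_cube continuous_intros)
        show ?thesis by (simp only: integral_add[OF A B] i1 i4)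
      qed
      finally show ?thesis by (simp add: algebra_simps)
    qed
    finally show ?thesis using B by (simp add: eq card_gt_0_iff)
  qed
  have "(\<lambda>N. e/2 + C * (6 * inverse (real (Suc N)))) \<longlonglongrightarrow> e/2 + C * (6 * 0)"
    by (intro tendsto_intros LIMSEQ_inverse_real_of_nat)
  then have "\<forall>\<^sub>F N in sequentially. e/2 + C * (6 * inverse (real (Suc N))) < e"
    by (rule order_tendstoD(2)) (use e in simp)
  then show ?thesis
  proof (rule eventually_mono, intro allI)
    fix N x assume "e/2 + C * (6 * inverse (real (Suc N))) < e"
    moreover have d: "6 / real (Suc N) = 6 * inverse (real (Suc N))" by (rule divide_inverse)
    ultimately show "cmod (tp (\<lambda>k. corr (cube_box N) k * cfc f k) x - f x) \<le> e"
      using main[of N x, unfolded d] by linarith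
  qed
qed

lemma trig_dense:
  fixes f :: "real^3 \<Rightarrow> complex"
  assumes f: "continuous_on UNIV f" "per f" and e: "e > 0"
  obtains c where "finsupp c" "\<And>x. cmod (tp c x - f x) \<le> e"
proof -
  obtain N where "\<forall>x. cmod (tp (\<lambda>k. corr (cube_box N) k * cfc f k) x - f x) \<le> e"
    using fejer_converges[OF f e] by (auto simp: eventually_sequentially)
  then show ?thesis
    by (intro that[of "\<lambda>k. corr (cube_box N) k * cfc f k"]) (auto intro!: finsupp_mult(2) corr_finsupp cube_box_facts)
qed

lemma periodic_iff_per: "periodic f \<longleftrightarrow> per f"
proof
  assume p: "periodic f"
  have ax: "f (x + axis i (real_of_int n)) = f x" for x i n
  proof (induction n arbitrary: x rule: int_induct[where k = 0])
    case base then show ?case by (simp add: axis_def zero_vec_def[symmetric])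
  next
    case (step1 n)
    have "x + axis i (real_of_int (n + 1)) = (x + axis i (real_of_int n)) + axis i 1"
      by (simp add: vec_eq_iff axis_def)
    then show ?case using p step1 by (metis periodic_def)
  next
    case (step2 n)
    have "x + axis i (real_of_int n) = (x + axis i (real_of_int (n - 1))) + axis i 1"
      by (simp add: vec_eq_iff axis_def)
    then show ?case using p step2 by (metis periodic_def)
  qed
  have sm: "f (x + (\<Sum>i\<in>I. axis i (real_of_int (m $ i)))) = f x" if "finite I" for x I and m :: "int^3"
    using that by (induction I arbitrary: x rule: finite_induct) (simp_all add: ax add.assoc[symmetric])
  have "freq m = (\<Sum>i\<in>UNIV. axis i (real_of_int (m $ i)))" for m
    by (simp add: vec_eq_iff axis_def if_distrib cong: if_cong)
  then show "per f" using sm by (simp add: per_def)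
next
  assume "per f"
  then have "f (x + freq (axis i 1)) = f x" for x i unfolding per_def by blast
  then show "periodic f" by (simp add: periodic_def)
qed

lemma per_comp: "per f \<Longrightarrow> per (\<lambda>x. g (f x))" "per f \<Longrightarrow> per f' \<Longrightarrow> per (\<lambda>x. g2 (f x) (f' x))"
  by (auto simp: per_def)

lemma per_tp: "per (tp c)" by (simp add: per_def tp_periodic)

section \<open>Fourier coefficients of derivatives\<close>

text \<open>The translate and the phase factor agree on trigonometric polynomials, which are dense. This avoids
  integrating over a shifted cube.\<close>
lemma cfc_shift:
  fixes f :: "real^3 \<Rightarrow> complex"
  assumes f: "continuous_on UNIV f" "per f"
  shows "cfc (\<lambda>x. f (x + h)) k = mode k h * cfc f k"
proof -
  have bd: "cmod (cfc (\<lambda>x. f (x + h)) k - mode k h * cfc f k) \<le> 2 * e" if e: "e > 0" for e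
  proof -
    obtain c where c: "finsupp c" "\<And>x. cmod (tp c x - f x) \<le> e" using trig_dense[OF f e] by blast
    have fh: "continuous_on UNIV (\<lambda>x. f (x + h))"
      by (rule continuous_on_compose2[OF f(1)]) (auto intro!: continuous_intros)
    have fsh: "finsupp (\<lambda>k. mode k h * c k)" using c(1) by (rule finsupp_mult(1))
    have translated: "tp c (x + h) = tp (\<lambda>k. mode k h * c k) x" for x
      using c(1) by (subst (1 2) tp_eq[where S = "{k. c k \<noteq> 0}"]) (auto simp: mode_shift mult_ac)
    have "cmod (cfc (\<lambda>x. tp (\<lambda>k. mode k h * c k) x - f (x + h)) k) \<le> e"
      by (rule norm_cfc_le) (use c(2)[of "x + h" for x] in \<open>auto simp: translated intro!: continuous_intros fh continuous_on_tp\<close>)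
    then have 1: "cmod (mode k h * c k - cfc (\<lambda>x. f (x + h)) k) \<le> e"
      using cfc_diff[OF continuous_on_tp fh, of "\<lambda>k. mode k h * c k" k] by (simp add: cfc_tp[OF fsh])
    have "cmod (cfc (\<lambda>x. tp c x - f x) k) \<le> e"
      by (rule norm_cfc_le) (use c(2) f in \<open>auto intro!: continuous_intros continuous_on_tp\<close>)
    then have "cmod (c k - cfc f k) \<le> e"
      using cfc_diff[OF continuous_on_tp f(1), of c k] c by (simp add: cfc_tp)
    then have "cmod (mode k h * (c k - cfc f k)) \<le> e" by (simp add: norm_mult)
    then have 2: "cmod (mode k h * c k - mode k h * cfc f k) \<le> e" by (simp add: right_diff_distrib)
    show ?thesis using 1 2 norm_triangle_ineq4[of "mode k h * c k - mode k h * cfc f k" "mode k h * c k - cfc (\<lambda>x. f (x + h)) k"]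
      by simp
  qed
  have "cmod (cfc (\<lambda>x. f (x + h)) k - mode k h * cfc f k) \<le> 0"
  proof (rule field_le_epsilon)
    fix e :: real assume "0 < e"
    then show "cmod (cfc (\<lambda>x. f (x + h)) k - mode k h * cfc f k) \<le> 0 + e" using bd[of "e/2"] by simp
  qed
  then show ?thesis by simp
qed

text \<open>By translation, the difference quotient of \<open>f\<close> in direction \<open>e\<^sub>i\<close> has the \<open>k\<close>-th coefficient
  \<open>(mode k (h e\<^sub>i) - 1) / h\<close> times that of \<open>f\<close>, and it converges uniformly to \<open>g\<close>.\<close>
lemma cfc_deriv:
  fixes f g :: "real^3 \<Rightarrow> complex"
  assumes f: "continuous_on UNIV f" "per f" and g: "continuous_on UNIV g" "per g"
    and der: "\<And>x t. ((\<lambda>s. f (x + s *\<^sub>R axis i 1)) has_vector_derivative g (x + t *\<^sub>R axis i 1)) (at t)"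
  shows "cfc g k = 2 * pi * \<i> * of_int (k $ i) * cfc f k"
proof -
  let ?e = "axis i 1 :: real^3"
  let ?D = "2 * pi * \<i> * of_int (k $ i)"
  have "((\<lambda>z. exp (?D * z)) has_field_derivative ?D) (at 0)"
    by (auto intro!: derivative_eq_intros)
  then have "((\<lambda>z. (exp (?D * z) - 1) / z) \<longlongrightarrow> ?D) (at 0)"
    by (simp add: DERIV_def)
  moreover have "filterlim complex_of_real (at 0) (at 0)"
    by (auto simp: filterlim_at eventually_at_filter intro!: tendsto_eq_intros)
  ultimately have "((\<lambda>h. (exp (?D * of_real h) - 1) / of_real h) \<longlongrightarrow> ?D) (at 0)"
    by (rule filterlim_compose)
  then have "((\<lambda>h. (exp (?D * of_real h) - 1) /\<^sub>R h) \<longlongrightarrow> ?D) (at 0)"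
    by (simp add: scaleR_conv_of_real field_simps)
  moreover have "exp (?D * of_real h) = mode k (h *\<^sub>R ?e)" for h :: real
    by (simp add: mode_def cis_conv_exp inner_axis mult_ac)
  ultimately have lim: "((\<lambda>h. (mode k (h *\<^sub>R ?e) - 1) /\<^sub>R h) \<longlongrightarrow> ?D) (at_right 0)"
    by (simp add: filterlim_at_split)
  have bd0: "cmod (?D * cfc f k - cfc g k) \<le> e" if e: "e > 0" for e
  proof -
    obtain C where C: "C \<ge> 0" "\<And>x y. cmod (g y - g x) \<le> e/2 + C * (\<Sum>i\<in>UNIV. 2 - 2 * cos (2 * pi * (x $ i - y $ i)))"
      using per_modulus[OF g, of "e/2"] e by auto
    have "((\<lambda>t::real. C * (2 - 2 * cos (2 * pi * t))) \<longlongrightarrow> C * (2 - 2 * cos (2 * pi * 0))) (at_right 0)"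
      by (intro tendsto_intros)
    then have "\<forall>\<^sub>F t in at_right 0. C * (2 - 2 * cos (2 * pi * t)) < e/2"
      by (rule order_tendstoD(2)) (use e in simp)
    then obtain h0 where h0: "h0 > 0" "\<And>t. 0 < t \<Longrightarrow> t < h0 \<Longrightarrow> C * (2 - 2 * cos (2 * pi * t)) < e/2"
      by (auto simp: eventually_at_right[OF zero_less_one])
    have gg: "cmod (g (x + t *\<^sub>R ?e) - g x) \<le> e" if "0 \<le> t" "t < h0" for x t
    proof (cases "t = 0")
      case True then show ?thesis using e by simp
    next
      case False
      have "(\<Sum>j\<in>UNIV. 2 - 2 * cos (2 * pi * (x $ j - (x + t *\<^sub>R ?e) $ j))) = (\<Sum>j\<in>UNIV. if j = i then 2 - 2 * cos (2 * pi * t) else 0)"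
        by (rule sum.cong) (auto simp: axis_def)
      then show ?thesis using C(2)[of "x + t *\<^sub>R ?e" x] h0(2)[of t] False that by simp
    qed
    have dq: "cmod (f (x + h *\<^sub>R ?e) - f x - of_real h * g x) \<le> e * h" if h: "0 < h" "h < h0" for x h
    proof -
      have "((\<lambda>t. g (x + t *\<^sub>R ?e)) has_integral (f (x + h *\<^sub>R ?e) - f (x + 0 *\<^sub>R ?e))) {0..h}"
        by (rule fundamental_theorem_of_calculus) (use h in simp, rule has_vector_derivative_at_within[OF der])
      moreover have "((\<lambda>t. g x) has_integral (h *\<^sub>R g x)) {0..h}"
        using has_integral_const_real[of "g x" 0 h] h by simp
      ultimately have I: "((\<lambda>t. g (x + t *\<^sub>R ?e) - g x) has_integral (f (x + h *\<^sub>R ?e) - f (x + 0 *\<^sub>R ?e) - h *\<^sub>R g x)) {0..h}"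
        by (rule has_integral_diff)
      have "cmod (f (x + h *\<^sub>R ?e) - f (x + 0 *\<^sub>R ?e) - h *\<^sub>R g x) \<le> e * measure lborel {0..h}"
        by (rule has_integral_bound_real[OF _ _ I, where S = "{}"]) (use gg h e in auto)
      then show ?thesis using h by (simp add: scaleR_conv_of_real[where 'a = complex])
    qed
    have bd: "cmod ((mode k (h *\<^sub>R ?e) - 1) /\<^sub>R h * cfc f k - cfc g k) \<le> e" if h: "0 < h" "h < h0" for h
    proof -
      have fh: "continuous_on UNIV (\<lambda>x. f (x + h *\<^sub>R ?e))"
        by (rule continuous_on_compose2[OF f(1)]) (auto intro!: continuous_intros)
      have hg: "continuous_on UNIV (\<lambda>x. of_real h * g x)" by (intro continuous_intros g)
      have "cmod (cfc (\<lambda>x. f (x + h *\<^sub>R ?e) - f x - of_real h * g x) k) \<le> e * h"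
        by (rule norm_cfc_le) (use dq h in \<open>auto intro!: continuous_intros f g fh\<close>)
      also have "cfc (\<lambda>x. f (x + h *\<^sub>R ?e) - f x - of_real h * g x) k = of_real h * ((mode k (h *\<^sub>R ?e) - 1) /\<^sub>R h * cfc f k - cfc g k)"
      proof -
        have "cfc (\<lambda>x. f (x + h *\<^sub>R ?e) - f x - of_real h * g x) k = mode k (h *\<^sub>R ?e) * cfc f k - cfc f k - of_real h * cfc g k"
          using cfc_diff[OF continuous_on_diff[OF fh f(1)] hg, of k] cfc_diff[OF fh f(1), of k]
          by (simp add: cfc_scale cfc_shift f)
        moreover have "of_real h * ((mode k (h *\<^sub>R ?e) - 1) /\<^sub>R h) = mode k (h *\<^sub>R ?e) - 1"
          using h by (simp add: scaleR_conv_of_real[where 'a = complex])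
        ultimately show ?thesis by (simp only: right_diff_distrib mult.assoc[symmetric]) (simp only: left_diff_distrib mult_1_left)
      qed
      finally show ?thesis using h by (simp add: norm_mult)
    qed
    have "((\<lambda>h. (mode k (h *\<^sub>R ?e) - 1) /\<^sub>R h * cfc f k - cfc g k) \<longlongrightarrow> ?D * cfc f k - cfc g k) (at_right 0)"
      by (intro tendsto_intros lim)
    moreover have "\<forall>\<^sub>F h in at_right 0. cmod ((mode k (h *\<^sub>R ?e) - 1) /\<^sub>R h * cfc f k - cfc g k) \<le> e"
      unfolding eventually_at_right[OF zero_less_one] using h0(1) bd by blast
    ultimately show ?thesis by (rule Lim_norm_ubound[OF trivial_limit_at_right_real])
  qed
  have "cmod (?D * cfc f k - cfc g k) \<le> 0"
    by (rule field_le_epsilon) (simp only: add_0_left bd0)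
  then show ?thesis by simp
qed

lemma smoothD:
  assumes "smooth f"
  shows "continuous_on UNIV f" "f differentiable (at x)" "b \<in> Basis \<Longrightarrow> smooth (\<lambda>x. frechet_derivative f (at x) b)"
proof -
  show "continuous_on UNIV f" using assms Ck.simps(1) unfolding smooth_def by blast
  have "Ck (Suc 0) f" using assms unfolding smooth_def by blast
  then show "f differentiable (at x)" by (auto simp: differentiable_on_def)
  have "Ck (Suc n) f" for n using assms unfolding smooth_def by blast
  then show "b \<in> Basis \<Longrightarrow> smooth (\<lambda>x. frechet_derivative f (at x) b)" by (auto simp: smooth_def)
qed

lemma smooth_line_derivative:
  fixes f :: "'a::euclidean_space \<Rightarrow> real"
  assumes "smooth f"
  shows "((\<lambda>s. f (x + s *\<^sub>R v)) has_real_derivative frechet_derivative f (at (x + t *\<^sub>R v)) v) (at t)"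
proof -
  have D: "(f has_derivative frechet_derivative f (at (x + t *\<^sub>R v))) (at (x + t *\<^sub>R v))"
    using smoothD(2)[OF assms] frechet_derivative_works by blast
  have "((\<lambda>s. x + s *\<^sub>R v) has_derivative (\<lambda>s. s *\<^sub>R v)) (at t)"
    by (auto intro!: derivative_eq_intros)
  from diff_chain_at[OF this D]
  have "((\<lambda>s. f (x + s *\<^sub>R v)) has_derivative (\<lambda>s. frechet_derivative f (at (x + t *\<^sub>R v)) (s *\<^sub>R v))) (at t)"
    by (simp add: o_def)
  then show ?thesis unfolding has_field_derivative_def
    by (rule has_derivative_eq_rhs)
      (simp add: fun_eq_iff linear_cmul[OF has_derivative_linear[OF D]] mult.commute)
qed

lemma frechet_periodic:
  fixes f :: "real^3 \<Rightarrow> real"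
  assumes "smooth f" "per f" shows "per (\<lambda>x. frechet_derivative f (at x) b)"
  unfolding per_def
proof (intro allI)
  fix x and m :: "int^3"
  have D: "(f has_derivative frechet_derivative f (at (x + freq m))) (at (x + freq m))"
    using smoothD(2)[OF assms(1)] frechet_derivative_works by blast
  have "((\<lambda>y. y + freq m) has_derivative (\<lambda>y. y)) (at x)" by (auto intro!: derivative_eq_intros)
  from diff_chain_at[OF this D] have "(f has_derivative frechet_derivative f (at (x + freq m))) (at x)"
    using assms(2) by (simp add: o_def per_def)
  then show "frechet_derivative f (at (x + freq m)) b = frechet_derivative f (at x) b"
    using frechet_derivative_at by metis
qed

lemma smooth_torusD:
  assumes "smooth_torus f"
  shows "continuous_on UNIV f" "per f" "smooth f" "smooth_torus (\<lambda>x. frechet_derivative f (at x) (axis i 1))"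
proof -
  show "smooth f" "per f" using assms by (auto simp: smooth_torus_def periodic_iff_per)
  then show "continuous_on UNIV f" "smooth_torus (\<lambda>x. frechet_derivative f (at x) (axis i 1))"
    using smoothD(1) smoothD(3)[of f "axis i 1"] frechet_periodic[of f "axis i 1"]
    by (auto simp: smooth_torus_def periodic_iff_per Basis_vec_def)
qed

lemma fcoef_partial:
  assumes "smooth_torus f"
  shows "fcoef (\<lambda>x. frechet_derivative f (at x) (axis i 1)) = dpartial i (fcoef f)"
proof
  fix k
  note f = smooth_torusD[OF assms]
  note g = smooth_torusD[OF f(4)]
  have "cfc (\<lambda>x. of_real (frechet_derivative f (at x) (axis i 1))) k = 2 * pi * \<i> * of_int (k $ i) * cfc (\<lambda>x. of_real (f x)) k"
  proof (rule cfc_deriv)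
    fix x t
    show "((\<lambda>s. complex_of_real (f (x + s *\<^sub>R axis i 1))) has_vector_derivative
       of_real (frechet_derivative f (at (x + t *\<^sub>R axis i 1)) (axis i 1))) (at t)"
      using smooth_line_derivative[OF f(3), of x "axis i 1" t]
      by (rule has_vector_derivative_of_real)
  next
    show "continuous_on UNIV (\<lambda>x. complex_of_real (f x))"
      "continuous_on UNIV (\<lambda>x. complex_of_real (frechet_derivative f (at x) (axis i 1)))"
      by (intro continuous_on_of_real f(1) g(1))+
    show "per (\<lambda>x. complex_of_real (f x))" "per (\<lambda>x. complex_of_real (frechet_derivative f (at x) (axis i 1)))"
      by (rule per_comp(1)[OF f(2)], rule per_comp(1)[OF g(2)])
  qed
  then show "fcoef (\<lambda>x. frechet_derivative f (at x) (axis i 1)) k = dpartial i (fcoef f) k"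
    by (simp add: fcoef_eq_cfc dpartial_def)
qed

text \<open>Each derivative gains one power of the frequency.\<close>
lemma fcoef_decay:
  assumes "smooth_torus f"
  shows "\<exists>C\<ge>0. \<forall>k. (\<Sum>i\<in>UNIV. \<bar>real_of_int (k $ i)\<bar>) ^ n * cmod (fcoef f k) \<le> C"
  using assms
proof (induction n arbitrary: f)
  case 0
  note f = smooth_torusD[OF 0]
  obtain M where M: "\<And>x. cmod (of_real (f x)) \<le> M" "M \<ge> 0"
    using per_norm_bounded[of "\<lambda>x. of_real (f x)"] f by (metis continuous_on_of_real per_comp(1))
  then show ?case unfolding fcoef_eq_cfc
    by (intro exI[of _ M]) (auto intro!: norm_cfc_le continuous_intros f)
next
  case (Suc n)
  have "\<exists>C\<ge>0. \<forall>k. (\<Sum>i\<in>UNIV. \<bar>real_of_int (k $ i)\<bar>) ^ n * cmod (fcoef (\<lambda>x. frechet_derivative f (at x) (axis j 1)) k) \<le> C" for j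
    by (rule Suc.IH) (rule smooth_torusD[OF Suc.prems])
  then obtain C where C: "\<And>j. C j \<ge> 0" "\<And>j k. (\<Sum>i\<in>UNIV. \<bar>real_of_int (k $ i)\<bar>) ^ n * cmod (dpartial j (fcoef f) k) \<le> C j"
    unfolding fcoef_partial[OF Suc.prems] by metis
  have "(\<Sum>i\<in>UNIV. \<bar>real_of_int (k $ i)\<bar>) ^ Suc n * cmod (fcoef f k) \<le> (\<Sum>j\<in>UNIV. C j)" for k
  proof -
    let ?s = "(\<Sum>i\<in>UNIV. \<bar>real_of_int (k $ i)\<bar>) ^ n"
    have s: "?s \<ge> 0" by (simp add: sum_nonneg)
    have "?s * (\<bar>real_of_int (k $ j)\<bar> * cmod (fcoef f k)) \<le> C j" for j
    proof -
      have "1 * (\<bar>real_of_int (k $ j)\<bar> * cmod (fcoef f k)) \<le> (2 * pi) * (\<bar>real_of_int (k $ j)\<bar> * cmod (fcoef f k))"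
        by (rule mult_right_mono) (use pi_gt3 in auto)
      also have "\<dots> = cmod (dpartial j (fcoef f) k)" by (simp add: dpartial_def norm_mult)
      finally have "?s * (1 * (\<bar>real_of_int (k $ j)\<bar> * cmod (fcoef f k))) \<le> ?s * cmod (dpartial j (fcoef f) k)"
        by (rule mult_left_mono[OF _ s])
      then show ?thesis using C(2)[where j=j and k=k] by (simp only: mult_1_left)
    qed
    then have "(\<Sum>j\<in>UNIV. ?s * (\<bar>real_of_int (k $ j)\<bar> * cmod (fcoef f k))) \<le> (\<Sum>j\<in>UNIV. C j)"
      by (intro sum_mono)
    then show ?thesis by (simp add: sum_distrib_left sum_distrib_right mult_ac)
  qed
  then show ?case using C(1) by (intro exI[of _ "\<Sum>j\<in>UNIV. C j"]) (auto intro: sum_nonneg)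
qed

text \<open>The induction over the order of differentiability needs arbitrary coefficients, because a derivative
  of a trigonometric polynomial is one with other coefficients.\<close>
lemma smooth_trig:
  "smooth (\<lambda>x. Re (\<Sum>k\<in>S. a k * mode k x))"
proof -
  have D: "((\<lambda>x. Re (\<Sum>k\<in>S. a k * mode k x)) has_derivative
     (\<lambda>h. Re (\<Sum>k\<in>S. a k * (2 * pi * \<i> * (freq k \<bullet> h)) * mode k x))) (at x)" for a :: coeffs and x
    unfolding mode_def Re_sum
    by (rule has_derivative_sum) (auto simp: cis.ctr algebra_simps intro!: derivative_eq_intros)
  have "Ck n (\<lambda>x. Re (\<Sum>k\<in>S. a k * mode k x))" for n
  proof (induction n arbitrary: a)
    case 0 then show ?case by (auto intro!: continuous_intros)
  next
    case (Suc n)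
    let ?f = "\<lambda>x. Re (\<Sum>k\<in>S. a k * mode k x)"
    have d: "frechet_derivative ?f (at x) b = Re (\<Sum>k\<in>S. a k * (2 * pi * \<i> * (freq k \<bullet> b)) * mode k x)" for x b
      using frechet_derivative_at[OF D[where a=a and x=x], symmetric] by simp
    have "Ck n (\<lambda>x. frechet_derivative ?f (at x) b)" for b
      unfolding d by (rule Suc.IH)
    moreover have "?f differentiable_on UNIV"
      using D by (auto simp: differentiable_on_def differentiable_def)
    ultimately show ?case unfolding Ck.simps by blast
  qed
  then show ?thesis by (simp add: smooth_def)
qed

section \<open>Fourier multipliers in the supremum norm\<close>

text \<open>The Fourier multiplier with symbol \<open>m\<close> has norm at most \<open>C\<close> on trigonometric polynomials with the
  supremum norm. Such symbols form an algebra, are stable under pointwise limits, and may be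
  translated.\<close>
definition multiplier :: "coeffs \<Rightarrow> real \<Rightarrow> bool" where
  "multiplier m C \<longleftrightarrow> C \<ge> 0 \<and> (\<forall>c A x. finsupp c \<longrightarrow> (\<forall>x. cmod (tp c x) \<le> A) \<longrightarrow> cmod (tp (\<lambda>k. m k * c k) x) \<le> C * A)"

lemma multiplierI:
  assumes "C \<ge> 0" "\<And>c A x. finsupp c \<Longrightarrow> A \<ge> 0 \<Longrightarrow> (\<And>x. cmod (tp c x) \<le> A) \<Longrightarrow> cmod (tp (\<lambda>k. m k * c k) x) \<le> C * A"
  shows "multiplier m C"
  unfolding multiplier_def
proof (intro conjI allI impI)
  fix c A x assume "finsupp c" "\<forall>x. cmod (tp c x) \<le> A"
  then show "cmod (tp (\<lambda>k. m k * c k) x) \<le> C * A"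
    using assms(2)[of c A x] norm_ge_zero[of "tp c x"] order_trans by blast
qed (fact assms)

lemma multiplierD: "multiplier m C \<Longrightarrow> finsupp c \<Longrightarrow> (\<And>x. cmod (tp c x) \<le> A) \<Longrightarrow> cmod (tp (\<lambda>k. m k * c k) x) \<le> C * A"
  and multiplier_nonneg: "multiplier m C \<Longrightarrow> C \<ge> 0"
  by (auto simp: multiplier_def)

lemma multiplier_mono: assumes "multiplier m C" "C \<le> C'" shows "multiplier m C'"
proof (rule multiplierI)
  show "0 \<le> C'" using assms multiplier_nonneg by fastforce
  fix c A x assume "finsupp c" "A \<ge> 0" "\<And>x. cmod (tp c x) \<le> A"
  then show "cmod (tp (\<lambda>k. m k * c k) x) \<le> C' * A"
    using multiplierD[OF assms(1), of c A x] mult_right_mono[OF assms(2), of A] order_trans by blast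
qed

lemma multiplier_const: "multiplier (\<lambda>_. a) (cmod a)"
  by (rule multiplierI) (auto simp: tp_scale norm_mult intro!: mult_left_mono)

lemma multiplier_mult: assumes "multiplier m C" "multiplier n D" shows "multiplier (\<lambda>k. m k * n k) (C * D)"
proof (rule multiplierI)
  show "0 \<le> C * D" using assms by (simp add: multiplier_nonneg)
  fix c A x assume "finsupp c" "\<And>x. cmod (tp c x) \<le> A"
  then show "cmod (tp (\<lambda>k. m k * n k * c k) x) \<le> C * D * A"
    using multiplierD[OF assms(1) finsupp_mult(1), of c n "D * A" x] multiplierD[OF assms(2), of c A] by (simp add: mult.assoc)
qed

lemma multiplier_add: assumes "multiplier m C" "multiplier n D" shows "multiplier (\<lambda>k. m k + n k) (C + D)"
proof (rule multiplierI)
  show "0 \<le> C + D" using assms by (simp add: multiplier_nonneg)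
  fix c A x assume c: "finsupp c" "\<And>x. cmod (tp c x) \<le> A"
  then show "cmod (tp (\<lambda>k. (m k + n k) * c k) x) \<le> (C + D) * A"
    using multiplierD[OF assms(1) c] multiplierD[OF assms(2) c] norm_triangle_ineq[of "tp (\<lambda>k. m k * c k) x" "tp (\<lambda>k. n k * c k) x"]
    by (simp add: distrib_right tp_add finsupp_mult(1) add_mono order_trans)
qed

lemma multiplier_scale: "multiplier m C \<Longrightarrow> multiplier (\<lambda>k. a * m k) (cmod a * C)"
  using multiplier_mult[OF multiplier_const] .

lemma multiplier_diff: assumes "multiplier m C" "multiplier n D" shows "multiplier (\<lambda>k. m k - n k) (C + D)"
  using multiplier_add[OF assms(1) multiplier_scale[OF assms(2), of "-1"]] by simp

lemma multiplier_sum: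
  "finite I \<Longrightarrow> (\<And>i. i \<in> I \<Longrightarrow> multiplier (m i) (C i)) \<Longrightarrow> multiplier (\<lambda>k. \<Sum>i\<in>I. m i k) (\<Sum>i\<in>I. C i)"
proof (induction rule: finite_induct)
  case empty then show ?case using multiplier_const[of 0] by simp
next
  case (insert i I) then show ?case using multiplier_add by simp
qed

lemma multiplier_lim:
  assumes "\<And>n::nat. multiplier (m n) C" "\<And>k. (\<lambda>n. m n k) \<longlonglongrightarrow> m' k"
  shows "multiplier m' C"
proof (rule multiplierI)
  show "0 \<le> C" using assms multiplier_nonneg by blast
  fix c A x assume c: "finsupp c" "\<And>x. cmod (tp c x) \<le> A"
  have eq: "tp (\<lambda>k. a k * c k) x = (\<Sum>k\<in>{k. c k \<noteq> 0}. a k * c k * mode k x)" for a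
    using c(1) by (intro tp_eq) auto
  have "(\<lambda>n. tp (\<lambda>k. m n k * c k) x) \<longlonglongrightarrow> tp (\<lambda>k. m' k * c k) x"
    unfolding eq by (intro tendsto_intros assms)
  moreover have "cmod (tp (\<lambda>k. m n k * c k) x) \<le> C * A" for n
    using multiplierD[OF assms(1) c] by blast
  ultimately show "cmod (tp (\<lambda>k. m' k * c k) x) \<le> C * A"
    using Lim_norm_ubound[of sequentially _ "tp (\<lambda>k. m' k * c k) x" "C * A"] by simp
qed

lemma multiplier_translate: "multiplier (\<lambda>k. mode k h) 1"
proof (rule multiplierI)
  fix c A x assume c: "finsupp c" "\<And>x. cmod (tp c x) \<le> A"
  have "tp (\<lambda>k. mode k h * c k) x = tp c (x + h)"
    using c(1) by (subst (1 2) tp_eq[where S = "{k. c k \<noteq> 0}"]) (auto simp: mode_shift mult_ac)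
  then show "cmod (tp (\<lambda>k. mode k h * c k) x) \<le> 1 * A" using c by simp
qed simp

text \<open>Multiplication by a character does not change absolute values, and it shifts frequencies.\<close>
lemma multiplier_shift: assumes "multiplier m C" shows "multiplier (\<lambda>k. m (k - l)) C"
proof (rule multiplierI)
  show "0 \<le> C" using assms by (rule multiplier_nonneg)
  fix c A x assume c: "finsupp c" "\<And>x. cmod (tp c x) \<le> A"
  have freq_gap: "tp c x = mode l x * tp (\<lambda>k. c (k + l)) x" "finsupp (\<lambda>k. c (k + l))" if "finsupp c" for c x
  proof -
    have b: "bij_betw (\<lambda>k. k + l) {k. c (k + l) \<noteq> 0} {k. c k \<noteq> 0}"
      by (rule bij_betw_byWitness[where f' = "\<lambda>k. k - l"]) auto
    show "finsupp (\<lambda>k. c (k + l))" using bij_betw_finite[OF b] that by simp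
    show "tp c x = mode l x * tp (\<lambda>k. c (k + l)) x"
      unfolding tp_def sum.reindex_bij_betw[OF b, symmetric] by (simp add: sum_distrib_left mode_add mult_ac)
  qed
  have "cmod (tp (\<lambda>k. c (k + l)) x) \<le> A" for x using c(2)[of x] freq_gap(1)[OF c(1), of x] by (simp add: norm_mult)
  then show "cmod (tp (\<lambda>k. m (k - l) * c k) x) \<le> C * A"
    using multiplierD[OF assms freq_gap(2)[OF c(1)]] freq_gap(1)[of "\<lambda>k. m (k - l) * c k"] finsupp_mult(1)[OF c(1)]
    by (simp add: norm_mult)
qed

lemma multiplier_corr: assumes "finite B" "B \<noteq> {}" shows "multiplier (corr B) 1"
proof (rule multiplierI)
  fix c A x assume c: "finsupp c" "\<And>x. cmod (tp c x) \<le> A"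
  then show "cmod (tp (\<lambda>k. corr B k * c k) x) \<le> 1 * A"
    using corr_bound[OF assms continuous_on_tp, of c A x] by (simp add: cfc_tp)
qed simp

text \<open>Fejer's multiplier in one coordinate is the limit of those of boxes whose other two sides tend to
  infinity.\<close>
lemma multiplier_tent:
  assumes "N > 0" shows "multiplier (\<lambda>k. of_real (tent N (k $ i))) 1"
proof (rule multiplier_lim)
  fix M
  show "multiplier (corr (box3 (\<lambda>j. if j = i then N else Suc M))) 1"
    by (rule multiplier_corr) (rule box3_facts, use assms in simp)+
next
  fix k
  have "(\<lambda>M. complex_of_real (\<Prod>j\<in>UNIV. tent (if j = i then N else Suc M) (k $ j))) \<longlonglongrightarrow>
     of_real (\<Prod>j\<in>UNIV. if j = i then tent N (k $ i) else 1)"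
    by (intro tendsto_of_real tendsto_prod) (auto simp: tent_lim)
  then show "(\<lambda>M. corr (box3 (\<lambda>j. if j = i then N else Suc M)) k) \<longlonglongrightarrow> of_real (tent N (k $ i))"
    using assms by (simp add: corr_box3 if_distrib cong: if_cong)
qed

text \<open>The symbol is finitely supported, so it is applied to a continuous function as well, through the
  Fejer means of the latter.\<close>
lemma multiplier_cont:
  assumes m: "multiplier m C" "finsupp m" and f: "continuous_on UNIV f" "\<And>x. x \<in> unit_cube \<Longrightarrow> cmod (f x) \<le> A"
  shows "cmod (tp (\<lambda>k. m k * cfc f k) x) \<le> C * A"
proof -
  have eq: "tp (\<lambda>k. m k * a k) x = (\<Sum>k\<in>{k. m k \<noteq> 0}. m k * a k * mode k x)" for a
    using m(2) by (intro tp_eq) auto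
  have "(\<lambda>N. tp (\<lambda>k. m k * (corr (cube_box N) k * cfc f k)) x) \<longlonglongrightarrow> tp (\<lambda>k. m k * (1 * cfc f k)) x"
    unfolding eq by (intro tendsto_intros corr_cube_lim)
  moreover have "cmod (tp (\<lambda>k. m k * (corr (cube_box N) k * cfc f k)) x) \<le> C * A" for N
    by (rule multiplierD[OF m(1)]) (auto intro!: finsupp_mult(2) corr_finsupp cube_box_facts corr_bound f)
  ultimately show ?thesis using Lim_norm_ubound[of sequentially _ "tp (\<lambda>k. m k * (1 * cfc f k)) x" "C * A"] by simp
qed

definition second_diff :: "(nat \<Rightarrow> real) \<Rightarrow> nat \<Rightarrow> real" where
  "second_diff c n = c (Suc n) - 2 * c n + c (n - 1)"

text \<open>Discrete Taylor expansion at \<open>M\<close>, read backwards: summation by parts twice.\<close>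
lemma second_difference_expansion:
  assumes "p \<le> M" "0 < M"
  shows "c p = c M + real (M - p) * (c (M - 1) - c M) + (\<Sum>n\<in>{1..<M}. real (n - p) * second_diff c n)"
  using assms
proof (induction M)
  case (Suc M)
  show ?case
  proof (cases "p \<le> M \<and> 0 < M")
    case True
    then have "c p = c M + real (M - p) * (c (M - 1) - c M) + (\<Sum>n\<in>{1..<M}. real (n - p) * second_diff c n)" using Suc.IH by blast
    moreover have "(\<Sum>n\<in>{1..<Suc M}. real (n - p) * second_diff c n) = (\<Sum>n\<in>{1..<M}. real (n - p) * second_diff c n) + real (M - p) * second_diff c M"
      using True by (simp add: atLeastLessThanSuc)
    ultimately show ?thesis using True by (simp add: second_diff_def algebra_simps Suc_diff_le)
  next
    case False
    then have "p = Suc M \<or> (p = 0 \<and> M = 0)" using Suc.prems by auto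
    then show ?thesis by (auto intro!: sum.neutral[symmetric])
  qed
qed simp

lemma tent_nat: "0 < n \<Longrightarrow> real n * tent n p = real (n - nat \<bar>p\<bar>)"
  by (auto simp: tent_def max_def field_simps of_nat_diff)

text \<open>Since \<open>n * tent n p = n - p\<close> (truncated at 0), this writes a finitely supported even sequence as a
  combination of Fejer multipliers with weights \<open>n * second_diff c n\<close>.\<close>
lemma even_expansion:
  assumes "0 < M" "\<And>n. n \<ge> M \<Longrightarrow> c n = 0"
  shows "c p = (\<Sum>n\<in>{1..<Suc M}. real (n - p) * second_diff c n)"
proof (cases "p \<le> Suc M")
  case True
  then show ?thesis using second_difference_expansion[of p "Suc M" c] assms by simp
next
  case False
  then show ?thesis using assms by (auto intro!: sum.neutral)
qed

text \<open>Polya's criterion. All weights of the tents in the second difference expansion are nonnegative,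
  so the multiplier norm is the value at \<open>0\<close>.\<close>
lemma multiplier_polya:
  assumes "\<And>n. c n \<ge> 0" "\<And>n. c (Suc n) \<le> c n" "\<And>n. n \<ge> 1 \<Longrightarrow> second_diff c n \<ge> 0"
  shows "multiplier (\<lambda>k. of_real (c (nat \<bar>k $ i\<bar>))) (c 0)"
proof (rule multiplier_lim)
  fix N
  let ?M = "Suc N"
  let ?m = "\<lambda>k::int^3. of_real (c ?M) + of_real (real ?M * (c N - c ?M)) * of_real (tent ?M (k $ i))
     + (\<Sum>n\<in>{1..<?M}. of_real (real n * second_diff c n) * complex_of_real (tent n (k $ i)))"
  have "multiplier ?m (cmod (of_real (c ?M)) + cmod (of_real (real ?M * (c N - c ?M))) * 1 + (\<Sum>n\<in>{1..<?M}. cmod (of_real (real n * second_diff c n)) * 1))"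
    by (intro multiplier_add multiplier_sum multiplier_scale multiplier_tent multiplier_const) auto
  also have "cmod (of_real (c ?M)) + cmod (of_real (real ?M * (c N - c ?M))) * 1 + (\<Sum>n\<in>{1..<?M}. cmod (of_real (real n * second_diff c n)) * 1)
     = c ?M + real ?M * (c N - c ?M) + (\<Sum>n\<in>{1..<?M}. real n * second_diff c n)"
    unfolding norm_of_real using assms by (intro arg_cong2[where f = "(+)"] sum.cong) (auto intro!: abs_of_nonneg mult_nonneg_nonneg)
  also have "\<dots> = c 0" using second_difference_expansion[of 0 ?M c] by simp
  finally show "multiplier ?m (c 0)" .
next
  fix k :: "int^3"
  let ?m = "\<lambda>N. of_real (c (Suc N)) + of_real (real (Suc N) * (c N - c (Suc N))) * of_real (tent (Suc N) (k $ i))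
     + (\<Sum>n\<in>{1..<Suc N}. of_real (real n * second_diff c n) * complex_of_real (tent n (k $ i)))"
  let ?p = "nat \<bar>k $ i\<bar>"
  have "?m N = of_real (c ?p)" if "N \<ge> ?p" for N
  proof -
    have S: "(\<Sum>n\<in>{1..<Suc N}. real (n - ?p) * second_diff c n) = (\<Sum>n\<in>{1..<Suc N}. real n * second_diff c n * tent n (k $ i))"
      by (rule sum.cong) (simp_all add: tent_nat[symmetric] mult_ac)
    have T: "real (Suc N - ?p) = real (Suc N) * tent (Suc N) (k $ i)" by (rule tent_nat[symmetric]) simp
    have "c ?p = c (Suc N) + real (Suc N) * tent (Suc N) (k $ i) * (c N - c (Suc N))
       + (\<Sum>n\<in>{1..<Suc N}. real n * second_diff c n * tent n (k $ i))"
      using second_difference_expansion[of ?p "Suc N" c] that unfolding S T by simp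
    also have "real (Suc N) * tent (Suc N) (k $ i) * (c N - c (Suc N)) = real (Suc N) * (c N - c (Suc N)) * tent (Suc N) (k $ i)"
      by (simp only: mult_ac)
    finally have "c ?p = c (Suc N) + real (Suc N) * (c N - c (Suc N)) * tent (Suc N) (k $ i)
       + (\<Sum>n\<in>{1..<Suc N}. real n * second_diff c n * tent n (k $ i))" .
    then show ?thesis by (simp only: of_real_add of_real_mult of_real_sum)
  qed
  then show "?m \<longlonglongrightarrow> of_real (c ?p)"
    by (intro tendsto_eventually eventually_sequentiallyI)
qed

text \<open>Bernstein's inequality. On \<open>[-N, N]\<close> the identity function is \<open>N\<close> times the difference of two tents
  of width \<open>N\<close>, centred at \<open>N\<close> and at \<open>- N\<close>.\<close>
lemma multiplier_derivative:
  assumes "N > 0"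
  shows "\<exists>m. multiplier m (2 * real N) \<and> (\<forall>k. \<bar>k $ i\<bar> \<le> int N \<longrightarrow> m k = of_int (k $ i))"
proof -
  let ?t = "\<lambda>k::int^3. complex_of_real (tent N (k $ i))"
  let ?m = "\<lambda>k. of_real (real N) * (?t (k - axis i (int N)) - ?t (k - axis i (- int N)))"
  have "multiplier ?m (cmod (of_real (real N)) * (1 + 1))"
    by (intro multiplier_scale multiplier_diff multiplier_shift[of ?t] multiplier_tent assms)
  moreover have "?m k = of_int (k $ i)" if "\<bar>k $ i\<bar> \<le> int N" for k
  proof -
    have "real N * (tent N (k $ i - int N) - tent N (k $ i + int N)) = of_int (k $ i)"
      using that assms by (auto simp: tent_def max_def field_simps abs_if split: if_splits)
    then have "complex_of_real (real N * (tent N (k $ i - int N) - tent N (k $ i + int N))) = of_int (k $ i)"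
      by simp
    then show ?thesis by (simp add: algebra_simps)
  qed
  ultimately show ?thesis by (intro exI[of _ ?m]) (simp add: mult.commute)
qed

section \<open>The heat semigroup on high frequencies\<close>

lemma cos_power_limit: "(\<lambda>n. cos (y / sqrt (real n)) ^ n) \<longlonglongrightarrow> exp (- y\<^sup>2 / 2)"
proof -
  have "(\<lambda>n. cos (y / sqrt (real n)) powr (real n)) \<longlonglongrightarrow> exp (- y\<^sup>2 / 2)"
    by (real_asymp simp: power2_eq_square)
  moreover have "\<forall>\<^sub>F n in sequentially. cos (y / sqrt (real n)) powr (real n) = cos (y / sqrt (real n)) ^ n"
  proof -
    have "\<forall>\<^sub>F n in sequentially. cos (y / sqrt (real n)) > 0" by real_asymp
    then show ?thesis by eventually_elim (simp add: powr_realpow)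
  qed
  ultimately show ?thesis by (rule Lim_transform_eventually)
qed

lemma multiplier_power: "multiplier m 1 \<Longrightarrow> multiplier (\<lambda>k. m k ^ n) 1"
proof (induction n)
  case 0 show ?case using multiplier_const[of 1] by simp
next
  case (Suc n) then show ?case using multiplier_mult[of m 1 "\<lambda>k. m k ^ n" 1] by simp
qed

text \<open>The cosine is the mean of two translations, which are isometries.\<close>
lemma multiplier_cos: "multiplier (\<lambda>k. of_real (cos (h * of_int (k $ i)))) 1"
proof -
  let ?v = "(h / (2 * pi)) *\<^sub>R axis i 1 :: real^3"
  have "multiplier (\<lambda>k. (1/2) * (mode k ?v + mode k (- ?v))) (cmod (1/2) * (1 + 1))"
    by (intro multiplier_scale multiplier_add multiplier_translate)
  moreover have "(1/2) * (mode k ?v + mode k (- ?v)) = of_real (cos (h * of_int (k $ i)))" for k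
    by (simp add: mode_def inner_axis complex_eq_iff mult_ac)
  ultimately show ?thesis by simp
qed

text \<open>By the central limit theorem for a fair coin, the Gaussian is a limit of powers of cosines.\<close>
lemma multiplier_gauss:
  assumes "t \<ge> 0" shows "multiplier (\<lambda>k. of_real (exp (- t * (of_int (k $ i))\<^sup>2))) 1"
proof (rule multiplier_lim)
  fix n
  show "multiplier (\<lambda>k. of_real (cos (sqrt (2 * t) / sqrt (real n) * of_int (k $ i))) ^ n) 1"
    by (intro multiplier_power multiplier_cos)
next
  fix k :: "int^3"
  have "(sqrt (2 * t) * of_int (k $ i))\<^sup>2 / 2 = t * (of_int (k $ i))\<^sup>2"
    using assms by (simp add: power_mult_distrib)
  then have "(\<lambda>n. cos (sqrt (2 * t) * of_int (k $ i) / sqrt (real n)) ^ n) \<longlonglongrightarrow> exp (- t * (of_int (k $ i))\<^sup>2)"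
    using cos_power_limit[of "sqrt (2 * t) * of_int (k $ i)"] by simp
  then have "(\<lambda>n. complex_of_real (cos (sqrt (2 * t) * of_int (k $ i) / sqrt (real n)) ^ n)) \<longlonglongrightarrow> of_real (exp (- t * (of_int (k $ i))\<^sup>2))"
    by (rule tendsto_of_real)
  then show "(\<lambda>n. complex_of_real (cos (sqrt (2 * t) / sqrt (real n) * of_int (k $ i))) ^ n) \<longlonglongrightarrow> of_real (exp (- t * (of_int (k $ i))\<^sup>2))"
    by simp
qed

lemma gauss_convex:
  fixes \<tau> s0 :: real
  assumes "\<tau> > 0" "s0 > 0" "2 * \<tau> * s0\<^sup>2 \<ge> 1"
  shows "convex_on {s0..} (\<lambda>s. exp (- \<tau> * s\<^sup>2))"
proof (rule f''_ge0_imp_convex)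
  fix s assume s: "s \<in> {s0..}"
  show "((\<lambda>s. exp (- \<tau> * s\<^sup>2)) has_real_derivative (- 2 * \<tau> * s) * exp (- \<tau> * s\<^sup>2)) (at s)"
    by (auto intro!: derivative_eq_intros)
  show "((\<lambda>s. (- 2 * \<tau> * s) * exp (- \<tau> * s\<^sup>2)) has_real_derivative (2 * \<tau> * (2 * \<tau> * s\<^sup>2 - 1)) * exp (- \<tau> * s\<^sup>2)) (at s)"
    by (auto intro!: derivative_eq_intros simp: algebra_simps power2_eq_square)
  have "s0\<^sup>2 \<le> s\<^sup>2" using s assms by (intro power_mono) auto
  then have "2 * \<tau> * s0\<^sup>2 \<le> 2 * \<tau> * s\<^sup>2" using assms by (intro mult_left_mono) auto
  then have "0 \<le> 2 * \<tau> * s\<^sup>2 - 1" using assms by linarith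
  then show "0 \<le> (2 * \<tau> * (2 * \<tau> * s\<^sup>2 - 1)) * exp (- \<tau> * s\<^sup>2)"
    using assms by (intro mult_nonneg_nonneg) auto
qed simp

text \<open>The Gaussian is convex beyond its inflection point. Extended to the left by its chord it satisfies
  Polya's criterion, and the value at \<open>0\<close> is still exponentially small.\<close>
lemma multiplier_gauss_tail:
  assumes t: "\<tau> > 0" and n0: "n0 \<ge> 1" "2 * \<tau> * (real n0)\<^sup>2 \<ge> 1"
  shows "\<exists>m. multiplier m (6 * exp (- \<tau> * (real n0)\<^sup>2 / 2)) \<and>
    (\<forall>k. int n0 \<le> \<bar>k $ i\<bar> \<longrightarrow> m k = of_real (exp (- \<tau> * (of_int (k $ i))\<^sup>2)))"
proof -
  define E where "E n = exp (- \<tau> * (real n)\<^sup>2)" for n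
  (* The chord through n0 and n0 + 1 is continued to the left of n0. *)
  define c where "c n = (if n0 \<le> n then E n else E n0 + (real n0 - real n) * (E n0 - E (Suc n0)))" for n
  have Edec: "E (Suc n) \<le> E n" for n
    using t by (auto simp: E_def intro!: mult_left_mono power_mono)
  have Epos: "E n > 0" for n by (simp add: E_def)
  have cpos: "c n \<ge> 0" for n using Edec[of n0] Epos[of n] Epos[of n0] by (auto simp: c_def intro!: add_nonneg_nonneg)
  have cdec: "c (Suc n) \<le> c n" for n
  proof -
    consider "n0 \<le> n" | "Suc n = n0" | "Suc n < n0" by linarith
    then show ?thesis
    proof cases
      case 1 then show ?thesis using Edec by (simp add: c_def)
    next
      case 2 then show ?thesis using Edec[of n0] by (auto simp: c_def)
    next
      case 3 then show ?thesis using Edec[of n0] by (simp add: c_def algebra_simps)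
    qed
  qed
  have cdd: "second_diff c n \<ge> 0" if n: "n \<ge> 1" for n
  proof -
    consider "n0 < n" | "n = n0" | "n < n0" by linarith
    then show ?thesis
    proof cases
      case 1
      have "convex_on {real n0..} (\<lambda>s. exp (- \<tau> * s\<^sup>2))" by (rule gauss_convex) (use assms in auto)
      from convex_onD[OF this, of "1/2" "real (n - 1)" "real (Suc n)"]
      have "exp (- \<tau> * ((1/2) * real (n - 1) + (1/2) * real (Suc n))\<^sup>2) \<le> (1/2) * E (n - 1) + (1/2) * E (Suc n)"
        using 1 by (simp add: E_def)
      moreover have "(1/2) * real (n - 1) + (1/2) * real (Suc n) = real n" using n by (simp add: of_nat_diff field_simps)
      ultimately have "E n \<le> (1/2) * E (n - 1) + (1/2) * E (Suc n)" by (simp only: E_def)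
      moreover have "n0 \<le> n - 1" using 1 by simp
      ultimately show ?thesis using 1 by (simp add: second_diff_def c_def)
    next
      case 2
      then have "c (n - 1) = E n0 + (real n0 - real (n - 1)) * (E n0 - E (Suc n0))" using n by (auto simp: c_def)
      then show ?thesis using 2 n by (simp add: second_diff_def c_def of_nat_diff algebra_simps)
    next
      case 3
      then have "c (Suc n) = E n0 + (real n0 - real (Suc n)) * (E n0 - E (Suc n0))"
      proof (cases "Suc n = n0")
        case True then show ?thesis by (auto simp: c_def)
      qed (auto simp: c_def)
      moreover have "c n = E n0 + (real n0 - real n) * (E n0 - E (Suc n0))" "c (n - 1) = E n0 + (real n0 - real (n - 1)) * (E n0 - E (Suc n0))"
        using 3 by (auto simp: c_def)
      ultimately show ?thesis using n by (simp add: second_diff_def of_nat_diff algebra_simps)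
    qed
  qed
  let ?y = "\<tau> * (real n0)\<^sup>2"
  have "c 0 \<le> 6 * exp (- \<tau> * (real n0)\<^sup>2 / 2)"
  proof -
    have y: "?y \<ge> 0" using t by simp
    have "c 0 = E n0 + real n0 * (E n0 - E (Suc n0))" using n0 by (simp add: c_def)
    also have "E (Suc n0) = E n0 * exp (- (\<tau> * (2 * real n0 + 1)))"
      by (simp add: E_def exp_add[symmetric] algebra_simps power2_eq_square)
    also have "E n0 + real n0 * (E n0 - E n0 * exp (- (\<tau> * (2 * real n0 + 1)))) = E n0 * (1 + real n0 * (1 - exp (- (\<tau> * (2 * real n0 + 1)))))"
      by (simp add: algebra_simps)
    also have "\<dots> \<le> E n0 * (1 + real n0 * (\<tau> * (2 * real n0 + 1)))"
      using exp_ge_add_one_self[of "- (\<tau> * (2 * real n0 + 1))"] Epos[of n0] by (intro mult_left_mono add_left_mono) auto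
    also have "\<dots> \<le> E n0 * (1 + 3 * ?y)"
    proof -
      have "real n0 * (2 * real n0 + 1) \<le> real n0 * (3 * real n0)" using n0 by (intro mult_left_mono) auto
      then have "\<tau> * (real n0 * (2 * real n0 + 1)) \<le> \<tau> * (real n0 * (3 * real n0))" by (rule mult_left_mono[OF _ less_imp_le[OF t]])
      then have "real n0 * (\<tau> * (2 * real n0 + 1)) \<le> 3 * ?y" by (simp only: power2_eq_square mult_ac)
      then show ?thesis using Epos[of n0] by (intro mult_left_mono) auto
    qed
    also have "\<dots> \<le> E n0 * (6 * exp (?y / 2))"
    proof -
      have "1 + 3 * ?y \<le> 6 * exp (?y / 2)" using exp_ge_add_one_self[of "?y / 2"] y by linarith
      then show ?thesis using Epos[of n0] by (intro mult_left_mono) auto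
    qed
    also have "\<dots> = 6 * exp (- \<tau> * (real n0)\<^sup>2 / 2)"
      by (simp add: E_def exp_add[symmetric])
    finally show ?thesis .
  qed
  moreover have "multiplier (\<lambda>k. of_real (c (nat \<bar>k $ i\<bar>))) (c 0)" by (rule multiplier_polya) (fact cpos cdec cdd)+
  ultimately have "multiplier (\<lambda>k. of_real (c (nat \<bar>k $ i\<bar>))) (6 * exp (- \<tau> * (real n0)\<^sup>2 / 2))" by (blast intro: multiplier_mono)
  moreover have "of_real (c (nat \<bar>k $ i\<bar>)) = complex_of_real (exp (- \<tau> * (of_int (k $ i))\<^sup>2))" if "int n0 \<le> \<bar>k $ i\<bar>" for k :: "int^3"
  proof -
    have "n0 \<le> nat \<bar>k $ i\<bar>" using that by linarith
    then show ?thesis by (simp add: c_def E_def)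
  qed
  ultimately show ?thesis by blast
qed

text \<open>Equal to 1 on \<open>[- b/2, b/2]\<close>, supported in \<open>[- b, b]\<close>, and a combination of two tents.\<close>
definition trapezoid :: "real \<Rightarrow> int \<Rightarrow> real" where
  "trapezoid b n = 2 * max 0 (1 - \<bar>of_int n\<bar> / b) - max 0 (1 - \<bar>of_int n\<bar> / (b / 2))"

lemma multiplier_real_tent:
  assumes "b > 0" shows "multiplier (\<lambda>k. of_real (max 0 (1 - \<bar>of_int (k $ i)\<bar> / b))) 1"
proof -
  let ?c = "\<lambda>n::nat. max 0 (1 - real n / b)"
  have "multiplier (\<lambda>k. of_real (?c (nat \<bar>k $ i\<bar>))) (?c 0)"
  proof (rule multiplier_polya)
    fix n
    show "?c (Suc n) \<le> ?c n" using assms by (intro max.mono) (auto simp: divide_right_mono)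
    assume n: "n \<ge> (1::nat)"
    have "1 - real (Suc n) / b + (1 - real (n - 1) / b) = 2 * (1 - real n / b)"
      using assms n by (simp add: field_simps of_nat_diff)
    then show "second_diff ?c n \<ge> 0" unfolding second_diff_def by linarith
  qed simp
  then show ?thesis by simp
qed

lemma multiplier_trapezoid: "b > 0 \<Longrightarrow> multiplier (\<lambda>k. of_real (trapezoid b (k $ i))) 3"
  using multiplier_diff[OF multiplier_scale[OF multiplier_real_tent[of b], of 2] multiplier_real_tent[of "b/2"]]
  by (simp add: trapezoid_def)

lemma multiplier_one_minus_trapezoid: "b > 0 \<Longrightarrow> multiplier (\<lambda>k. 1 - of_real (trapezoid b (k $ i))) 4"
  using multiplier_diff[OF multiplier_const[of 1] multiplier_trapezoid[of b]] by simp

lemma trapezoid_values: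
  assumes "b > 0"
  shows "\<bar>of_int n\<bar> \<ge> b \<Longrightarrow> trapezoid b n = 0" "\<bar>of_int n\<bar> \<le> b / 2 \<Longrightarrow> trapezoid b n = 1"
  using assms by (auto simp: trapezoid_def max_def field_simps)

text \<open>The Gaussian away from the origin. If its inflection point lies inside the region that is cut away,
  the convex tail has an exponentially small norm; otherwise \<open>\<tau> b\<^sup>2\<close> is bounded, and the crude
  bound is already of the required size.\<close>
lemma multiplier_gauss_cut:
  assumes "b > 0" "\<tau> \<ge> 0"
  shows "multiplier (\<lambda>k. (1 - of_real (trapezoid b (k $ i))) * of_real (exp (- \<tau> * (of_int (k $ i))\<^sup>2))) (24 * exp (- \<tau> * b\<^sup>2 / 8))"
proof -
  define n0 where "n0 = nat \<lceil>b / 2\<rceil>"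
  have n0: "n0 \<ge> 1" "b / 2 \<le> real n0" using assms by (auto simp: n0_def) linarith+
  have sq: "b\<^sup>2 / 4 \<le> (real n0)\<^sup>2" using power_mono[OF n0(2), of 2] assms by (simp add: power_divide)
  then have sqt: "\<tau> * (b\<^sup>2 / 4) \<le> \<tau> * (real n0)\<^sup>2" using assms by (intro mult_left_mono) auto
  show ?thesis
  proof (cases "2 * \<tau> * (real n0)\<^sup>2 \<ge> 1")
    case True
    then have "\<tau> \<noteq> 0" by auto
    then obtain m where m: "multiplier m (6 * exp (- \<tau> * (real n0)\<^sup>2 / 2))"
      "\<And>k. int n0 \<le> \<bar>k $ i\<bar> \<Longrightarrow> m k = of_real (exp (- \<tau> * (of_int (k $ i))\<^sup>2))"
      using multiplier_gauss_tail[of \<tau> n0 i] True n0 assms by fastforce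
    have "(1 - of_real (trapezoid b (k $ i))) * m k = (1 - of_real (trapezoid b (k $ i))) * of_real (exp (- \<tau> * (of_int (k $ i))\<^sup>2))" for k
    proof (cases "\<bar>of_int (k $ i)\<bar> \<le> b / 2")
      case True then show ?thesis using trapezoid_values(2)[OF assms(1)] by simp
    next
      case False
      then have "int n0 \<le> \<bar>k $ i\<bar>" unfolding n0_def by (simp add: ceiling_le_iff)
      then show ?thesis using m(2) by simp
    qed
    moreover have "multiplier (\<lambda>k. (1 - of_real (trapezoid b (k $ i))) * m k) (4 * (6 * exp (- \<tau> * (real n0)\<^sup>2 / 2)))"
      by (intro multiplier_mult multiplier_one_minus_trapezoid m assms)
    moreover have "4 * (6 * exp (- \<tau> * (real n0)\<^sup>2 / 2)) \<le> 24 * exp (- \<tau> * b\<^sup>2 / 8)"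
      using sqt by simp
    ultimately show ?thesis using multiplier_mono[of _ "4 * (6 * exp (- \<tau> * (real n0)\<^sup>2 / 2))"] by (simp only:)
  next
    case False
    then have "\<tau> * b\<^sup>2 / 8 \<le> 1/4" using sqt by linarith
    then have "1/2 \<le> exp (- \<tau> * b\<^sup>2 / 8)" using exp_ge_add_one_self[of "- \<tau> * b\<^sup>2 / 8"] by simp
    then have "4 * 1 \<le> 24 * exp (- \<tau> * b\<^sup>2 / 8)" by simp
    with multiplier_mult[OF multiplier_one_minus_trapezoid[OF assms(1)] multiplier_gauss[OF assms(2)]]
    show ?thesis by (rule multiplier_mono)
  qed
qed

definition heatsym :: "real \<Rightarrow> int^3 \<Rightarrow> complex" where
  "heatsym t k = of_real (exp (- t * (1 + 4 * pi\<^sup>2 * (norm (freq k))\<^sup>2)))"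

lemma heat_eq: "heat t u = (\<lambda>k. heatsym t k * u k)"
  by (simp add: heat_def heatsym_def fun_eq_iff)

lemma norm_freq_sq: "(norm (freq k))\<^sup>2 = (of_int (k $ 1))\<^sup>2 + (of_int (k $ 2))\<^sup>2 + (of_int (k $ 3))\<^sup>2"
  by (simp add: power2_norm_eq_inner inner_vec_def sum_3) (simp add: power2_eq_square)

lemma heatsym_prod:
  "heatsym t k = of_real (exp (- t)) * (of_real (exp (- (4 * pi\<^sup>2 * t) * (of_int (k $ 1))\<^sup>2)) *
     of_real (exp (- (4 * pi\<^sup>2 * t) * (of_int (k $ 2))\<^sup>2)) * of_real (exp (- (4 * pi\<^sup>2 * t) * (of_int (k $ 3))\<^sup>2)))"
  unfolding heatsym_def of_real_mult[symmetric] norm_freq_sq by (simp add: exp_add[symmetric] algebra_simps)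

lemma multiplier_heat: assumes "t \<ge> 0" shows "multiplier (heatsym t) (exp (- t))"
proof -
  have "multiplier (heatsym t) (cmod (of_real (exp (- t))) * (1 * 1 * 1))"
    unfolding heatsym_prod[abs_def] by (intro multiplier_scale multiplier_mult multiplier_gauss) (use assms in auto)
  then show ?thesis by simp
qed

text \<open>If \<open>\<bar>k\<bar> \<ge> b\<close>, some coordinate of \<open>k\<close> is at least \<open>b/2\<close> in absolute value. The telescoping identity
  \<open>1 = (1 - T\<^sub>1) + T\<^sub>1 (1 - T\<^sub>2) + T\<^sub>1 T\<^sub>2 (1 - T\<^sub>3) + T\<^sub>1 T\<^sub>2 T\<^sub>3\<close> with trapezoids \<open>T\<^sub>i\<close> in the coordinates, whose last term
  vanishes on the annulus, splits the heat symbol into three pieces, each of which contains one Gaussian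
  cut off near the origin.\<close>
lemma heat_annulus:
  assumes b: "b > 0" and t: "t \<ge> 0" and c: "finsupp c" "\<And>x. cmod (tp c x) \<le> A"
    and supp: "\<And>k. c k \<noteq> 0 \<Longrightarrow> b \<le> norm (freq k)"
  shows "cmod (tp (heat t c) x) \<le> 648 * exp (- t * b\<^sup>2) * A"
proof -
  define \<tau> where "\<tau> = 4 * pi\<^sup>2 * t"
  have tau: "\<tau> \<ge> 0" using t by (simp add: \<tau>_def)
  let ?T = "\<lambda>i k. complex_of_real (trapezoid (b/2) (k $ i))"
  let ?G = "\<lambda>i (k::int^3). complex_of_real (exp (- \<tau> * (of_int (k $ i))\<^sup>2))"
  let ?C = "24 * exp (- \<tau> * (b/2)\<^sup>2 / 8)"
  have b2: "b / 2 > 0" using b by simp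
  have P: "multiplier (\<lambda>k. (1 - ?T i k) * ?G i k) ?C" "multiplier (?G i) 1" "multiplier (\<lambda>k. ?T i k * ?G i k) 3" for i :: 3
    using multiplier_gauss_cut[OF b2 tau, of i] multiplier_gauss[OF tau, of i] multiplier_mult[OF multiplier_trapezoid[OF b2, of i] multiplier_gauss[OF tau, of i]] by auto
  let ?m = "\<lambda>k. of_real (exp (- t)) * (((1 - ?T 1 k) * ?G 1 k) * ?G 2 k * ?G 3 k
     + (?T 1 k * ?G 1 k) * ((1 - ?T 2 k) * ?G 2 k) * ?G 3 k
     + (?T 1 k * ?G 1 k) * (?T 2 k * ?G 2 k) * ((1 - ?T 3 k) * ?G 3 k))"
  have M: "multiplier ?m (cmod (of_real (exp (- t))) * (?C * 1 * 1 + 3 * ?C * 1 + 3 * 3 * ?C))"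
    by (intro multiplier_scale multiplier_add multiplier_mult P)
  have "heat t c = (\<lambda>k. ?m k * c k)"
  proof
    fix k
    show "heat t c k = ?m k * c k"
    proof (cases "c k = 0")
      case True then show ?thesis by (simp add: heat_eq)
    next
      case False
      have "\<exists>i. b / 2 \<le> \<bar>of_int (k $ i)\<bar>"
      proof (rule ccontr)
        assume "\<nexists>i. b / 2 \<le> \<bar>of_int (k $ i)\<bar>"
        then have "(of_int (k $ i))\<^sup>2 \<le> (b/2)\<^sup>2" for i
          by (metis abs_le_square_iff abs_of_pos b2 less_imp_le not_le)
        from this[of 1] this[of 2] this[of 3] have "(norm (freq k))\<^sup>2 \<le> 3 * (b/2)\<^sup>2"
          by (simp add: norm_freq_sq)
        also have "\<dots> < b\<^sup>2" using b by (simp add: power_divide)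
        finally show False using supp[OF False] b by (meson less_imp_le not_less power_mono)
      qed
      then obtain i where "b / 2 \<le> \<bar>of_int (k $ i)\<bar>" by blast
      then have "trapezoid (b/2) (k $ i) = 0" using trapezoid_values(1)[OF b2] by simp
      then have "?T 1 k * ?T 2 k * ?T 3 k = 0" using exhaust_3[of i] by auto
      then have "(1 - ?T 1 k) + ?T 1 k * (1 - ?T 2 k) + ?T 1 k * ?T 2 k * (1 - ?T 3 k) = 1"
        by (simp add: algebra_simps)
      moreover have "?m k = heatsym t k * ((1 - ?T 1 k) + ?T 1 k * (1 - ?T 2 k) + ?T 1 k * ?T 2 k * (1 - ?T 3 k))"
        unfolding heatsym_prod \<tau>_def[symmetric] by (simp only: algebra_simps)
      ultimately show ?thesis by (simp add: heat_eq)
    qed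
  qed
  then have "cmod (tp (heat t c) x) \<le> (cmod (of_real (exp (- t))) * (?C * 1 * 1 + 3 * ?C * 1 + 3 * 3 * ?C)) * A"
    using multiplierD[OF M c] by simp
  also have "\<dots> \<le> 648 * exp (- t * b\<^sup>2) * A"
  proof (rule mult_right_mono)
    show "A \<ge> 0" using c(2)[of 0] norm_ge_zero order_trans by blast
    have "9 * 1 \<le> pi * pi" using pi_gt3 mult_mono[of 3 pi 3 pi] by simp
    then have "(t * b\<^sup>2) * 8 \<le> (t * b\<^sup>2) * (pi * pi)" using t by (intro mult_left_mono) auto
    then have "t * b\<^sup>2 \<le> \<tau> * (b/2)\<^sup>2 / 8" by (simp add: \<tau>_def power2_eq_square mult_ac)
    then have "exp (- \<tau> * (b/2)\<^sup>2 / 8) \<le> exp (- t * b\<^sup>2)" by simp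
    moreover have "exp (- t) \<le> 1" using t by simp
    ultimately have "exp (- t) * (312 * exp (- \<tau> * (b/2)\<^sup>2 / 8)) \<le> 1 * (312 * exp (- t * b\<^sup>2))" by (intro mult_mono) auto
    also have "\<dots> \<le> 648 * exp (- t * b\<^sup>2)" by simp
    finally show "cmod (of_real (exp (- t))) * (?C * 1 * 1 + 3 * ?C * 1 + 3 * 3 * ?C) \<le> 648 * exp (- t * b\<^sup>2)" by simp
  qed
  finally show ?thesis .
qed

section \<open>Symbols of Littlewood--Paley blocks\<close>

definition D2 :: "'a::euclidean_space \<Rightarrow> ('a \<Rightarrow> real) \<Rightarrow> 'a \<Rightarrow> real" where
  "D2 v f x = f (x + v) - 2 * f x + f (x - v)"

text \<open>Differentiability in direction \<open>b\<close> only; unlike smoothness, it is obviously inherited by second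
  differences in other directions.\<close>
definition linediff :: "'a::euclidean_space \<Rightarrow> ('a \<Rightarrow> real) \<Rightarrow> ('a \<Rightarrow> real) \<Rightarrow> bool" where
  "linediff b g g' \<longleftrightarrow> (\<forall>x t. ((\<lambda>s. g (x + s *\<^sub>R b)) has_real_derivative g' (x + t *\<^sub>R b)) (at t))"

lemma linediff_D2: assumes "linediff b g g'" shows "linediff b (D2 v g) (D2 v g')"
  unfolding linediff_def D2_def
proof (intro allI)
  fix x t
  have d: "((\<lambda>s. g (y + s *\<^sub>R b)) has_real_derivative g' (y + t *\<^sub>R b)) (at t)" for y
    using assms by (auto simp: linediff_def)
  show "((\<lambda>s. g (x + s *\<^sub>R b + v) - 2 * g (x + s *\<^sub>R b) + g (x + s *\<^sub>R b - v)) has_real_derivative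
      g' (x + t *\<^sub>R b + v) - 2 * g' (x + t *\<^sub>R b) + g' (x + t *\<^sub>R b - v)) (at t)"
    using DERIV_add[OF DERIV_diff[OF d[of "x + v"] DERIV_cmult[OF d[of x], of 2]] d[of "x - v"]]
    by (simp add: algebra_simps)
qed

text \<open>Two applications of the mean value theorem.\<close>
lemma D2_bound:
  assumes g: "linediff b g g1" "linediff b g1 g2" and B: "\<And>x. \<bar>g2 x\<bar> \<le> B" and h: "h > 0"
  shows "\<bar>D2 (h *\<^sub>R b) g x\<bar> \<le> 2 * B * h\<^sup>2"
proof -
  have d1: "((\<lambda>s. g (x + s *\<^sub>R b)) has_real_derivative g1 (x + t *\<^sub>R b)) (at t)" for t
    using g(1) by (auto simp: linediff_def)
  have d2: "((\<lambda>s. g1 (x + s *\<^sub>R b)) has_real_derivative g2 (x + t *\<^sub>R b)) (at t)" for t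
    using g(2) by (auto simp: linediff_def)
  have d1m: "((\<lambda>s. g (x + (- s) *\<^sub>R b)) has_real_derivative - g1 (x + (- t) *\<^sub>R b)) (at t)" for t
    using DERIV_chain[OF d1[of "- t"] DERIV_minus[OF DERIV_ident]] by (simp add: o_def)
  have "\<exists>z. 0 < z \<and> z < h \<and> (g (x + h *\<^sub>R b) + g (x + (- h) *\<^sub>R b)) - (g (x + 0 *\<^sub>R b) + g (x + (- 0) *\<^sub>R b)) =
      (h - 0) * (g1 (x + z *\<^sub>R b) + - g1 (x + (- z) *\<^sub>R b))"
    by (rule MVT2[OF h]) (intro DERIV_add d1 d1m)
  then obtain z where z: "0 < z" "z < h" "D2 (h *\<^sub>R b) g x = h * (g1 (x + z *\<^sub>R b) - g1 (x + (- z) *\<^sub>R b))"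
    by (auto simp: D2_def)
  have "\<exists>y. - z < y \<and> y < z \<and> g1 (x + z *\<^sub>R b) - g1 (x + (- z) *\<^sub>R b) = (z - (- z)) * g2 (x + y *\<^sub>R b)"
    by (rule MVT2) (use z d2 in auto)
  then obtain y where y: "g1 (x + z *\<^sub>R b) - g1 (x + (- z) *\<^sub>R b) = 2 * z * g2 (x + y *\<^sub>R b)" by auto
  have "\<bar>D2 (h *\<^sub>R b) g x\<bar> = (h * (2 * z)) * \<bar>g2 (x + y *\<^sub>R b)\<bar>"
    unfolding z(3) y using z h by (simp add: abs_mult)
  also have "\<dots> \<le> (h * (2 * h)) * B" using z h B by (intro mult_mono) auto
  finally show ?thesis by (simp add: power2_eq_square mult_ac)
qed

lemma linediff_smooth: "smooth f \<Longrightarrow> linediff b f (\<lambda>x. frechet_derivative f (at x) b)"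
  unfolding linediff_def using smooth_line_derivative by blast

lemma frechet_support:
  fixes f :: "'a::euclidean_space \<Rightarrow> real"
  assumes "\<And>x. f x \<noteq> 0 \<Longrightarrow> norm x \<le> R" "frechet_derivative f (at x) b \<noteq> 0"
  shows "norm x \<le> R"
proof (rule ccontr)
  assume "\<not> norm x \<le> R"
  then have "x \<in> - cball 0 R" by simp
  moreover have "open (- cball (0::'a) R)" by (simp add: open_Compl)
  ultimately have "(f has_derivative (\<lambda>_. 0)) (at x)"
    by (intro has_derivative_transform_within_open[OF has_derivative_const[of 0]]) (use assms(1) in fastforce)+
  then show False using assms(2) frechet_derivative_at by (metis)
qed

text \<open>Derivatives and second differences commute, so the three second differences are bounded one after
  the other by the mixed derivative of order six, which is bounded because its support is compact.\<close>
lemma mixed_D2_bound: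
  fixes f :: "'a::euclidean_space \<Rightarrow> real"
  assumes f: "smooth f" "\<And>x. f x \<noteq> 0 \<Longrightarrow> norm x \<le> R" and b: "b1 \<in> Basis" "b2 \<in> Basis" "b3 \<in> Basis"
  shows "\<exists>B\<ge>0. \<forall>h>0. \<forall>x. \<bar>D2 (h *\<^sub>R b3) (D2 (h *\<^sub>R b2) (D2 (h *\<^sub>R b1) f)) x\<bar> \<le> B * h ^ 6"
proof -
  let ?d = "\<lambda>b g x. frechet_derivative g (at x) b"
  let ?P = "\<lambda>g. smooth g \<and> (\<forall>x. g x \<noteq> 0 \<longrightarrow> norm x \<le> R)"
  have step: "?P (?d b g)" if "?P g" "b \<in> Basis" for g b
    using that smoothD(3) frechet_support[of g R] by blast
  have P: "?P (?d b3 (?d b3 f))" "?P (?d b2 (?d b2 (?d b3 (?d b3 f))))" "?P (?d b1 (?d b1 (?d b2 (?d b2 (?d b3 (?d b3 f))))))"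
    "?P f" "?P (?d b3 f)" "?P (?d b2 (?d b3 (?d b3 f)))" "?P (?d b1 (?d b2 (?d b2 (?d b3 (?d b3 f)))))"
    using f b by (intro step conjI allI impI; simp)+
  let ?g = "?d b1 (?d b1 (?d b2 (?d b2 (?d b3 (?d b3 f)))))"
  have "compact (?g ` cball 0 R)"
    by (rule compact_continuous_image) (use P(3) smoothD(1) continuous_on_subset in blast, simp)
  then obtain B0 where B0: "\<And>y. y \<in> ?g ` cball 0 R \<Longrightarrow> \<bar>y\<bar> \<le> B0" using compact_imp_bounded bounded_iff by (metis real_norm_def)
  define B where "B = max 0 B0"
  have gB: "\<bar>?g x\<bar> \<le> B" for x
  proof (cases "?g x = 0")
    case False
    then have "norm x \<le> R" using P(3) by blast
    then have "?g x \<in> ?g ` cball 0 R" by (intro imageI) simp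
    from B0[OF this] show ?thesis by (simp add: B_def)
  qed (simp add: B_def)
  have "\<bar>D2 (h *\<^sub>R b3) (D2 (h *\<^sub>R b2) (D2 (h *\<^sub>R b1) f)) x\<bar> \<le> (8 * B) * h ^ 6" if h: "h > 0" for h x
  proof -
    have 1: "\<bar>D2 (h *\<^sub>R b1) (?d b2 (?d b2 (?d b3 (?d b3 f)))) x\<bar> \<le> 2 * B * h\<^sup>2" for x
      by (rule D2_bound[OF linediff_smooth linediff_smooth gB h]) (use P in auto)
    have 2: "\<bar>D2 (h *\<^sub>R b2) (D2 (h *\<^sub>R b1) (?d b3 (?d b3 f))) x\<bar> \<le> 2 * (2 * B * h\<^sup>2) * h\<^sup>2" for x
      by (rule D2_bound[OF linediff_D2[OF linediff_smooth] linediff_D2[OF linediff_smooth] 1 h]) (use P in auto)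
    have 3: "\<bar>D2 (h *\<^sub>R b3) (D2 (h *\<^sub>R b2) (D2 (h *\<^sub>R b1) f)) x\<bar> \<le> 2 * (2 * (2 * B * h\<^sup>2) * h\<^sup>2) * h\<^sup>2"
      by (rule D2_bound[OF linediff_D2[OF linediff_D2[OF linediff_smooth]] linediff_D2[OF linediff_D2[OF linediff_smooth]] 2 h]) (use P in auto)
    then show ?thesis by (simp add: numeral_eq_Suc mult_ac)
  qed
  then show ?thesis by (intro exI[of _ "8 * B"]) (simp add: B_def)
qed

lemma norm_eq_abs: "(\<And>i. \<bar>x $ i\<bar> = \<bar>y $ i\<bar>) \<Longrightarrow> norm (x :: real^3) = norm y"
  by (simp add: norm_vec_def)

text \<open>A smooth even symbol of compact support, sampled on the lattice of mesh \<open>h = 1/N\<close>, is expanded into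
  tents in each coordinate. There are of order \<open>N\<^sup>3\<close> terms, the tents carry weights of order \<open>N\<^sup>3\<close>, and the
  mixed sixth order difference is of order \<open>N\<^sup>-\<^sup>6\<close>, so the total weight is bounded independently of
  \<open>N\<close>. Radial symmetry makes the symbol even in each coordinate.\<close>
lemma multiplier_dilate:
  fixes f :: "real^3 \<Rightarrow> real"
  assumes f: "smooth f" "\<And>x. f x \<noteq> 0 \<Longrightarrow> norm x \<le> R" and radial: "\<And>x y. norm x = norm y \<Longrightarrow> f x = f y"
  shows "\<exists>C. \<forall>N\<ge>1. multiplier (\<lambda>k. of_real (f (freq k /\<^sub>R N))) C"
proof -
  define R' where "R' = max R 0"
  have R': "R' \<ge> 0" "\<And>x. f x \<noteq> 0 \<Longrightarrow> norm x \<le> R'" using f(2) by (fastforce simp: R'_def)+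
  let ?e = "\<lambda>i::3. axis i (1::real)"
  have bas: "?e i \<in> Basis" for i by (auto simp: Basis_vec_def)
  obtain B where B: "B \<ge> 0" "\<And>h x. h > 0 \<Longrightarrow> \<bar>D2 (h *\<^sub>R ?e 3) (D2 (h *\<^sub>R ?e 2) (D2 (h *\<^sub>R ?e 1) f)) x\<bar> \<le> B * h ^ 6"
    using mixed_D2_bound[OF f(1) R'(2) bas[of 1] bas[of 2] bas[of 3]] by blast
  have "multiplier (\<lambda>k. of_real (f (freq k /\<^sub>R N))) (B * (R' + 2) ^ 6)" if N: "N \<ge> 1" for N
  proof -
    define h where "h = 1 / N"
    have h: "h > 0" "h * N = 1" using N by (auto simp: h_def)
    define pt where "pt p q r = (real p * h) *\<^sub>R ?e 1 + (real q * h) *\<^sub>R ?e 2 + (real r * h) *\<^sub>R ?e 3" for p q r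
    have comp: "pt p q r $ 1 = real p * h" "pt p q r $ 2 = real q * h" "pt p q r $ 3 = real r * h" for p q r
      by (simp_all add: pt_def axis_def)
    (* Beyond M mesh points the symbol vanishes. *)
    define M where "M = nat \<lceil>R' * N\<rceil> + 1"
    have M: "R' * N < real M" "real M \<le> (R' + 2) * N" "0 < M"
    proof -
      have "0 \<le> R' * N" using R' N by simp
      then show "R' * N < real M" "real M \<le> (R' + 2) * N" "0 < M" unfolding M_def using N by (simp_all add: distrib_right) linarith+
    qed
    have big: "R' < real p * h" if "M \<le> p" for p
    proof -
      have "R' * N < real p" using M(1) that by linarith
      from mult_strict_right_mono[OF this h(1)] have "R' * N * h < real p * h" .
      moreover have "R' * N * h = R'" using h by (simp add: mult.assoc mult.commute)
      ultimately show ?thesis by (simp only:)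
    qed
    have z: "f (pt p q r) = 0" if "M \<le> p \<or> M \<le> q \<or> M \<le> r" for p q r
    proof -
      have "R' < \<bar>pt p q r $ 1\<bar> \<or> R' < \<bar>pt p q r $ 2\<bar> \<or> R' < \<bar>pt p q r $ 3\<bar>"
        using that big by (metis comp abs_ge_self order_less_le_trans)
      then have "R' < norm (pt p q r)" by (meson component_le_norm_cart order_less_le_trans)
      then show ?thesis using R'(2) by (meson not_le)
    qed
    define H1 where "H1 q r a = second_diff (\<lambda>p. f (pt p q r)) a" for q r a
    define H2 where "H2 r a b = second_diff (\<lambda>q. H1 q r a) b" for r a b
    define H3 where "H3 a b c = second_diff (\<lambda>r. H2 r a b) c" for a b c
    have z1: "H1 q r a = 0" if "M \<le> q \<or> M \<le> r" for q r a using that z by (simp add: H1_def second_diff_def)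
    have z2: "H2 r a b = 0" if "M \<le> r" for r a b using that z1 by (simp add: H2_def second_diff_def)
    let ?I = "{1..<Suc M}"
    (* Summation by parts in the three coordinates in turn. *)
    have rep: "f (pt p q r) = (\<Sum>a\<in>?I. \<Sum>b\<in>?I. \<Sum>c\<in>?I. H3 a b c * (real (a - p) * real (b - q) * real (c - r)))" for p q r
    proof -
      have "f (pt p q r) = (\<Sum>a\<in>?I. real (a - p) * H1 q r a)"
        unfolding H1_def by (rule even_expansion[of M "\<lambda>p. f (pt p q r)"]) (use M z in auto)
      also have "\<dots> = (\<Sum>a\<in>?I. real (a - p) * (\<Sum>b\<in>?I. real (b - q) * H2 r a b))"
        unfolding H2_def by (intro sum.cong refl arg_cong2[where f = "(*)"] even_expansion[of M "\<lambda>q. H1 q r _"]) (use M z1 in auto)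
      also have "\<dots> = (\<Sum>a\<in>?I. real (a - p) * (\<Sum>b\<in>?I. real (b - q) * (\<Sum>c\<in>?I. real (c - r) * H3 a b c)))"
        unfolding H3_def by (intro sum.cong refl arg_cong2[where f = "(*)"] even_expansion[of M "\<lambda>r. H2 r _ _"]) (use M z2 in auto)
      finally show ?thesis by (simp only: sum_distrib_left mult_ac)
    qed
    have H3b: "\<bar>H3 a b c\<bar> \<le> B * h ^ 6" if "a \<ge> 1" "b \<ge> 1" "c \<ge> 1" for a b c
    proof -
      have p1: "pt (Suc a) q r = pt a q r + h *\<^sub>R ?e 1" "1 \<le> a \<Longrightarrow> pt (a - 1) q r = pt a q r - h *\<^sub>R ?e 1" for a q r
        by (auto simp: pt_def algebra_simps of_nat_diff)
      have p2: "pt a (Suc q) r = pt a q r + h *\<^sub>R ?e 2" "1 \<le> q \<Longrightarrow> pt a (q - 1) r = pt a q r - h *\<^sub>R ?e 2" for a q r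
        by (auto simp: pt_def algebra_simps of_nat_diff)
      have p3: "pt a q (Suc r) = pt a q r + h *\<^sub>R ?e 3" "1 \<le> r \<Longrightarrow> pt a q (r - 1) = pt a q r - h *\<^sub>R ?e 3" for a q r
        by (auto simp: pt_def algebra_simps of_nat_diff)
      have 1: "H1 q r a = D2 (h *\<^sub>R ?e 1) f (pt a q r)" for q r
        using that by (simp only: H1_def second_diff_def D2_def p1)
      have 2: "H2 r a b = D2 (h *\<^sub>R ?e 2) (D2 (h *\<^sub>R ?e 1) f) (pt a b r)" for r
        unfolding H2_def second_diff_def 1 D2_def[of "h *\<^sub>R ?e 2"] using that by (simp only: p2)
      have "H3 a b c = D2 (h *\<^sub>R ?e 3) (D2 (h *\<^sub>R ?e 2) (D2 (h *\<^sub>R ?e 1) f)) (pt a b c)"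
        unfolding H3_def second_diff_def 2 D2_def[of "h *\<^sub>R ?e 3"] using that by (simp only: p3)
      then show ?thesis using B(2)[OF h(1)] by simp
    qed
    let ?t = "\<lambda>a i (k::int^3). complex_of_real (tent a (k $ i))"
    let ?m = "\<lambda>k. \<Sum>a\<in>?I. \<Sum>b\<in>?I. \<Sum>c\<in>?I. of_real (H3 a b c * (real a * real b * real c)) * (?t a 1 k * ?t b 2 k * ?t c 3 k)"
    let ?Q = "\<Sum>a\<in>?I. \<Sum>b\<in>?I. \<Sum>c\<in>?I. cmod (of_real (H3 a b c * (real a * real b * real c))) * (1 * 1 * 1)"
    have mm: "multiplier ?m ?Q"
      by (intro multiplier_sum multiplier_scale multiplier_mult multiplier_tent) auto
    have eq: "of_real (f (freq k /\<^sub>R N)) = ?m k" for k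
    proof -
      have "f (freq k /\<^sub>R N) = f (pt (nat \<bar>k $ 1\<bar>) (nat \<bar>k $ 2\<bar>) (nat \<bar>k $ 3\<bar>))"
      proof (rule radial, rule norm_eq_abs)
        fix i
        have "\<bar>(freq k /\<^sub>R N) $ i\<bar> = \<bar>of_int (k $ i)\<bar> * h" using N by (simp add: h_def abs_mult field_simps)
        then show "\<bar>(freq k /\<^sub>R N) $ i\<bar> = \<bar>pt (nat \<bar>k $ 1\<bar>) (nat \<bar>k $ 2\<bar>) (nat \<bar>k $ 3\<bar>) $ i\<bar>"
          using exhaust_3[of i] h by (auto simp: comp)
      qed
      also have "\<dots> = (\<Sum>a\<in>?I. \<Sum>b\<in>?I. \<Sum>c\<in>?I. H3 a b c * (real a * real b * real c) * (tent a (k $ 1) * tent b (k $ 2) * tent c (k $ 3)))"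
        unfolding rep by (intro sum.cong refl) (simp add: tent_nat[symmetric] mult_ac del: sum.op_ivl_Suc)
      finally show ?thesis by (simp only: of_real_sum of_real_mult)
    qed
    have "?Q \<le> B * (R' + 2) ^ 6"
    proof -
      have M1: "real a \<le> real M" if "a \<in> ?I" for a using that by simp
      have each: "cmod (of_real (H3 a b c * (real a * real b * real c))) * (1 * 1 * 1) \<le> (B * h ^ 6) * (real M * real M * real M)"
        if "a \<in> ?I" "b \<in> ?I" "c \<in> ?I" for a b c
      proof -
        have "\<bar>H3 a b c\<bar> * (real a * real b * real c) \<le> (B * h ^ 6) * (real M * real M * real M)"
        proof (rule mult_mono)
          show "real a * real b * real c \<le> real M * real M * real M"
            using M1 that by (intro mult_mono) auto
        qed (use H3b[of a b c] that B h in auto)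
        then show ?thesis by (simp add: abs_mult norm_mult)
      qed
      have "?Q \<le> (\<Sum>a\<in>?I. \<Sum>b\<in>?I. \<Sum>c\<in>?I. (B * h ^ 6) * (real M * real M * real M))"
        by (intro sum_mono each)
      also have "\<dots> = B * (real M * h) ^ 6" by (simp add: power_mult_distrib numeral_eq_Suc)
      also have "\<dots> \<le> B * (R' + 2) ^ 6"
      proof -
        have "real M * h \<le> (R' + 2) * N * h" using M h by (intro mult_right_mono) auto
        also have "\<dots> = R' + 2" using h by (simp add: mult.assoc mult.commute[of N])
        finally show ?thesis using B h by (intro mult_left_mono power_mono) auto
      qed
      finally show ?thesis .
    qed
    then show ?thesis unfolding eq using mm multiplier_mono by blast
  qed
  then show ?thesis by blast
qed

section \<open>Littlewood--Paley decompositions\<close>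

text \<open>The coefficients of a real-valued distribution.\<close>
definition herm :: "coeffs \<Rightarrow> bool" where
  "herm u \<longleftrightarrow> (\<forall>k. u (- k) = cnj (u k))"

lemma herm_arith:
  "herm u \<Longrightarrow> herm v \<Longrightarrow> herm (\<lambda>k. u k + v k)" "herm u \<Longrightarrow> herm v \<Longrightarrow> herm (u - v)"
  "herm u \<Longrightarrow> herm (\<lambda>k. of_real a * u k)" "herm (\<lambda>k. 0)"
  by (auto simp: herm_def)

text \<open>What is used of a dyadic partition of unity. Blocks are counted from 0, that is, the index is
  \<open>n = j + 1\<close>; \<open>r\<close> and \<open>R\<close> bound the annuli, and \<open>K\<close> bounds the multiplier norms of all blocks and of all
  partial sums.\<close>
locale lp_frame =
  fixes \<theta> :: "int \<Rightarrow> real^3 \<Rightarrow> real" and r R K :: real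
  assumes r_pos: "0 < r" and R_pos: "0 < R" and K_ge_1: "1 \<le> K"
    and multiplier_block: "\<And>n::nat. multiplier (\<lambda>k. of_real (\<theta> (int n - 1) (freq k))) K"
    and multiplier_partial: "\<And>n::nat. multiplier (\<lambda>k. of_real (\<Sum>i<n. \<theta> (int i - 1) (freq k))) K"
    and symbol_even: "\<And>n::nat. \<theta> (int n - 1) (- x) = \<theta> (int n - 1) x"
    and lower: "\<And>n k. 1 \<le> n \<Longrightarrow> \<theta> (int n - 1) (freq k) \<noteq> 0 \<Longrightarrow> r * 2 ^ n \<le> norm (freq k)"
    and upper: "\<And>n k. \<theta> (int n - 1) (freq k) \<noteq> 0 \<Longrightarrow> norm (freq k) \<le> R * 2 ^ n"
    and total: "\<And>n k. 1 \<le> n \<Longrightarrow> norm (freq k) < r * 2 ^ n \<Longrightarrow> (\<Sum>i<n. \<theta> (int i - 1) (freq k)) = 1"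
    and apart: "\<And>m n k. \<theta> (int m - 1) (freq k) \<noteq> 0 \<Longrightarrow> \<theta> (int n - 1) (freq k) \<noteq> 0 \<Longrightarrow> m \<le> n + 1"

text \<open>By scaling, the partial sums of the partition are dilates of \<open>\<chi>\<^sub>0\<close>: the tail of the partition at \<open>x\<close> is
  the partition without its first term, evaluated at \<open>x / 2\<^sup>m\<close>. So the blocks and the partial sums are dilates
  of just two smooth radial symbols.\<close>
lemma dyadic_partition_lp_frame:
  assumes "dyadic_partition \<theta>"
  shows "\<exists>r R K. lp_frame \<theta> r R K"
proof -
  obtain \<chi>0 \<rho> r R where P: "smooth \<chi>0 \<and> smooth \<rho> \<and> (\<forall>x. 0 \<le> \<chi>0 x \<and> 0 \<le> \<rho> x) \<and>
     (\<forall>x y. norm x = norm y \<longrightarrow> \<chi>0 x = \<chi>0 y \<and> \<rho> x = \<rho> y) \<and>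
     0 < r \<and> r < R \<and>
     (\<forall>x. \<chi>0 x \<noteq> 0 \<longrightarrow> norm x \<le> R) \<and> (\<forall>x. \<rho> x \<noteq> 0 \<longrightarrow> r \<le> norm x \<and> norm x \<le> R) \<and>
     \<theta> (- 1) = \<chi>0 \<and> (\<forall>j::nat. \<theta> (int j) = (\<lambda>x. \<rho> (x /\<^sub>R 2 ^ j))) \<and>
     (\<forall>x. (\<lambda>j::nat. \<theta> (int j) x) sums (1 - \<theta> (- 1) x)) \<and>
     (\<forall>i\<ge>-1. \<forall>j\<ge>-1. 1 < \<bar>i - j\<bar> \<longrightarrow>
        closure {x. \<theta> i x \<noteq> 0} \<inter> closure {x. \<theta> j x \<noteq> 0} = {})"
    using assms unfolding dyadic_partition_def by (elim exE) (erule that)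
  have sm: "smooth \<chi>0" "smooth \<rho>" and rad: "\<And>x y. norm x = norm y \<Longrightarrow> \<chi>0 x = \<chi>0 y \<and> \<rho> x = \<rho> y"
    and rR: "0 < r" "r < R" and s0: "\<And>x. \<chi>0 x \<noteq> 0 \<Longrightarrow> norm x \<le> R"
    and s1: "\<And>x. \<rho> x \<noteq> 0 \<Longrightarrow> r \<le> norm x \<and> norm x \<le> R"
    and th: "\<theta> (- 1) = \<chi>0" "\<And>j::nat. \<theta> (int j) = (\<lambda>x. \<rho> (x /\<^sub>R 2 ^ j))"
    and sums: "\<And>x. (\<lambda>j::nat. \<theta> (int j) x) sums (1 - \<theta> (- 1) x)"
    and disj: "\<And>i j. i \<ge> -1 \<Longrightarrow> j \<ge> -1 \<Longrightarrow> 1 < \<bar>i - j\<bar> \<Longrightarrow> closure {x. \<theta> i x \<noteq> 0} \<inter> closure {x. \<theta> j x \<noteq> 0} = {}"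
    using P by blast+
  obtain C0 where C0: "\<And>N. N \<ge> 1 \<Longrightarrow> multiplier (\<lambda>k. of_real (\<chi>0 (freq k /\<^sub>R N))) C0"
    using multiplier_dilate[OF sm(1), of R] s0 rad by blast
  obtain C1 where C1: "\<And>N. N \<ge> 1 \<Longrightarrow> multiplier (\<lambda>k. of_real (\<rho> (freq k /\<^sub>R N))) C1"
    using multiplier_dilate[OF sm(2), of R] s1 rad by blast
  define K where "K = max 1 (max C0 C1)"
  have nz: "\<theta> (int n - 1) = (if n = 0 then \<chi>0 else (\<lambda>x. \<rho> (x /\<^sub>R 2 ^ (n - 1))))" for n
  proof (cases n)
    case (Suc m) then show ?thesis using th(2)[of m] by simp
  qed (simp add: th)
  have psum: "(\<Sum>i<Suc m. \<theta> (int i - 1) x) = \<chi>0 (x /\<^sub>R 2 ^ m)" for m x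
  proof -
    have "(\<lambda>j::nat. \<theta> (int j) (x /\<^sub>R 2 ^ m)) sums (1 - \<chi>0 (x /\<^sub>R 2 ^ m))"
      using sums[of "x /\<^sub>R 2 ^ m"] th by simp
    moreover have "\<theta> (int j) (x /\<^sub>R 2 ^ m) = \<theta> (int (j + m)) x" for j
      unfolding th(2) by (simp add: power_add mult.commute)
    ultimately have "(\<lambda>j::nat. \<theta> (int (j + m)) x) sums (1 - \<chi>0 (x /\<^sub>R 2 ^ m))" by simp
    then have "(\<lambda>j::nat. \<theta> (int j) x) sums (1 - \<chi>0 (x /\<^sub>R 2 ^ m) + (\<Sum>j<m. \<theta> (int j) x))"
      by (subst (asm) sums_iff_shift) simp
    then have "1 - \<chi>0 (x /\<^sub>R 2 ^ m) + (\<Sum>j<m. \<theta> (int j) x) = 1 - \<chi>0 x"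
      using sums[of x] th sums_unique2 by fastforce
    moreover have "(\<Sum>i<Suc m. \<theta> (int i - 1) x) = \<chi>0 x + (\<Sum>j<m. \<theta> (int j) x)"
      unfolding sum.lessThan_Suc_shift using th(1) by simp
    ultimately show ?thesis by simp
  qed
  (* The lower radius is halved because the index is shifted: block n lives on the scale 2 ^ (n - 1). *)
  have "lp_frame \<theta> (r / 2) R K"
  proof
    show "0 < r / 2" "0 < R" "1 \<le> K" using rR by (auto simp: K_def)
    show "multiplier (\<lambda>k. of_real (\<theta> (int n - 1) (freq k))) K" for n
    proof (cases "n = 0")
      case True
      then show ?thesis using multiplier_mono[OF C0[of 1], of K] by (simp add: nz th(1) K_def)
    next
      case False
      then show ?thesis using multiplier_mono[OF C1[of "2 ^ (n - 1)"], of K] by (simp add: nz th(1) K_def)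
    qed
    show "multiplier (\<lambda>k. of_real (\<Sum>i<n. \<theta> (int i - 1) (freq k))) K" for n
    proof (cases n)
      case 0 then show ?thesis using multiplier_mono[OF multiplier_const[of 0], of K] by (simp add: K_def)
    next
      case (Suc m)
      then show ?thesis using multiplier_mono[OF C0[of "2 ^ m"], of K] unfolding Suc psum by (simp add: K_def)
    qed
    show "\<theta> (int n - 1) (- x) = \<theta> (int n - 1) x" for n x
      using rad[of "- x" x] rad[of "- (x /\<^sub>R 2 ^ (n - 1))" "x /\<^sub>R 2 ^ (n - 1)"] by (simp add: nz th(1))
    show low: "r / 2 * 2 ^ n \<le> norm (freq k)" if "1 \<le> n" "\<theta> (int n - 1) (freq k) \<noteq> 0" for n k
    proof -
      have "r \<le> norm (freq k /\<^sub>R 2 ^ (n - 1))" using that s1[of "freq k /\<^sub>R 2 ^ (n - 1)"] by (simp add: nz th(1))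
      then have "r * 2 ^ (n - 1) \<le> norm (freq k)" by (simp add: field_simps)
      moreover have "(2::real) ^ n = 2 * 2 ^ (n - 1)" using that by (cases n) auto
      ultimately show ?thesis by simp
    qed
    show "norm (freq k) \<le> R * 2 ^ n" if "\<theta> (int n - 1) (freq k) \<noteq> 0" for n k
    proof (cases "n = 0")
      case True then show ?thesis using that s0 by (simp add: nz th(1))
    next
      case False
      then have "norm (freq k /\<^sub>R 2 ^ (n - 1)) \<le> R" using that s1[of "freq k /\<^sub>R 2 ^ (n - 1)"] by (simp add: nz th(1))
      then have "norm (freq k) \<le> R * 2 ^ (n - 1)" by (simp add: field_simps)
      also have "\<dots> \<le> R * 2 ^ n" using rR by (intro mult_left_mono power_increasing) auto
      finally show ?thesis .
    qed
    show "(\<Sum>i<n. \<theta> (int i - 1) (freq k)) = 1" if nk: "1 \<le> n" "norm (freq k) < r / 2 * 2 ^ n" for n k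
    proof -
      have "\<theta> (int j) (freq k) = 0" if j: "j \<notin> {..<n - 1}" for j :: nat
      proof (rule ccontr)
        assume a: "\<theta> (int j) (freq k) \<noteq> 0"
        have "r / 2 * 2 ^ n \<le> r / 2 * 2 ^ Suc j" using rR j by (intro mult_left_mono power_increasing) auto
        also have "\<dots> \<le> norm (freq k)" using low[of "Suc j" k] a by simp
        finally show False using nk(2) by linarith
      qed
      then have "(\<lambda>j::nat. \<theta> (int j) (freq k)) sums (\<Sum>j<n - 1. \<theta> (int j) (freq k))"
        by (intro sums_finite) auto
      then have "(\<Sum>j<n - 1. \<theta> (int j) (freq k)) = 1 - \<chi>0 (freq k)"
        using sums[of "freq k"] th sums_unique2 by fastforce
      moreover have "(\<Sum>i<Suc (n - 1). \<theta> (int i - 1) (freq k)) = \<chi>0 (freq k) + (\<Sum>j<n - 1. \<theta> (int j) (freq k))"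
        unfolding sum.lessThan_Suc_shift using th(1) by simp
      ultimately show ?thesis using nk by simp
    qed
    show "m \<le> n + 1" if "\<theta> (int m - 1) (freq k) \<noteq> 0" "\<theta> (int n - 1) (freq k) \<noteq> 0" for m n k
    proof (rule ccontr)
      assume "\<not> m \<le> n + 1"
      then have "closure {x. \<theta> (int m - 1) x \<noteq> 0} \<inter> closure {x. \<theta> (int n - 1) x \<noteq> 0} = {}"
        by (intro disj) auto
      then show False using that closure_subset[of "{x. \<theta> (int m - 1) x \<noteq> 0}"] closure_subset[of "{x. \<theta> (int n - 1) x \<noteq> 0}"] by blast
    qed
  qed
  then show ?thesis by blast
qed

lemma finite_freq_ball: "finite {k. norm (freq k) \<le> B}"
proof -
  have "{k. norm (freq k) \<le> B} \<subseteq> {k::int^3. \<forall>i. k $ i \<in> {- \<lceil>B\<rceil>..\<lceil>B\<rceil>}}"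
  proof (intro subsetI CollectI allI)
    fix k :: "int^3" and i assume "k \<in> {k. norm (freq k) \<le> B}"
    then have "\<bar>real_of_int (k $ i)\<bar> \<le> B" using component_le_norm_cart[of "freq k" i] by simp
    then show "k $ i \<in> {- \<lceil>B\<rceil>..\<lceil>B\<rceil>}" by (simp add: abs_le_iff) linarith
  qed
  moreover have "finite {k::int^3. \<forall>i. k $ i \<in> {- \<lceil>B\<rceil>..\<lceil>B\<rceil>}}"
  proof -
    have "{k::int^3. \<forall>i. k $ i \<in> {- \<lceil>B\<rceil>..\<lceil>B\<rceil>}} = (\<lambda>f. \<chi> i. f i) ` (PiE UNIV (\<lambda>_. {- \<lceil>B\<rceil>..\<lceil>B\<rceil>}))"
      by (auto simp: image_iff vec_eq_iff intro!: bexI[of _ "\<lambda>i. _ $ i"])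
    then show ?thesis by (simp add: finite_PiE)
  qed
  ultimately show ?thesis by (rule finite_subset)
qed

context lp_frame
begin

abbreviation \<Theta> :: "nat \<Rightarrow> int^3 \<Rightarrow> real" where "\<Theta> n k \<equiv> \<theta> (int n - 1) (freq k)"

definition blk :: "nat \<Rightarrow> coeffs \<Rightarrow> coeffs" where "blk n u = (\<lambda>k. of_real (\<Theta> n k) * u k)"
definition low :: "nat \<Rightarrow> coeffs \<Rightarrow> coeffs" where "low n u = (\<lambda>k. of_real (\<Sum>i<n. \<Theta> i k) * u k)"

lemma finite_symbol: "finite {k. \<Theta> n k \<noteq> 0}"
  by (rule finite_subset[OF _ finite_freq_ball[of "R * 2 ^ n"]]) (auto simp: upper)

lemma finsupp_symbol: "finsupp (\<lambda>k. of_real (\<Theta> n k))" "finsupp (\<lambda>k. of_real (\<Sum>i<n. \<Theta> i k))"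
proof -
  show "finsupp (\<lambda>k. of_real (\<Theta> n k))" using finite_symbol by simp
  have "finsupp (\<lambda>k. \<Sum>i<n. complex_of_real (\<Theta> i k))"
    by (rule finsupp_sum) (use finite_symbol in auto)
  then show "finsupp (\<lambda>k. of_real (\<Sum>i<n. \<Theta> i k))" by simp
qed

lemma finsupp_blk [simp]: "finsupp (blk n u)" and finsupp_low [simp]: "finsupp (low n u)"
  unfolding blk_def low_def by (rule finsupp_mult(2)[OF finsupp_symbol(1)], rule finsupp_mult(2)[OF finsupp_symbol(2)])

lemma low_eq_sum: "tp (low n u) x = (\<Sum>i<n. tp (blk i u) x)"
proof -
  have "low n u = (\<lambda>k. \<Sum>i<n. blk i u k)" by (simp add: low_def blk_def sum_distrib_right)
  then show ?thesis by (simp add: tp_sum)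
qed

lemma blk_add: "blk n (\<lambda>k. u k + v k) = (\<lambda>k. blk n u k + blk n v k)"
  and blk_diff: "blk n (u - v) = (\<lambda>k. blk n u k - blk n v k)"
  and blk_scale: "blk n (\<lambda>k. a * u k) = (\<lambda>k. a * blk n u k)"
  and low_diff: "low n (u - v) = (\<lambda>k. low n u k - low n v k)"
  and low_scale: "low n (\<lambda>k. a * u k) = (\<lambda>k. a * low n u k)"
  by (auto simp: blk_def low_def algebra_simps)

lemma tp_blk_arith:
  "tp (blk n (\<lambda>k. u k + v k)) x = tp (blk n u) x + tp (blk n v) x" "tp (blk n (u - v)) x = tp (blk n u) x - tp (blk n v) x"
  "tp (blk n (\<lambda>k. a * u k)) x = a * tp (blk n u) x"
  unfolding blk_add blk_diff blk_scale by (simp_all add: tp_add tp_diff tp_scale)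

lemma low_eventually: "1 \<le> n \<Longrightarrow> norm (freq k) < r * 2 ^ n \<Longrightarrow> low n u k = u k"
  by (simp add: low_def total del: of_real_sum)

lemma tp_herm_real:
  assumes "herm c" shows "cnj (tp c x) = tp c x"
proof -
  have "cnj (tp c x) = (\<Sum>k\<in>{k. c k \<noteq> 0}. c (- k) * mode (- k) x)"
    using assms by (simp add: tp_def herm_def mode_minus)
  also have "\<dots> = (\<Sum>k\<in>{k. c k \<noteq> 0}. c k * mode k x)"
    by (rule sum.reindex_bij_witness[where i = uminus and j = uminus]) (use assms in \<open>auto simp: herm_def\<close>)
  finally show ?thesis by (simp add: tp_def)
qed

lemma tp_herm_Re: "herm c \<Longrightarrow> of_real (Re (tp c x)) = tp c x"
  using tp_herm_real[of c x] by (simp add: complex_eq_iff)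

lemma herm_blk: "herm u \<Longrightarrow> herm (blk n u)" and herm_low: "herm u \<Longrightarrow> herm (low n u)"
  using symbol_even by (auto simp: herm_def blk_def low_def)

lemma LP_eq: "LP \<theta> (int n - 1) u x = Re (tp (blk n u) x)"
proof -
  have "tp (blk n u) x = (\<Sum>k\<in>{k. \<Theta> n k \<noteq> 0}. blk n u k * mode k x)"
    by (rule tp_eq) (use finite_symbol in \<open>auto simp: blk_def\<close>)
  then show ?thesis by (simp add: LP_def blk_def mode_def)
qed

lemma norm_LP: "herm u \<Longrightarrow> \<bar>LP \<theta> (int n - 1) u x\<bar> = cmod (tp (blk n u) x)"
  by (metis LP_eq herm_blk norm_of_real tp_herm_Re real_norm_def)

lemma lowfreq_eq: "lowfreq \<theta> n u x = Re (tp (low (n + 2) u) x)"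
proof -
  have "lowfreq \<theta> n u x = (\<Sum>i<n + 2. LP \<theta> (int i - 1) u x)"
    unfolding lowfreq_def
    by (rule sum.reindex_bij_witness[where i = "\<lambda>i. int i - 1" and j = "\<lambda>j. nat (j + 1)"]) auto
  then show ?thesis by (simp add: LP_eq low_eq_sum)
qed

text \<open>The weight \<open>2\<^sup>-\<^sup>\<alpha>\<^sup>j\<close> with \<open>j = n - 1\<close>.\<close>
definition wt :: "real \<Rightarrow> nat \<Rightarrow> real" where "wt \<alpha> n = 2 powr (- \<alpha> * (real n - 1))"

lemma wt_pos [simp]: "wt \<alpha> n > 0" by (simp add: wt_def)
lemma wt_nonneg [simp]: "wt \<alpha> n \<ge> 0" by (simp add: wt_def)

text \<open>The distribution \<open>u\<close> is real and its norm of regularity \<open>\<alpha>\<close> is at most \<open>C\<close>. Estimates are stated in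
  this form rather than with \<open>hnorm\<close>, whose supremum is meaningful only for bounded sets.\<close>
definition besov :: "real \<Rightarrow> real \<Rightarrow> coeffs \<Rightarrow> bool" where
  "besov \<alpha> C u \<longleftrightarrow> herm u \<and> (\<forall>n x. cmod (tp (blk n u) x) \<le> C * wt \<alpha> n)"

lemma besovD: "besov \<alpha> C u \<Longrightarrow> cmod (tp (blk n u) x) \<le> C * wt \<alpha> n" "besov \<alpha> C u \<Longrightarrow> herm u"
  by (auto simp: besov_def)

lemma besov_nonneg: assumes "besov \<alpha> C u" shows "C \<ge> 0"
proof -
  have "0 \<le> C * wt \<alpha> 0" using besovD(1)[OF assms, of 0 0] norm_ge_zero order_trans by blast
  then show ?thesis using mult_neg_pos[OF _ wt_pos, of C \<alpha> 0] by linarith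
qed

lemma besov_mono: "besov \<alpha> C u \<Longrightarrow> C \<le> C' \<Longrightarrow> besov \<alpha> C' u"
  unfolding besov_def by (meson mult_right_mono order_trans wt_nonneg)

lemma besov_add: "besov \<alpha> C u \<Longrightarrow> besov \<alpha> D v \<Longrightarrow> besov \<alpha> (C + D) (\<lambda>k. u k + v k)"
  unfolding besov_def by (auto simp: herm_arith tp_blk_arith distrib_right intro: order_trans[OF norm_triangle_ineq add_mono])

lemma besov_diff: "besov \<alpha> C u \<Longrightarrow> besov \<alpha> D v \<Longrightarrow> besov \<alpha> (C + D) (u - v)"
  unfolding besov_def by (auto simp: herm_arith tp_blk_arith distrib_right intro: order_trans[OF norm_triangle_ineq4 add_mono])

lemma besov_scale: "besov \<alpha> C u \<Longrightarrow> besov \<alpha> (\<bar>a\<bar> * C) (\<lambda>k. of_real a * u k)"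
  unfolding besov_def by (auto simp: herm_arith tp_blk_arith norm_mult mult.assoc mult_left_mono)

lemma besov_zero: "besov \<alpha> 0 (\<lambda>k. 0)"
  by (auto simp: besov_def herm_def blk_def tp_def)

lemma wt_mono: assumes "\<beta> \<le> \<alpha>" shows "wt \<alpha> n \<le> 2 powr (\<alpha> - \<beta>) * wt \<beta> n"
proof -
  have "0 \<le> (\<alpha> - \<beta>) * real n" using assms by simp
  then have "- \<alpha> * (real n - 1) \<le> (\<alpha> - \<beta>) + - \<beta> * (real n - 1)" by (simp add: algebra_simps)
  then show ?thesis unfolding wt_def powr_add[symmetric] by simp
qed

lemma besov_lower: assumes "besov \<alpha> C u" "\<beta> \<le> \<alpha>" shows "besov \<beta> (2 powr (\<alpha> - \<beta>) * C) u"
  unfolding besov_def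
proof (intro conjI allI)
  fix n x
  have "cmod (tp (blk n u) x) \<le> C * wt \<alpha> n" by (rule besovD(1)[OF assms(1)])
  also have "\<dots> \<le> C * (2 powr (\<alpha> - \<beta>) * wt \<beta> n)" by (rule mult_left_mono[OF wt_mono[OF assms(2)] besov_nonneg[OF assms(1)]])
  finally show "cmod (tp (blk n u) x) \<le> 2 powr (\<alpha> - \<beta>) * C * wt \<beta> n" by (simp add: mult_ac)
qed (rule besovD(2)[OF assms(1)])

lemma block_norm_eq:
  assumes "herm u"
  shows "block_norm \<theta> \<alpha> u (int n - 1) = (SUP x. cmod (tp (blk n u) x)) / wt \<alpha> n"
  using assms by (simp add: block_norm_def norm_LP wt_def powr_minus_divide mult.commute)

lemma bdd_tp: "bdd_above (range (\<lambda>x. cmod (tp c x)))"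
proof (rule bdd_aboveI2)
  fix x show "cmod (tp c x) \<le> (\<Sum>k\<in>{k. c k \<noteq> 0}. cmod (c k))"
    unfolding tp_def by (rule order_trans[OF norm_sum]) (simp add: norm_mult)
qed

lemma block_norm_le_iff:
  assumes "herm u"
  shows "block_norm \<theta> \<alpha> u (int n - 1) \<le> C \<longleftrightarrow> (\<forall>x. cmod (tp (blk n u) x) \<le> C * wt \<alpha> n)"
proof -
  have "block_norm \<theta> \<alpha> u (int n - 1) \<le> C \<longleftrightarrow> (SUP x. cmod (tp (blk n u) x)) \<le> C * wt \<alpha> n"
    by (simp add: block_norm_eq[OF assms] pos_divide_le_eq)
  also have "\<dots> \<longleftrightarrow> (\<forall>x. cmod (tp (blk n u) x) \<le> C * wt \<alpha> n)"
    by (subst cSUP_le_iff) (auto simp: bdd_tp)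
  finally show ?thesis .
qed

lemma image_index: "block_norm \<theta> \<alpha> u ` {-1..} = (\<lambda>n. block_norm \<theta> \<alpha> u (int n - 1)) ` UNIV"
proof -
  have "{-1..} = (\<lambda>n. int n - 1) ` UNIV"
  proof (intro equalityI subsetI)
    fix j :: int assume "j \<in> {-1..}"
    then show "j \<in> range (\<lambda>n. int n - 1)" by (intro image_eqI[of _ _ "nat (j + 1)"]) auto
  qed auto
  then show ?thesis by (simp add: image_image)
qed

lemma hnorm_le: assumes "besov \<alpha> C u" shows "hnorm \<theta> \<alpha> u \<le> C"
  unfolding hnorm_def image_index
  by (rule cSUP_least) (use assms in \<open>auto simp: block_norm_le_iff besov_def\<close>)

lemma besov_hnorm: assumes "herm u" "bdd_above (block_norm \<theta> \<alpha> u ` {-1..})" shows "besov \<alpha> (hnorm \<theta> \<alpha> u) u"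
proof -
  have "block_norm \<theta> \<alpha> u (int n - 1) \<le> hnorm \<theta> \<alpha> u" for n
    unfolding hnorm_def image_index by (rule cSUP_upper) (use assms(2) in \<open>auto simp: image_index\<close>)
  then show ?thesis using assms(1) by (simp add: besov_def block_norm_le_iff)
qed

lemma besov_bdd: "besov \<alpha> C u \<Longrightarrow> bdd_above (block_norm \<theta> \<alpha> u ` {-1..})"
  unfolding image_index by (rule bdd_aboveI2[where M = C]) (auto simp: block_norm_le_iff besov_def)

lemma besov_hnorm': "besov \<alpha> C u \<Longrightarrow> besov \<alpha> (hnorm \<theta> \<alpha> u) u"
  by (rule besov_hnorm[OF besovD(2) besov_bdd])

text \<open>A number of blocks that suffices to reproduce the \<open>k\<close>-th coefficient.\<close>
definition block_index :: "int^3 \<Rightarrow> nat" where "block_index k = (SOME n. 1 \<le> n \<and> norm (freq k) < r * 2 ^ n)"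

lemma block_index: "1 \<le> block_index k" "norm (freq k) < r * 2 ^ block_index k"
proof -
  obtain n where n: "norm (freq k) / r < 2 ^ n" using real_arch_pow[of 2] by auto
  have "2 ^ n \<le> (2::real) ^ Suc n" by simp
  then have "norm (freq k) / r < 2 ^ Suc n" using n by linarith
  then have "1 \<le> Suc n \<and> norm (freq k) < r * 2 ^ Suc n" using r_pos by (simp add: field_simps)
  then have "\<exists>n. 1 \<le> n \<and> norm (freq k) < r * 2 ^ n" by blast
  then show "1 \<le> block_index k" "norm (freq k) < r * 2 ^ block_index k" unfolding block_index_def by (metis (mono_tags, lifting) someI_ex)+
qed

lemma coeff_eq_sum_blk: "u k = (\<Sum>i<block_index k. blk i u k)"
  using low_eventually[OF block_index, of k u] by (simp add: low_def blk_def sum_distrib_right)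

lemma norm_blk_coeff: "besov \<alpha> C u \<Longrightarrow> cmod (blk n u k) \<le> C * wt \<alpha> n"
  by (rule norm_coeff_le) (auto simp: besovD)

definition coeff_weight :: "real \<Rightarrow> int^3 \<Rightarrow> real" where "coeff_weight \<alpha> k = (\<Sum>i<block_index k. wt \<alpha> i)"

text \<open>A coefficient is the sum of finitely many coefficients of blocks, each at most the supremum of its
  block.\<close>
lemma coeff_bound: assumes "besov \<alpha> C u" shows "cmod (u k) \<le> C * coeff_weight \<alpha> k"
proof -
  have "cmod (u k) \<le> (\<Sum>i<block_index k. cmod (blk i u k))" by (subst coeff_eq_sum_blk) (rule norm_sum)
  also have "\<dots> \<le> (\<Sum>i<block_index k. C * wt \<alpha> i)" by (intro sum_mono norm_blk_coeff assms)
  finally show ?thesis by (simp add: coeff_weight_def sum_distrib_left)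
qed

text \<open>At most two blocks contain a given frequency \<open>k\<close>, and their index \<open>n\<close> satisfies
  \<open>2\<^sup>n \<le> (1 + 1/r) (1 + \<bar>k\<bar>)\<close>, so the coefficients grow at most polynomially.\<close>
lemma besov_torus_distr: assumes "besov \<alpha> C u" shows "torus_distr u"
proof -
  define N where "N = nat \<lceil>\<bar>\<alpha>\<bar>\<rceil>"
  have C: "C \<ge> 0" by (rule besov_nonneg[OF assms])
  have each: "cmod (blk n u k) \<le> C * ((1 + 1 / r) ^ N * 2 powr \<bar>\<alpha>\<bar> * (1 + norm (freq k)) ^ N)" for n k
  proof (cases "blk n u k = 0")
    case True
    have "0 \<le> C * ((1 + 1 / r) ^ N * 2 powr \<bar>\<alpha>\<bar> * (1 + norm (freq k)) ^ N)"
      using C r_pos by (intro mult_nonneg_nonneg) auto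
    then show ?thesis using True by simp
  next
    case False
    then have th: "\<Theta> n k \<noteq> 0" by (auto simp: blk_def)
    have pw: "2 ^ n \<le> (1 + 1 / r) * (1 + norm (freq k))"
    proof (cases "n = 0")
      case True
      have "1 * 1 \<le> (1 + 1 / r) * (1 + norm (freq k))" using r_pos by (intro mult_mono) auto
      then show ?thesis using True by simp
    next
      case False
      then have "r * 2 ^ n \<le> norm (freq k)" using lower th by simp
      then have "2 ^ n \<le> (1 / r) * norm (freq k)" using r_pos by (simp add: field_simps)
      also have "\<dots> \<le> (1 + 1 / r) * (1 + norm (freq k))" using r_pos by (intro mult_mono) auto
      finally show ?thesis .
    qed
    have "wt \<alpha> n \<le> 2 powr (\<bar>\<alpha>\<bar> * (real n + 1))"
    proof -
      have "- \<alpha> * (real n - 1) \<le> \<bar>\<alpha> * (real n - 1)\<bar>" by linarith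
      also have "\<dots> \<le> \<bar>\<alpha>\<bar> * (real n + 1)" unfolding abs_mult by (intro mult_left_mono) auto
      finally show ?thesis by (simp add: wt_def)
    qed
    also have "\<dots> = (2 ^ n) powr \<bar>\<alpha>\<bar> * 2 powr \<bar>\<alpha>\<bar>"
      by (simp add: powr_powr powr_add algebra_simps flip: powr_realpow)
    also have "\<dots> \<le> ((1 + 1 / r) * (1 + norm (freq k))) powr \<bar>\<alpha>\<bar> * 2 powr \<bar>\<alpha>\<bar>"
      using pw by (intro mult_right_mono powr_mono2) auto
    also have "\<dots> \<le> ((1 + 1 / r) * (1 + norm (freq k))) powr real N * 2 powr \<bar>\<alpha>\<bar>"
    proof -
      have "1 \<le> (1 + 1 / r) * (1 + norm (freq k))" using order_trans[OF _ pw, of 1] by simp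
      then show ?thesis by (intro mult_right_mono powr_mono) (auto simp: N_def)
    qed
    also have "\<dots> = (1 + 1 / r) ^ N * 2 powr \<bar>\<alpha>\<bar> * (1 + norm (freq k)) ^ N"
    proof -
      have "0 < (1 + 1 / r) * (1 + norm (freq k))" using r_pos by (intro mult_pos_pos) (auto simp: add_pos_nonneg)
      then show ?thesis by (simp add: powr_realpow power_mult_distrib mult_ac)
    qed
    finally have "C * wt \<alpha> n \<le> C * ((1 + 1 / r) ^ N * 2 powr \<bar>\<alpha>\<bar> * (1 + norm (freq k)) ^ N)"
      using C by (rule mult_left_mono)
    then show ?thesis using norm_blk_coeff[OF assms, of n k] by linarith
  qed
  have "cmod (u k) \<le> 2 * (C * ((1 + 1 / r) ^ N * 2 powr \<bar>\<alpha>\<bar> * (1 + norm (freq k)) ^ N))" for k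
  proof -
    let ?I = "{i\<in>{..<block_index k}. blk i u k \<noteq> 0}"
    let ?E = "C * ((1 + 1 / r) ^ N * 2 powr \<bar>\<alpha>\<bar> * (1 + norm (freq k)) ^ N)"
    have E: "0 \<le> ?E" using C r_pos by (intro mult_nonneg_nonneg) auto
    (* Only neighbouring blocks overlap. *)
    have "card ?I \<le> 2"
    proof (cases "?I = {}")
      case False
      define i0 where "i0 = Min ?I"
      have "i0 \<in> ?I" unfolding i0_def by (rule Min_in) (use False in auto)
      have "?I \<subseteq> {i0, i0 + 1}"
      proof
        fix i assume i: "i \<in> ?I"
        have "i0 \<le> i" unfolding i0_def by (rule Min_le) (use i in auto)
        moreover have "i \<le> i0 + 1" using apart[of i k i0] i \<open>i0 \<in> ?I\<close> by (auto simp: blk_def)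
        ultimately show "i \<in> {i0, i0 + 1}" by auto
      qed
      then have "card ?I \<le> card {i0, i0 + 1}" by (intro card_mono) auto
      then show ?thesis by simp
    next
      case True
      show ?thesis unfolding True by simp
    qed
    have "(\<Sum>i<block_index k. blk i u k) = (\<Sum>i\<in>?I. blk i u k)"
      by (rule sum.mono_neutral_right) auto
    with coeff_eq_sum_blk[of u k] have "cmod (u k) = cmod (\<Sum>i\<in>?I. blk i u k)" by (simp only:)
    also have "\<dots> \<le> (\<Sum>i\<in>?I. cmod (blk i u k))" by (rule norm_sum)
    also have "\<dots> \<le> real (card ?I) * ?E" by (rule sum_bounded_above) (rule each)
    also have "\<dots> \<le> 2 * ?E" using \<open>card ?I \<le> 2\<close> E by (intro mult_right_mono) auto
    finally show ?thesis .
  qed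
  then have "\<forall>k. cmod (u k) \<le> (2 * C * ((1 + 1 / r) ^ N * 2 powr \<bar>\<alpha>\<bar>)) * (1 + norm (freq k)) ^ N"
    by (simp only: mult.assoc simp_thms)
  then show ?thesis using besovD(2)[OF assms] unfolding torus_distr_def herm_def by blast
qed

end

lemma card_freq_ball:
  assumes "B \<ge> 0" shows "real (card {k. norm (freq k) \<le> B}) \<le> (2 * B + 3) ^ 3"
proof -
  have sub: "{k. norm (freq k) \<le> B} \<subseteq> {k::int^3. \<forall>i. k $ i \<in> {- \<lceil>B\<rceil>..\<lceil>B\<rceil>}}"
  proof (intro subsetI CollectI allI)
    fix k :: "int^3" and i assume "k \<in> {k. norm (freq k) \<le> B}"
    then have "\<bar>real_of_int (k $ i)\<bar> \<le> B" using component_le_norm_cart[of "freq k" i] by simp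
    then show "k $ i \<in> {- \<lceil>B\<rceil>..\<lceil>B\<rceil>}" by (simp add: abs_le_iff) linarith
  qed
  have c: "card {k::int^3. \<forall>i. k $ i \<in> {- \<lceil>B\<rceil>..\<lceil>B\<rceil>}} = nat (2 * \<lceil>B\<rceil> + 1) ^ 3"
    by (subst card_vec_box) (simp add: algebra_simps power3_eq_cube)
  have "finite {k::int^3. \<forall>i. k $ i \<in> {- \<lceil>B\<rceil>..\<lceil>B\<rceil>}}"
    by (rule card_ge_0_finite, unfold c) (use assms in simp)
  then have "card {k. norm (freq k) \<le> B} \<le> nat (2 * \<lceil>B\<rceil> + 1) ^ 3"
    using card_mono[OF _ sub] c by simp
  then have "real (card {k. norm (freq k) \<le> B}) \<le> real (nat (2 * \<lceil>B\<rceil> + 1)) ^ 3"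
    by (metis of_nat_le_iff of_nat_power)
  also have "\<dots> \<le> (2 * B + 3) ^ 3"
    by (intro power_mono) (use assms in \<open>simp_all, linarith\<close>)
  finally show ?thesis .
qed

section \<open>The spaces of the statement and their curves\<close>

context lp_frame
begin

text \<open>The blocks are of smaller order than the norm allows; this characterizes the closure of the
  smooth functions.\<close>
definition little :: "real \<Rightarrow> coeffs \<Rightarrow> bool" where
  "little \<alpha> u \<longleftrightarrow> (\<forall>\<delta>>0. \<exists>N. \<forall>n\<ge>N. \<forall>x. cmod (tp (blk n u) x) \<le> \<delta> * wt \<alpha> n)"

definition finite_norm :: "real \<Rightarrow> coeffs \<Rightarrow> bool" where "finite_norm \<alpha> u \<longleftrightarrow> (\<exists>C. besov \<alpha> C u)"

lemma finite_norm_besov: "finite_norm \<alpha> u \<Longrightarrow> besov \<alpha> (hnorm \<theta> \<alpha> u) u"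
  unfolding finite_norm_def using besov_hnorm' by blast

lemma finite_norm_diff: "finite_norm \<alpha> u \<Longrightarrow> finite_norm \<alpha> v \<Longrightarrow> finite_norm \<alpha> (u - v)"
  unfolding finite_norm_def using besov_diff by blast

lemma besov_finite_norm: "besov \<alpha> C u \<Longrightarrow> finite_norm \<alpha> u" unfolding finite_norm_def by blast

lemma hnorm_ge0: "finite_norm \<alpha> u \<Longrightarrow> 0 \<le> hnorm \<theta> \<alpha> u"
  using finite_norm_besov besov_nonneg by blast

lemma hnorm_triangle: "finite_norm \<alpha> u \<Longrightarrow> finite_norm \<alpha> v \<Longrightarrow> hnorm \<theta> \<alpha> (u - v) \<le> hnorm \<theta> \<alpha> u + hnorm \<theta> \<alpha> v"
  using hnorm_le[OF besov_diff[OF finite_norm_besov finite_norm_besov]] .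

lemma besov_swap: assumes "besov \<alpha> C (u - v)" shows "besov \<alpha> C (v - u)"
proof -
  have "v - u = (\<lambda>k. of_real (-1) * (u - v) k)" by auto
  then show ?thesis using besov_scale[OF assms, of "-1"] by simp
qed

lemma besov_trans: assumes "besov \<alpha> C (u - v)" "besov \<alpha> D (v - w)" shows "besov \<alpha> (C + D) (u - w)"
  using besov_add[OF assms] by (simp add: fun_diff_def)

lemma besov_from_diff: assumes "besov \<alpha> C (u - v)" "besov \<alpha> D v" shows "besov \<alpha> (C + D) u"
  using besov_add[OF assms] by (simp add: fun_diff_def)

lemma hnorm_minus_commute: "finite_norm \<alpha> (u - v) \<Longrightarrow> hnorm \<theta> \<alpha> (u - v) = hnorm \<theta> \<alpha> (v - u)"
  by (rule antisym; rule hnorm_le; rule besov_swap; rule finite_norm_besov) (auto simp: finite_norm_def dest: besov_swap)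

lemma finite_norm_from_diff: "finite_norm \<alpha> (u - v) \<Longrightarrow> finite_norm \<alpha> v \<Longrightarrow> finite_norm \<alpha> u"
  unfolding finite_norm_def using besov_from_diff by blast

lemma hnorm_diff_le: "finite_norm \<alpha> u \<Longrightarrow> finite_norm \<alpha> v \<Longrightarrow> hnorm \<theta> \<alpha> u \<le> hnorm \<theta> \<alpha> (u - v) + hnorm \<theta> \<alpha> v"
  using hnorm_le[OF besov_from_diff[OF finite_norm_besov[OF finite_norm_diff] finite_norm_besov]] by blast

lemma little_fin: assumes "herm u" "little \<alpha> u" shows "finite_norm \<alpha> u"
proof -
  obtain N where N: "\<And>n x. n \<ge> N \<Longrightarrow> cmod (tp (blk n u) x) \<le> 1 * wt \<alpha> n"
    using assms(2) zero_less_one unfolding little_def by blast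
  have "\<exists>M. \<forall>x. cmod (tp (blk n u) x) \<le> M" for n
    using bdd_tp[of "blk n u"] unfolding bdd_above_def by auto
  then obtain M where M: "\<And>n x. cmod (tp (blk n u) x) \<le> M n" by metis
  have M0: "M n \<ge> 0" for n using M[of n 0] norm_ge_zero order_trans by blast
  let ?C = "1 + (\<Sum>n<N. M n / wt \<alpha> n)"
  have s0: "(\<Sum>n<N. M n / wt \<alpha> n) \<ge> 0" by (intro sum_nonneg) (simp add: M0)
  have "cmod (tp (blk n u) x) \<le> ?C * wt \<alpha> n" for n x
  proof (cases "n < N")
    case True
    have "M n / wt \<alpha> n \<le> (\<Sum>n<N. M n / wt \<alpha> n)" by (rule member_le_sum) (use True M0 in auto)
    then have "M n / wt \<alpha> n \<le> ?C" by simp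
    then have "M n \<le> ?C * wt \<alpha> n" by (simp add: pos_divide_le_eq)
    then show ?thesis using M[of n x] by linarith
  next
    case False
    then have "cmod (tp (blk n u) x) \<le> 1 * wt \<alpha> n" using N by simp
    also have "\<dots> \<le> ?C * wt \<alpha> n" using s0 by (intro mult_right_mono) auto
    finally show ?thesis .
  qed
  then show ?thesis using assms(1) by (auto simp: finite_norm_def besov_def)
qed

lemma norm_symbol: "\<bar>\<Theta> n k\<bar> \<le> K"
proof -
  let ?c = "\<lambda>l. if l = k then 1 else 0 :: complex"
  have c: "finsupp ?c" by simp
  have "cmod (tp ?c x) \<le> 1" for x by (subst tp_eq[where S="{k}"]) (auto split: if_splits)
  then have "cmod (tp (\<lambda>l. of_real (\<Theta> n l) * ?c l) x) \<le> K * 1" for x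
    using multiplierD[OF multiplier_block c, of 1 n] by blast
  then have "cmod ((\<lambda>l. of_real (\<Theta> n l) * ?c l) k) \<le> K * 1"
    by (rule norm_coeff_le[rotated]) simp
  then show ?thesis by simp
qed

lemma tp_blk_le_sum: "cmod (tp (blk n u) x) \<le> K * (\<Sum>k\<in>{k. \<Theta> n k \<noteq> 0}. cmod (u k))"
proof -
  have "tp (blk n u) x = (\<Sum>k\<in>{k. \<Theta> n k \<noteq> 0}. blk n u k * mode k x)"
    by (rule tp_eq) (use finite_symbol in \<open>auto simp: blk_def\<close>)
  then have "cmod (tp (blk n u) x) \<le> (\<Sum>k\<in>{k. \<Theta> n k \<noteq> 0}. K * cmod (u k))"
    by (auto intro!: order_trans[OF norm_sum] sum_mono mult_right_mono norm_symbol simp: blk_def norm_mult)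
  then show ?thesis by (simp add: sum_distrib_left)
qed

lemma cfc_herm: "(\<And>x. Im (f x) = 0) \<Longrightarrow> herm (cfc f)"
proof -
  assume f: "\<And>x. Im (f x) = 0"
  then have e: "f x * mode (- (- k)) x = cnj (f x * mode (- k) x)" for k x
    by (simp add: mode_minus complex_eq_iff)
  show ?thesis unfolding herm_def cfc_def e integral_cnj by simp
qed

lemma herm_fcoef: "herm (fcoef f)"
  unfolding fcoef_eq_cfc by (rule cfc_herm) simp

text \<open>The coefficients of a smooth function decay faster than any power, while a block contains of order
  \<open>8\<^sup>n\<close> of them.\<close>
lemma smooth_little: assumes "smooth_torus f" shows "little \<alpha> (fcoef f)"
  unfolding little_def
proof (intro allI impI)
  fix \<delta> :: real assume d: "\<delta> > 0"
  (* Three powers of 2 ^ n pay for the number of frequencies and one is left for the decay. *)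
  define p where "p = nat \<lceil>\<bar>\<alpha>\<bar>\<rceil> + 4"
  obtain C where C: "C \<ge> 0" "\<And>k. (\<Sum>i\<in>UNIV. \<bar>real_of_int (k $ i)\<bar>) ^ p * cmod (fcoef f k) \<le> C"
    using fcoef_decay[OF assms, of p] by blast
  define E where "E = K * ((2 * R + 3) ^ 3 * (C / r ^ p)) * 2 powr \<bar>\<alpha>\<bar>"
  have main: "cmod (tp (blk n (fcoef f)) x) \<le> E * (1/2) ^ n * wt \<alpha> n" if n: "n \<ge> 1" for n x
  proof -
    have each: "cmod (fcoef f k) \<le> C / (r * 2 ^ n) ^ p" if "\<Theta> n k \<noteq> 0" for k
    proof -
      have "r * 2 ^ n \<le> norm (freq k)" using lower n that by blast
      also have "\<dots> \<le> (\<Sum>i\<in>UNIV. \<bar>real_of_int (k $ i)\<bar>)" using norm_le_l1_cart[of "freq k"] by simp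
      finally have "(r * 2 ^ n) ^ p \<le> (\<Sum>i\<in>UNIV. \<bar>real_of_int (k $ i)\<bar>) ^ p"
        using r_pos by (intro power_mono) auto
      then have "(r * 2 ^ n) ^ p * cmod (fcoef f k) \<le> C"
        using C(2)[of k] mult_right_mono[of "(r * 2 ^ n) ^ p" _ "cmod (fcoef f k)"] by (meson norm_ge_zero order_trans)
      then show ?thesis using r_pos by (simp add: pos_le_divide_eq mult.commute)
    qed
    have "(\<Sum>k\<in>{k. \<Theta> n k \<noteq> 0}. cmod (fcoef f k)) \<le> real (card {k. \<Theta> n k \<noteq> 0}) * (C / (r * 2 ^ n) ^ p)"
      by (rule sum_bounded_above) (use each in auto)
    also have "\<dots> \<le> ((2 * R + 3) * 2 ^ n) ^ 3 * (C / (r * 2 ^ n) ^ p)"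
    proof (rule mult_right_mono)
      have "real (card {k. \<Theta> n k \<noteq> 0}) \<le> real (card {k. norm (freq k) \<le> R * 2 ^ n})"
        by (intro of_nat_mono card_mono finite_freq_ball) (auto simp: upper)
      also have "\<dots> \<le> (2 * (R * 2 ^ n) + 3) ^ 3" by (rule card_freq_ball) (use R_pos in simp)
      also have "\<dots> \<le> ((2 * R + 3) * 2 ^ n) ^ 3"
      proof (rule power_mono)
        have "3 * 1 \<le> 3 * (2::real) ^ n" by (intro mult_left_mono) auto
        then show "2 * (R * 2 ^ n) + 3 \<le> (2 * R + 3) * 2 ^ n" by (simp add: algebra_simps)
      qed (use R_pos in simp)
      finally show "real (card {k. \<Theta> n k \<noteq> 0}) \<le> ((2 * R + 3) * 2 ^ n) ^ 3" .
    qed (use C r_pos in simp)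
    also have "\<dots> = (2 * R + 3) ^ 3 * (C / r ^ p) * ((2 ^ n) ^ 3 / (2 ^ n) ^ p)"
      by (simp add: power_mult_distrib)
    also have "(2 ^ n) ^ 3 / (2 ^ n) ^ p = 2 powr (3 * real n - real n * real p)"
    proof -
      have pw: "((2::real) ^ n) ^ q = 2 powr (real n * real q)" for q
        by (metis of_nat_mult power_mult powr_realpow zero_less_numeral)
      show ?thesis unfolding pw powr_diff by (simp add: mult.commute)
    qed
    also have "(2 * R + 3) ^ 3 * (C / r ^ p) * 2 powr (3 * real n - real n * real p) \<le>
      (2 * R + 3) ^ 3 * (C / r ^ p) * (2 powr \<bar>\<alpha>\<bar> * ((1/2) ^ n * wt \<alpha> n))"
    proof (rule mult_left_mono)
      have "\<bar>\<alpha>\<bar> + 4 \<le> real p" by (simp add: p_def)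
      then have "real n * (\<bar>\<alpha>\<bar> + 4) \<le> real n * real p" by (intro mult_left_mono) auto
      moreover have "\<alpha> * real n \<le> \<bar>\<alpha>\<bar> * real n" by (intro mult_right_mono) auto
      moreover have "- \<alpha> \<le> \<bar>\<alpha>\<bar>" by simp
      ultimately have "3 * real n - real n * real p \<le> \<bar>\<alpha>\<bar> + - real n + - \<alpha> * (real n - 1)"
        by (simp add: algebra_simps)
      then have "2 powr (3 * real n - real n * real p) \<le> 2 powr (\<bar>\<alpha>\<bar> + - real n + - \<alpha> * (real n - 1))" by simp
      also have "\<dots> = 2 powr \<bar>\<alpha>\<bar> * (2 powr (- real n) * wt \<alpha> n)" unfolding wt_def powr_add by (rule mult.assoc)
      also have "2 powr (- real n) = (1/2) ^ n" by (simp add: powr_minus powr_realpow power_one_over inverse_eq_divide)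
      finally show "2 powr (3 * real n - real n * real p) \<le> 2 powr \<bar>\<alpha>\<bar> * ((1/2) ^ n * wt \<alpha> n)" .
      show "0 \<le> (2 * R + 3) ^ 3 * (C / r ^ p)" using C r_pos R_pos by simp
    qed
    finally have "K * (\<Sum>k\<in>{k. \<Theta> n k \<noteq> 0}. cmod (fcoef f k)) \<le> K * ((2 * R + 3) ^ 3 * (C / r ^ p) * (2 powr \<bar>\<alpha>\<bar> * ((1/2) ^ n * wt \<alpha> n)))"
      using K_ge_1 by (intro mult_left_mono) auto
    also have "\<dots> = E * (1/2) ^ n * wt \<alpha> n" by (simp add: E_def mult_ac)
    finally show ?thesis using tp_blk_le_sum[of n "fcoef f" x] by linarith
  qed
  have "(\<lambda>n. E * (1/2) ^ n) \<longlonglongrightarrow> E * 0" by (intro tendsto_intros) auto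
  then have "\<forall>\<^sub>F n in sequentially. E * (1/2) ^ n < \<delta>" by (rule order_tendstoD(2)) (use d in simp)
  then obtain N where N: "\<And>n. n \<ge> N \<Longrightarrow> E * (1/2) ^ n < \<delta>" by (auto simp: eventually_sequentially)
  have "cmod (tp (blk n (fcoef f)) x) \<le> \<delta> * wt \<alpha> n" if "n \<ge> Suc N" for n x
  proof -
    have "E * (1/2) ^ n * wt \<alpha> n \<le> \<delta> * wt \<alpha> n"
      using N[of n] that by (intro mult_right_mono) auto
    then show ?thesis using main[of n x] that by linarith
  qed
  then show "\<exists>N. \<forall>n\<ge>N. \<forall>x. cmod (tp (blk n (fcoef f)) x) \<le> \<delta> * wt \<alpha> n" by blast
qed

lemma low_block_zero: assumes "m + 2 \<le> N" shows "blk m (u - low N u) = (\<lambda>k. 0)"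
proof
  fix k
  show "blk m (u - low N u) k = 0"
  proof (cases "\<Theta> m k = 0")
    case False
    let ?M = "max N (block_index k)"
    have "norm (freq k) < r * 2 ^ block_index k" by (rule block_index)
    also have "\<dots> \<le> r * 2 ^ ?M" using r_pos by (intro mult_left_mono power_increasing) auto
    finally have "(\<Sum>i<?M. \<Theta> i k) = 1" using block_index(1)[of k] by (intro total) auto
    moreover have "(\<Sum>i<?M. \<Theta> i k) = (\<Sum>i<N. \<Theta> i k)"
    proof (rule sum.mono_neutral_right)
      show "\<forall>i\<in>{..<?M} - {..<N}. \<Theta> i k = 0"
      proof
        fix i assume "i \<in> {..<?M} - {..<N}"
        then have "\<not> i \<le> m + 1" using assms by auto
        then show "\<Theta> i k = 0" using apart[of i k m] False by blast
      qed
    qed auto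
    ultimately show ?thesis by (simp add: blk_def low_def del: of_real_sum)
  qed (simp add: blk_def)
qed

lemma blk_low_bound:
  assumes "\<And>x. cmod (tp (blk m u) x) \<le> A" shows "cmod (tp (blk m (low N u)) x) \<le> K * A"
proof -
  have "blk m (low N u) = (\<lambda>k. of_real (\<Sum>i<N. \<Theta> i k) * blk m u k)" by (simp add: blk_def low_def mult_ac)
  then show ?thesis using multiplierD[OF multiplier_partial finsupp_blk assms, of N x] by simp
qed

text \<open>Blocks with an index below \<open>N\<close> of the error vanish, and the others are bounded by blocks of \<open>u\<close>.\<close>
lemma truncation_error:
  assumes u: "herm u" and N: "\<And>n x. n \<ge> N \<Longrightarrow> cmod (tp (blk n u) x) \<le> \<delta> * wt \<alpha> n" and d: "\<delta> \<ge> 0"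
  shows "besov \<alpha> ((1 + K) * \<delta>) (u - low (N + 1) u)"
  unfolding besov_def
proof (intro conjI allI)
  show "herm (u - low (N + 1) u)" using u herm_low herm_arith by blast
  fix n x
  show "cmod (tp (blk n (u - low (N + 1) u)) x) \<le> (1 + K) * \<delta> * wt \<alpha> n"
  proof (cases "n \<ge> N")
    case True
    have "cmod (tp (blk n (u - low (N + 1) u)) x) \<le> cmod (tp (blk n u) x) + cmod (tp (blk n (low (N + 1) u)) x)"
      unfolding tp_blk_arith by (rule norm_triangle_ineq4)
    also have "\<dots> \<le> \<delta> * wt \<alpha> n + K * (\<delta> * wt \<alpha> n)"
      by (intro add_mono blk_low_bound N True)
    finally show ?thesis by (simp add: algebra_simps)
  next
    case False
    then have "blk n (u - low (N + 1) u) = (\<lambda>k. 0)" by (intro low_block_zero) simp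
    then show ?thesis using d K_ge_1 by (simp add: tp_def)
  qed
qed

text \<open>Smooth functions have rapidly decreasing blocks, and \<open>little\<close> is a closed condition. Conversely, the
  partial sums are trigonometric polynomials that approximate \<open>u\<close>.\<close>
lemma Hoelder_iff: "u \<in> Hoelder \<theta> \<alpha> \<longleftrightarrow> herm u \<and> little \<alpha> u"
proof
  assume u: "u \<in> Hoelder \<theta> \<alpha>"
  then have h: "herm u" and bd: "bdd_above (block_norm \<theta> \<alpha> u ` {-1..})"
    and ap: "\<And>\<delta>. \<delta> > 0 \<Longrightarrow> \<exists>f. smooth_torus f \<and> hnorm \<theta> \<alpha> (u - fcoef f) < \<delta>"
    by (auto simp: Hoelder_def torus_distr_def herm_def)
  have fu: "finite_norm \<alpha> u" using besov_hnorm[OF h bd] by (auto simp: finite_norm_def)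
  have "\<exists>N. \<forall>n\<ge>N. \<forall>x. cmod (tp (blk n u) x) \<le> \<delta> * wt \<alpha> n" if d: "\<delta> > 0" for \<delta>
  proof -
    obtain f where f: "smooth_torus f" "hnorm \<theta> \<alpha> (u - fcoef f) < \<delta> / 2" using ap[of "\<delta> / 2"] d by auto
    have l: "little \<alpha> (fcoef f)" by (rule smooth_little[OF f(1)])
    have "besov \<alpha> (\<delta> / 2) (u - fcoef f)"
      using besov_mono[OF finite_norm_besov[OF finite_norm_diff[OF fu little_fin[OF herm_fcoef l]]], of "\<delta> / 2"] f by simp
    then have 1: "cmod (tp (blk n u) x - tp (blk n (fcoef f)) x) \<le> \<delta> / 2 * wt \<alpha> n" for n x
      using besovD(1)[of \<alpha> "\<delta> / 2" "u - fcoef f" n x] by (simp add: tp_blk_arith)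
    obtain N where N: "\<And>n x. n \<ge> N \<Longrightarrow> cmod (tp (blk n (fcoef f)) x) \<le> \<delta> / 2 * wt \<alpha> n"
      using l[unfolded little_def, rule_format, of "\<delta> / 2"] d by auto
    have "cmod (tp (blk n u) x) \<le> \<delta> * wt \<alpha> n" if "n \<ge> N" for n x
      using 1[of n x] N[OF that, of x] norm_triangle_sub[of "tp (blk n u) x" "tp (blk n (fcoef f)) x"] by simp
    then show ?thesis by blast
  qed
  then show "herm u \<and> little \<alpha> u" using h by (simp add: little_def)
next
  assume u: "herm u \<and> little \<alpha> u"
  obtain C where C: "besov \<alpha> C u" using little_fin u by (auto simp: finite_norm_def)
  have "\<exists>f. smooth_torus f \<and> hnorm \<theta> \<alpha> (u - fcoef f) < \<delta>" if d: "\<delta> > 0" for \<delta>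
  proof -
    define d' where "d' = \<delta> / (2 * (1 + K))"
    have d': "d' > 0" using d K_ge_1 by (simp add: d'_def)
    then obtain N where N: "\<And>n x. n \<ge> N \<Longrightarrow> cmod (tp (blk n u) x) \<le> d' * wt \<alpha> n"
      using u unfolding little_def by meson
    let ?c = "low (N + 1) u"
    let ?f = "\<lambda>x. Re (tp ?c x)"
    have "hnorm \<theta> \<alpha> (u - ?c) \<le> (1 + K) * d'"
      by (rule hnorm_le[OF truncation_error]) (use u N d' in auto)
    also have "\<dots> = \<delta> / 2"
    proof -
      have "1 + K \<noteq> 0" using K_ge_1 by linarith
      then show ?thesis unfolding d'_def by (simp only: times_divide_eq_right mult.commute[of 2] nonzero_mult_divide_mult_cancel_left not_False_eq_True)
    qed
    also have "\<dots> < \<delta>" using d by simp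
    finally have 1: "hnorm \<theta> \<alpha> (u - ?c) < \<delta>" .
    have "fcoef ?f = ?c" using tp_herm_Re[OF herm_low[of u "N + 1"]] u by (simp add: fcoef_eq_cfc cfc_tp)
    moreover have "smooth_torus ?f"
      unfolding smooth_torus_def periodic_iff_per
      by (intro conjI per_comp(1)[OF per_tp]) (unfold tp_def, rule smooth_trig)
    ultimately show ?thesis using 1 by metis
  qed
  then show "u \<in> Hoelder \<theta> \<alpha>" using besov_torus_distr[OF C] besov_bdd[OF C] by (simp add: Hoelder_def)
qed

lemma Hoelder_fin: "u \<in> Hoelder \<theta> \<alpha> \<Longrightarrow> finite_norm \<alpha> u"
  using Hoelder_iff little_fin by blast

lemma little_diff: assumes "little \<alpha> u" "little \<alpha> v" shows "little \<alpha> (u - v)"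
  unfolding little_def
proof (intro allI impI)
  fix \<delta> :: real assume d: "\<delta> > 0"
  obtain N1 where N1: "\<And>n x. n \<ge> N1 \<Longrightarrow> cmod (tp (blk n u) x) \<le> \<delta> / 2 * wt \<alpha> n"
    using assms(1)[unfolded little_def, rule_format, of "\<delta> / 2"] d by auto
  obtain N2 where N2: "\<And>n x. n \<ge> N2 \<Longrightarrow> cmod (tp (blk n v) x) \<le> \<delta> / 2 * wt \<alpha> n"
    using assms(2)[unfolded little_def, rule_format, of "\<delta> / 2"] d by auto
  have "cmod (tp (blk n (u - v)) x) \<le> \<delta> * wt \<alpha> n" if "n \<ge> max N1 N2" for n x
    using N1[of n x] N2[of n x] that norm_triangle_ineq4[of "tp (blk n u) x" "tp (blk n v) x"]
    by (simp add: tp_blk_arith)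
  then show "\<exists>N. \<forall>n\<ge>N. \<forall>x. cmod (tp (blk n (u - v)) x) \<le> \<delta> * wt \<alpha> n" by blast
qed

lemma Hoelder_diff: "u \<in> Hoelder \<theta> \<alpha> \<Longrightarrow> v \<in> Hoelder \<theta> \<alpha> \<Longrightarrow> u - v \<in> Hoelder \<theta> \<alpha>"
  using little_diff herm_arith(2) by (auto simp: Hoelder_iff)

lemma besov_limit:
  assumes "\<And>m. besov \<alpha> C (v m)" "\<And>k. (\<lambda>m. v m k) \<longlonglongrightarrow> u k"
  shows "besov \<alpha> C u"
  unfolding besov_def
proof (intro conjI allI)
  show "herm u" unfolding herm_def
  proof
    fix k
    have "(\<lambda>m. v m (- k)) \<longlonglongrightarrow> cnj (u k)"
      using tendsto_cnj[OF assms(2)[of k]] besovD(2)[OF assms(1)] by (simp add: herm_def)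
    then show "u (- k) = cnj (u k)" using assms(2)[of "- k"] LIMSEQ_unique by blast
  qed
  fix n x
  have eq: "tp (blk n w) x = (\<Sum>k\<in>{k. \<Theta> n k \<noteq> 0}. of_real (\<Theta> n k) * w k * mode k x)" for w
    by (subst tp_eq[OF finite_symbol[of n]]) (auto simp: blk_def)
  have "(\<lambda>m. tp (blk n (v m)) x) \<longlonglongrightarrow> tp (blk n u) x"
    unfolding eq by (intro tendsto_intros assms(2))
  moreover have "\<forall>\<^sub>F m in sequentially. cmod (tp (blk n (v m)) x) \<le> C * wt \<alpha> n"
    by (rule always_eventually) (rule allI, rule besovD(1)[OF assms(1)])
  ultimately show "cmod (tp (blk n u) x) \<le> C * wt \<alpha> n"
    by (rule Lim_norm_ubound[OF sequentially_bot])
qed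

lemma CT_Hoelder: "u \<in> CT \<theta> \<alpha> T \<Longrightarrow> t \<in> {0..T} \<Longrightarrow> u t \<in> Hoelder \<theta> \<alpha>"
  by (auto simp: CT_def)

lemma CT_fin: "u \<in> CT \<theta> \<alpha> T \<Longrightarrow> t \<in> {0..T} \<Longrightarrow> finite_norm \<alpha> (u t)"
  using CT_Hoelder Hoelder_fin by blast

lemma CT_tendsto: "u \<in> CT \<theta> \<alpha> T \<Longrightarrow> t \<in> {0..T} \<Longrightarrow> ((\<lambda>s. hnorm \<theta> \<alpha> (u s - u t)) \<longlongrightarrow> 0) (at t within {0..T})"
  by (auto simp: CT_def)

lemma CT_subset: assumes "u \<in> CT \<theta> \<alpha> T" "T' \<le> T" shows "u \<in> CT \<theta> \<alpha> T'"
  unfolding CT_def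
proof (intro CollectI conjI ballI)
  fix t assume t: "t \<in> {0..T'}"
  then have t': "t \<in> {0..T}" using assms(2) by auto
  show "u t \<in> Hoelder \<theta> \<alpha>" by (rule CT_Hoelder[OF assms(1) t'])
  show "((\<lambda>s. hnorm \<theta> \<alpha> (u s - u t)) \<longlongrightarrow> 0) (at t within {0..T'})"
    by (rule tendsto_within_subset[OF CT_tendsto[OF assms(1) t']]) (use assms(2) in auto)
qed

lemma CT_diff: assumes "u \<in> CT \<theta> \<alpha> T" "v \<in> CT \<theta> \<alpha> T" shows "(\<lambda>t. u t - v t) \<in> CT \<theta> \<alpha> T"
  unfolding CT_def
proof (intro CollectI conjI ballI)
  fix t assume t: "t \<in> {0..T}"
  show "u t - v t \<in> Hoelder \<theta> \<alpha>" by (intro Hoelder_diff CT_Hoelder[OF assms(1) t] CT_Hoelder[OF assms(2) t])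
  have b: "norm (hnorm \<theta> \<alpha> (u s - v s - (u t - v t))) \<le> hnorm \<theta> \<alpha> (u s - u t) + hnorm \<theta> \<alpha> (v s - v t)" if s: "s \<in> {0..T}" for s
  proof -
    have e: "u s - v s - (u t - v t) = (u s - u t) - (v s - v t)" by (auto simp: fun_diff_def)
    note f = finite_norm_diff[OF CT_fin[OF assms(1) s] CT_fin[OF assms(1) t]] finite_norm_diff[OF CT_fin[OF assms(2) s] CT_fin[OF assms(2) t]]
    show ?thesis unfolding e using hnorm_triangle[OF f] hnorm_ge0[OF finite_norm_diff[OF f]] by simp
  qed
  show "((\<lambda>s. hnorm \<theta> \<alpha> (u s - v s - (u t - v t))) \<longlongrightarrow> 0) (at t within {0..T})"
  proof (rule Lim_null_comparison)
    show "\<forall>\<^sub>F s in at t within {0..T}. norm (hnorm \<theta> \<alpha> (u s - v s - (u t - v t))) \<le> hnorm \<theta> \<alpha> (u s - u t) + hnorm \<theta> \<alpha> (v s - v t)"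
      unfolding eventually_at_filter by (rule always_eventually) (use b in blast)
    show "((\<lambda>s. hnorm \<theta> \<alpha> (u s - u t) + hnorm \<theta> \<alpha> (v s - v t)) \<longlongrightarrow> 0) (at t within {0..T})"
      using tendsto_add[OF CT_tendsto[OF assms(1) t] CT_tendsto[OF assms(2) t]] by simp
  qed
qed

lemma CT_hnorm_cont: assumes "u \<in> CT \<theta> \<alpha> T" shows "continuous_on {0..T} (\<lambda>t. hnorm \<theta> \<alpha> (u t))"
  unfolding continuous_on_def
proof
  fix t assume t: "t \<in> {0..T}"
  have "((\<lambda>s. hnorm \<theta> \<alpha> (u s) - hnorm \<theta> \<alpha> (u t)) \<longlongrightarrow> 0) (at t within {0..T})"
  proof (rule Lim_null_comparison[OF _ CT_tendsto[OF assms t]])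
    have "norm (hnorm \<theta> \<alpha> (u s) - hnorm \<theta> \<alpha> (u t)) \<le> hnorm \<theta> \<alpha> (u s - u t)" if s: "s \<in> {0..T}" for s
      using hnorm_diff_le[OF CT_fin[OF assms s] CT_fin[OF assms t]] hnorm_diff_le[OF CT_fin[OF assms t] CT_fin[OF assms s]]
        hnorm_minus_commute[OF finite_norm_diff[OF CT_fin[OF assms s] CT_fin[OF assms t]]] by simp
    then show "\<forall>\<^sub>F s in at t within {0..T}. norm (hnorm \<theta> \<alpha> (u s) - hnorm \<theta> \<alpha> (u t)) \<le> hnorm \<theta> \<alpha> (u s - u t)"
      unfolding eventually_at_filter by (intro always_eventually) blast
  qed
  then show "((\<lambda>t. hnorm \<theta> \<alpha> (u t)) \<longlongrightarrow> hnorm \<theta> \<alpha> (u t)) (at t within {0..T})"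
    by (simp add: LIM_zero_iff)
qed

lemma CT_bdd: assumes "u \<in> CT \<theta> \<alpha> T" shows "bdd_above ((\<lambda>t. hnorm \<theta> \<alpha> (u t)) ` {0..T})"
  by (rule bounded_imp_bdd_above[OF compact_imp_bounded[OF compact_continuous_image[OF CT_hnorm_cont[OF assms]]]]) simp

lemma hnorm_le_CT_norm: "u \<in> CT \<theta> \<alpha> T \<Longrightarrow> t \<in> {0..T} \<Longrightarrow> hnorm \<theta> \<alpha> (u t) \<le> CT_norm \<theta> \<alpha> T u"
  unfolding CT_norm_def by (rule cSUP_upper[OF _ CT_bdd])

lemma CT_norm_le: "0 \<le> T \<Longrightarrow> (\<And>t. t \<in> {0..T} \<Longrightarrow> hnorm \<theta> \<alpha> (u t) \<le> C) \<Longrightarrow> CT_norm \<theta> \<alpha> T u \<le> C"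
  unfolding CT_norm_def by (rule cSUP_least) auto

text \<open>Continuity of each coefficient controls finitely many blocks, and the remaining ones are small
  uniformly in time.\<close>
lemma CT_I:
  assumes h: "\<And>t. t \<in> {0..T} \<Longrightarrow> herm (u t)" and c: "\<And>k. continuous_on {0..T} (\<lambda>t. u t k)"
    and tail: "\<And>\<delta>. \<delta> > 0 \<Longrightarrow> \<exists>N. \<forall>t\<in>{0..T}. \<forall>n\<ge>N. \<forall>x. cmod (tp (blk n (u t)) x) \<le> \<delta> * wt \<alpha> n"
  shows "u \<in> CT \<theta> \<alpha> T"
  unfolding CT_def
proof (intro CollectI conjI ballI)
  fix t assume t: "t \<in> {0..T}"
  have H: "u s \<in> Hoelder \<theta> \<alpha>" if "s \<in> {0..T}" for s
    unfolding Hoelder_iff little_def using h tail that by meson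
  then show "u t \<in> Hoelder \<theta> \<alpha>" using t by blast
  show "((\<lambda>s. hnorm \<theta> \<alpha> (u s - u t)) \<longlongrightarrow> 0) (at t within {0..T})"
  proof (rule tendstoI)
    fix e :: real assume e: "e > 0"
    have "e / 4 > 0" using e by simp
    from tail[OF this] obtain N where "\<forall>t\<in>{0..T}. \<forall>n\<ge>N. \<forall>x. cmod (tp (blk n (u t)) x) \<le> e / 4 * wt \<alpha> n" ..
    then have N: "\<And>s n x. s \<in> {0..T} \<Longrightarrow> n \<ge> N \<Longrightarrow> cmod (tp (blk n (u s)) x) \<le> e / 4 * wt \<alpha> n" by blast
    have "\<forall>\<^sub>F s in at t within {0..T}. K * (\<Sum>k\<in>{k. \<Theta> n k \<noteq> 0}. cmod (u s k - u t k)) < e / 2 * wt \<alpha> n" for n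
    proof -
      have "((\<lambda>s. K * (\<Sum>k\<in>{k. \<Theta> n k \<noteq> 0}. cmod (u s k - u t k))) \<longlongrightarrow> K * (\<Sum>k\<in>{k. \<Theta> n k \<noteq> 0}. cmod (u t k - u t k))) (at t within {0..T})"
        using c t by (intro tendsto_intros) (auto simp: continuous_on_def)
      then show ?thesis by (rule order_tendstoD(2)) (use e in simp)
    qed
    then have "\<forall>\<^sub>F s in at t within {0..T}. \<forall>n\<in>{..<N}. K * (\<Sum>k\<in>{k. \<Theta> n k \<noteq> 0}. cmod (u s k - u t k)) < e / 2 * wt \<alpha> n"
      by (intro eventually_ball_finite) auto
    moreover have "\<forall>\<^sub>F s in at t within {0..T}. s \<in> {0..T}" by (simp add: eventually_at_filter)
    ultimately show "\<forall>\<^sub>F s in at t within {0..T}. dist (hnorm \<theta> \<alpha> (u s - u t)) 0 < e"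
    proof eventually_elim
      case (elim s)
      have "besov \<alpha> (e / 2) (u s - u t)"
        unfolding besov_def
      proof (intro conjI allI)
        show "herm (u s - u t)" using h elim t herm_arith(2) by blast
        fix n x
        show "cmod (tp (blk n (u s - u t)) x) \<le> e / 2 * wt \<alpha> n"
        proof (cases "n < N")
          case True
          have "cmod (tp (blk n (u s - u t)) x) \<le> K * (\<Sum>k\<in>{k. \<Theta> n k \<noteq> 0}. cmod ((u s - u t) k))"
            by (rule tp_blk_le_sum)
          moreover have "K * (\<Sum>k\<in>{k. \<Theta> n k \<noteq> 0}. cmod (u s k - u t k)) < e / 2 * wt \<alpha> n"
            using elim(1) True by blast
          ultimately show ?thesis by simp
        next
          case False
          then show ?thesis using N[OF elim(2), of n x] N[OF t, of n x]
            norm_triangle_ineq4[of "tp (blk n (u s)) x" "tp (blk n (u t)) x"] by (simp add: tp_blk_arith)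
        qed
      qed
      then show ?case using hnorm_le[of \<alpha> "e / 2" "u s - u t"] hnorm_ge0[OF besov_finite_norm] e by (auto simp: dist_real_def)
    qed
  qed
qed

text \<open>Three epsilons; the closure of the smooth functions is closed under uniform limits as well.\<close>
lemma CT_limit:
  assumes U: "\<And>n. U n \<in> CT \<theta> \<alpha> T" and h: "\<And>t. t \<in> {0..T} \<Longrightarrow> herm (u t)"
    and e: "\<And>n t. t \<in> {0..T} \<Longrightarrow> besov \<alpha> (e n) (U n t - u t)" and lim: "e \<longlonglongrightarrow> 0"
  shows "u \<in> CT \<theta> \<alpha> T"
  unfolding CT_def
proof (intro CollectI conjI ballI)
  have f: "finite_norm \<alpha> (u t)" if "t \<in> {0..T}" for t
    by (rule finite_norm_from_diff[OF _ CT_fin[OF U[of 0] that]]) (use besov_swap[OF e[OF that, of 0]] in \<open>auto simp: finite_norm_def\<close>)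
  fix t assume t: "t \<in> {0..T}"
  have "little \<alpha> (u t)" unfolding little_def
  proof (intro allI impI)
    fix \<delta> :: real assume d: "\<delta> > 0"
    then have "\<forall>\<^sub>F n in sequentially. e n < \<delta> / 2" by (intro order_tendstoD(2)[OF lim]) simp
    then obtain n where n: "e n < \<delta> / 2" by (auto simp: eventually_sequentially)
    have b: "besov \<alpha> (\<delta> / 2) (U n t - u t)" using besov_mono[OF e[OF t, of n]] n by simp
    obtain N where N: "\<And>m x. m \<ge> N \<Longrightarrow> cmod (tp (blk m (U n t)) x) \<le> \<delta> / 2 * wt \<alpha> m"
      using CT_Hoelder[OF U t, of n] d unfolding Hoelder_iff little_def by (meson half_gt_zero)
    have "cmod (tp (blk m (u t)) x) \<le> \<delta> * wt \<alpha> m" if "m \<ge> N" for m x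
      using N[OF that, of x] besovD(1)[OF b, of m x] norm_triangle_sub[of "tp (blk m (u t)) x" "tp (blk m (U n t)) x"]
      by (simp add: tp_blk_arith norm_minus_commute)
    then show "\<exists>N. \<forall>m\<ge>N. \<forall>x. cmod (tp (blk m (u t)) x) \<le> \<delta> * wt \<alpha> m" by blast
  qed
  then show "u t \<in> Hoelder \<theta> \<alpha>" using h t by (simp add: Hoelder_iff)
  show "((\<lambda>s. hnorm \<theta> \<alpha> (u s - u t)) \<longlongrightarrow> 0) (at t within {0..T})"
  proof (rule tendstoI)
    fix d :: real assume d: "d > 0"
    then have "\<forall>\<^sub>F n in sequentially. e n < d / 4" by (intro order_tendstoD(2)[OF lim]) simp
    then obtain n where n: "e n < d / 4" by (auto simp: eventually_sequentially)
    have "\<forall>\<^sub>F s in at t within {0..T}. hnorm \<theta> \<alpha> (U n s - U n t) < d / 4"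
      by (rule order_tendstoD(2)[OF CT_tendsto[OF U t]]) (use d in simp)
    moreover have "\<forall>\<^sub>F s in at t within {0..T}. s \<in> {0..T}" by (simp add: eventually_at_filter)
    ultimately show "\<forall>\<^sub>F s in at t within {0..T}. dist (hnorm \<theta> \<alpha> (u s - u t)) 0 < d"
    proof eventually_elim
      case (elim s)
      have "besov \<alpha> (d / 4) (U n s - U n t)"
        using besov_mono[OF finite_norm_besov[OF finite_norm_diff[OF CT_fin[OF U elim(2)] CT_fin[OF U t]]]] elim(1) by (meson less_imp_le)
      from besov_trans[OF besov_trans[OF besov_swap[OF e[OF elim(2)]] this] e[OF t]]
      have b: "besov \<alpha> (e n + d / 4 + e n) (u s - u t)" .
      then show ?case using hnorm_le[OF b] hnorm_ge0[OF besov_finite_norm[OF b]] n d by (simp add: dist_real_def)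
    qed
  qed
qed

end

section \<open>Point values and products\<close>

context lp_frame
begin

text \<open>The constant in the geometric series of the weights of positive or of negative regularity.\<close>
definition geom_sum :: "real \<Rightarrow> real" where "geom_sum \<alpha> = 1 / \<bar>1 - 2 powr (- \<alpha>)\<bar>"

lemma wt_Suc: "wt \<alpha> (Suc n) = 2 powr (- \<alpha>) * wt \<alpha> n"
  by (simp add: wt_def powr_add[symmetric] algebra_simps)

lemma wt_add: "wt \<alpha> (n + m) = 2 powr (- \<alpha> * real m) * wt \<alpha> n"
  by (simp add: wt_def powr_add[symmetric] algebra_simps)

lemma wt_mult: "wt \<alpha> n * wt \<beta> n = wt (\<alpha> + \<beta>) n"
  by (simp add: wt_def powr_add[symmetric] algebra_simps)

lemma wt_antimono: "0 \<le> \<alpha> \<Longrightarrow> m \<le> n \<Longrightarrow> wt \<alpha> n \<le> wt \<alpha> m"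
  by (auto simp: wt_def intro!: mult_left_mono)

lemma geom_sum_nonneg: "geom_sum \<alpha> \<ge> 0" by (simp add: geom_sum_def)

lemma sum_wt_tail: assumes "\<alpha> > 0" "n \<le> m" shows "(\<Sum>i\<in>{n..<m}. wt \<alpha> i) \<le> geom_sum \<alpha> * wt \<alpha> n"
proof -
  let ?q = "2 powr (- \<alpha>)"
  have q: "?q < 1" using powr_less_mono[of "- \<alpha>" 0 2] assms(1) by simp
  have "(1 - ?q) * (\<Sum>i\<in>{n..<m}. wt \<alpha> i) = wt \<alpha> n - wt \<alpha> m"
    using assms(2)
  proof (induction m rule: dec_induct)
    case (step m)
    have "(1 - ?q) * (\<Sum>i\<in>{n..<Suc m}. wt \<alpha> i) = (1 - ?q) * (\<Sum>i\<in>{n..<m}. wt \<alpha> i) + (1 - ?q) * wt \<alpha> m"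
      using step by (simp add: distrib_left)
    also have "\<dots> = wt \<alpha> n - wt \<alpha> (Suc m)" unfolding step.IH wt_Suc by (simp add: algebra_simps)
    finally show ?case .
  qed simp
  also have "\<dots> \<le> wt \<alpha> n" using wt_nonneg[of \<alpha> m] by linarith
  finally show ?thesis using q by (simp add: geom_sum_def field_simps)
qed

lemma sum_wt_head: assumes "\<alpha> < 0" shows "(\<Sum>i<n. wt \<alpha> i) \<le> geom_sum \<alpha> * wt \<alpha> n"
proof -
  let ?q = "2 powr (- \<alpha>)"
  have q: "?q > 1" using powr_less_mono[of 0 "- \<alpha>" 2] assms(1) by simp
  have "(?q - 1) * (\<Sum>i<n. wt \<alpha> i) = wt \<alpha> n - wt \<alpha> 0"
  proof (induction n)
    case (Suc n)
    have "(?q - 1) * (\<Sum>i<Suc n. wt \<alpha> i) = (?q - 1) * (\<Sum>i<n. wt \<alpha> i) + (?q - 1) * wt \<alpha> n"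
      by (simp add: distrib_left)
    also have "\<dots> = wt \<alpha> (Suc n) - wt \<alpha> 0" unfolding Suc.IH wt_Suc by (simp add: algebra_simps)
    finally show ?case .
  qed simp
  also have "\<dots> \<le> wt \<alpha> n" using wt_nonneg[of \<alpha> 0] by linarith
  finally show ?thesis using q by (simp add: geom_sum_def field_simps)
qed

text \<open>For negative regularity the last block dominates the partial sum.\<close>
lemma norm_low_neg: assumes "besov \<alpha> C u" "\<alpha> < 0" shows "cmod (tp (low n u) x) \<le> geom_sum \<alpha> * C * wt \<alpha> n"
proof -
  have "cmod (tp (low n u) x) \<le> (\<Sum>i<n. C * wt \<alpha> i)"
    unfolding low_eq_sum by (rule order_trans[OF norm_sum]) (intro sum_mono besovD(1)[OF assms(1)])
  also have "\<dots> \<le> C * (geom_sum \<alpha> * wt \<alpha> n)"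
    using mult_left_mono[OF sum_wt_head[OF assms(2)] besov_nonneg[OF assms(1)]] by (simp add: sum_distrib_left)
  finally show ?thesis by (simp add: mult_ac)
qed

text \<open>For positive regularity the blocks are summable, and the first one dominates the tail.\<close>
lemma norm_low_diff: assumes "besov \<alpha> C u" "\<alpha> > 0" "n \<le> m" shows "cmod (tp (low m u) x - tp (low n u) x) \<le> geom_sum \<alpha> * C * wt \<alpha> n"
proof -
  have "tp (low m u) x - tp (low n u) x = (\<Sum>i\<in>{n..<m}. tp (blk i u) x)"
    unfolding low_eq_sum using sum_diff_nat_ivl[of 0 n m "\<lambda>i. tp (blk i u) x"] assms(3) by (simp add: atLeast0LessThan)
  then have "cmod (tp (low m u) x - tp (low n u) x) \<le> (\<Sum>i\<in>{n..<m}. C * wt \<alpha> i)"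
    by (simp add: order_trans[OF norm_sum sum_mono] besovD(1)[OF assms(1)])
  also have "\<dots> \<le> C * (geom_sum \<alpha> * wt \<alpha> n)"
    using mult_left_mono[OF sum_wt_tail[OF assms(2,3)] besov_nonneg[OF assms(1)]] by (simp add: sum_distrib_left)
  finally show ?thesis by (simp add: mult_ac)
qed

lemma low_0: "low 0 u = (\<lambda>k. 0)" and tp_zero: "tp (\<lambda>k. 0) x = 0"
  by (auto simp: low_def tp_def)

lemma norm_low_pos: assumes "besov \<alpha> C u" "\<alpha> > 0" shows "cmod (tp (low m u) x) \<le> geom_sum \<alpha> * C * wt \<alpha> 0"
  using norm_low_diff[OF assms, of 0 m x] by (simp add: low_0 tp_zero)

lemma wt_lim: assumes "\<alpha> > 0" shows "(\<lambda>n. C * wt \<alpha> n) \<longlonglongrightarrow> 0"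
proof -
  have "(\<lambda>n. 2 powr (- \<alpha> * (real n - 1))) \<longlonglongrightarrow> 0" using assms by real_asymp
  then have "(\<lambda>n. C * wt \<alpha> n) \<longlonglongrightarrow> C * 0" unfolding wt_def by (intro tendsto_intros)
  then show ?thesis by simp
qed

lemma pval_lim: assumes "besov \<alpha> C u" "\<alpha> > 0" shows "(\<lambda>n. tp (low n u) x) \<longlonglongrightarrow> of_real (pval \<theta> u x)"
proof -
  have "Cauchy (\<lambda>n. tp (low n u) x)"
  proof (rule metric_CauchyI)
    fix e :: real assume e: "e > 0"
    have "\<forall>\<^sub>F n in sequentially. geom_sum \<alpha> * C * wt \<alpha> n < e / 2"
      by (rule order_tendstoD(2)[OF wt_lim[OF assms(2)]]) (use e in simp)
    then obtain N where N: "geom_sum \<alpha> * C * wt \<alpha> N < e / 2" by (auto simp: eventually_sequentially)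
    have "dist (tp (low m u) x) (tp (low n u) x) < e" if "m \<ge> N" "n \<ge> N" for m n
      using norm_low_diff[OF assms that(1), of x] norm_low_diff[OF assms that(2), of x] N
        dist_triangle_half_l[of "tp (low m u) x" "tp (low N u) x" e "tp (low n u) x"] by (simp add: dist_norm)
    then show "\<exists>M. \<forall>m\<ge>M. \<forall>n\<ge>M. dist (tp (low m u) x) (tp (low n u) x) < e" by blast
  qed
  then obtain L where L: "(\<lambda>n. tp (low n u) x) \<longlonglongrightarrow> L" using Cauchy_convergent_iff convergent_def by blast
  then have "(\<lambda>n. Re (tp (low (n + 2) u) x)) \<longlonglongrightarrow> Re L" by (intro tendsto_intros LIMSEQ_ignore_initial_segment)
  then have p: "pval \<theta> u x = Re L" unfolding pval_def lowfreq_eq by (rule limI)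
  have "(\<lambda>n. of_real (Re (tp (low n u) x))) \<longlonglongrightarrow> complex_of_real (Re L)" by (intro tendsto_intros L)
  then show ?thesis unfolding p by (simp only: tp_herm_Re[OF herm_low[OF besovD(2)[OF assms(1)]]])
qed

lemma pval_error: assumes "besov \<alpha> C u" "\<alpha> > 0" shows "cmod (of_real (pval \<theta> u x) - tp (low n u) x) \<le> geom_sum \<alpha> * C * wt \<alpha> n"
proof -
  have "(\<lambda>m. tp (low m u) x - tp (low n u) x) \<longlonglongrightarrow> of_real (pval \<theta> u x) - tp (low n u) x"
    by (intro tendsto_intros pval_lim[OF assms])
  moreover have "\<forall>\<^sub>F m in sequentially. cmod (tp (low m u) x - tp (low n u) x) \<le> geom_sum \<alpha> * C * wt \<alpha> n"
    unfolding eventually_sequentially using norm_low_diff[OF assms] by blast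
  ultimately show ?thesis by (rule Lim_norm_ubound[OF sequentially_bot])
qed

lemma pval_bound: assumes "besov \<alpha> C u" "\<alpha> > 0" shows "\<bar>pval \<theta> u x\<bar> \<le> geom_sum \<alpha> * C * wt \<alpha> 0"
  using pval_error[OF assms, of x 0] by (simp add: low_0 tp_zero)

lemma pval_cont: assumes "besov \<alpha> C u" "\<alpha> > 0" shows "continuous_on UNIV (pval \<theta> u)"
proof -
  have "continuous_on UNIV (\<lambda>x. complex_of_real (pval \<theta> u x))"
  proof (rule uniform_limit_theorem[where F = sequentially and f = "\<lambda>n. tp (low n u)"])
    show "uniform_limit UNIV (\<lambda>n. tp (low n u)) (\<lambda>x. complex_of_real (pval \<theta> u x)) sequentially"
    proof (rule uniform_limitI)
      fix e :: real assume e: "e > 0"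
      have "\<forall>\<^sub>F n in sequentially. geom_sum \<alpha> * C * wt \<alpha> n < e"
        by (rule order_tendstoD(2)[OF wt_lim[OF assms(2)]]) (use e in simp)
      then show "\<forall>\<^sub>F n in sequentially. \<forall>x\<in>UNIV. dist (tp (low n u) x) (complex_of_real (pval \<theta> u x)) < e"
      proof eventually_elim
        case (elim n)
        show ?case
        proof
          fix x
          show "dist (tp (low n u) x) (complex_of_real (pval \<theta> u x)) < e"
            using pval_error[OF assms, of x n] elim unfolding dist_norm norm_minus_commute[of "tp (low n u) x"] by linarith
        qed
      qed
    qed
  qed (auto intro!: always_eventually continuous_on_tp)
  from continuous_on_Re[OF this] show ?thesis by simp
qed

lemma pval_per: assumes "besov \<alpha> C u" "\<alpha> > 0" shows "per (pval \<theta> u)"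
  unfolding per_def
proof (intro allI)
  fix x m
  have "(\<lambda>n. tp (low n u) x) \<longlonglongrightarrow> of_real (pval \<theta> u (x + freq m))"
    using pval_lim[OF assms, of "x + freq m"] by (simp add: tp_periodic)
  then have "complex_of_real (pval \<theta> u (x + freq m)) = of_real (pval \<theta> u x)"
    using pval_lim[OF assms, of x] LIMSEQ_unique by blast
  then show "pval \<theta> u (x + freq m) = pval \<theta> u x" by simp
qed

lemma low_coeff_lim: "(\<lambda>n. low n u k) \<longlonglongrightarrow> u k"
proof (rule tendsto_eventually, rule eventually_sequentiallyI)
  fix n assume n: "block_index k \<le> n"
  have "norm (freq k) < r * 2 ^ block_index k" by (rule block_index)
  also have "\<dots> \<le> r * 2 ^ n" using r_pos n by (intro mult_left_mono power_increasing) auto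
  finally show "low n u k = u k" using block_index(1)[of k] n by (intro low_eventually) auto
qed

lemma fcoef_pval: assumes "besov \<alpha> C u" "\<alpha> > 0" shows "fcoef (pval \<theta> u) = u"
proof
  fix k
  let ?f = "\<lambda>x. complex_of_real (pval \<theta> u x)"
  have c: "continuous_on UNIV ?f" by (intro continuous_intros pval_cont[OF assms])
  have "cmod (cfc ?f k - low n u k) \<le> geom_sum \<alpha> * C * wt \<alpha> n" for n
  proof -
    have "cmod (cfc (\<lambda>x. ?f x - tp (low n u) x) k) \<le> geom_sum \<alpha> * C * wt \<alpha> n"
      by (rule norm_cfc_le) (auto intro!: continuous_intros c continuous_on_tp pval_error[OF assms])
    then show ?thesis by (simp add: cfc_diff[OF c continuous_on_tp] cfc_tp)
  qed
  then have "(\<lambda>n. cfc ?f k - low n u k) \<longlonglongrightarrow> 0"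
    by (intro Lim_null_comparison[OF _ wt_lim[OF assms(2), of "geom_sum \<alpha> * C"]] always_eventually allI)
  moreover have "(\<lambda>n. cfc ?f k - low n u k) \<longlonglongrightarrow> cfc ?f k - u k" by (intro tendsto_intros low_coeff_lim)
  ultimately have "cfc ?f k - u k = 0" using LIMSEQ_unique by blast
  then show "fcoef (pval \<theta> u) k = u k" by (simp add: fcoef_eq_cfc)
qed

lemma pval_diff:
  assumes "besov \<alpha> C u" "besov \<alpha> D v" "\<alpha> > 0" shows "pval \<theta> (u - v) x = pval \<theta> u x - pval \<theta> v x"
proof -
  have "(\<lambda>n. tp (low n u) x - tp (low n v) x) \<longlonglongrightarrow> of_real (pval \<theta> u x) - of_real (pval \<theta> v x)"
    by (intro tendsto_intros pval_lim[OF assms(1,3)] pval_lim[OF assms(2,3)])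
  moreover have "tp (low n (u - v)) x = tp (low n u) x - tp (low n v) x" for n
    unfolding low_diff by (simp add: tp_diff)
  ultimately have "complex_of_real (pval \<theta> (u - v) x) = of_real (pval \<theta> u x) - of_real (pval \<theta> v x)"
    using LIMSEQ_unique[OF pval_lim[OF besov_diff[OF assms(1,2)] assms(3), of x]] by simp
  then have "complex_of_real (pval \<theta> (u - v) x) = of_real (pval \<theta> u x - pval \<theta> v x)" by simp
  then show ?thesis by (simp only: of_real_eq_iff)
qed

lemma norm_blk_cont:
  assumes "continuous_on UNIV f" "\<And>x. cmod (f x) \<le> A" shows "cmod (tp (blk n (cfc f)) x) \<le> K * A"
  unfolding blk_def by (rule multiplier_cont[OF multiplier_block finsupp_symbol(1)]) (use assms in auto)

lemma besov_cont:
  assumes "continuous_on UNIV f" "\<And>x. \<bar>f x\<bar> \<le> A" shows "besov 0 (K * A) (fcoef f)"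
  unfolding besov_def
proof (intro conjI allI herm_fcoef)
  fix n x
  show "cmod (tp (blk n (fcoef f)) x) \<le> K * A * wt 0 n"
    using norm_blk_cont[of "\<lambda>x. of_real (f x)" A n x] assms by (simp add: fcoef_eq_cfc wt_def continuous_intros)
qed

text \<open>The partial sums are eventually the identity on a trigonometric polynomial, and they are
  bounded uniformly in \<open>n\<close>; trigonometric polynomials are dense.\<close>
lemma low_cont_lim:
  assumes f: "continuous_on UNIV f" "per f" and e: "e > 0"
  shows "\<forall>\<^sub>F n in sequentially. \<forall>x. cmod (tp (low n (cfc f)) x - f x) \<le> e"
proof -
  define d where "d = e / (K + 1)"
  have d: "d > 0" using e K_ge_1 by (simp add: d_def)
  obtain c where c: "finsupp c" "\<And>x. cmod (tp c x - f x) \<le> d" using trig_dense[OF f d] by blast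
  have "\<forall>\<^sub>F n in sequentially. \<forall>k\<in>{k. c k \<noteq> 0}. low n c k = c k"
  proof (rule eventually_ball_finite[OF c(1)], rule ballI, rule eventually_sequentiallyI)
    fix k n assume n: "block_index k \<le> n"
    have "norm (freq k) < r * 2 ^ block_index k" by (rule block_index)
    also have "\<dots> \<le> r * 2 ^ n" using r_pos n by (intro mult_left_mono power_increasing) auto
    finally show "low n c k = c k" using block_index(1)[of k] n by (intro low_eventually) auto
  qed
  then show ?thesis
  proof eventually_elim
    case (elim n)
    have lc: "low n c = c"
    proof
      fix k show "low n c k = c k" using elim by (cases "c k = 0") (auto simp: low_def)
    qed
    have cf: "cfc (\<lambda>x. tp c x - f x) = c - cfc f"
      using cfc_diff[OF continuous_on_tp f(1), of c] by (auto simp: cfc_tp c fun_eq_iff)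
    show ?case
    proof
      fix x
      have "cmod (tp (low n (cfc (\<lambda>x. tp c x - f x))) x) \<le> K * d" unfolding low_def
        by (rule multiplier_cont[OF multiplier_partial finsupp_symbol(2)]) (use c in \<open>auto intro!: continuous_intros continuous_on_tp f\<close>)
      then have "cmod (tp c x - tp (low n (cfc f)) x) \<le> K * d"
        unfolding cf low_diff lc by (simp add: tp_diff c)
      then have "cmod (tp (low n (cfc f)) x - f x) \<le> K * d + d"
        using c(2)[of x] norm_triangle_ineq[of "tp (low n (cfc f)) x - tp c x" "tp c x - f x"]
        by (simp add: norm_minus_commute)
      also have "\<dots> = (K + 1) * d" by (simp add: distrib_right)
      also have "\<dots> = e" using K_ge_1 by (simp add: d_def)
      finally show "cmod (tp (low n (cfc f)) x - f x) \<le> e" .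
    qed
  qed
qed

lemma pval_fcoef: assumes "continuous_on UNIV f" "per f" shows "pval \<theta> (fcoef f) = f"
proof
  fix x
  have c: "continuous_on UNIV (\<lambda>x. complex_of_real (f x))" by (intro continuous_intros assms)
  have "(\<lambda>n. tp (low n (fcoef f)) x) \<longlonglongrightarrow> of_real (f x)"
  proof (rule tendstoI)
    fix e :: real assume e: "e > 0"
    then have "\<forall>\<^sub>F n in sequentially. \<forall>x. cmod (tp (low n (fcoef f)) x - of_real (f x)) \<le> e / 2"
      unfolding fcoef_eq_cfc using low_cont_lim[OF c per_comp(1)[OF assms(2)], of "e/2"] by simp
    then show "\<forall>\<^sub>F n in sequentially. dist (tp (low n (fcoef f)) x) (of_real (f x)) < e"
    proof eventually_elim
      case (elim n)
      have "cmod (tp (low n (fcoef f)) x - of_real (f x)) \<le> e / 2" using elim by blast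
      then show ?case using e by (simp add: dist_norm)
    qed
  qed
  then have "(\<lambda>n. Re (tp (low (n + 2) (fcoef f)) x)) \<longlonglongrightarrow> Re (of_real (f x))"
    by (intro tendsto_intros LIMSEQ_ignore_initial_segment)
  then show "pval \<theta> (fcoef f) x = f x" unfolding pval_def lowfreq_eq by (simp add: limI)
qed

text \<open>Frequencies add in a product.\<close>
lemma cfc_tp_mult_support:
  assumes "finsupp c" "finsupp d" "cfc (\<lambda>x. tp c x * tp d x) k \<noteq> 0"
  shows "\<exists>k1 k2. c k1 \<noteq> 0 \<and> d k2 \<noteq> 0 \<and> k = k1 + k2"
proof -
  have "(\<lambda>x. tp c x * tp d x) = (\<lambda>x. \<Sum>p\<in>{k. c k \<noteq> 0} \<times> {k. d k \<noteq> 0}. (c (fst p) * d (snd p)) * mode (fst p + snd p) x)"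
    by (simp add: tp_def sum_product sum.cartesian_product case_prod_beta mode_add mult_ac)
  then have "cfc (\<lambda>x. tp c x * tp d x) k = (\<Sum>p\<in>{k. c k \<noteq> 0} \<times> {k. d k \<noteq> 0}. (c (fst p) * d (snd p)) * cfc (mode (fst p + snd p)) k)"
    using assms by (simp only:) (subst cfc_sum, auto intro!: continuous_intros simp: cfc_scale)
  then have "\<exists>p\<in>{k. c k \<noteq> 0} \<times> {k. d k \<noteq> 0}. cfc (mode (fst p + snd p)) k \<noteq> 0"
    using assms(3) by (metis (no_types, lifting) mult_zero_right sum.not_neutral_contains_not_neutral)
  then show ?thesis by (auto simp: cfc_mode split: if_splits)
qed

text \<open>A gap after which frequencies of a low factor cannot compensate those of a high one.\<close>
definition freq_gap :: nat where "freq_gap = (SOME p. 1 \<le> p \<and> 2 * R < r * 2 ^ p)"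

lemma freq_gap: "1 \<le> freq_gap" "2 * R < r * 2 ^ freq_gap"
proof -
  obtain n where n: "2 * R / r < 2 ^ n" using real_arch_pow[of 2] by auto
  have "(2::real) ^ n \<le> 2 ^ Suc n" by simp
  then have "2 * R / r < 2 ^ Suc n" using n by linarith
  then have "1 \<le> Suc n \<and> 2 * R < r * 2 ^ Suc n" using r_pos by (simp add: field_simps)
  then have "\<exists>p. 1 \<le> p \<and> 2 * R < r * 2 ^ p" by blast
  then show "1 \<le> freq_gap" "2 * R < r * 2 ^ freq_gap" unfolding freq_gap_def by (metis (mono_tags, lifting) someI_ex)+
qed

lemma low_support: assumes "low n u k \<noteq> 0" shows "norm (freq k) \<le> R * 2 ^ n" "1 \<le> n"
proof -
  have "\<exists>i<n. \<Theta> i k \<noteq> 0"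
  proof (rule ccontr)
    assume "\<not> (\<exists>i<n. \<Theta> i k \<noteq> 0)"
    then have "(\<Sum>i<n. \<Theta> i k) = 0" by (intro sum.neutral) auto
    then show False using assms by (simp add: low_def del: of_real_sum)
  qed
  then obtain i where i: "i < n" "\<Theta> i k \<noteq> 0" by blast
  have "norm (freq k) \<le> R * 2 ^ i" by (rule upper[OF i(2)])
  also have "\<dots> \<le> R * 2 ^ n" using i R_pos by (intro mult_left_mono power_increasing) auto
  finally show "norm (freq k) \<le> R * 2 ^ n" .
  show "1 \<le> n" using i by simp
qed

text \<open>Two low factors have a product of low frequency.\<close>
lemma blk_low_low_zero: "blk l (cfc (\<lambda>x. tp (low (l - freq_gap) u) x * tp (low (l - freq_gap) v) x)) = (\<lambda>k. 0)"
proof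
  fix k
  show "blk l (cfc (\<lambda>x. tp (low (l - freq_gap) u) x * tp (low (l - freq_gap) v) x)) k = 0"
  proof (rule ccontr)
    assume "blk l (cfc (\<lambda>x. tp (low (l - freq_gap) u) x * tp (low (l - freq_gap) v) x)) k \<noteq> 0"
    then have th: "\<Theta> l k \<noteq> 0" and nz: "cfc (\<lambda>x. tp (low (l - freq_gap) u) x * tp (low (l - freq_gap) v) x) k \<noteq> 0"
      by (auto simp: blk_def)
    obtain k1 k2 where k: "low (l - freq_gap) u k1 \<noteq> 0" "low (l - freq_gap) v k2 \<noteq> 0" "k = k1 + k2"
      using cfc_tp_mult_support[OF finsupp_low finsupp_low nz] by blast
    have l: "1 \<le> l - freq_gap" using low_support(2)[OF k(1)] .
    have "norm (freq k) \<le> norm (freq k1) + norm (freq k2)" unfolding k(3) freq_simps by (rule norm_triangle_ineq)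
    also have "\<dots> \<le> 2 * R * 2 ^ (l - freq_gap)" using low_support(1)[OF k(1)] low_support(1)[OF k(2)] by simp
    also have "\<dots> < r * 2 ^ freq_gap * 2 ^ (l - freq_gap)" using freq_gap(2) by simp
    also have "\<dots> = r * 2 ^ l" using l by (simp add: power_add[symmetric])
    finally have "norm (freq k) < r * 2 ^ l" .
    moreover have "1 \<le> l" using l by linarith
    ultimately show False using lower[OF _ th] by simp
  qed
qed

text \<open>The product of a high and a low factor has high frequency.\<close>
lemma blk_high_low_zero:
  assumes "l + freq_gap \<le> n" shows "blk l (cfc (\<lambda>x. tp (blk n u) x * tp (low (n - freq_gap) v) x)) = (\<lambda>k. 0)"
proof
  fix k
  show "blk l (cfc (\<lambda>x. tp (blk n u) x * tp (low (n - freq_gap) v) x)) k = 0"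
  proof (rule ccontr)
    assume "blk l (cfc (\<lambda>x. tp (blk n u) x * tp (low (n - freq_gap) v) x)) k \<noteq> 0"
    then have th: "\<Theta> l k \<noteq> 0" and nz: "cfc (\<lambda>x. tp (blk n u) x * tp (low (n - freq_gap) v) x) k \<noteq> 0"
      by (auto simp: blk_def)
    obtain k1 k2 where k: "blk n u k1 \<noteq> 0" "low (n - freq_gap) v k2 \<noteq> 0" "k = k1 + k2"
      using cfc_tp_mult_support[OF finsupp_blk finsupp_low nz] by blast
    have n: "1 \<le> n" using assms freq_gap(1) by simp
    have "\<Theta> n k1 \<noteq> 0" using k(1) by (auto simp: blk_def)
    then have "r * 2 ^ n \<le> norm (freq k1)" using lower n by blast
    also have "\<dots> \<le> norm (freq k) + norm (freq k2)"
      using norm_triangle_ineq4[of "freq k" "freq k2"] by (simp add: k(3))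
    also have "\<dots> \<le> R * 2 ^ l + R * 2 ^ (n - freq_gap)" by (intro add_mono upper[OF th] low_support(1)[OF k(2)])
    also have "R * 2 ^ l \<le> R * 2 ^ (n - freq_gap)" using assms R_pos by (intro mult_left_mono power_increasing) auto
    finally have "r * 2 ^ n \<le> 2 * R * 2 ^ (n - freq_gap)" by simp
    also have "\<dots> < r * 2 ^ freq_gap * 2 ^ (n - freq_gap)" using freq_gap(2) by simp
    also have "\<dots> = r * 2 ^ n" using assms by (simp add: power_add[symmetric])
    finally show False by simp
  qed
qed

text \<open>Only the part of the product that contains a factor beyond frequency \<open>2\<^sup>n\<close>, up to the gap, is
  seen by the \<open>n\<close>-th block, and there one factor is small.\<close>
lemma besov_mult_pos:
  assumes u: "besov \<alpha> A u" and v: "besov \<alpha> B v" and a: "\<alpha> > 0"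
  shows "besov \<alpha> (K * (2 * (geom_sum \<alpha>)\<^sup>2 * wt \<alpha> 0 * 2 powr (\<alpha> * freq_gap)) * A * B) (fcoef (\<lambda>x. pval \<theta> u x * pval \<theta> v x))"
  unfolding besov_def
proof (intro conjI allI herm_fcoef)
  fix n x
  let ?f = "\<lambda>x. complex_of_real (pval \<theta> u x)" and ?g = "\<lambda>x. complex_of_real (pval \<theta> v x)"
  let ?S = "tp (low (n - freq_gap) u)" and ?T = "tp (low (n - freq_gap) v)"
  have cf: "continuous_on UNIV ?f" and cg: "continuous_on UNIV ?g"
    by (intro continuous_intros pval_cont[OF u a] pval_cont[OF v a])+
  have "cmod (?f x * ?g x - ?S x * ?T x) \<le> 2 * (geom_sum \<alpha>)\<^sup>2 * wt \<alpha> 0 * A * B * wt \<alpha> (n - freq_gap)" for x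
  proof -
    have "?f x * ?g x - ?S x * ?T x = (?f x - ?S x) * ?g x + ?S x * (?g x - ?T x)" by (simp add: algebra_simps)
    then have "cmod (?f x * ?g x - ?S x * ?T x) \<le> cmod (?f x - ?S x) * cmod (?g x) + cmod (?S x) * cmod (?g x - ?T x)"
      by (metis norm_mult norm_triangle_ineq)
    also have "\<dots> \<le> (geom_sum \<alpha> * A * wt \<alpha> (n - freq_gap)) * (geom_sum \<alpha> * B * wt \<alpha> 0) + (geom_sum \<alpha> * A * wt \<alpha> 0) * (geom_sum \<alpha> * B * wt \<alpha> (n - freq_gap))"
      using pval_error[OF u a, of x "n - freq_gap"] pval_error[OF v a, of x "n - freq_gap"] pval_bound[OF v a, of x] norm_low_pos[OF u a, of "n - freq_gap" x]
        geom_sum_nonneg[of \<alpha>] besov_nonneg[OF u] besov_nonneg[OF v]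
      by (intro add_mono mult_mono) (auto intro!: mult_nonneg_nonneg)
    finally show ?thesis by (simp add: power2_eq_square mult_ac)
  qed
  then have b: "cmod (tp (blk n (cfc (\<lambda>x. ?f x * ?g x - ?S x * ?T x))) x) \<le> K * (2 * (geom_sum \<alpha>)\<^sup>2 * wt \<alpha> 0 * A * B * wt \<alpha> (n - freq_gap))"
    by (intro norm_blk_cont continuous_intros cf cg continuous_on_tp)
  have cc: "cfc (\<lambda>x. ?f x * ?g x - ?S x * ?T x) = cfc (\<lambda>x. ?f x * ?g x) - cfc (\<lambda>x. ?S x * ?T x)"
    by (auto intro!: cfc_diff continuous_intros cf cg continuous_on_tp simp: fun_eq_iff)
  have w: "wt \<alpha> (n - freq_gap) \<le> 2 powr (\<alpha> * freq_gap) * wt \<alpha> n"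
  proof -
    have "real n \<le> real (n - freq_gap) + real freq_gap" by linarith
    then have "\<alpha> * real n \<le> \<alpha> * (real (n - freq_gap) + real freq_gap)" using a by (intro mult_left_mono) auto
    then have "- \<alpha> * (real (n - freq_gap) - 1) \<le> \<alpha> * real freq_gap + - \<alpha> * (real n - 1)" by (simp add: algebra_simps)
    then show ?thesis unfolding wt_def powr_add[symmetric] by simp
  qed
  have "cmod (tp (blk n (cfc (\<lambda>x. ?f x * ?g x))) x) \<le> K * (2 * (geom_sum \<alpha>)\<^sup>2 * wt \<alpha> 0 * A * B * wt \<alpha> (n - freq_gap))"
    using b unfolding cc blk_diff blk_low_low_zero by simp
  also have "\<dots> \<le> K * (2 * (geom_sum \<alpha>)\<^sup>2 * wt \<alpha> 0 * A * B * (2 powr (\<alpha> * freq_gap) * wt \<alpha> n))"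
    using K_ge_1 geom_sum_nonneg[of \<alpha>] besov_nonneg[OF u] besov_nonneg[OF v] by (intro mult_left_mono w mult_nonneg_nonneg) auto
  finally show "cmod (tp (blk n (fcoef (\<lambda>x. pval \<theta> u x * pval \<theta> v x))) x) \<le> K * (2 * (geom_sum \<alpha>)\<^sup>2 * wt \<alpha> 0 * 2 powr (\<alpha> * freq_gap)) * A * B * wt \<alpha> n"
    by (simp add: fcoef_eq_cfc mult_ac)
qed

text \<open>The product of the truncations, whose limit defines \<open>dprod\<close>; the truncations there are shifted by two
  indices.\<close>
definition tprod :: "nat \<Rightarrow> coeffs \<Rightarrow> coeffs \<Rightarrow> coeffs" where
  "tprod n u v = cfc (\<lambda>x. tp (low n u) x * tp (low n v) x)"

lemma dprod_eq: assumes "herm u" "herm v" shows "dprod \<theta> u v k = lim (\<lambda>n. tprod (n + 2) u v k)"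
proof -
  have "fcoef (\<lambda>x. lowfreq \<theta> n u x * lowfreq \<theta> n v x) = tprod (n + 2) u v" for n
    unfolding fcoef_eq_cfc lowfreq_eq of_real_mult tprod_def
    by (simp only: tp_herm_Re[OF herm_low[OF assms(1)]] tp_herm_Re[OF herm_low[OF assms(2)]])
  then show ?thesis by (simp add: dprod_def)
qed

lemma herm_tprod: assumes "herm u" "herm v" shows "herm (tprod n u v)"
  unfolding tprod_def
proof (rule cfc_herm)
  fix x
  have "tp (low n u) x * tp (low n v) x = of_real (Re (tp (low n u) x) * Re (tp (low n v) x))"
    unfolding of_real_mult by (simp only: tp_herm_Re[OF herm_low[OF assms(1)]] tp_herm_Re[OF herm_low[OF assms(2)]])
  then show "Im (tp (low n u) x * tp (low n v) x) = 0" by (simp only: Im_complex_of_real)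
qed

lemma tp_low_Suc: "tp (low (Suc n) u) x = tp (low n u) x + tp (blk n u) x"
  by (simp add: low_eq_sum)

lemma tp_blk_cfc_add:
  assumes "continuous_on UNIV f" "continuous_on UNIV g"
  shows "tp (blk l (cfc (\<lambda>x. f x + g x))) x = tp (blk l (cfc f)) x + tp (blk l (cfc g)) x"
proof -
  have "cfc (\<lambda>x. f x + g x) = (\<lambda>k. cfc f k + cfc g k)" by (rule ext) (rule cfc_add[OF assms])
  then show ?thesis by (simp add: tp_blk_arith)
qed

definition tail_const :: "real \<Rightarrow> real \<Rightarrow> real" where
  "tail_const \<alpha> \<beta> = K * (geom_sum \<beta> * 2 powr (\<beta> * freq_gap) + geom_sum \<alpha> * 2 powr (- \<alpha>))"

text \<open>When \<open>n\<close> grows by one, the product changes by \<open>\<Delta>\<^sub>n u\<close> times a truncation of \<open>v\<close>, and by \<open>\<Delta>\<^sub>n v\<close> times a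
  truncation of \<open>u\<close>. Of the first, a low block sees only the frequencies of \<open>v\<close> comparable to \<open>2\<^sup>n\<close>, so
  both changes are of size \<open>2\<^sup>-\<^sup>(\<^sup>\<alpha>\<^sup>+\<^sup>\<beta>\<^sup>)\<^sup>n\<close>.\<close>
lemma tprod_step:
  assumes u: "besov \<alpha> A u" and v: "besov \<beta> B v" and ab: "\<alpha> < 0" "0 < \<beta>" and n: "l + freq_gap \<le> n"
  shows "cmod (tp (blk l (tprod (Suc n) u v)) x - tp (blk l (tprod n u v)) x) \<le> tail_const \<alpha> \<beta> * A * B * wt (\<alpha> + \<beta>) n"
proof -
  let ?f1 = "\<lambda>x. tp (blk n u) x * tp (low (n - freq_gap) v) x"
  let ?f2 = "\<lambda>x. tp (blk n u) x * (tp (low n v) x - tp (low (n - freq_gap) v) x)"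
  let ?f3 = "\<lambda>x. tp (low (Suc n) u) x * tp (blk n v) x"
  let ?f0 = "\<lambda>x. tp (low n u) x * tp (low n v) x"
  have A: "A \<ge> 0" "B \<ge> 0" using besov_nonneg u v by auto
  have e: "(\<lambda>x. tp (low (Suc n) u) x * tp (low (Suc n) v) x) = (\<lambda>x. ?f0 x + (?f1 x + (?f2 x + ?f3 x)))"
    by (rule ext) (simp add: tp_low_Suc algebra_simps)
  have "tp (blk l (tprod (Suc n) u v)) x - tp (blk l (tprod n u v)) x = tp (blk l (cfc ?f1)) x + (tp (blk l (cfc ?f2)) x + tp (blk l (cfc ?f3)) x)"
    unfolding tprod_def e
    by (subst tp_blk_cfc_add, (intro continuous_intros continuous_on_tp)+)
      (subst tp_blk_cfc_add, (intro continuous_intros continuous_on_tp)+,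
       subst tp_blk_cfc_add, (intro continuous_intros continuous_on_tp)+, simp)
  also have "\<dots> = tp (blk l (cfc ?f2)) x + tp (blk l (cfc ?f3)) x" by (simp add: blk_high_low_zero[OF n] tp_zero)
  finally have eq: "tp (blk l (tprod (Suc n) u v)) x - tp (blk l (tprod n u v)) x = tp (blk l (cfc ?f2)) x + tp (blk l (cfc ?f3)) x" .
  have ws: "wt \<beta> (n - freq_gap) = 2 powr (\<beta> * freq_gap) * wt \<beta> n"
  proof -
    have "wt \<beta> n = 2 powr (- \<beta> * real freq_gap) * wt \<beta> (n - freq_gap)" using wt_add[of \<beta> "n - freq_gap" freq_gap] n by simp
    then show ?thesis by (simp add: mult.assoc[symmetric] powr_add[symmetric])
  qed
  have b2: "cmod (tp (blk l (cfc ?f2)) x) \<le> K * ((A * wt \<alpha> n) * (geom_sum \<beta> * B * wt \<beta> (n - freq_gap)))"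
  proof (rule norm_blk_cont)
    fix x show "cmod (?f2 x) \<le> (A * wt \<alpha> n) * (geom_sum \<beta> * B * wt \<beta> (n - freq_gap))"
      unfolding norm_mult using besovD(1)[OF u] norm_low_diff[OF v ab(2), of "n - freq_gap" n] A by (intro mult_mono) auto
  qed (intro continuous_intros continuous_on_tp)
  have b3: "cmod (tp (blk l (cfc ?f3)) x) \<le> K * ((geom_sum \<alpha> * A * wt \<alpha> (Suc n)) * (B * wt \<beta> n))"
  proof (rule norm_blk_cont)
    fix x show "cmod (?f3 x) \<le> (geom_sum \<alpha> * A * wt \<alpha> (Suc n)) * (B * wt \<beta> n)"
      unfolding norm_mult using norm_low_neg[OF u ab(1)] besovD(1)[OF v] A geom_sum_nonneg by (intro mult_mono) auto
  qed (intro continuous_intros continuous_on_tp)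
  have "cmod (tp (blk l (cfc ?f2)) x + tp (blk l (cfc ?f3)) x) \<le> K * ((A * wt \<alpha> n) * (geom_sum \<beta> * B * wt \<beta> (n - freq_gap))) + K * ((geom_sum \<alpha> * A * wt \<alpha> (Suc n)) * (B * wt \<beta> n))"
    by (rule order_trans[OF norm_triangle_ineq add_mono[OF b2 b3]])
  also have "\<dots> = tail_const \<alpha> \<beta> * A * B * (wt \<alpha> n * wt \<beta> n)"
    unfolding ws wt_Suc tail_const_def by (simp add: algebra_simps)
  finally show ?thesis unfolding eq wt_mult .
qed

text \<open>Here \<open>\<alpha> + \<beta> > 0\<close> makes the changes summable.\<close>
lemma tprod_cauchy:
  assumes u: "besov \<alpha> A u" and v: "besov \<beta> B v" and ab: "\<alpha> < 0" "0 < \<beta>" "0 < \<alpha> + \<beta>" and n: "l + freq_gap \<le> n" "n \<le> m"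
  shows "cmod (tp (blk l (tprod m u v)) x - tp (blk l (tprod n u v)) x) \<le> tail_const \<alpha> \<beta> * A * B * geom_sum (\<alpha> + \<beta>) * wt (\<alpha> + \<beta>) n"
proof -
  have cp: "0 \<le> tail_const \<alpha> \<beta> * A * B" using besov_nonneg[OF u] besov_nonneg[OF v] geom_sum_nonneg K_ge_1 by (simp add: tail_const_def)
  have "cmod (tp (blk l (tprod m u v)) x - tp (blk l (tprod n u v)) x) \<le> (\<Sum>i\<in>{n..<m}. tail_const \<alpha> \<beta> * A * B * wt (\<alpha> + \<beta>) i)"
    using n(2)
  proof (induction m rule: dec_induct)
    case (step m)
    have "cmod (tp (blk l (tprod (Suc m) u v)) x - tp (blk l (tprod m u v)) x) \<le> tail_const \<alpha> \<beta> * A * B * wt (\<alpha> + \<beta>) m"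
      by (rule tprod_step[OF u v ab(1,2)]) (use n step in simp)
    then show ?case using step norm_triangle_ineq[of "tp (blk l (tprod (Suc m) u v)) x - tp (blk l (tprod m u v)) x" "tp (blk l (tprod m u v)) x - tp (blk l (tprod n u v)) x"]
      by simp
  qed simp
  also have "\<dots> \<le> tail_const \<alpha> \<beta> * A * B * (geom_sum (\<alpha> + \<beta>) * wt (\<alpha> + \<beta>) n)"
    unfolding sum_distrib_left[symmetric] by (rule mult_left_mono[OF sum_wt_tail[OF ab(3) n(2)] cp])
  finally show ?thesis by (simp add: mult.assoc)
qed

lemma tprod_convergent:
  assumes u: "besov \<alpha> A u" and v: "besov \<beta> B v" and ab: "\<alpha> < 0" "0 < \<beta>" "0 < \<alpha> + \<beta>"
  shows "(\<lambda>n. tprod n u v k) \<longlonglongrightarrow> dprod \<theta> u v k"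
proof -
  have "Cauchy (\<lambda>n. tprod n u v k)"
  proof (rule metric_CauchyI)
    fix e :: real assume e: "e > 0"
    let ?E = "real (block_index k) * (tail_const \<alpha> \<beta> * A * B * geom_sum (\<alpha> + \<beta>))"
    have "\<forall>\<^sub>F n in sequentially. ?E * wt (\<alpha> + \<beta>) n < e / 2"
      by (rule order_tendstoD(2)[OF wt_lim[OF ab(3)]]) (use e in simp)
    then have "\<forall>\<^sub>F n in sequentially. ?E * wt (\<alpha> + \<beta>) n < e / 2 \<and> block_index k + freq_gap \<le> n"
      using eventually_ge_at_top by (rule eventually_conj)
    then obtain N where N: "?E * wt (\<alpha> + \<beta>) N < e / 2" "block_index k + freq_gap \<le> N" by (auto simp: eventually_sequentially)
    have "dist (tprod m u v k) (tprod N u v k) < e / 2" if "m \<ge> N" for m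
    proof -
      have "cmod (tprod m u v k - tprod N u v k) = cmod (\<Sum>i<block_index k. blk i (tprod m u v) k - blk i (tprod N u v) k)"
        by (subst (1 2) coeff_eq_sum_blk) (simp add: sum_subtractf)
      also have "\<dots> \<le> (\<Sum>i<block_index k. tail_const \<alpha> \<beta> * A * B * geom_sum (\<alpha> + \<beta>) * wt (\<alpha> + \<beta>) N)"
      proof (rule order_trans[OF norm_sum], rule sum_mono)
        fix i assume i: "i \<in> {..<block_index k}"
        have "cmod ((\<lambda>k. blk i (tprod m u v) k - blk i (tprod N u v) k) k) \<le> tail_const \<alpha> \<beta> * A * B * geom_sum (\<alpha> + \<beta>) * wt (\<alpha> + \<beta>) N"
        proof (rule norm_coeff_le)
          show "finsupp (\<lambda>k. blk i (tprod m u v) k - blk i (tprod N u v) k)"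
            by (rule finite_subset[of _ "{k. blk i (tprod m u v) k \<noteq> 0} \<union> {k. blk i (tprod N u v) k \<noteq> 0}"]) auto
          show "cmod (tp (\<lambda>k. blk i (tprod m u v) k - blk i (tprod N u v) k) x) \<le> tail_const \<alpha> \<beta> * A * B * geom_sum (\<alpha> + \<beta>) * wt (\<alpha> + \<beta>) N" for x
            using tprod_cauchy[OF u v ab, of i N m x] i N(2) that by (simp add: tp_diff)
        qed
        then show "cmod (blk i (tprod m u v) k - blk i (tprod N u v) k) \<le> tail_const \<alpha> \<beta> * A * B * geom_sum (\<alpha> + \<beta>) * wt (\<alpha> + \<beta>) N" by simp
      qed
      also have "\<dots> = ?E * wt (\<alpha> + \<beta>) N" by simp
      finally show ?thesis using N by (simp add: dist_norm)
    qed
    then show "\<exists>M. \<forall>m\<ge>M. \<forall>n\<ge>M. dist (tprod m u v k) (tprod n u v k) < e"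
      by (intro exI[of _ N] allI impI) (rule dist_triangle_half_l[of _ "tprod N u v k"])
  qed
  then obtain L where L: "(\<lambda>n. tprod n u v k) \<longlonglongrightarrow> L" using Cauchy_convergent_iff convergent_def by blast
  then have "(\<lambda>n. tprod (n + 2) u v k) \<longlonglongrightarrow> L" by (rule LIMSEQ_ignore_initial_segment)
  then have "dprod \<theta> u v k = L" unfolding dprod_eq[OF besovD(2)[OF u] besovD(2)[OF v]] by (rule limI)
  then show ?thesis using L by simp
qed

definition product_const :: "real \<Rightarrow> real \<Rightarrow> real" where
  "product_const \<alpha> \<beta> = (K * geom_sum \<alpha> * geom_sum \<beta> + tail_const \<alpha> \<beta> * geom_sum (\<alpha> + \<beta>)) * wt \<beta> 0 * 2 powr (- \<alpha> * freq_gap)"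

lemma product_const_nonneg: "product_const \<alpha> \<beta> \<ge> 0"
  using geom_sum_nonneg K_ge_1 by (simp add: product_const_def tail_const_def)

text \<open>The product of a distribution of negative regularity \<open>\<alpha>\<close> with one of sufficiently positive regularity
  has regularity \<open>\<alpha>\<close>: the \<open>l\<close>-th block of the product is compared with that of the product of the
  truncations at \<open>l\<close>, up to the gap.\<close>
lemma besov_dprod:
  assumes u: "besov \<alpha> A u" and v: "besov \<beta> B v" and ab: "\<alpha> < 0" "0 < \<beta>" "0 < \<alpha> + \<beta>"
  shows "besov \<alpha> (product_const \<alpha> \<beta> * A * B) (dprod \<theta> u v)"
  unfolding besov_def
proof (intro conjI allI)
  have A: "A \<ge> 0" "B \<ge> 0" using besov_nonneg u v by auto
  show "herm (dprod \<theta> u v)" unfolding herm_def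
  proof
    fix k
    have "(\<lambda>n. tprod n u v (- k)) \<longlonglongrightarrow> cnj (dprod \<theta> u v k)"
      using tendsto_cnj[OF tprod_convergent[OF assms, of k]] herm_tprod[OF besovD(2)[OF u] besovD(2)[OF v]] by (simp add: herm_def)
    then show "dprod \<theta> u v (- k) = cnj (dprod \<theta> u v k)" using tprod_convergent[OF assms, of "- k"] LIMSEQ_unique by blast
  qed
  fix l x
  let ?n = "l + freq_gap"
  (* The truncation of u grows and that of v is bounded. *)
  have b0: "cmod (tp (blk l (tprod ?n u v)) x) \<le> K * ((geom_sum \<alpha> * A * wt \<alpha> ?n) * (geom_sum \<beta> * B * wt \<beta> 0))"
    unfolding tprod_def
  proof (rule norm_blk_cont)
    fix x show "cmod (tp (low ?n u) x * tp (low ?n v) x) \<le> (geom_sum \<alpha> * A * wt \<alpha> ?n) * (geom_sum \<beta> * B * wt \<beta> 0)"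
      unfolding norm_mult using norm_low_neg[OF u ab(1)] norm_low_pos[OF v ab(2)] A geom_sum_nonneg by (intro mult_mono) auto
  qed (intro continuous_intros continuous_on_tp)
  have "cmod (tp (blk l (tprod m u v)) x) \<le> product_const \<alpha> \<beta> * A * B * wt \<alpha> l" if m: "m \<ge> ?n" for m
  proof -
    have "cmod (tp (blk l (tprod m u v)) x) \<le> tail_const \<alpha> \<beta> * A * B * geom_sum (\<alpha> + \<beta>) * wt (\<alpha> + \<beta>) ?n + K * ((geom_sum \<alpha> * A * wt \<alpha> ?n) * (geom_sum \<beta> * B * wt \<beta> 0))"
      using tprod_cauchy[OF assms order_refl m, of x] b0 norm_triangle_sub[of "tp (blk l (tprod m u v)) x" "tp (blk l (tprod ?n u v)) x"] by linarith
    also have "\<dots> \<le> tail_const \<alpha> \<beta> * A * B * geom_sum (\<alpha> + \<beta>) * (wt \<alpha> ?n * wt \<beta> 0) + K * ((geom_sum \<alpha> * A * wt \<alpha> ?n) * (geom_sum \<beta> * B * wt \<beta> 0))"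
    proof (rule add_right_mono, rule mult_left_mono)
      show "wt (\<alpha> + \<beta>) ?n \<le> wt \<alpha> ?n * wt \<beta> 0"
        unfolding wt_mult[symmetric] using wt_antimono[of \<beta> 0 ?n] ab(2) by (intro mult_left_mono) auto
      show "0 \<le> tail_const \<alpha> \<beta> * A * B * geom_sum (\<alpha> + \<beta>)" using A geom_sum_nonneg K_ge_1 by (simp add: tail_const_def)
    qed
    also have "\<dots> = product_const \<alpha> \<beta> * A * B * wt \<alpha> l"
      unfolding wt_add product_const_def by (simp add: algebra_simps)
    finally show ?thesis .
  qed
  moreover have "(\<lambda>m. tp (blk l (tprod m u v)) x) \<longlonglongrightarrow> tp (blk l (dprod \<theta> u v)) x"
  proof -
    have eq: "tp (blk l w) x = (\<Sum>k\<in>{k. \<Theta> l k \<noteq> 0}. of_real (\<Theta> l k) * w k * mode k x)" for w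
      by (subst tp_eq[OF finite_symbol[of l]]) (auto simp: blk_def)
    show ?thesis unfolding eq by (intro tendsto_intros tprod_convergent[OF assms])
  qed
  ultimately show "cmod (tp (blk l (dprod \<theta> u v)) x) \<le> product_const \<alpha> \<beta> * A * B * wt \<alpha> l"
    by (intro Lim_norm_ubound[OF sequentially_bot, of _ "tp (blk l (dprod \<theta> u v)) x"]) (auto simp: eventually_sequentially)
qed

lemma tprod_diff:
  "tprod n (u - u') v k = tprod n u v k - tprod n u' v k" "tprod n u (v - v') k = tprod n u v k - tprod n u v' k"
proof -
  have l: "tp (low n (w - w')) x = tp (low n w) x - tp (low n w') x" for w w' x
    unfolding low_diff by (simp add: tp_diff)
  show "tprod n (u - u') v k = tprod n u v k - tprod n u' v k"
    unfolding tprod_def l left_diff_distrib by (rule cfc_diff) (intro continuous_intros continuous_on_tp)+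
  show "tprod n u (v - v') k = tprod n u v k - tprod n u v' k"
    unfolding tprod_def l right_diff_distrib by (rule cfc_diff) (intro continuous_intros continuous_on_tp)+
qed

lemma dprod_diff_left:
  assumes u: "besov \<alpha> A u" "besov \<alpha> A' u'" and v: "besov \<beta> B v" and ab: "\<alpha> < 0" "0 < \<beta>" "0 < \<alpha> + \<beta>"
  shows "dprod \<theta> (u - u') v = dprod \<theta> u v - dprod \<theta> u' v"
proof
  fix k
  have "(\<lambda>n. tprod n u v k - tprod n u' v k) \<longlonglongrightarrow> dprod \<theta> u v k - dprod \<theta> u' v k"
    by (intro tendsto_intros tprod_convergent[OF u(1) v ab] tprod_convergent[OF u(2) v ab])
  then show "dprod \<theta> (u - u') v k = (dprod \<theta> u v - dprod \<theta> u' v) k"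
    using LIMSEQ_unique[OF tprod_convergent[OF besov_diff[OF u] v ab, of k, unfolded tprod_diff]] by simp
qed

lemma dprod_diff_right:
  assumes u: "besov \<alpha> A u" and v: "besov \<beta> B v" "besov \<beta> B' v'" and ab: "\<alpha> < 0" "0 < \<beta>" "0 < \<alpha> + \<beta>"
  shows "dprod \<theta> u (v - v') = dprod \<theta> u v - dprod \<theta> u v'"
proof
  fix k
  have "(\<lambda>n. tprod n u v k - tprod n u v' k) \<longlonglongrightarrow> dprod \<theta> u v k - dprod \<theta> u v' k"
    by (intro tendsto_intros tprod_convergent[OF u v(1) ab] tprod_convergent[OF u v(2) ab])
  then show "dprod \<theta> u (v - v') k = (dprod \<theta> u v - dprod \<theta> u v') k"
    using LIMSEQ_unique[OF tprod_convergent[OF u besov_diff[OF v] ab, of k, unfolded tprod_diff]] by simp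
qed

lemma besov_dprod_diff:
  assumes u: "besov \<alpha> A u" "besov \<alpha> dA (u - u')" "besov \<alpha> A' u'" and v: "besov \<beta> B v" "besov \<beta> dB (v - v')" "besov \<beta> B' v'"
    and ab: "\<alpha> < 0" "0 < \<beta>" "0 < \<alpha> + \<beta>"
  shows "besov \<alpha> (product_const \<alpha> \<beta> * dA * B + product_const \<alpha> \<beta> * A' * dB) (dprod \<theta> u v - dprod \<theta> u' v')"
proof (rule besov_trans)
  show "besov \<alpha> (product_const \<alpha> \<beta> * dA * B) (dprod \<theta> u v - dprod \<theta> u' v)"
    using besov_dprod[OF u(2) v(1) ab] dprod_diff_left[OF u(1,3) v(1) ab] by simp
  show "besov \<alpha> (product_const \<alpha> \<beta> * A' * dB) (dprod \<theta> u' v - dprod \<theta> u' v')"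
    using besov_dprod[OF u(3) v(2) ab] dprod_diff_right[OF u(3) v(1,3) ab] by simp
qed

text \<open>For continuous functions the truncations converge uniformly.\<close>
lemma dprod_cont:
  assumes f: "continuous_on UNIV f" "per f" and g: "continuous_on UNIV g" "per g"
  shows "dprod \<theta> (fcoef f) (fcoef g) = fcoef (\<lambda>x. f x * g x)"
proof
  fix k
  let ?f = "\<lambda>x. complex_of_real (f x)" and ?g = "\<lambda>x. complex_of_real (g x)"
  have F: "continuous_on UNIV ?f" "per ?f" and G: "continuous_on UNIV ?g" "per ?g"
    by (rule continuous_on_of_real[OF f(1)], rule per_comp(1)[OF f(2)], rule continuous_on_of_real[OF g(1)], rule per_comp(1)[OF g(2)])
  obtain A where A: "\<And>x. cmod (?f x) \<le> A" "A \<ge> 0" using per_norm_bounded[OF F] by blast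
  obtain B where B: "\<And>x. cmod (?g x) \<le> B" "B \<ge> 0" using per_norm_bounded[OF G] by blast
  have "(\<lambda>n. tprod n (cfc ?f) (cfc ?g) k) \<longlonglongrightarrow> cfc (\<lambda>x. ?f x * ?g x) k"
  proof (rule tendstoI)
    fix e :: real assume e: "e > 0"
    define P where "P = A + B + 1 + e"
    define d where "d = e / (2 * P)"
    have pos: "P > 0" using A B e by (simp add: P_def)
    have d: "d > 0" using e pos by (simp add: d_def)
    have d1: "d \<le> 1" unfolding d_def using pos A B e by (simp add: P_def)
    from low_cont_lim[OF F d] low_cont_lim[OF G d]
    show "\<forall>\<^sub>F n in sequentially. dist (tprod n (cfc ?f) (cfc ?g) k) (cfc (\<lambda>x. ?f x * ?g x) k) < e"
    proof eventually_elim
      case (elim n)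
      let ?S = "tp (low n (cfc ?f))" and ?T = "tp (low n (cfc ?g))"
      have "cmod (cfc (\<lambda>x. ?S x * ?T x - ?f x * ?g x) k) \<le> d * (A + B + 1)"
      proof (rule norm_cfc_le)
        fix x
        have s: "cmod (?S x - ?f x) \<le> d" and t: "cmod (?T x - ?g x) \<le> d" using elim by auto
        have "cmod (?T x) \<le> B + 1" using t B(1)[of x] d1 norm_triangle_sub[of "?T x" "?g x"] by linarith
        have "?S x * ?T x - ?f x * ?g x = (?S x - ?f x) * ?T x + ?f x * (?T x - ?g x)" by (simp add: algebra_simps)
        then have "cmod (?S x * ?T x - ?f x * ?g x) \<le> cmod (?S x - ?f x) * cmod (?T x) + cmod (?f x) * cmod (?T x - ?g x)"
          by (metis norm_mult norm_triangle_ineq)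
        also have "\<dots> \<le> d * (B + 1) + A * d"
          using s t A B d \<open>cmod (?T x) \<le> B + 1\<close> by (intro add_mono mult_mono) auto
        finally show "cmod (?S x * ?T x - ?f x * ?g x) \<le> d * (A + B + 1)" by (simp add: algebra_simps)
      qed (intro continuous_intros continuous_on_tp F G)
      also have "cfc (\<lambda>x. ?S x * ?T x - ?f x * ?g x) k = tprod n (cfc ?f) (cfc ?g) k - cfc (\<lambda>x. ?f x * ?g x) k"
        unfolding tprod_def by (rule cfc_diff) (intro continuous_intros continuous_on_tp F G)+
      finally have "dist (tprod n (cfc ?f) (cfc ?g) k) (cfc (\<lambda>x. ?f x * ?g x) k) \<le> d * (A + B + 1)" by (simp add: dist_norm)
      also have "\<dots> \<le> d * P" using d e by (intro mult_left_mono) (auto simp: P_def)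
      also have "\<dots> = e / 2" using pos by (simp add: d_def)
      finally show ?case using e by simp
    qed
  qed
  then have "(\<lambda>n. tprod (n + 2) (fcoef f) (fcoef g) k) \<longlonglongrightarrow> fcoef (\<lambda>x. f x * g x) k"
    unfolding fcoef_eq_cfc of_real_mult by (rule LIMSEQ_ignore_initial_segment)
  then show "dprod \<theta> (fcoef f) (fcoef g) k = fcoef (\<lambda>x. f x * g x) k"
    unfolding dprod_eq[OF herm_fcoef herm_fcoef] by (rule limI)
qed

definition deriv_const :: real where "deriv_const = 8 * pi * real (nat \<lceil>R\<rceil>)"

lemma deriv_const_nonneg: "deriv_const \<ge> 0" by (simp add: deriv_const_def)

text \<open>Bernstein's inequality on each block.\<close>
lemma besov_dpartial: assumes u: "besov \<alpha> C u" shows "besov (\<alpha> - 1) (deriv_const * C) (dpartial i u)"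
  unfolding besov_def
proof (intro conjI allI)
  show "herm (dpartial i u)" using besovD(2)[OF u] by (simp add: herm_def dpartial_def)
  fix n x
  (* On the block the i-th coordinate of the frequency is at most N, so Bernstein applies. *)
  let ?N = "nat \<lceil>R\<rceil> * 2 ^ n"
  have N: "?N > 0" using R_pos by simp
  obtain m where m: "multiplier m (2 * real ?N)" "\<And>k. \<bar>k $ i\<bar> \<le> int ?N \<Longrightarrow> m k = of_int (k $ i)"
    using multiplier_derivative[OF N, of i] by blast
  have "blk n (dpartial i u) = (\<lambda>k. (2 * of_real pi * \<i>) * (m k * blk n u k))"
  proof
    fix k
    show "blk n (dpartial i u) k = (2 * of_real pi * \<i>) * (m k * blk n u k)"
    proof (cases "\<Theta> n k = 0")
      case False
      have "\<bar>real_of_int (k $ i)\<bar> \<le> norm (freq k)" using component_le_norm_cart[of "freq k" i] by simp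
      also have "\<dots> \<le> R * 2 ^ n" by (rule upper[OF False])
      also have "\<dots> \<le> real (nat \<lceil>R\<rceil>) * 2 ^ n" using R_pos by (intro mult_right_mono) (auto simp: le_of_int_ceiling)
      also have "\<dots> = real_of_int (int ?N)" by simp
      finally have "\<bar>k $ i\<bar> \<le> int ?N" by linarith
      then show ?thesis using m(2) by (simp add: blk_def dpartial_def)
    qed (simp add: blk_def)
  qed
  then have "cmod (tp (blk n (dpartial i u)) x) = 2 * pi * cmod (tp (\<lambda>k. m k * blk n u k) x)"
    by (simp add: tp_scale norm_mult)
  also have "\<dots> \<le> 2 * pi * (2 * real ?N * (C * wt \<alpha> n))"
    by (intro mult_left_mono multiplierD[OF m(1)] finsupp_blk besovD(1)[OF u]) auto
  also have "\<dots> = deriv_const * C * wt (\<alpha> - 1) n"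
  proof -
    have "2 ^ n = (2::real) powr real n" by (simp add: powr_realpow)
    then have "2 ^ n * wt \<alpha> n = 2 powr (real n + - \<alpha> * (real n - 1))" by (simp only: wt_def powr_add)
    also have "real n + - \<alpha> * (real n - 1) = 1 + - (\<alpha> - 1) * (real n - 1)" by (simp add: algebra_simps)
    also have "2 powr (1 + - (\<alpha> - 1) * (real n - 1)) = 2 * wt (\<alpha> - 1) n" unfolding powr_add wt_def by simp
    finally have w: "2 ^ n * wt \<alpha> n = 2 * wt (\<alpha> - 1) n" .
    have "2 * pi * (2 * real ?N * (C * wt \<alpha> n)) = 4 * pi * real (nat \<lceil>R\<rceil>) * C * (2 ^ n * wt \<alpha> n)" by simp
    then show ?thesis unfolding w by (simp add: deriv_const_def)
  qed
  finally show "cmod (tp (blk n (dpartial i u)) x) \<le> deriv_const * C * wt (\<alpha> - 1) n" .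
qed

lemma dpartial_diff: "dpartial i (u - v) = dpartial i u - dpartial i v"
  by (rule ext) (simp add: dpartial_def algebra_simps)

end

lemma exp_lipschitz:
  fixes x y :: real
  assumes "\<bar>x\<bar> \<le> a" "\<bar>y\<bar> \<le> a" shows "\<bar>exp x - exp y\<bar> \<le> exp a * \<bar>x - y\<bar>"
proof -
  have *: "\<bar>exp x - exp y\<bar> \<le> exp a * \<bar>x - y\<bar>" if "x \<le> y" "y \<le> a" for x y :: real
  proof -
    have "exp x = exp y * exp (x - y)" by (simp add: exp_add[symmetric])
    then have "exp y - exp x = exp y * (1 - exp (x - y))" by (simp add: algebra_simps)
    also have "\<dots> \<le> exp a * (y - x)"
    proof (rule mult_mono)
      show "1 - exp (x - y) \<le> y - x" using exp_ge_add_one_self[of "x - y"] by linarith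
    qed (use that in auto)
    finally show ?thesis using that by simp
  qed
  show ?thesis using *[of x y] *[of y x] assms by (cases "x \<le> y") (auto simp: abs_minus_commute)
qed

section \<open>The right-hand side\<close>

context lp_frame
begin

lemma besov_sum:
  assumes "finite I" "\<And>i. i \<in> I \<Longrightarrow> besov \<alpha> C (u i)" shows "besov \<alpha> (real (card I) * C) (\<lambda>k. \<Sum>i\<in>I. u i k)"
  using assms
proof (induction rule: finite_induct)
  case empty then show ?case by (simp add: besov_zero)
next
  case (insert i I)
  then have "besov \<alpha> (C + real (card I) * C) (\<lambda>k. u i k + (\<Sum>i\<in>I. u i k))" by (intro besov_add) auto
  then show ?case using insert by (simp add: algebra_simps)
qed

lemma besov_minus: assumes "besov \<alpha> C u" shows "besov \<alpha> C (\<lambda>k. - u k)"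
  using besov_scale[OF assms, of "-1"] by simp

lemma lipschitz_transport:
  assumes "continuous_on UNIV f" "continuous_on UNIV g" "\<And>x. \<bar>f x - g x\<bar> \<le> A"
  shows "besov 0 (K * A) (fcoef f - fcoef g)"
proof -
  have "fcoef f - fcoef g = fcoef (\<lambda>x. f x - g x)"
    using cfc_diff[of "\<lambda>x. of_real (f x)" "\<lambda>x. of_real (g x)"] assms
    by (auto simp: fcoef_eq_cfc fun_eq_iff continuous_intros)
  then show ?thesis using besov_cont[of "\<lambda>x. f x - g x" A] assms by (simp add: continuous_intros)
qed

lemma pval_sq: "(\<lambda>x. (pval \<theta> u x)\<^sup>2) = (\<lambda>x. pval \<theta> u x * pval \<theta> u x)"
  by (simp add: power2_eq_square)

definition square_const :: "real \<Rightarrow> real" where "square_const \<alpha> = K * (2 * (geom_sum \<alpha>)\<^sup>2 * wt \<alpha> 0 * 2 powr (\<alpha> * freq_gap))"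

lemma square_const_nonneg: "square_const \<alpha> \<ge> 0" using K_ge_1 by (simp add: square_const_def)

lemma besov_square: assumes "besov \<alpha> A u" "\<alpha> > 0" shows "besov \<alpha> (square_const \<alpha> * A * A) (fcoef (\<lambda>x. (pval \<theta> u x)\<^sup>2))"
  unfolding pval_sq square_const_def by (rule besov_mult_pos[OF assms(1,1,2)])

text \<open>\<open>u\<^sup>2 - v\<^sup>2 = u (u - v) + (u - v) v\<close>.\<close>
lemma besov_square_diff:
  assumes u: "besov \<alpha> A u" and v: "besov \<alpha> A v" and d: "besov \<alpha> d (u - v)" and a: "\<alpha> > 0"
  shows "besov \<alpha> (2 * square_const \<alpha> * A * d) (fcoef (\<lambda>x. (pval \<theta> u x)\<^sup>2) - fcoef (\<lambda>x. (pval \<theta> v x)\<^sup>2))"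
proof -
  note c = pval_cont[OF u a] pval_cont[OF v a] pval_cont[OF d a]
  let ?f1 = "\<lambda>x. pval \<theta> u x * pval \<theta> (u - v) x" and ?f2 = "\<lambda>x. pval \<theta> (u - v) x * pval \<theta> v x"
  have "fcoef (\<lambda>x. (pval \<theta> u x)\<^sup>2) - fcoef (\<lambda>x. (pval \<theta> v x)\<^sup>2) = fcoef (\<lambda>x. (pval \<theta> u x)\<^sup>2 - (pval \<theta> v x)\<^sup>2)"
    using cfc_diff[of "\<lambda>x. of_real ((pval \<theta> u x)\<^sup>2)" "\<lambda>x. of_real ((pval \<theta> v x)\<^sup>2)"] c
    by (auto simp: fcoef_eq_cfc fun_eq_iff continuous_intros)
  also have "(\<lambda>x. (pval \<theta> u x)\<^sup>2 - (pval \<theta> v x)\<^sup>2) = (\<lambda>x. ?f1 x + ?f2 x)"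
    by (rule ext) (simp add: pval_diff[OF u v a] power2_eq_square algebra_simps)
  also have "fcoef (\<lambda>x. ?f1 x + ?f2 x) = (\<lambda>k. fcoef ?f1 k + fcoef ?f2 k)"
    using cfc_add[of "\<lambda>x. of_real (?f1 x)" "\<lambda>x. of_real (?f2 x)"] c
    by (auto simp: fcoef_eq_cfc fun_eq_iff continuous_intros)
  finally have e: "fcoef (\<lambda>x. (pval \<theta> u x)\<^sup>2) - fcoef (\<lambda>x. (pval \<theta> v x)\<^sup>2) = (\<lambda>k. fcoef ?f1 k + fcoef ?f2 k)" .
  have "besov \<alpha> (square_const \<alpha> * A * d + square_const \<alpha> * d * A) (\<lambda>k. fcoef ?f1 k + fcoef ?f2 k)"
    unfolding square_const_def by (intro besov_add besov_mult_pos u v d a)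
  moreover have "square_const \<alpha> * A * d + square_const \<alpha> * d * A = 2 * square_const \<alpha> * A * d" by (simp add: algebra_simps)
  ultimately show ?thesis unfolding e by simp
qed

text \<open>The cubic term is a pointwise function of two bounded functions, and regularity 0 is controlled by
  the supremum norm.\<close>
lemma cubic_lipschitz:
  assumes V: "besov \<alpha> A V" "besov \<alpha> A V'" "besov \<alpha> d (V - V')" "\<alpha> > 0"
    and u: "besov \<beta> A u" "besov \<beta> A u'" "besov \<beta> d (u - u')" "\<beta> > 0"
  defines "a \<equiv> geom_sum \<alpha> * A * wt \<alpha> 0" and "b \<equiv> geom_sum \<beta> * A * wt \<beta> 0"
  shows "besov 0 (K * (exp (6 * a) * (6 * geom_sum \<alpha> * wt \<alpha> 0 * b ^ 3 + 3 * b\<^sup>2 * (geom_sum \<beta> * wt \<beta> 0)) * d))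
    (fcoef (\<lambda>x. exp (- 6 * pval \<theta> V x) * (pval \<theta> u x) ^ 3) - fcoef (\<lambda>x. exp (- 6 * pval \<theta> V' x) * (pval \<theta> u' x) ^ 3))"
proof (rule lipschitz_transport)
  show "continuous_on UNIV (\<lambda>x. exp (- 6 * pval \<theta> V x) * (pval \<theta> u x) ^ 3)"
    by (intro continuous_intros pval_cont[OF V(1,4)] pval_cont[OF u(1,4)])
  show "continuous_on UNIV (\<lambda>x. exp (- 6 * pval \<theta> V' x) * (pval \<theta> u' x) ^ 3)"
    by (intro continuous_intros pval_cont[OF V(2,4)] pval_cont[OF u(2,4)])
  fix x
  let ?p = "pval \<theta> V x" and ?p' = "pval \<theta> V' x" and ?q = "pval \<theta> u x" and ?q' = "pval \<theta> u' x"
  have A: "A \<ge> 0" "d \<ge> 0" using besov_nonneg V by auto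
  have ab: "a \<ge> 0" "b \<ge> 0" using A geom_sum_nonneg by (auto simp: a_def b_def)
  have p: "\<bar>?p\<bar> \<le> a" "\<bar>?p'\<bar> \<le> a" "\<bar>?p - ?p'\<bar> \<le> geom_sum \<alpha> * d * wt \<alpha> 0"
    unfolding a_def pval_diff[OF V(1,2,4), symmetric] using V by (auto intro!: pval_bound)
  have q: "\<bar>?q\<bar> \<le> b" "\<bar>?q'\<bar> \<le> b" "\<bar>?q - ?q'\<bar> \<le> geom_sum \<beta> * d * wt \<beta> 0"
    unfolding b_def pval_diff[OF u(1,2,4), symmetric] using u by (auto intro!: pval_bound)
  (* Local Lipschitz constants of the exponential and of the cube. *)
  have e1: "\<bar>exp (- 6 * ?p) - exp (- 6 * ?p')\<bar> \<le> exp (6 * a) * (6 * (geom_sum \<alpha> * d * wt \<alpha> 0))"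
  proof -
    have "\<bar>exp (- 6 * ?p) - exp (- 6 * ?p')\<bar> \<le> exp (6 * a) * \<bar>- 6 * ?p - - 6 * ?p'\<bar>"
      by (rule exp_lipschitz) (use p in auto)
    also have "\<bar>- 6 * ?p - - 6 * ?p'\<bar> = 6 * \<bar>?p - ?p'\<bar>"
      by (simp only: right_diff_distrib[symmetric] abs_mult abs_neg_numeral abs_numeral)
    also have "exp (6 * a) * (6 * \<bar>?p - ?p'\<bar>) \<le> exp (6 * a) * (6 * (geom_sum \<alpha> * d * wt \<alpha> 0))"
      using p by (intro mult_left_mono) auto
    finally show ?thesis .
  qed
  have e2: "\<bar>exp (- 6 * ?p')\<bar> \<le> exp (6 * a)" using p by (simp add: abs_le_iff)
  have c1: "\<bar>?q ^ 3\<bar> \<le> b ^ 3" unfolding power_abs by (intro power_mono q) auto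
  have c2: "\<bar>?q ^ 3 - ?q' ^ 3\<bar> \<le> (geom_sum \<beta> * d * wt \<beta> 0) * (3 * b\<^sup>2)"
  proof -
    have "?q ^ 3 - ?q' ^ 3 = (?q - ?q') * (?q * ?q + ?q * ?q' + ?q' * ?q')"
      by (simp add: power3_eq_cube algebra_simps)
    moreover have "\<bar>?q * ?q + ?q * ?q' + ?q' * ?q'\<bar> \<le> 3 * b\<^sup>2"
    proof -
      have "\<bar>y * z\<bar> \<le> b * b" if "\<bar>y\<bar> \<le> b" "\<bar>z\<bar> \<le> b" for y z
        unfolding abs_mult using that ab by (intro mult_mono) auto
      from this[of ?q ?q] this[of ?q ?q'] this[of ?q' ?q'] show ?thesis using q unfolding power2_eq_square by linarith
    qed
    ultimately show ?thesis unfolding abs_mult using q A geom_sum_nonneg ab by (simp add: abs_mult) (intro mult_mono, auto)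
  qed
  have "exp (- 6 * ?p) * ?q ^ 3 - exp (- 6 * ?p') * ?q' ^ 3 = (exp (- 6 * ?p) - exp (- 6 * ?p')) * ?q ^ 3 + exp (- 6 * ?p') * (?q ^ 3 - ?q' ^ 3)"
    by (simp add: algebra_simps)
  then have "\<bar>exp (- 6 * ?p) * ?q ^ 3 - exp (- 6 * ?p') * ?q' ^ 3\<bar> \<le> \<bar>exp (- 6 * ?p) - exp (- 6 * ?p')\<bar> * \<bar>?q ^ 3\<bar> + \<bar>exp (- 6 * ?p')\<bar> * \<bar>?q ^ 3 - ?q' ^ 3\<bar>"
    by (metis abs_mult abs_triangle_ineq)
  also have "\<dots> \<le> (exp (6 * a) * (6 * (geom_sum \<alpha> * d * wt \<alpha> 0))) * b ^ 3 + exp (6 * a) * ((geom_sum \<beta> * d * wt \<beta> 0) * (3 * b\<^sup>2))"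
    using e1 e2 c1 c2 A geom_sum_nonneg ab by (intro add_mono mult_mono) auto
  also have "\<dots> = exp (6 * a) * (6 * geom_sum \<alpha> * wt \<alpha> 0 * b ^ 3 + 3 * b\<^sup>2 * (geom_sum \<beta> * wt \<beta> 0)) * d"
    by (simp add: algebra_simps)
  finally show "\<bar>exp (- 6 * ?p) * ?q ^ 3 - exp (- 6 * ?p') * ?q' ^ 3\<bar> \<le> exp (6 * a) * (6 * geom_sum \<alpha> * wt \<alpha> 0 * b ^ 3 + 3 * b\<^sup>2 * (geom_sum \<beta> * wt \<beta> 0)) * d" .
qed

end

locale equation_frame = lp_frame +
  fixes \<epsilon> :: real
  assumes eps: "0 < \<epsilon>" "\<epsilon> < 1/6"
begin

abbreviation \<kappa> :: real where "\<kappa> \<equiv> \<epsilon> / 2"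
abbreviation \<beta> :: real where "\<beta> \<equiv> 3/2 - \<epsilon>"
abbreviation \<gamma> :: real where "\<gamma> \<equiv> - 1/2 - \<kappa>"

text \<open>The data at one time have norms at most \<open>A\<close>, with the exponents in which the equation is solved.\<close>
definition data_bound :: "real \<Rightarrow> coeffs \<Rightarrow> coeffs \<Rightarrow> coeffs \<Rightarrow> coeffs \<Rightarrow> bool" where
  "data_bound A V Z0 Z1 Z2 \<longleftrightarrow> besov (1 - \<kappa>) A V \<and> besov \<gamma> A Z0 \<and> besov \<gamma> A Z1 \<and> besov \<gamma> A Z2"

text \<open>The local Lipschitz constant of the right-hand side on the ball of radius \<open>A\<close>.\<close>
definition clip_const :: "real \<Rightarrow> real" where
  "clip_const A = 6 * (3 * (2 powr (- \<kappa> - \<gamma>) * (2 * product_const (- \<kappa>) (1/2 - \<epsilon>) * deriv_const * deriv_const * A)))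
     + 2 powr (0 - \<gamma>) * (K * (exp (6 * (geom_sum (1 - \<kappa>) * A * wt (1 - \<kappa>) 0)) *
         (6 * geom_sum (1 - \<kappa>) * wt (1 - \<kappa>) 0 * (geom_sum \<beta> * A * wt \<beta> 0) ^ 3 + 3 * (geom_sum \<beta> * A * wt \<beta> 0)\<^sup>2 * (geom_sum \<beta> * wt \<beta> 0))))
     + (product_const \<gamma> \<beta> * (square_const \<beta> * A * A) + product_const \<gamma> \<beta> * A * (2 * square_const \<beta> * A))
     + 2 * product_const \<gamma> \<beta> * A + 1"

lemma clip_const_nonneg: "A \<ge> 0 \<Longrightarrow> clip_const A \<ge> 0"
  unfolding clip_const_def using product_const_nonneg deriv_const_nonneg geom_sum_nonneg square_const_nonneg K_ge_1
  by (intro add_nonneg_nonneg mult_nonneg_nonneg zero_le_power) auto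

text \<open>The factor \<open>d\<close> is extracted from the sum of the bounds for the single terms.\<close>
lemma collect_constants:
  "6 * (3 * (w * (c1 * d))) + v * (k * (e * x * d)) + (c * d * s + c * a * (q * d)) + (c * d * a + c * a * d) + d
    = (6 * (3 * (w * c1)) + v * (k * (e * x)) + (c * s + c * a * q) + 2 * c * a + 1) * (d::real)"
  by algebra

text \<open>The product of the gradients has regularity \<open>-\<kappa>\<close> and the cubic term has regularity 0; both are better
  than \<open>\<gamma>\<close>, which is the regularity of the coefficients \<open>Z\<^sub>0, Z\<^sub>1, Z\<^sub>2\<close>.\<close>
lemma rhs_lipschitz:
  assumes D: "data_bound A V Z0 Z1 Z2" "data_bound A V' Z0' Z1' Z2'" "data_bound d (V - V') (Z0 - Z0') (Z1 - Z1') (Z2 - Z2')"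
    and u: "besov \<beta> A u" "besov \<beta> A u'" "besov \<beta> d (u - u')"
  shows "besov \<gamma> (clip_const A * d) (rhs \<theta> V Z0 Z1 Z2 u - rhs \<theta> V' Z0' Z1' Z2' u')"
proof -
  have V: "besov (1 - \<kappa>) A V" "besov (1 - \<kappa>) A V'" "besov (1 - \<kappa>) d (V - V')"
    and Z: "besov \<gamma> d (Z0 - Z0')" "besov \<gamma> A Z1" "besov \<gamma> A Z1'" "besov \<gamma> d (Z1 - Z1')" "besov \<gamma> A Z2" "besov \<gamma> A Z2'" "besov \<gamma> d (Z2 - Z2')"
    using D by (auto simp: data_bound_def)
  have A: "A \<ge> 0" "d \<ge> 0" using besov_nonneg u by auto
  let ?c1 = "2 * product_const (- \<kappa>) (1/2 - \<epsilon>) * deriv_const * deriv_const * A"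
  let ?P = "\<lambda>i V u. dprod \<theta> (dpartial i V) (dpartial i u)"
  have b1: "besov \<gamma> (2 powr (- \<kappa> - \<gamma>) * (?c1 * d)) (?P i V u - ?P i V' u')" for i
  proof (rule besov_lower)
    have pv: "besov (- \<kappa>) (deriv_const * C) (dpartial i W)" if "besov (1 - \<kappa>) C W" for C W
      using besov_dpartial[OF that, of i] by simp
    have pu: "besov (1/2 - \<epsilon>) (deriv_const * C) (dpartial i W)" if "besov \<beta> C W" for C W
      using besov_dpartial[OF that, of i] by simp
    have "besov (- \<kappa>) (product_const (- \<kappa>) (1/2 - \<epsilon>) * (deriv_const * d) * (deriv_const * A) + product_const (- \<kappa>) (1/2 - \<epsilon>) * (deriv_const * A) * (deriv_const * d))
       (?P i V u - ?P i V' u')"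
      by (rule besov_dprod_diff[OF pv[OF V(1)] _ pv[OF V(2)] pu[OF u(1)] _ pu[OF u(2)]])
        (use eps pv[OF V(3)] pu[OF u(3)] in \<open>auto simp: dpartial_diff\<close>)
    then show "besov (- \<kappa>) (?c1 * d) (?P i V u - ?P i V' u')" by (rule besov_mono) (simp add: algebra_simps)
  qed (use eps in simp)
  have B1: "besov \<gamma> (6 * (3 * (2 powr (- \<kappa> - \<gamma>) * (?c1 * d)))) (\<lambda>k. of_real (- 6) * (\<Sum>i\<in>UNIV. (?P i V u - ?P i V' u') k))"
    using besov_scale[OF besov_sum[where I = "UNIV :: 3 set", OF finite_class.finite_UNIV b1], of "- 6"] by simp
  let ?E = "\<lambda>V u. fcoef (\<lambda>x. exp (- 6 * pval \<theta> V x) * (pval \<theta> u x) ^ 3)"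
  let ?c2 = "K * (exp (6 * (geom_sum (1 - \<kappa>) * A * wt (1 - \<kappa>) 0)) *
         (6 * geom_sum (1 - \<kappa>) * wt (1 - \<kappa>) 0 * (geom_sum \<beta> * A * wt \<beta> 0) ^ 3 + 3 * (geom_sum \<beta> * A * wt \<beta> 0)\<^sup>2 * (geom_sum \<beta> * wt \<beta> 0)) * d)"
  have B2: "besov \<gamma> (2 powr (0 - \<gamma>) * ?c2) (\<lambda>k. - (?E V u - ?E V' u') k)"
    by (intro besov_minus besov_lower cubic_lipschitz V u) (use eps in auto)
  let ?S = "\<lambda>u. fcoef (\<lambda>x. (pval \<theta> u x)\<^sup>2)"
  have ab: "\<gamma> < 0" "0 < \<beta>" "0 < \<gamma> + \<beta>" using eps by auto
  have B3: "besov \<gamma> (product_const \<gamma> \<beta> * d * (square_const \<beta> * A * A) + product_const \<gamma> \<beta> * A * (2 * square_const \<beta> * A * d)) (dprod \<theta> Z2 (?S u) - dprod \<theta> Z2' (?S u'))"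
    by (rule besov_dprod_diff[OF Z(5,7,6) besov_square[OF u(1)] besov_square_diff[OF u] besov_square[OF u(2)] ab]) (use ab in auto)
  have B4: "besov \<gamma> (product_const \<gamma> \<beta> * d * A + product_const \<gamma> \<beta> * A * d) (dprod \<theta> Z1 u - dprod \<theta> Z1' u')"
    by (rule besov_dprod_diff[OF Z(2,4,3) u(1,3,2) ab])
  have e: "rhs \<theta> V Z0 Z1 Z2 u - rhs \<theta> V' Z0' Z1' Z2' u' =
    (\<lambda>k. (((of_real (- 6) * (\<Sum>i\<in>UNIV. (?P i V u - ?P i V' u') k) + - (?E V u - ?E V' u') k)
      + (dprod \<theta> Z2 (?S u) - dprod \<theta> Z2' (?S u')) k) + (dprod \<theta> Z1 u - dprod \<theta> Z1' u') k) + (Z0 - Z0') k)"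
    by (rule ext) (simp add: rhs_def sum_subtractf algebra_simps)
  have "besov \<gamma> (6 * (3 * (2 powr (- \<kappa> - \<gamma>) * (?c1 * d))) + 2 powr (0 - \<gamma>) * ?c2
     + (product_const \<gamma> \<beta> * d * (square_const \<beta> * A * A) + product_const \<gamma> \<beta> * A * (2 * square_const \<beta> * A * d))
     + (product_const \<gamma> \<beta> * d * A + product_const \<gamma> \<beta> * A * d) + d) (rhs \<theta> V Z0 Z1 Z2 u - rhs \<theta> V' Z0' Z1' Z2' u')"
    unfolding e by (intro besov_add B1 B2 B3 B4 Z(1))
  moreover have "6 * (3 * (2 powr (- \<kappa> - \<gamma>) * (?c1 * d))) + 2 powr (0 - \<gamma>) * ?c2
     + (product_const \<gamma> \<beta> * d * (square_const \<beta> * A * A) + product_const \<gamma> \<beta> * A * (2 * square_const \<beta> * A * d))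
     + (product_const \<gamma> \<beta> * d * A + product_const \<gamma> \<beta> * A * d) + d = clip_const A * d"
    unfolding clip_const_def by (rule collect_constants)
  ultimately show ?thesis by simp
qed

lemma fcoef_zero: "fcoef (\<lambda>x. 0) = (\<lambda>k. 0)"
  by (simp add: fcoef_def fun_eq_iff)

lemma rhs_zero: "rhs \<theta> (\<lambda>k. 0) (\<lambda>k. 0) (\<lambda>k. 0) (\<lambda>k. 0) (\<lambda>k. 0) = (\<lambda>k. 0)"
proof -
  have lf: "lowfreq \<theta> n (\<lambda>k. 0) x = 0" for n x by (simp add: lowfreq_eq low_def tp_def)
  have p: "pval \<theta> (\<lambda>k. 0) x = 0" for x by (simp add: pval_def lf)
  have d: "dprod \<theta> (\<lambda>k. 0) v k = 0" for v k by (simp add: dprod_def lf fcoef_zero)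
  have dp: "dpartial i (\<lambda>k. 0) = (\<lambda>k. 0)" for i by (simp add: dpartial_def fun_eq_iff)
  show ?thesis by (rule ext) (simp add: rhs_def p d dp fcoef_zero)
qed

text \<open>The right-hand side vanishes if the data and the unknown do, so a bound is a special case of the
  Lipschitz estimate.\<close>
lemma rhs_bound:
  assumes D: "data_bound A V Z0 Z1 Z2" and u: "besov \<beta> A u"
  shows "besov \<gamma> (clip_const A * A) (rhs \<theta> V Z0 Z1 Z2 u)"
proof -
  have A: "A \<ge> 0" using besov_nonneg u by auto
  have z: "besov \<alpha> A (\<lambda>k. 0)" for \<alpha> by (rule besov_mono[OF besov_zero A])
  have m: "w - (\<lambda>k. 0) = w" for w :: coeffs by (simp add: fun_eq_iff)
  have "besov \<gamma> (clip_const A * A) (rhs \<theta> V Z0 Z1 Z2 u - rhs \<theta> (\<lambda>k. 0) (\<lambda>k. 0) (\<lambda>k. 0) (\<lambda>k. 0) (\<lambda>k. 0))"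
    by (rule rhs_lipschitz) (use D u in \<open>auto simp: data_bound_def z m\<close>)
  then show ?thesis by (simp add: rhs_zero m)
qed

end

section \<open>The heat flow\<close>

context lp_frame
begin

definition heat_rate :: real where "heat_rate = min 1 (r\<^sup>2)"

lemma heat_rate_bounds: "0 < heat_rate" "heat_rate \<le> 1" "heat_rate \<le> r\<^sup>2" using r_pos by (auto simp: heat_rate_def)

lemma blk_heat: "blk n (heat t u) = heat t (blk n u)"
  by (simp add: blk_def heat_eq mult_ac)

lemma herm_heat: "herm u \<Longrightarrow> herm (heat t u)"
  by (simp add: herm_def heat_def)

lemma besov_heat: assumes "besov \<alpha> C u" "t \<ge> 0" shows "besov \<alpha> C (heat t u)"
  unfolding besov_def blk_heat
proof (intro conjI allI herm_heat besovD(2)[OF assms(1)])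
  fix n x
  have "cmod (tp (heat t (blk n u)) x) \<le> exp (- t) * (C * wt \<alpha> n)"
    unfolding heat_eq by (rule multiplierD[OF multiplier_heat[OF assms(2)] finsupp_blk besovD(1)[OF assms(1)]])
  also have "\<dots> \<le> 1 * (C * wt \<alpha> n)" using assms besov_nonneg[OF assms(1)] by (intro mult_right_mono) auto
  finally show "cmod (tp (heat t (blk n u)) x) \<le> C * wt \<alpha> n" by simp
qed

text \<open>For \<open>n = 0\<close> the frequencies are not bounded away from 0, and the decay comes from the mass term in
  \<open>\<Delta> - 1\<close>; this is the reason for the minimum in \<open>heat_rate\<close>.\<close>
lemma blk_heat_decay:
  assumes "\<And>x. cmod (tp (blk n u) x) \<le> A" "t \<ge> 0"
  shows "cmod (tp (blk n (heat t u)) x) \<le> 648 * exp (- heat_rate * 4 ^ n * t) * A"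
proof (cases "n = 0")
  case True
  have A: "A \<ge> 0" using assms(1)[of 0] norm_ge_zero order_trans by blast
  have "cmod (tp (heat t (blk n u)) x) \<le> exp (- t) * A"
    unfolding heat_eq by (rule multiplierD[OF multiplier_heat[OF assms(2)] finsupp_blk assms(1)])
  also have "\<dots> \<le> 648 * exp (- heat_rate * 4 ^ n * t) * A"
  proof (rule mult_right_mono[OF _ A])
    have "heat_rate * t \<le> 1 * t" using heat_rate_bounds assms(2) by (intro mult_right_mono) auto
    then have "exp (- t) \<le> exp (- heat_rate * 4 ^ n * t)" using True by simp
    also have "\<dots> \<le> 648 * exp (- heat_rate * 4 ^ n * t)" by simp
    finally show "exp (- t) \<le> 648 * exp (- heat_rate * 4 ^ n * t)" .
  qed
  finally show ?thesis unfolding blk_heat .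
next
  case False
  have A: "A \<ge> 0" using assms(1)[of 0] norm_ge_zero order_trans by blast
  have "cmod (tp (heat t (blk n u)) x) \<le> 648 * exp (- t * (r * 2 ^ n)\<^sup>2) * A"
    by (rule heat_annulus[OF _ assms(2) finsupp_blk assms(1)]) (use r_pos lower[of n] False in \<open>auto simp: blk_def\<close>)
  also have "\<dots> \<le> 648 * exp (- heat_rate * 4 ^ n * t) * A"
  proof (intro mult_right_mono[OF _ A] mult_left_mono)
    have "(r * 2 ^ n)\<^sup>2 = r\<^sup>2 * 4 ^ n" by (simp add: power_mult_distrib power2_eq_square flip: power_mult_distrib)
    moreover have "heat_rate * (4 ^ n * t) \<le> r\<^sup>2 * (4 ^ n * t)" using heat_rate_bounds assms(2) by (intro mult_right_mono) auto
    ultimately show "exp (- t * (r * 2 ^ n)\<^sup>2) \<le> exp (- heat_rate * 4 ^ n * t)" by (simp add: mult_ac)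
  qed simp
  finally show ?thesis unfolding blk_heat .
qed

definition duhamel :: "(real \<Rightarrow> coeffs) \<Rightarrow> real \<Rightarrow> coeffs" where
  "duhamel F t k = integral {0..t} (\<lambda>s. heat (t - s) (F s) k)"

lemma heat_integrand_cont:
  assumes "continuous_on {0..t} (\<lambda>s. F s k)" shows "continuous_on {0..t} (\<lambda>s. heat (\<tau> - s) (F s) k)"
  unfolding heat_def by (intro continuous_intros assms)

lemma duhamel_has_integral:
  assumes "continuous_on {0..t} (\<lambda>s. F s k)" shows "((\<lambda>s. heat (t - s) (F s) k) has_integral duhamel F t k) {0..t}"
  unfolding duhamel_def by (intro integrable_integral integrable_continuous_interval heat_integrand_cont assms)

lemma tp_blk_duhamel:
  assumes "\<And>k. continuous_on {0..t} (\<lambda>s. F s k)"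
  shows "((\<lambda>s. tp (blk n (heat (t - s) (F s))) x) has_integral tp (blk n (duhamel F t)) x) {0..t}"
proof -
  have eq: "tp (blk n w) x = (\<Sum>k\<in>{k. \<Theta> n k \<noteq> 0}. (of_real (\<Theta> n k) * mode k x) * w k)" for w
    by (subst tp_eq[OF finite_symbol[of n]]) (auto simp: blk_def mult_ac)
  show ?thesis unfolding eq
    by (intro has_integral_sum finite_symbol has_integral_mult_right duhamel_has_integral assms)
qed

lemma exp_integral:
  assumes "a > (0::real)" "0 \<le> t"
  shows "((\<lambda>s. exp (- a * (t - s))) has_integral (1 - exp (- a * t)) / a) {0..t}"
proof -
  have "((\<lambda>s. exp (- a * (t - s))) has_integral (exp (- a * (t - t)) / a - exp (- a * (t - 0)) / a)) {0..t}"
    by (rule fundamental_theorem_of_calculus[OF assms(2)])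
      (use assms(1) in \<open>auto intro!: derivative_eq_intros simp: has_real_derivative_iff_has_vector_derivative[symmetric]\<close>)
  then show ?thesis by (simp add: diff_divide_distrib)
qed

text \<open>Integrate the decay of the block against the growth \<open>exp (\<mu> s)\<close> of the source.\<close>
lemma duhamel_blk_bound:
  assumes t: "0 \<le> t" and c: "\<And>k. continuous_on {0..t} (\<lambda>s. F s k)"
    and F: "\<And>s. s \<in> {0..t} \<Longrightarrow> besov \<gamma> (M * exp (\<mu> * s)) (F s)" and l: "\<mu> > 0"
  shows "cmod (tp (blk n (duhamel F t)) x) \<le> 648 * M * exp (\<mu> * t) * wt \<gamma> n / (heat_rate * 4 ^ n + \<mu>)"
proof -
  let ?a = "heat_rate * 4 ^ n + \<mu>"
  have a: "?a > 0" using heat_rate_bounds l by (intro add_pos_pos) auto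
  have M: "M \<ge> 0" using besov_nonneg[OF F[of 0]] t by simp
  let ?g = "\<lambda>s. (648 * M * exp (\<mu> * t) * wt \<gamma> n) * exp (- ?a * (t - s))"
  have g: "(?g has_integral (648 * M * exp (\<mu> * t) * wt \<gamma> n) * ((1 - exp (- ?a * t)) / ?a)) {0..t}"
    by (intro has_integral_mult_right exp_integral a t)
  have "cmod (tp (blk n (heat (t - s) (F s))) x) \<le> ?g s" if s: "s \<in> {0..t}" for s
  proof -
    have "cmod (tp (blk n (heat (t - s) (F s))) x) \<le> 648 * exp (- heat_rate * 4 ^ n * (t - s)) * (M * exp (\<mu> * s) * wt \<gamma> n)"
      by (rule blk_heat_decay[OF besovD(1)[OF F[OF s]]]) (use s in auto)
    also have "\<dots> = 648 * M * wt \<gamma> n * exp (- heat_rate * 4 ^ n * (t - s) + \<mu> * s)" by (simp only: exp_add mult_ac)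
    also have "- heat_rate * 4 ^ n * (t - s) + \<mu> * s = \<mu> * t + - ?a * (t - s)" by (simp add: algebra_simps)
    finally show ?thesis by (simp only: exp_add mult_ac)
  qed
  then have "cmod (integral {0..t} (\<lambda>s. tp (blk n (heat (t - s) (F s))) x)) \<le> integral {0..t} ?g"
    by (intro integral_norm_bound_integral has_integral_integrable[OF tp_blk_duhamel[OF c]] has_integral_integrable[OF g])
  then have "cmod (tp (blk n (duhamel F t)) x) \<le> (648 * M * exp (\<mu> * t) * wt \<gamma> n) * ((1 - exp (- ?a * t)) / ?a)"
    by (simp only: integral_unique[OF tp_blk_duhamel[OF c]] integral_unique[OF g])
  also have "\<dots> \<le> (648 * M * exp (\<mu> * t) * wt \<gamma> n) * (1 / ?a)"
    using M a by (intro mult_left_mono divide_right_mono) auto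
  finally show ?thesis by simp
qed

definition duhamel_const :: "real \<Rightarrow> real" where "duhamel_const \<sigma> = 648 * heat_rate powr (- \<sigma>)"

lemma duhamel_const_nonneg: "duhamel_const \<sigma> \<ge> 0" by (simp add: duhamel_const_def)

text \<open>Young's inequality: with \<open>x\<close> proportional to \<open>4\<^sup>n\<close>, the denominator \<open>x + \<mu>\<close> is at least \<open>x\<^sup>\<sigma> \<mu>\<^sup>1\<^sup>-\<^sup>\<sigma>\<close>.\<close>
lemma weight_gain:
  assumes s: "0 \<le> \<sigma>" "\<sigma> \<le> 1" and l: "\<mu> > 0"
  shows "wt \<gamma> n / (heat_rate * 4 ^ n + \<mu>) \<le> heat_rate powr (- \<sigma>) * \<mu> powr (- (1 - \<sigma>)) * wt (\<gamma> + 2 * \<sigma>) n"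
proof -
  let ?x = "heat_rate * 4 ^ n"
  have x: "?x > 0" using heat_rate_bounds by simp
  have young: "?x powr \<sigma> * \<mu> powr (1 - \<sigma>) \<le> ?x + \<mu>"
  proof -
    have "?x powr \<sigma> * \<mu> powr (1 - \<sigma>) \<le> (?x + \<mu>) powr \<sigma> * (?x + \<mu>) powr (1 - \<sigma>)"
      using x l s by (intro mult_mono powr_mono2) auto
    also have "\<dots> = ?x + \<mu>" using x l by (simp add: powr_add[symmetric])
    finally show ?thesis .
  qed
  have four: "(4::real) ^ n = 2 powr (2 * real n)"
  proof -
    have "(4::real) = 2 powr 2" by simp
    then show ?thesis by (metis powr_powr powr_realpow zero_less_numeral powr_gt_zero mult.commute)
  qed
  have w: "wt \<gamma> n \<le> (4 ^ n) powr \<sigma> * wt (\<gamma> + 2 * \<sigma>) n"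
  proof -
    have "- \<gamma> * (real n - 1) \<le> 2 * real n * \<sigma> + - (\<gamma> + 2 * \<sigma>) * (real n - 1)" using s by (simp add: algebra_simps)
    then show ?thesis unfolding four powr_powr wt_def powr_add[symmetric] by simp
  qed
  have "wt \<gamma> n / (?x + \<mu>) \<le> ((4 ^ n) powr \<sigma> * wt (\<gamma> + 2 * \<sigma>) n) / (?x powr \<sigma> * \<mu> powr (1 - \<sigma>))"
    using w young x l heat_rate_bounds by (intro frac_le) auto
  also have "\<dots> = heat_rate powr (- \<sigma>) * \<mu> powr (- (1 - \<sigma>)) * wt (\<gamma> + 2 * \<sigma>) n"
    using heat_rate_bounds l unfolding powr_minus by (simp add: powr_mult field_simps)
  finally show ?thesis .
qed

lemma herm_duhamel: assumes "\<And>s. s \<in> {0..t} \<Longrightarrow> herm (F s)" shows "herm (duhamel F t)"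
  unfolding herm_def
proof
  fix k
  have "integral {0..t} (\<lambda>s. heat (t - s) (F s) (- k)) = integral {0..t} (\<lambda>s. cnj (heat (t - s) (F s) k))"
    by (rule integral_cong) (use herm_heat[OF assms] in \<open>simp add: herm_def\<close>)
  then show "duhamel F t (- k) = cnj (duhamel F t k)" by (simp add: duhamel_def integral_cnj)
qed

text \<open>Schauder's estimate in the norm weighted by \<open>exp (- \<mu> t)\<close>. It gains \<open>2\<sigma>\<close> derivatives, and for
  \<open>\<sigma> < 1\<close> the constant tends to 0 as \<open>\<mu>\<close> grows.\<close>
lemma besov_duhamel:
  assumes t: "0 \<le> t" and c: "\<And>k. continuous_on {0..t} (\<lambda>s. F s k)"
    and F: "\<And>s. s \<in> {0..t} \<Longrightarrow> besov \<gamma> (M * exp (\<mu> * s)) (F s)" and l: "\<mu> > 0" and s: "0 \<le> \<sigma>" "\<sigma> \<le> 1"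
  shows "besov (\<gamma> + 2 * \<sigma>) (duhamel_const \<sigma> * \<mu> powr (- (1 - \<sigma>)) * M * exp (\<mu> * t)) (duhamel F t)"
  unfolding besov_def
proof (intro conjI allI)
  show "herm (duhamel F t)" by (rule herm_duhamel) (use besovD(2)[OF F] in auto)
  fix n x
  have M: "M \<ge> 0" using besov_nonneg[OF F[of 0]] t by simp
  have "cmod (tp (blk n (duhamel F t)) x) \<le> 648 * M * exp (\<mu> * t) * (wt \<gamma> n / (heat_rate * 4 ^ n + \<mu>))"
    using duhamel_blk_bound[OF t c F l] by simp
  also have "\<dots> \<le> 648 * M * exp (\<mu> * t) * (heat_rate powr (- \<sigma>) * \<mu> powr (- (1 - \<sigma>)) * wt (\<gamma> + 2 * \<sigma>) n)"
    using M by (intro mult_left_mono weight_gain s l) auto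
  finally show "cmod (tp (blk n (duhamel F t)) x) \<le> duhamel_const \<sigma> * \<mu> powr (- (1 - \<sigma>)) * M * exp (\<mu> * t) * wt (\<gamma> + 2 * \<sigma>) n"
    by (simp add: duhamel_const_def mult_ac)
qed

lemma heat_coeff: "heat (t - s) u k = of_real (exp (- t * (1 + 4 * pi\<^sup>2 * (norm (freq k))\<^sup>2))) * (of_real (exp (s * (1 + 4 * pi\<^sup>2 * (norm (freq k))\<^sup>2))) * u k)"
proof -
  have "exp (- (t - s) * m) = exp (- t * m) * exp (s * m)" for m :: real by (simp add: exp_add[symmetric] algebra_simps)
  then show ?thesis by (simp add: heat_def)
qed

lemma duhamel_coeff_cont:
  assumes "continuous_on {0..T} (\<lambda>s. F s k)" shows "continuous_on {0..T} (\<lambda>t. duhamel F t k)"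
proof -
  let ?m = "1 + 4 * pi\<^sup>2 * (norm (freq k))\<^sup>2"
  have "duhamel F t k = of_real (exp (- t * ?m)) * integral {0..t} (\<lambda>s. of_real (exp (s * ?m)) * F s k)" for t
    unfolding duhamel_def heat_coeff by (rule integral_mult_right)
  moreover have "continuous_on {0..T} (\<lambda>t. integral {0..t} (\<lambda>s. of_real (exp (s * ?m)) * F s k))"
    by (intro indefinite_integral_continuous_1 integrable_continuous_interval continuous_intros assms)
  ultimately show ?thesis by (simp add: continuous_intros)
qed

lemma duhamel_diff:
  assumes "\<And>k. continuous_on {0..t} (\<lambda>s. F s k)" "\<And>k. continuous_on {0..t} (\<lambda>s. G s k)"
  shows "duhamel F t - duhamel G t = duhamel (\<lambda>s. F s - G s) t"
proof
  fix k
  have "heat (t - s) (F s - G s) k = heat (t - s) (F s) k - heat (t - s) (G s) k" for s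
    by (simp add: heat_def algebra_simps)
  then show "(duhamel F t - duhamel G t) k = duhamel (\<lambda>s. F s - G s) t k"
    unfolding duhamel_def
    by (simp add: integral_diff integrable_continuous_interval heat_integrand_cont assms)
qed

text \<open>For sources with continuous modes, being a mild solution is a fixed point equation.\<close>
lemma mild_iff:
  assumes "\<And>k. continuous_on {0..T} (\<lambda>s. F s k)"
  shows "mild T \<phi> F u \<longleftrightarrow> (\<forall>t\<in>{0..T}. u t = (\<lambda>k. heat t \<phi> k + duhamel F t k))"
proof -
  have "((\<lambda>s. heat (t - s) (F s) k) has_integral (u t k - heat t \<phi> k)) {0..t} \<longleftrightarrow> u t k = heat t \<phi> k + duhamel F t k" if "t \<in> {0..T}" for t k
  proof -
    have "continuous_on {0..t} (\<lambda>s. F s k)" using continuous_on_subset[OF assms[of k]] that by auto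
    note H = duhamel_has_integral[of t F k, OF this]
    show ?thesis
    proof
      assume "((\<lambda>s. heat (t - s) (F s) k) has_integral (u t k - heat t \<phi> k)) {0..t}"
      then have "u t k - heat t \<phi> k = duhamel F t k" using H by (rule has_integral_unique)
      then show "u t k = heat t \<phi> k + duhamel F t k" by (simp add: algebra_simps)
    next
      assume "u t k = heat t \<phi> k + duhamel F t k"
      then have "u t k - heat t \<phi> k = duhamel F t k" by simp
      then show "((\<lambda>s. heat (t - s) (F s) k) has_integral (u t k - heat t \<phi> k)) {0..t}" using H by (simp only:)
    qed
  qed
  then show ?thesis unfolding mild_def fun_eq_iff by simp
qed

end

type_synonym curve = "real \<Rightarrow> coeffs"

section \<open>The clipped equation\<close>

context equation_frame
begin

text \<open>The radial retraction onto the ball of radius \<open>M\<close>.\<close>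
definition clip :: "real \<Rightarrow> coeffs \<Rightarrow> coeffs" where
  "clip M u = (if hnorm \<theta> \<beta> u \<le> M then u else (\<lambda>k. of_real (M / hnorm \<theta> \<beta> u) * u k))"

lemma besov_clip: assumes "finite_norm \<beta> u" "0 < M" shows "besov \<beta> M (clip M u)"
proof (cases "hnorm \<theta> \<beta> u \<le> M")
  case True then show ?thesis using besov_mono[OF finite_norm_besov[OF assms(1)] True] by (simp add: clip_def)
next
  case False
  have "besov \<beta> (\<bar>M / hnorm \<theta> \<beta> u\<bar> * hnorm \<theta> \<beta> u) (\<lambda>k. of_real (M / hnorm \<theta> \<beta> u) * u k)"
    by (rule besov_scale[OF finite_norm_besov[OF assms(1)]])
  moreover have "\<bar>M / hnorm \<theta> \<beta> u\<bar> * hnorm \<theta> \<beta> u = M" using False assms by (simp add: abs_mult)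
  ultimately show ?thesis using False by (simp add: clip_def)
qed

lemma clip_same: "hnorm \<theta> \<beta> u \<le> M \<Longrightarrow> clip M u = u" by (simp add: clip_def)

text \<open>The radial retraction of a normed space is Lipschitz with constant 2. By symmetry the first
  argument may be assumed to have the larger norm.\<close>
lemma besov_clip_diff:
  assumes u: "finite_norm \<beta> u" and v: "finite_norm \<beta> v" and M: "0 < M" and d: "besov \<beta> d (u - v)"
  shows "besov \<beta> (2 * d) (clip M u - clip M v)"
proof -
  let ?N = "hnorm \<theta> \<beta>"
  define fac where "fac w = (if ?N w \<le> M then 1 else M / ?N w)" for w
  have cl: "clip M w = (\<lambda>k. of_real (fac w) * w k)" for w by (simp add: clip_def fac_def fun_eq_iff)
  have wlog: "besov \<beta> (2 * d) (clip M u - clip M v)" if "?N v \<le> ?N u" "finite_norm \<beta> u" "finite_norm \<beta> v" "besov \<beta> d (u - v)" for u v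
  proof -
    have f: "0 \<le> fac u" "fac u \<le> 1" "fac u \<le> fac v" "0 \<le> fac v"
      using M that(1) hnorm_ge0[OF that(2)] hnorm_ge0[OF that(3)] by (auto simp: fac_def intro!: divide_left_mono mult_pos_pos)
    have d0: "0 \<le> d" using besov_nonneg[OF that(4)] .
    have gap: "?N u - ?N v \<le> d" using hnorm_diff_le[OF that(2,3)] hnorm_le[OF that(4)] by linarith
    have key: "\<bar>fac u - fac v\<bar> * ?N v \<le> d"
    proof (cases "?N u \<le> M")
      case True then show ?thesis using that(1) d0 by (simp add: fac_def)
    next
      case False
      then have Nu: "?N u > 0" using M by linarith
      show ?thesis
      proof (cases "?N v \<le> M")
        case True
        have "\<bar>fac u - fac v\<bar> * ?N v = (1 - M / ?N u) * ?N v" using False True Nu M by (simp add: fac_def abs_if)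
        also have "\<dots> \<le> (1 - M / ?N u) * ?N u" using that(1) False Nu by (intro mult_left_mono) auto
        also have "\<dots> = ?N u - M" using Nu by (simp add: field_simps)
        also have "\<dots> \<le> d" using True gap by linarith
        finally show ?thesis .
      next
        case v: False
        then have Nv: "?N v > 0" using M by linarith
        have "\<bar>fac u - fac v\<bar> * ?N v = (fac v - fac u) * ?N v" using f by (simp add: abs_if)
        also have "\<dots> = (M / ?N u) * (?N u - ?N v)" using False v Nu Nv by (simp add: fac_def field_simps)
        also have "\<dots> \<le> 1 * (?N u - ?N v)" using False Nu that(1) M by (intro mult_right_mono) auto
        also have "\<dots> \<le> d" using gap by simp
        finally show ?thesis .
      qed
    qed
    have e: "clip M u - clip M v = (\<lambda>k. of_real (fac u) * (u - v) k + of_real (fac u - fac v) * v k)"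
      unfolding cl by (auto simp: algebra_simps)
    have "besov \<beta> (\<bar>fac u\<bar> * d + \<bar>fac u - fac v\<bar> * ?N v) (clip M u - clip M v)"
      unfolding e by (rule besov_add[OF besov_scale[OF that(4)] besov_scale[OF finite_norm_besov[OF that(3)]]])
    moreover have "\<bar>fac u\<bar> * d \<le> 1 * d" using f d0 by (intro mult_right_mono) auto
    moreover have "\<bar>fac u\<bar> * d + \<bar>fac u - fac v\<bar> * ?N v \<le> 2 * d" using calculation(2) key by linarith
    ultimately show ?thesis using besov_mono by blast
  qed
  show ?thesis
  proof (cases "?N v \<le> ?N u")
    case True then show ?thesis using wlog u v d by blast
  next
    case False
    have "besov \<beta> (2 * d) (clip M v - clip M u)" using wlog[of u v] False u v besov_swap[OF d] by simp
    then show ?thesis by (rule besov_swap)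
  qed
qed

definition data_on :: "real \<Rightarrow> real \<Rightarrow> curve \<Rightarrow> curve \<Rightarrow> curve \<Rightarrow> curve \<Rightarrow> bool" where
  "data_on T A V Z0 Z1 Z2 \<longleftrightarrow> V \<in> CT \<theta> (1 - \<kappa>) T \<and> Z0 \<in> CT \<theta> \<gamma> T \<and> Z1 \<in> CT \<theta> \<gamma> T \<and> Z2 \<in> CT \<theta> \<gamma> T \<and>
     (\<forall>t\<in>{0..T}. data_bound A (V t) (Z0 t) (Z1 t) (Z2 t))"

definition clipped_rhs :: "real \<Rightarrow> curve \<Rightarrow> curve \<Rightarrow> curve \<Rightarrow> curve \<Rightarrow> curve \<Rightarrow> curve" where
  "clipped_rhs M V Z0 Z1 Z2 u = (\<lambda>t. rhs \<theta> (V t) (Z0 t) (Z1 t) (Z2 t) (clip M (u t)))"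

definition step :: "real \<Rightarrow> curve \<Rightarrow> curve \<Rightarrow> curve \<Rightarrow> curve \<Rightarrow> coeffs \<Rightarrow> curve \<Rightarrow> curve" where
  "step M V Z0 Z1 Z2 \<phi> u = (\<lambda>t k. heat t \<phi> k + duhamel (clipped_rhs M V Z0 Z1 Z2 u) t k)"

lemma data_bound_mono: "data_bound A V Z0 Z1 Z2 \<Longrightarrow> A \<le> B \<Longrightarrow> data_bound B V Z0 Z1 Z2"
  unfolding data_bound_def using besov_mono by blast

lemma data_onD: "data_on T A V Z0 Z1 Z2 \<Longrightarrow> t \<in> {0..T} \<Longrightarrow> data_bound A (V t) (Z0 t) (Z1 t) (Z2 t)"
  unfolding data_on_def by blast

lemma clipped_rhs_lipschitz:
  assumes D: "data_on T A V Z0 Z1 Z2" "data_on T A V' Z0' Z1' Z2'" and M: "0 < M" and t: "t \<in> {0..T}" "s \<in> {0..T}"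
    and d: "data_bound d (V t - V' s) (Z0 t - Z0' s) (Z1 t - Z1' s) (Z2 t - Z2' s)"
    and u: "finite_norm \<beta> (u t)" "finite_norm \<beta> (u' s)" "besov \<beta> e (u t - u' s)" and B: "A \<le> B" "M \<le> B"
  shows "besov \<gamma> (clip_const B * (d + 2 * e)) (clipped_rhs M V Z0 Z1 Z2 u t - clipped_rhs M V' Z0' Z1' Z2' u' s)"
  unfolding clipped_rhs_def
proof (rule rhs_lipschitz)
  have e: "0 \<le> e" "0 \<le> d" using besov_nonneg[OF u(3)] besov_nonneg d by (auto simp: data_bound_def)
  show "data_bound B (V t) (Z0 t) (Z1 t) (Z2 t)" "data_bound B (V' s) (Z0' s) (Z1' s) (Z2' s)"
    by (rule data_bound_mono[OF data_onD[OF D(1) t(1)] B(1)], rule data_bound_mono[OF data_onD[OF D(2) t(2)] B(1)])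
  show "data_bound (d + 2 * e) (V t - V' s) (Z0 t - Z0' s) (Z1 t - Z1' s) (Z2 t - Z2' s)"
    by (rule data_bound_mono[OF d]) (use e in simp)
  show "besov \<beta> B (clip M (u t))" "besov \<beta> B (clip M (u' s))"
    by (rule besov_mono[OF besov_clip[OF u(1) M] B(2)], rule besov_mono[OF besov_clip[OF u(2) M] B(2)])
  show "besov \<beta> (d + 2 * e) (clip M (u t) - clip M (u' s))"
    using besov_mono[OF besov_clip_diff[OF u(1,2) M u(3)]] e by simp
qed

lemma clipped_rhs_bound:
  assumes D: "data_on T A V Z0 Z1 Z2" and M: "0 < M" and t: "t \<in> {0..T}" and u: "finite_norm \<beta> (u t)" and B: "A \<le> B" "M \<le> B"
  shows "besov \<gamma> (clip_const B * B) (clipped_rhs M V Z0 Z1 Z2 u t)"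
  unfolding clipped_rhs_def
proof (rule rhs_bound)
  show "data_bound B (V t) (Z0 t) (Z1 t) (Z2 t)" by (rule data_bound_mono[OF data_onD[OF D t] B(1)])
  show "besov \<beta> B (clip M (u t))" by (rule besov_mono[OF besov_clip[OF u M] B(2)])
qed

lemma data_bound_diff_hnorm:
  assumes D: "data_on T A V Z0 Z1 Z2" and t: "t \<in> {0..T}" "s \<in> {0..T}"
  shows "data_bound (hnorm \<theta> (1 - \<kappa>) (V s - V t) + hnorm \<theta> \<gamma> (Z0 s - Z0 t) + hnorm \<theta> \<gamma> (Z1 s - Z1 t) + hnorm \<theta> \<gamma> (Z2 s - Z2 t))
    (V s - V t) (Z0 s - Z0 t) (Z1 s - Z1 t) (Z2 s - Z2 t)"
proof -
  have f: "finite_norm (1 - \<kappa>) (V s - V t)" "finite_norm \<gamma> (Z0 s - Z0 t)" "finite_norm \<gamma> (Z1 s - Z1 t)" "finite_norm \<gamma> (Z2 s - Z2 t)"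
    using D t unfolding data_on_def by (auto intro!: finite_norm_diff dest: CT_fin)
  note n = f[THEN hnorm_ge0]
  show ?thesis unfolding data_bound_def
    by (intro conjI besov_mono[OF finite_norm_besov[OF f(1)]] besov_mono[OF finite_norm_besov[OF f(2)]] besov_mono[OF finite_norm_besov[OF f(3)]] besov_mono[OF finite_norm_besov[OF f(4)]])
      (use n in linarith)+
qed

text \<open>The Lipschitz estimate, applied to the data and the unknown at two times.\<close>
lemma clipped_rhs_coeff_cont:
  assumes D: "data_on T A V Z0 Z1 Z2" and M: "0 < M" and u: "u \<in> CT \<theta> \<beta> T"
  shows "continuous_on {0..T} (\<lambda>s. clipped_rhs M V Z0 Z1 Z2 u s k)"
  unfolding continuous_on_def
proof
  fix t assume t: "t \<in> {0..T}"
  let ?d = "\<lambda>s. hnorm \<theta> (1 - \<kappa>) (V s - V t) + hnorm \<theta> \<gamma> (Z0 s - Z0 t) + hnorm \<theta> \<gamma> (Z1 s - Z1 t) + hnorm \<theta> \<gamma> (Z2 s - Z2 t)"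
  let ?e = "\<lambda>s. hnorm \<theta> \<beta> (u s - u t)"
  let ?B = "max A M"
  have "((\<lambda>s. clipped_rhs M V Z0 Z1 Z2 u s k - clipped_rhs M V Z0 Z1 Z2 u t k) \<longlongrightarrow> 0) (at t within {0..T})"
  proof (rule Lim_null_comparison)
    have "norm (clipped_rhs M V Z0 Z1 Z2 u s k - clipped_rhs M V Z0 Z1 Z2 u t k) \<le> clip_const ?B * (?d s + 2 * ?e s) * coeff_weight \<gamma> k" if s: "s \<in> {0..T}" for s
    proof -
      have "besov \<gamma> (clip_const ?B * (?d s + 2 * ?e s)) (clipped_rhs M V Z0 Z1 Z2 u s - clipped_rhs M V Z0 Z1 Z2 u t)"
        by (rule clipped_rhs_lipschitz[OF D D M s t data_bound_diff_hnorm[OF D t s]])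
          (use CT_fin[OF u s] CT_fin[OF u t] in \<open>auto intro!: finite_norm_besov finite_norm_diff\<close>)
      from coeff_bound[OF this, of k] show ?thesis by simp
    qed
    then show "\<forall>\<^sub>F s in at t within {0..T}. norm (clipped_rhs M V Z0 Z1 Z2 u s k - clipped_rhs M V Z0 Z1 Z2 u t k) \<le> clip_const ?B * (?d s + 2 * ?e s) * coeff_weight \<gamma> k"
      unfolding eventually_at_filter by (intro always_eventually) blast
    have "((\<lambda>s. clip_const ?B * (?d s + 2 * ?e s) * coeff_weight \<gamma> k) \<longlongrightarrow> clip_const ?B * ((0 + 0 + 0 + 0) + 2 * 0) * coeff_weight \<gamma> k) (at t within {0..T})"
      using D t u by (intro tendsto_intros CT_tendsto[of _ _ T]) (auto simp: data_on_def)
    then show "((\<lambda>s. clip_const ?B * (?d s + 2 * ?e s) * coeff_weight \<gamma> k) \<longlongrightarrow> 0) (at t within {0..T})" by simp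
  qed
  then show "((\<lambda>s. clipped_rhs M V Z0 Z1 Z2 u s k) \<longlongrightarrow> clipped_rhs M V Z0 Z1 Z2 u t k) (at t within {0..T})"
    by (simp add: LIM_zero_iff)
qed

lemma cont_sub: "continuous_on {0..T} f \<Longrightarrow> t \<in> {0..T} \<Longrightarrow> continuous_on {0..t} f" for T t :: real
  by (erule continuous_on_subset) auto

abbreviation \<sigma> :: real where "\<sigma> \<equiv> 1 - \<epsilon> / 4"

lemma heat_curve_coeff_cont: "continuous_on S (\<lambda>t. heat t \<phi> k)"
  unfolding heat_def by (intro continuous_intros)

text \<open>The integral term has regularity \<open>\<gamma> + 2 = \<beta> + \<kappa>\<close>, better than required, so its blocks are uniformly
  small; the heat flow does not increase the blocks of the initial value, which lies in the closure of
  the smooth functions.\<close>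
lemma duhamel_in_CT:
  assumes c: "\<And>k. continuous_on {0..T} (\<lambda>s. F s k)" and F: "\<And>s. s \<in> {0..T} \<Longrightarrow> besov \<gamma> M (F s)" and phi: "\<phi> \<in> Hoelder \<theta> \<beta>"
  shows "(\<lambda>t k. heat t \<phi> k + duhamel F t k) \<in> CT \<theta> \<beta> T"
proof (rule CT_I)
  have hp: "herm \<phi>" "little \<beta> \<phi>" using phi by (auto simp: Hoelder_iff)
  have hd: "herm (duhamel F t)" if "t \<in> {0..T}" for t by (rule herm_duhamel, rule besovD(2)[OF F]) (use that in auto)
  show "herm (\<lambda>k. heat t \<phi> k + duhamel F t k)" if "t \<in> {0..T}" for t
    by (intro herm_arith herm_heat hp hd that)
  show "continuous_on {0..T} (\<lambda>t. heat t \<phi> k + duhamel F t k)" for k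
    by (intro continuous_on_add heat_curve_coeff_cont duhamel_coeff_cont c)
  fix \<delta> :: real assume d: "\<delta> > 0"
  define C where "C = duhamel_const 1 * M * exp T"
  have b: "besov (\<gamma> + 2) C (duhamel F t)" if t: "t \<in> {0..T}" for t
  proof -
    have M: "M \<ge> 0" using besov_nonneg[OF F[OF t]] .
    have "besov (\<gamma> + 2 * 1) (duhamel_const 1 * 1 powr (- (1 - 1)) * M * exp (1 * t)) (duhamel F t)"
    proof (rule besov_duhamel)
      show "continuous_on {0..t} (\<lambda>s. F s k)" for k using c t by (rule cont_sub)
      show "besov \<gamma> (M * exp (1 * s)) (F s)" if "s \<in> {0..t}" for s
        by (rule besov_mono[OF F]) (use that t M mult_left_mono[of 1 "exp s" M] in auto)
    qed (use t in auto)
    moreover have "duhamel_const 1 * 1 powr (- (1 - 1)) * M * exp (1 * t) \<le> C"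
      using t M duhamel_const_nonneg[of 1] unfolding C_def by (auto intro!: mult_left_mono)
    ultimately show ?thesis using besov_mono[of "\<gamma> + 2 * 1"] by simp
  qed
  obtain N1 where N1: "\<And>n x. n \<ge> N1 \<Longrightarrow> cmod (tp (blk n \<phi>) x) \<le> \<delta> / 2 * wt \<beta> n"
    using hp(2)[unfolded little_def, rule_format, of "\<delta> / 2"] d by auto
  have "(\<lambda>n::nat. C * 2 powr (- \<kappa> * (real n - 1))) \<longlonglongrightarrow> C * 0"
    using wt_lim[of \<kappa> C] eps by (simp add: wt_def)
  then have "\<forall>\<^sub>F n in sequentially. C * 2 powr (- \<kappa> * (real n - 1)) < \<delta> / 2"
    by (rule order_tendstoD(2)) (use d in simp)
  then obtain N2 where N2: "\<And>n. n \<ge> N2 \<Longrightarrow> C * 2 powr (- \<kappa> * (real n - 1)) < \<delta> / 2" by (auto simp: eventually_sequentially)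
  have "cmod (tp (blk n (\<lambda>k. heat t \<phi> k + duhamel F t k)) x) \<le> \<delta> * wt \<beta> n" if t: "t \<in> {0..T}" and n: "n \<ge> max N1 N2" for t n x
  proof -
    have 1: "cmod (tp (blk n (heat t \<phi>)) x) \<le> \<delta> / 2 * wt \<beta> n"
    proof -
      have "cmod (tp (heat t (blk n \<phi>)) x) \<le> exp (- t) * (\<delta> / 2 * wt \<beta> n)"
        unfolding heat_eq by (rule multiplierD[OF multiplier_heat finsupp_blk N1]) (use t n in auto)
      also have "\<dots> \<le> 1 * (\<delta> / 2 * wt \<beta> n)" using t d by (intro mult_right_mono) auto
      finally show ?thesis by (simp add: blk_heat)
    qed
    (* The surplus regularity is a decaying factor. *)
    have w: "wt (\<gamma> + 2) n = 2 powr (- \<kappa> * (real n - 1)) * wt \<beta> n"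
    proof -
      have "- ((\<gamma> + 2) * (real n - 1)) = - \<kappa> * (real n - 1) + - (\<beta> * (real n - 1))" by (simp add: field_simps)
      moreover have "- ((\<gamma> + 2) * (real n - 1)) = - (\<gamma> + 2) * (real n - 1)" "- (\<beta> * (real n - 1)) = - \<beta> * (real n - 1)"
        by (rule minus_mult_left)+
      ultimately show ?thesis unfolding wt_def powr_add[symmetric] by metis
    qed
    have "cmod (tp (blk n (duhamel F t)) x) \<le> C * 2 powr (- \<kappa> * (real n - 1)) * wt \<beta> n"
      using besovD(1)[OF b[OF t], of n x] unfolding w by (simp add: mult.assoc)
    also have "\<dots> \<le> \<delta> / 2 * wt \<beta> n" using N2[of n] n by (intro mult_right_mono) auto
    finally have 2: "cmod (tp (blk n (duhamel F t)) x) \<le> \<delta> / 2 * wt \<beta> n" .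
    show ?thesis unfolding tp_blk_arith using norm_triangle_ineq[of "tp (blk n (heat t \<phi>)) x" "tp (blk n (duhamel F t)) x"] 1 2 by simp
  qed
  then show "\<exists>N. \<forall>t\<in>{0..T}. \<forall>n\<ge>N. \<forall>x. cmod (tp (blk n (\<lambda>k. heat t \<phi> k + duhamel F t k)) x) \<le> \<delta> * wt \<beta> n" by blast
qed

lemma step_CT:
  assumes D: "data_on T A V Z0 Z1 Z2" and M: "0 < M" and u: "u \<in> CT \<theta> \<beta> T" and phi: "\<phi> \<in> Hoelder \<theta> \<beta>"
  shows "step M V Z0 Z1 Z2 \<phi> u \<in> CT \<theta> \<beta> T"
  unfolding step_def
  by (rule duhamel_in_CT[OF clipped_rhs_coeff_cont[OF D M u] clipped_rhs_bound[where B = "max A M", OF D M _ CT_fin[OF u]] phi]) auto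

text \<open>In the norm weighted by \<open>exp (- \<mu> t)\<close> the integral operator is small for large \<open>\<mu>\<close>.\<close>
lemma small_weight: assumes "C \<ge> 0" shows "\<exists>\<mu>>0. duhamel_const \<sigma> * \<mu> powr (- (1 - \<sigma>)) * C \<le> 1/4"
proof -
  let ?g = "1 - \<sigma>"
  have g: "?g > 0" using eps by simp
  define B where "B = 4 * duhamel_const \<sigma> * C + 1"
  have B: "B > 0" using assms duhamel_const_nonneg[of \<sigma>] by (simp add: B_def add_nonneg_pos)
  let ?m = "B powr (1 / ?g)"
  have "?m powr (- ?g) = 1 / B" using B g by (simp add: powr_powr powr_minus_divide)
  then have "duhamel_const \<sigma> * ?m powr (- ?g) * C = duhamel_const \<sigma> * C / B" by simp
  also have "\<dots> \<le> 1/4" using B by (simp add: B_def pos_divide_le_eq)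
  finally show ?thesis using B by (intro exI[of _ ?m]) simp
qed

text \<open>The regularity to be gained is less than the two derivatives that the semigroup offers.\<close>
lemma sigma: "\<gamma> + 2 * \<sigma> = \<beta>" "0 \<le> \<sigma>" "\<sigma> \<le> 1" using eps by auto

lemma step_diff:
  assumes D: "data_on T A V Z0 Z1 Z2" "data_on T A V' Z0' Z1' Z2'" and M: "0 < M" and B: "A \<le> B" "M \<le> B"
    and d: "\<And>t. t \<in> {0..T} \<Longrightarrow> data_bound d (V t - V' t) (Z0 t - Z0' t) (Z1 t - Z1' t) (Z2 t - Z2' t)" "0 \<le> d"
    and u: "u \<in> CT \<theta> \<beta> T" "u' \<in> CT \<theta> \<beta> T" and m: "0 \<le> m"
    and e: "\<And>t. t \<in> {0..T} \<Longrightarrow> besov \<beta> (m * exp (\<mu> * t)) (u t - u' t)"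
    and phi: "besov \<beta> p (\<phi> - \<phi>')" and mu: "\<mu> > 0" and t: "t \<in> {0..T}"
  shows "besov \<beta> (p + duhamel_const \<sigma> * \<mu> powr (- (1 - \<sigma>)) * (clip_const B * (d + 2 * m)) * exp (\<mu> * t))
    (step M V Z0 Z1 Z2 \<phi> u t - step M V' Z0' Z1' Z2' \<phi>' u' t)"
proof -
  let ?F = "clipped_rhs M V Z0 Z1 Z2 u" and ?G = "clipped_rhs M V' Z0' Z1' Z2' u'"
  have cF: "continuous_on {0..t} (\<lambda>s. ?F s k)" and cG: "continuous_on {0..t} (\<lambda>s. ?G s k)" for k
    using cont_sub[OF clipped_rhs_coeff_cont[OF D(1) M u(1)] t] cont_sub[OF clipped_rhs_coeff_cont[OF D(2) M u(2)] t] by auto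
  have cc: "continuous_on {0..t} (\<lambda>s. (?F s - ?G s) k)" for k
    using continuous_on_diff[OF cF[of k] cG[of k]] by simp
  have bnd: "besov \<gamma> ((clip_const B * (d + 2 * m)) * exp (\<mu> * s)) (?F s - ?G s)" if s: "s \<in> {0..t}" for s
  proof -
    have sT: "s \<in> {0..T}" using s t by auto
    have cB: "clip_const B \<ge> 0" using B M by (intro clip_const_nonneg) linarith
    have "besov \<gamma> (clip_const B * (d + 2 * (m * exp (\<mu> * s)))) (?F s - ?G s)"
      by (rule clipped_rhs_lipschitz[of T A V Z0 Z1 Z2 V' Z0' Z1' Z2' M s s d u u' "m * exp (\<mu> * s)" B, OF D M sT sT d(1)[OF sT] CT_fin[OF u(1) sT] CT_fin[OF u(2) sT] e[OF sT] B])
    moreover have "clip_const B * (d + 2 * (m * exp (\<mu> * s))) \<le> (clip_const B * (d + 2 * m)) * exp (\<mu> * s)"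
    proof -
      have "1 \<le> exp (\<mu> * s)" using mu s by simp
      then have "d * 1 \<le> d * exp (\<mu> * s)" using d(2) by (rule mult_left_mono)
      then have "d + 2 * (m * exp (\<mu> * s)) \<le> (d + 2 * m) * exp (\<mu> * s)" by (simp add: algebra_simps)
      then show ?thesis using cB by (simp add: mult.assoc mult_left_mono)
    qed
    ultimately show ?thesis by (rule besov_mono)
  qed
  have "besov (\<gamma> + 2 * \<sigma>) (duhamel_const \<sigma> * \<mu> powr (- (1 - \<sigma>)) * (clip_const B * (d + 2 * m)) * exp (\<mu> * t)) (duhamel (\<lambda>s. ?F s - ?G s) t)"
    by (rule besov_duhamel[OF _ cc bnd mu sigma(2,3)]) (use t in auto)
  then have 1: "besov \<beta> (duhamel_const \<sigma> * \<mu> powr (- (1 - \<sigma>)) * (clip_const B * (d + 2 * m)) * exp (\<mu> * t)) (duhamel ?F t - duhamel ?G t)"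
    unfolding sigma(1) duhamel_diff[OF cF cG] .
  have 2: "besov \<beta> p (heat t (\<phi> - \<phi>'))" using besov_heat[OF phi] t by simp
  have "step M V Z0 Z1 Z2 \<phi> u t - step M V' Z0' Z1' Z2' \<phi>' u' t = (\<lambda>k. heat t (\<phi> - \<phi>') k + (duhamel ?F t - duhamel ?G t) k)"
    by (rule ext) (simp add: step_def heat_def algebra_simps)
  then show ?thesis using besov_add[OF 2 1] by simp
qed

lemma CT_hnorm_bound: assumes "u \<in> CT \<theta> \<alpha> T" "0 \<le> T" obtains C where "C \<ge> 0" "\<And>t. t \<in> {0..T} \<Longrightarrow> besov \<alpha> C (u t)"
proof
  show "0 \<le> CT_norm \<theta> \<alpha> T u"
    using hnorm_le_CT_norm[OF assms(1), of 0] hnorm_ge0[OF CT_fin[OF assms(1), of 0]] assms(2) by simp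
  show "besov \<alpha> (CT_norm \<theta> \<alpha> T u) (u t)" if "t \<in> {0..T}" for t
    by (rule besov_mono[OF finite_norm_besov[OF CT_fin[OF assms(1) that]] hnorm_le_CT_norm[OF assms(1) that]])
qed

definition trunc_sol :: "real \<Rightarrow> real \<Rightarrow> curve \<Rightarrow> curve \<Rightarrow> curve \<Rightarrow> curve \<Rightarrow> coeffs \<Rightarrow> curve \<Rightarrow> bool" where
  "trunc_sol M T V Z0 Z1 Z2 \<phi> u \<longleftrightarrow> u \<in> CT \<theta> \<beta> T \<and> (\<forall>t\<in>{0..T}. u t = step M V Z0 Z1 Z2 \<phi> u t)"

text \<open>Both curves are fixed points, and the weight \<open>\<mu>\<close> makes the fixed point map contracting with
  constant \<open>1/2\<close> up to the perturbation of the data. The weighted distance \<open>m\<close> of the curves hence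
  satisfies \<open>m \<le> p + (d + 2 m) / 4\<close>.\<close>
lemma trunc_stability:
  assumes M: "0 < M"
  shows "\<exists>C\<ge>0. \<forall>V Z0 Z1 Z2 V' Z0' Z1' Z2' \<phi> \<phi>' u u' d p. data_on T A V Z0 Z1 Z2 \<longrightarrow> data_on T A V' Z0' Z1' Z2' \<longrightarrow>
     (\<forall>t\<in>{0..T}. data_bound d (V t - V' t) (Z0 t - Z0' t) (Z1 t - Z1' t) (Z2 t - Z2' t)) \<longrightarrow> 0 \<le> d \<longrightarrow> besov \<beta> p (\<phi> - \<phi>') \<longrightarrow>
     trunc_sol M T V Z0 Z1 Z2 \<phi> u \<longrightarrow> trunc_sol M T V' Z0' Z1' Z2' \<phi>' u' \<longrightarrow>
     (\<forall>t\<in>{0..T}. besov \<beta> (C * (p + d)) (u t - u' t))"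
proof -
  define B where "B = max A M"
  have cB: "clip_const B \<ge> 0" unfolding B_def using M by (intro clip_const_nonneg) linarith
  obtain \<mu> where mu: "\<mu> > 0" "duhamel_const \<sigma> * \<mu> powr (- (1 - \<sigma>)) * clip_const B \<le> 1/4" using small_weight[OF cB] by blast
  let ?q = "duhamel_const \<sigma> * \<mu> powr (- (1 - \<sigma>)) * clip_const B"
  have main: "besov \<beta> (2 * exp (\<mu> * T) * (p + d)) (u t - u' t)"
    if D: "data_on T A V Z0 Z1 Z2" "data_on T A V' Z0' Z1' Z2'"
      and d: "\<forall>t\<in>{0..T}. data_bound d (V t - V' t) (Z0 t - Z0' t) (Z1 t - Z1' t) (Z2 t - Z2' t)" "0 \<le> d" and p: "besov \<beta> p (\<phi> - \<phi>')"
      and s: "trunc_sol M T V Z0 Z1 Z2 \<phi> u" "trunc_sol M T V' Z0' Z1' Z2' \<phi>' u'" and t: "t \<in> {0..T}"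
    for V Z0 Z1 Z2 V' Z0' Z1' Z2' \<phi> \<phi>' u u' d p t
  proof -
    have T: "0 \<le> T" using t by simp
    have u: "u \<in> CT \<theta> \<beta> T" "u' \<in> CT \<theta> \<beta> T" using s by (auto simp: trunc_sol_def)
    obtain C0 where C0: "C0 \<ge> 0" "\<And>t. t \<in> {0..T} \<Longrightarrow> besov \<beta> C0 (u t - u' t)"
      using CT_hnorm_bound[OF CT_diff[OF u] T] by blast
    (* The distance of the two curves in the weighted norm. *)
    define m where "m = (SUP t\<in>{0..T}. exp (- \<mu> * t) * hnorm \<theta> \<beta> (u t - u' t))"
    have bdd: "bdd_above ((\<lambda>t. exp (- \<mu> * t) * hnorm \<theta> \<beta> (u t - u' t)) ` {0..T})"
    proof (rule bdd_aboveI2)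
      fix t assume t: "t \<in> {0..T}"
      have "exp (- \<mu> * t) * hnorm \<theta> \<beta> (u t - u' t) \<le> 1 * C0"
        using hnorm_le[OF C0(2)[OF t]] mu t hnorm_ge0[OF besov_finite_norm[OF C0(2)[OF t]]] by (intro mult_mono) auto
      then show "exp (- \<mu> * t) * hnorm \<theta> \<beta> (u t - u' t) \<le> C0" by simp
    qed
    have le_m: "hnorm \<theta> \<beta> (u t - u' t) \<le> m * exp (\<mu> * t)" if "t \<in> {0..T}" for t
    proof -
      have "exp (- \<mu> * t) * hnorm \<theta> \<beta> (u t - u' t) \<le> m" unfolding m_def by (rule cSUP_upper[OF that bdd])
      then have "exp (\<mu> * t) * (exp (- \<mu> * t) * hnorm \<theta> \<beta> (u t - u' t)) \<le> exp (\<mu> * t) * m" by (intro mult_left_mono) auto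
      then show ?thesis by (simp add: mult.assoc[symmetric] exp_add[symmetric] mult.commute)
    qed
    have m0: "0 \<le> m" using le_m[of 0] hnorm_ge0[OF besov_finite_norm[OF C0(2), of 0]] T by simp
    have bm: "besov \<beta> (m * exp (\<mu> * t)) (u t - u' t)" if "t \<in> {0..T}" for t
      by (rule besov_mono[OF finite_norm_besov[OF besov_finite_norm[OF C0(2)[OF that]]] le_m[OF that]])
    have p0: "0 \<le> p" by (rule besov_nonneg[OF p])
    have "m \<le> p + (d + 2 * m) / 4"
    proof -
      have X: "exp (- \<mu> * t) * hnorm \<theta> \<beta> (u t - u' t) \<le> p + (d + 2 * m) / 4" if t: "t \<in> {0..T}" for t
      proof -
        have "besov \<beta> (p + duhamel_const \<sigma> * \<mu> powr (- (1 - \<sigma>)) * (clip_const B * (d + 2 * m)) * exp (\<mu> * t)) (step M V Z0 Z1 Z2 \<phi> u t - step M V' Z0' Z1' Z2' \<phi>' u' t)"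
          by (rule step_diff[OF D M _ _ _ d(2) u m0 bm p mu(1) t]) (use d(1) in \<open>auto simp: B_def\<close>)
        then have "hnorm \<theta> \<beta> (u t - u' t) \<le> p + ?q * (d + 2 * m) * exp (\<mu> * t)"
          using s t hnorm_le by (auto simp: trunc_sol_def mult.assoc)
        also have "\<dots> \<le> p * exp (\<mu> * t) + 1/4 * (d + 2 * m) * exp (\<mu> * t)"
        proof (intro add_mono mult_right_mono)
          show "p \<le> p * exp (\<mu> * t)" using mult_left_mono[of 1 "exp (\<mu> * t)" p] p0 mu t by simp
        qed (use mu d m0 in auto)
        also have "\<dots> = (p + (d + 2 * m) / 4) * exp (\<mu> * t)" by (simp add: algebra_simps)
        finally have "exp (- \<mu> * t) * hnorm \<theta> \<beta> (u t - u' t) \<le> exp (- \<mu> * t) * ((p + (d + 2 * m) / 4) * exp (\<mu> * t))"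
          by (intro mult_left_mono) auto
        also have "\<dots> = (p + (d + 2 * m) / 4) * (exp (- \<mu> * t) * exp (\<mu> * t))" by (simp only: mult_ac)
        also have "exp (- \<mu> * t) * exp (\<mu> * t) = 1" by (simp add: exp_add[symmetric])
        finally show ?thesis by (simp only: mult_1_right)
      qed
      have "(SUP t\<in>{0..T}. exp (- \<mu> * t) * hnorm \<theta> \<beta> (u t - u' t)) \<le> p + (d + 2 * m) / 4"
        by (rule cSUP_least) (use T in simp, rule X)
      then show ?thesis by (simp only: m_def[symmetric])
    qed
    then have "4 * m \<le> 4 * p + d + 2 * m" by (simp add: field_simps)
    then have "m \<le> 2 * (p + d)" using d(2) p0 by (simp add: algebra_simps)
    then have "m * exp (\<mu> * t) \<le> (2 * (p + d)) * exp (\<mu> * T)" using m0 mu t by (intro mult_mono) auto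
    then show ?thesis using besov_mono[OF bm[OF t]] by (simp only: mult_ac)
  qed
  show ?thesis
  proof (intro exI[of _ "2 * exp (\<mu> * T)"] conjI)
    show "0 \<le> 2 * exp (\<mu> * T)" by simp
  qed (intro allI impI ballI, rule main; assumption)
qed

lemma besov_zero_eq: assumes "besov \<alpha> 0 (u - v)" shows "u = v"
proof
  fix k
  have "cmod ((u - v) k) \<le> 0 * coeff_weight \<alpha> k" by (rule coeff_bound[OF assms])
  then show "u k = v k" by simp
qed

lemma data_bound_refl: "data_bound 0 (V - V) (Z0 - Z0) (Z1 - Z1) (Z2 - Z2)"
proof -
  have "u - u = (\<lambda>k. 0)" for u :: coeffs by (simp add: fun_eq_iff)
  then show ?thesis by (simp add: data_bound_def besov_zero)
qed

lemma trunc_unique: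
  assumes "0 < M" "data_on T A V Z0 Z1 Z2" "trunc_sol M T V Z0 Z1 Z2 \<phi> u" "trunc_sol M T V Z0 Z1 Z2 \<phi> v" "t \<in> {0..T}"
  shows "u t = v t"
proof -
  have z: "\<phi> - \<phi> = (\<lambda>k. 0)" by (simp add: fun_eq_iff)
  obtain C where "\<forall>V Z0 Z1 Z2 V' Z0' Z1' Z2' \<phi> \<phi>' u u' d p. data_on T A V Z0 Z1 Z2 \<longrightarrow> data_on T A V' Z0' Z1' Z2' \<longrightarrow>
     (\<forall>t\<in>{0..T}. data_bound d (V t - V' t) (Z0 t - Z0' t) (Z1 t - Z1' t) (Z2 t - Z2' t)) \<longrightarrow> 0 \<le> d \<longrightarrow> besov \<beta> p (\<phi> - \<phi>') \<longrightarrow>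
     trunc_sol M T V Z0 Z1 Z2 \<phi> u \<longrightarrow> trunc_sol M T V' Z0' Z1' Z2' \<phi>' u' \<longrightarrow>
     (\<forall>t\<in>{0..T}. besov \<beta> (C * (p + d)) (u t - u' t))"
    using trunc_stability[OF assms(1), of T A] by blast
  from this[rule_format, OF assms(2,2) data_bound_refl order_refl _ assms(3,4,5), of 0] have "besov \<beta> (C * (0 + 0)) (u t - v t)"
    by (simp add: z besov_zero)
  then show ?thesis using besov_zero_eq by simp
qed

text \<open>Picard iteration in the weighted norm. As the clipped equation is globally Lipschitz, the length of
  the time interval is arbitrary.\<close>
lemma trunc_exists:
  assumes M: "0 < M" and D: "data_on T A V Z0 Z1 Z2" and phi: "\<phi> \<in> Hoelder \<theta> \<beta>" and T: "0 \<le> T"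
  shows "\<exists>u. trunc_sol M T V Z0 Z1 Z2 \<phi> u"
proof -
  define B where "B = max A M"
  have cB: "clip_const B \<ge> 0" unfolding B_def using M by (intro clip_const_nonneg) linarith
  obtain \<mu> where mu: "\<mu> > 0" "duhamel_const \<sigma> * \<mu> powr (- (1 - \<sigma>)) * clip_const B \<le> 1/4" using small_weight[OF cB] by blast
  let ?S = "step M V Z0 Z1 Z2 \<phi>"
  define U where "U n = (?S ^^ n) (\<lambda>t k. heat t \<phi> k + duhamel (\<lambda>s k. 0) t k)" for n
  have U_Suc: "U (Suc n) = ?S (U n)" for n by (simp add: U_def)
  have U_CT: "U n \<in> CT \<theta> \<beta> T" for n
  proof (induction n)
    case 0 then show ?case unfolding U_def using duhamel_in_CT[of T "\<lambda>s k. 0" 0 \<phi>] phi by (simp add: besov_zero)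
  next
    case (Suc n) then show ?case unfolding U_Suc by (rule step_CT[OF D M _ phi])
  qed
  have pz: "besov \<beta> 0 (\<phi> - \<phi>)" using besov_zero[of \<beta>] by (simp add: fun_diff_def)
  have contr: "besov \<beta> (m / 2 * exp (\<mu> * t)) (?S u t - ?S u' t)"
    if u: "u \<in> CT \<theta> \<beta> T" "u' \<in> CT \<theta> \<beta> T" and m: "0 \<le> m" and e: "\<And>t. t \<in> {0..T} \<Longrightarrow> besov \<beta> (m * exp (\<mu> * t)) (u t - u' t)" and t: "t \<in> {0..T}"
    for u u' m t
  proof -
    have "besov \<beta> (0 + duhamel_const \<sigma> * \<mu> powr (- (1 - \<sigma>)) * (clip_const B * (0 + 2 * m)) * exp (\<mu> * t)) (?S u t - ?S u' t)"
      by (rule step_diff[OF D D M _ _ data_bound_refl order_refl u m e pz mu(1) t]) (auto simp: B_def)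
    moreover have "0 + duhamel_const \<sigma> * \<mu> powr (- (1 - \<sigma>)) * (clip_const B * (0 + 2 * m)) * exp (\<mu> * t) \<le> m / 2 * exp (\<mu> * t)"
      using mult_right_mono[OF mu(2), of "2 * m * exp (\<mu> * t)"] m by (simp add: mult_ac)
    ultimately show ?thesis by (rule besov_mono)
  qed
  obtain C0 where C0: "C0 \<ge> 0" "\<And>t. t \<in> {0..T} \<Longrightarrow> besov \<beta> C0 (U 1 t - U 0 t)"
    using CT_hnorm_bound[OF CT_diff[OF U_CT U_CT] T, of 1 0] by blast
  (* Successive iterates approach each other geometrically. *)
  have inc: "besov \<beta> (C0 / 2 ^ n * exp (\<mu> * t)) (U (Suc n) t - U n t)" if "t \<in> {0..T}" for n t
    using that
  proof (induction n arbitrary: t)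
    case 0
    have "C0 * 1 \<le> C0 * exp (\<mu> * t)" using C0 mu 0 by (intro mult_left_mono) auto
    then have "besov \<beta> (C0 * exp (\<mu> * t)) (U 1 t - U 0 t)" using besov_mono[OF C0(2)[OF 0]] by simp
    then show ?case by (simp only: power_0 div_by_1 One_nat_def)
  next
    case (Suc n)
    have "besov \<beta> (C0 / 2 ^ n / 2 * exp (\<mu> * t)) (?S (U (Suc n)) t - ?S (U n) t)"
      by (rule contr[OF U_CT U_CT _ Suc.IH Suc.prems]) (use C0 in auto)
    moreover have "C0 / 2 ^ n / 2 = C0 / 2 ^ Suc n" by simp
    ultimately show ?case by (simp only: U_Suc)
  qed
  define E where "E = 2 * C0 * exp (\<mu> * T)"
  have E0: "E \<ge> 0" using C0 by (simp add: E_def)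
  have gap: "besov \<beta> (E / 2 ^ n - E / 2 ^ m) (U m t - U n t)" if t: "t \<in> {0..T}" and nm: "n \<le> m" for n m t
    using nm
  proof (induction m rule: dec_induct)
    case base
    then show ?case using besov_zero[of \<beta>] by (simp add: fun_diff_def)
  next
    case (step m)
    have "C0 / 2 ^ m * exp (\<mu> * t) \<le> C0 / 2 ^ m * exp (\<mu> * T)" using C0 mu t by (intro mult_left_mono) auto
    also have "\<dots> = E / 2 ^ m - E / 2 ^ Suc m" by (simp add: E_def field_simps)
    finally have "besov \<beta> (E / 2 ^ m - E / 2 ^ Suc m) (U (Suc m) t - U m t)" using besov_mono[OF inc[OF t]] by blast
    from besov_trans[OF this step.IH] have "besov \<beta> (E / 2 ^ m - E / 2 ^ Suc m + (E / 2 ^ n - E / 2 ^ m)) (U (Suc m) t - U n t)" .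
    moreover have "E / 2 ^ m - E / 2 ^ Suc m + (E / 2 ^ n - E / 2 ^ m) = E / 2 ^ n - E / 2 ^ Suc m" by simp
    ultimately show ?case by (simp only:)
  qed
  have gap': "besov \<beta> (E / 2 ^ n) (U m t - U n t)" if "t \<in> {0..T}" "n \<le> m" for n m t
    by (rule besov_mono[OF gap[OF that]]) (use E0 in simp)
  have elim0: "(\<lambda>n. E * (1/2) ^ n) \<longlonglongrightarrow> E * 0" by (rule tendsto_mult[OF tendsto_const LIMSEQ_power_zero]) simp
  have elim1: "(\<lambda>n. E / 2 ^ n) \<longlonglongrightarrow> 0" using elim0 unfolding power_one_over mult_zero_right times_divide_eq_right mult_1_right .
  define u where "u t k = lim (\<lambda>n. U n t k)" for t k
  have conv: "(\<lambda>n. U n t k) \<longlonglongrightarrow> u t k" if t: "t \<in> {0..T}" for t k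
  proof -
    have "Cauchy (\<lambda>n. U n t k)"
    proof (rule metric_CauchyI)
      fix e :: real assume e: "e > 0"
      have "(\<lambda>n. E / 2 ^ n * coeff_weight \<beta> k) \<longlonglongrightarrow> 0 * coeff_weight \<beta> k" by (intro tendsto_intros elim1)
      then have "\<forall>\<^sub>F n in sequentially. E / 2 ^ n * coeff_weight \<beta> k < e / 2" by (intro order_tendstoD(2)) (use e in auto)
      then obtain N where N: "E / 2 ^ N * coeff_weight \<beta> k < e / 2" by (auto simp: eventually_sequentially)
      have "dist (U m t k) (U N t k) < e / 2" if "m \<ge> N" for m
        using le_less_trans[OF coeff_bound[OF gap'[OF t that]] N] by (simp add: dist_norm)
      then show "\<exists>M. \<forall>m\<ge>M. \<forall>n\<ge>M. dist (U m t k) (U n t k) < e"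
        by (intro exI[of _ N] allI impI) (rule dist_triangle_half_l[of _ "U N t k"])
    qed
    then show ?thesis unfolding u_def by (simp add: Cauchy_convergent_iff convergent_LIMSEQ_iff)
  qed
  have ud: "besov \<beta> (E / 2 ^ n) (U n t - u t)" if t: "t \<in> {0..T}" for n t
  proof -
    have "besov \<beta> (E / 2 ^ n) (u t - U n t)"
    proof (rule besov_limit)
      show "besov \<beta> (E / 2 ^ n) (U (m + n) t - U n t)" for m by (rule gap'[OF t]) simp
      show "(\<lambda>m. (U (m + n) t - U n t) k) \<longlonglongrightarrow> (u t - U n t) k" for k
        using tendsto_diff[OF LIMSEQ_ignore_initial_segment[OF conv[OF t]] tendsto_const, of n k "U n t k"] by simp
    qed
    then show ?thesis by (rule besov_swap)
  qed
  have u_CT: "u \<in> CT \<theta> \<beta> T"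
  proof (rule CT_limit[OF U_CT _ ud elim1])
    show "herm (u t)" if "t \<in> {0..T}" for t
    proof -
      have "herm (U 0 t - (U 0 t - u t))" using besovD(2)[OF ud[OF that, of 0]] besovD(2)[OF finite_norm_besov[OF CT_fin[OF U_CT that, of 0]]] by (rule herm_arith(2)[rotated])
      moreover have "U 0 t - (U 0 t - u t) = u t" by (simp add: fun_eq_iff)
      ultimately show ?thesis by simp
    qed
  qed
  have "u t = ?S u t" if t: "t \<in> {0..T}" for t
  proof
    fix k
    have "besov \<beta> (E / 2 ^ n / 2 * exp (\<mu> * t)) (?S (U n) t - ?S u t)" for n
    proof (rule contr[OF U_CT u_CT _ _ t])
      fix s assume s: "s \<in> {0..T}"
      have "E / 2 ^ n * 1 \<le> E / 2 ^ n * exp (\<mu> * s)" using E0 mu s by (intro mult_left_mono) auto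
      then show "besov \<beta> (E / 2 ^ n * exp (\<mu> * s)) (U n s - u s)" using besov_mono[OF ud[OF s]] by simp
    qed (use E0 in simp)
    then have "cmod (U (Suc n) t k - ?S u t k) \<le> E / 2 ^ n / 2 * exp (\<mu> * t) * coeff_weight \<beta> k" for n
      using coeff_bound[of \<beta> "E / 2 ^ n / 2 * exp (\<mu> * t)" "?S (U n) t - ?S u t" k] by (simp add: U_Suc)
    moreover have "(\<lambda>n. E / 2 ^ n / 2 * exp (\<mu> * t) * coeff_weight \<beta> k) \<longlonglongrightarrow> 0 / 2 * exp (\<mu> * t) * coeff_weight \<beta> k" by (intro tendsto_intros elim1) simp
    ultimately have l0: "(\<lambda>n. U (Suc n) t k - ?S u t k) \<longlonglongrightarrow> 0"
      by (intro Lim_null_comparison[of "\<lambda>n. U (Suc n) t k - ?S u t k" "\<lambda>n. E / 2 ^ n / 2 * exp (\<mu> * t) * coeff_weight \<beta> k"]) auto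
    have "(\<lambda>n. U (Suc n) t k - ?S u t k) \<longlonglongrightarrow> u t k - ?S u t k"
      by (intro tendsto_diff tendsto_const LIMSEQ_Suc conv t)
    from LIMSEQ_unique[OF this l0] show "u t k = ?S u t k" by simp
  qed
  then show ?thesis using u_CT by (auto simp: trunc_sol_def)
qed

end

section \<open>Solutions and their dependence on the data\<close>

lemma mild_cong: assumes "\<And>t. t \<in> {0..T} \<Longrightarrow> F t = G t" shows "mild T \<phi> F u \<longleftrightarrow> mild T \<phi> G u"
proof -
  have "((\<lambda>s. heat (t - s) (F s) k) has_integral I) {0..t} \<longleftrightarrow> ((\<lambda>s. heat (t - s) (G s) k) has_integral I) {0..t}" if "t \<in> {0..T}" for t k I
    by (rule has_integral_cong) (use assms that in auto)
  then show ?thesis unfolding mild_def by auto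
qed

context equation_frame
begin

lemma zspace_data:
  assumes "(V, Z0, Z1, Z2) \<in> zspace \<theta> T" "0 \<le> T" shows "\<exists>A. data_on T A V Z0 Z1 Z2"
proof -
  have k: "\<kappa> > 0" using eps by simp
  have C: "V \<in> CT \<theta> (1 - \<kappa>) T" "Z0 \<in> CT \<theta> \<gamma> T" "Z1 \<in> CT \<theta> \<gamma> T" "Z2 \<in> CT \<theta> \<gamma> T"
    using assms(1) k unfolding zspace_def by auto
  obtain A0 A1 A2 A3 where A: "\<And>t. t \<in> {0..T} \<Longrightarrow> besov (1 - \<kappa>) A0 (V t)" "\<And>t. t \<in> {0..T} \<Longrightarrow> besov \<gamma> A1 (Z0 t)"
    "\<And>t. t \<in> {0..T} \<Longrightarrow> besov \<gamma> A2 (Z1 t)" "\<And>t. t \<in> {0..T} \<Longrightarrow> besov \<gamma> A3 (Z2 t)"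
    using CT_hnorm_bound[OF C(1) assms(2)] CT_hnorm_bound[OF C(2) assms(2)] CT_hnorm_bound[OF C(3) assms(2)] CT_hnorm_bound[OF C(4) assms(2)]
    by metis
  have "data_on T (max (max A0 A1) (max A2 A3)) V Z0 Z1 Z2"
    unfolding data_on_def data_bound_def using C by (intro conjI ballI besov_mono[OF A(1)] besov_mono[OF A(2)] besov_mono[OF A(3)] besov_mono[OF A(4)]) linarith+
  then show ?thesis by blast
qed

lemma data_on_subset: "data_on T A V Z0 Z1 Z2 \<Longrightarrow> T' \<le> T \<Longrightarrow> data_on T' A V Z0 Z1 Z2"
  unfolding data_on_def using CT_subset by auto

lemma data_on_mono: "data_on T A V Z0 Z1 Z2 \<Longrightarrow> A \<le> B \<Longrightarrow> data_on T B V Z0 Z1 Z2"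
  unfolding data_on_def using data_bound_mono by blast

lemma clipped_rhs_same: "hnorm \<theta> \<beta> (u t) \<le> M \<Longrightarrow> clipped_rhs M V Z0 Z1 Z2 u t = rhs \<theta> (V t) (Z0 t) (Z1 t) (Z2 t) (u t)"
  by (simp add: clipped_rhs_def clip_same)

lemma duhamel_at_0: "duhamel F 0 k = 0" by (simp add: duhamel_def)

text \<open>As long as the norm stays below \<open>M\<close>, clipping has no effect.\<close>
lemma solution_iff_trunc:
  assumes D: "data_on T A V Z0 Z1 Z2" and M: "0 < M" and T: "0 \<le> T" and u: "\<And>t. t \<in> {0..T} \<Longrightarrow> hnorm \<theta> \<beta> (u t) \<le> M"
  shows "solution \<theta> \<epsilon> T (V, Z0, Z1, Z2) \<phi> u \<longleftrightarrow> trunc_sol M T V Z0 Z1 Z2 \<phi> u"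
proof -
  let ?F = "clipped_rhs M V Z0 Z1 Z2 u"
  have m: "mild T \<phi> (\<lambda>t. rhs \<theta> (V t) (Z0 t) (Z1 t) (Z2 t) (u t)) u \<longleftrightarrow> mild T \<phi> ?F u"
    by (rule mild_cong) (use clipped_rhs_same u in metis)
  have c: "continuous_on {0..T} (\<lambda>s. ?F s k)" if "u \<in> CT \<theta> \<beta> T" for k by (rule clipped_rhs_coeff_cont[OF D M that])
  have i: "mild T \<phi> ?F u \<longleftrightarrow> (\<forall>t\<in>{0..T}. u t = step M V Z0 Z1 Z2 \<phi> u t)" if "u \<in> CT \<theta> \<beta> T"
    unfolding step_def by (rule mild_iff[OF c[OF that]])
  have z: "u 0 = \<phi>" if "u 0 = step M V Z0 Z1 Z2 \<phi> u 0"
    unfolding that by (simp add: step_def duhamel_at_0 heat_def fun_eq_iff)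
  show ?thesis unfolding solution.simps trunc_sol_def m using i z T by auto
qed

lemma solution_CT: "solution \<theta> \<epsilon> T \<Z> \<phi> u \<Longrightarrow> u \<in> CT \<theta> \<beta> T"
  by (cases \<Z>) auto

lemma solution_unique:
  assumes Z: "\<Z> \<in> zspace \<theta> T" and s: "solution \<theta> \<epsilon> T \<Z> \<phi> u" "solution \<theta> \<epsilon> T \<Z> \<phi> v" and t: "t \<in> {0..T}"
  shows "u t = v t"
proof -
  obtain V Z0 Z1 Z2 where e: "\<Z> = (V, Z0, Z1, Z2)" by (cases \<Z>) auto
  have T: "0 \<le> T" using t by simp
  obtain A where D: "data_on T A V Z0 Z1 Z2" using zspace_data Z T unfolding e by blast
  obtain C1 where C1: "C1 \<ge> 0" "\<And>t. t \<in> {0..T} \<Longrightarrow> besov \<beta> C1 (u t)" using CT_hnorm_bound[OF solution_CT[OF s(1)] T] by blast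
  obtain C2 where C2: "C2 \<ge> 0" "\<And>t. t \<in> {0..T} \<Longrightarrow> besov \<beta> C2 (v t)" using CT_hnorm_bound[OF solution_CT[OF s(2)] T] by blast
  define M where "M = C1 + C2 + 1"
  have M: "0 < M" "\<And>t. t \<in> {0..T} \<Longrightarrow> hnorm \<theta> \<beta> (u t) \<le> M" "\<And>t. t \<in> {0..T} \<Longrightarrow> hnorm \<theta> \<beta> (v t) \<le> M"
    using C1 C2 hnorm_le[OF C1(2)] hnorm_le[OF C2(2)] by (force simp: M_def)+
  show ?thesis
    using trunc_unique[OF M(1) D _ _ t] s solution_iff_trunc[where u = u, OF D M(1) T M(2)] solution_iff_trunc[where u = v, OF D M(1) T M(3)]
    unfolding e by blast
qed

lemma solution_restrict:
  assumes "solution \<theta> \<epsilon> T \<Z> \<phi> u" "T' \<le> T" shows "solution \<theta> \<epsilon> T' \<Z> \<phi> u"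
proof -
  obtain V Z0 Z1 Z2 where e: "\<Z> = (V, Z0, Z1, Z2)" by (cases \<Z>) auto
  show ?thesis using assms CT_subset[of u \<beta> T T'] unfolding e solution.simps mild_def by auto
qed

lemma CT_cong: assumes "\<And>t. t \<in> {0..T} \<Longrightarrow> u t = v t" "u \<in> CT \<theta> \<alpha> T" shows "v \<in> CT \<theta> \<alpha> T"
  unfolding CT_def
proof (intro CollectI conjI ballI)
  fix t assume t: "t \<in> {0..T}"
  show "v t \<in> Hoelder \<theta> \<alpha>" using CT_Hoelder[OF assms(2) t] assms(1)[OF t] by simp
  have "\<forall>\<^sub>F s in at t within {0..T}. hnorm \<theta> \<alpha> (u s - u t) = hnorm \<theta> \<alpha> (v s - v t)"
    unfolding eventually_at_filter by (rule always_eventually) (use assms(1) t in metis)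
  then show "((\<lambda>s. hnorm \<theta> \<alpha> (v s - v t)) \<longlongrightarrow> 0) (at t within {0..T})"
    using CT_tendsto[OF assms(2) t] by (rule Lim_transform_eventually[rotated])
qed

lemma solution_cong:
  assumes uv: "\<And>t. t \<in> {0..T} \<Longrightarrow> u t = v t" and s: "solution \<theta> \<epsilon> T \<Z> \<phi> u" and T: "0 \<le> T"
  shows "solution \<theta> \<epsilon> T \<Z> \<phi> v"
proof -
  obtain V Z0 Z1 Z2 where e: "\<Z> = (V, Z0, Z1, Z2)" by (cases \<Z>) auto
  have "mild T \<phi> (\<lambda>t. rhs \<theta> (V t) (Z0 t) (Z1 t) (Z2 t) (u t)) u" using s unfolding e by simp
  moreover have "mild T \<phi> (\<lambda>t. rhs \<theta> (V t) (Z0 t) (Z1 t) (Z2 t) (u t)) u \<longleftrightarrow> mild T \<phi> (\<lambda>t. rhs \<theta> (V t) (Z0 t) (Z1 t) (Z2 t) (v t)) u"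
    by (rule mild_cong) (simp only: uv)
  ultimately have "mild T \<phi> (\<lambda>t. rhs \<theta> (V t) (Z0 t) (Z1 t) (Z2 t) (v t)) u" by blast
  then have "mild T \<phi> (\<lambda>t. rhs \<theta> (V t) (Z0 t) (Z1 t) (Z2 t) (v t)) v" using uv by (auto simp: mild_def)
  moreover have "v 0 = \<phi>" using s uv[of 0] T unfolding e by simp
  ultimately show ?thesis using CT_cong[OF uv solution_CT[OF s]] unfolding e by simp
qed

text \<open>The solution of the equation clipped at a level above the norm of the initial value stays below
  this level for a short time, because its norm is continuous.\<close>
lemma local_existence:
  assumes Z: "\<Z> \<in> zspace \<theta> T" and phi: "\<phi> \<in> Hoelder \<theta> \<beta>" and T: "0 < T"
  shows "\<exists>\<tau>>0. \<exists>u. solution \<theta> \<epsilon> \<tau> \<Z> \<phi> u"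
proof -
  obtain V Z0 Z1 Z2 where e: "\<Z> = (V, Z0, Z1, Z2)" by (cases \<Z>) auto
  obtain A where D: "data_on T A V Z0 Z1 Z2" using zspace_data Z T unfolding e by fastforce
  define M where "M = hnorm \<theta> \<beta> \<phi> + 1"
  have M: "0 < M" using hnorm_ge0[OF Hoelder_fin[OF phi]] by (simp add: M_def)
  obtain u where u: "trunc_sol M T V Z0 Z1 Z2 \<phi> u" using trunc_exists[OF M D phi] T by auto
  have uc: "u \<in> CT \<theta> \<beta> T" using u by (simp add: trunc_sol_def)
  have u0: "u 0 = \<phi>"
  proof -
    have "u 0 = step M V Z0 Z1 Z2 \<phi> u 0" using u T by (simp add: trunc_sol_def)
    then show ?thesis by (simp add: step_def duhamel_at_0 heat_def fun_eq_iff)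
  qed
  have "((\<lambda>t. hnorm \<theta> \<beta> (u t)) \<longlongrightarrow> hnorm \<theta> \<beta> (u 0)) (at 0 within {0..T})"
    using CT_hnorm_cont[OF uc] T unfolding continuous_on_def by simp
  then have "\<forall>\<^sub>F t in at 0 within {0..T}. hnorm \<theta> \<beta> (u t) < M"
    by (rule order_tendstoD(2)) (simp add: u0 M_def)
  then obtain d where d: "d > 0" "\<And>t. t \<in> {0..T} \<Longrightarrow> t \<noteq> 0 \<Longrightarrow> dist t 0 < d \<Longrightarrow> hnorm \<theta> \<beta> (u t) < M"
    unfolding eventually_at by blast
  define \<tau> where "\<tau> = min T (d / 2)"
  have t: "0 < \<tau>" "\<tau> \<le> T" using d T by (auto simp: \<tau>_def)
  have b: "hnorm \<theta> \<beta> (u t) \<le> M" if "t \<in> {0..\<tau>}" for t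
  proof (cases "t = 0")
    case True then show ?thesis by (simp add: u0 M_def)
  next
    case False
    have "dist t 0 < d" using that d by (auto simp: \<tau>_def dist_real_def)
    then show ?thesis using d(2)[of t] that False t by auto
  qed
  have "trunc_sol M \<tau> V Z0 Z1 Z2 \<phi> u" using u t CT_subset[OF uc t(2)] by (auto simp: trunc_sol_def)
  then have "solution \<theta> \<epsilon> \<tau> \<Z> \<phi> u"
    unfolding e using solution_iff_trunc[where u = u, OF data_on_subset[OF D t(2)] M less_imp_le[OF t(1)] b] by simp
  then show ?thesis using t by blast
qed

lemma besov_CT_diff:
  assumes "u \<in> CT \<theta> \<alpha> T" "v \<in> CT \<theta> \<alpha> T" "t \<in> {0..T}"
  shows "besov \<alpha> (CT_norm \<theta> \<alpha> T (\<lambda>t. u t - v t)) (u t - v t)" "0 \<le> CT_norm \<theta> \<alpha> T (\<lambda>t. u t - v t)"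
proof -
  have f: "finite_norm \<alpha> (u t - v t)" by (rule CT_fin[OF CT_diff[OF assms(1,2)] assms(3)])
  have l: "hnorm \<theta> \<alpha> (u t - v t) \<le> CT_norm \<theta> \<alpha> T (\<lambda>t. u t - v t)"
    by (rule hnorm_le_CT_norm[OF CT_diff[OF assms(1,2)] assms(3)])
  show "besov \<alpha> (CT_norm \<theta> \<alpha> T (\<lambda>t. u t - v t)) (u t - v t)" by (rule besov_mono[OF finite_norm_besov[OF f] l])
  show "0 \<le> CT_norm \<theta> \<alpha> T (\<lambda>t. u t - v t)" using hnorm_ge0[OF f] l by linarith
qed

text \<open>The solution for the perturbed data is that of the equation clipped at one unit above the norm of the
  given solution. By stability it is so close to the given one that it does not reach the level.\<close>
lemma dependence:
  assumes Z: "\<Z> \<in> zspace \<theta> T" and phi: "\<phi> \<in> Hoelder \<theta> \<beta>" and T: "0 < T" and s: "solution \<theta> \<epsilon> T \<Z> \<phi> u" and d: "\<delta> > 0"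
  shows "\<exists>q>0. \<forall>\<Z>'\<in>zspace \<theta> T. \<forall>\<phi>'\<in>Hoelder \<theta> \<beta>. zdist \<theta> \<kappa> T \<Z>' \<Z> < q \<longrightarrow> hnorm \<theta> \<beta> (\<phi>' - \<phi>) < q \<longrightarrow>
    (\<exists>u'. unique_solution \<theta> \<epsilon> T \<Z>' \<phi>' u' \<and> CT_norm \<theta> \<beta> T (\<lambda>t. u' t - u t) < \<delta>)"
proof -
  have T0: "0 \<le> T" using T by simp
  have k: "\<kappa> > 0" using eps by simp
  obtain V Z0 Z1 Z2 where e: "\<Z> = (V, Z0, Z1, Z2)" by (cases \<Z>) auto
  obtain A0 where D0: "data_on T A0 V Z0 Z1 Z2" using zspace_data Z T0 unfolding e by blast
  obtain M0 where M0: "M0 \<ge> 0" "\<And>t. t \<in> {0..T} \<Longrightarrow> besov \<beta> M0 (u t)" using CT_hnorm_bound[OF solution_CT[OF s] T0] by blast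
  define A where "A = A0 + 1"
  define M where "M = M0 + 1"
  have M: "0 < M" using M0 by (simp add: M_def)
  have D: "data_on T A V Z0 Z1 Z2" by (rule data_on_mono[OF D0]) (simp add: A_def)
  obtain C where C: "C \<ge> 0" "\<forall>V Z0 Z1 Z2 V' Z0' Z1' Z2' \<phi> \<phi>' u u' d p. data_on T A V Z0 Z1 Z2 \<longrightarrow> data_on T A V' Z0' Z1' Z2' \<longrightarrow>
     (\<forall>t\<in>{0..T}. data_bound d (V t - V' t) (Z0 t - Z0' t) (Z1 t - Z1' t) (Z2 t - Z2' t)) \<longrightarrow> 0 \<le> d \<longrightarrow> besov \<beta> p (\<phi> - \<phi>') \<longrightarrow>
     trunc_sol M T V Z0 Z1 Z2 \<phi> u \<longrightarrow> trunc_sol M T V' Z0' Z1' Z2' \<phi>' u' \<longrightarrow>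
     (\<forall>t\<in>{0..T}. besov \<beta> (C * (p + d)) (u t - u' t))"
    using trunc_stability[OF M, of T A] by blast
  (* The second bound keeps the perturbed solution within min 1 (delta) / 2 of the given one, hence below the level M. *)
  define q where "q = min 1 (min 1 \<delta> / (2 * (2 * C + 1)))"
  have C1: "0 < 2 * C + 1" using C by simp
  have q: "q > 0" "q \<le> 1" using d C1 by (auto simp: q_def)
  have Cq: "C * (q + q) \<le> min 1 \<delta> / 2"
  proof -
    have "C * (q + q) \<le> (2 * C + 1) * q" using q C by (simp add: algebra_simps)
    also have "\<dots> \<le> (2 * C + 1) * (min 1 \<delta> / (2 * (2 * C + 1)))" using C1 by (intro mult_left_mono) (auto simp: q_def)
    also have "\<dots> = min 1 \<delta> / 2"
    proof -
      have "x * (y / (2 * x)) = y / 2" if "0 < x" for x y :: real using that by simp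
      from this[OF C1] show ?thesis .
    qed
    finally show ?thesis .
  qed
  have hu: "hnorm \<theta> \<beta> (u t) \<le> M" if "t \<in> {0..T}" for t using hnorm_le[OF M0(2)[OF that]] by (simp add: M_def)
  have tu: "trunc_sol M T V Z0 Z1 Z2 \<phi> u" using s solution_iff_trunc[where u = u, OF D M T0 hu] unfolding e by blast
  show ?thesis
  proof (intro exI[of _ q] conjI q(1) ballI impI)
    fix \<Z>' \<phi>' assume Z': "\<Z>' \<in> zspace \<theta> T" and phi': "\<phi>' \<in> Hoelder \<theta> \<beta>"
      and zd: "zdist \<theta> \<kappa> T \<Z>' \<Z> < q" and pd: "hnorm \<theta> \<beta> (\<phi>' - \<phi>) < q"
    obtain V' Z0' Z1' Z2' where e': "\<Z>' = (V', Z0', Z1', Z2')" by (cases \<Z>') auto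
    have CC: "V \<in> CT \<theta> (1 - \<kappa>) T" "Z0 \<in> CT \<theta> \<gamma> T" "Z1 \<in> CT \<theta> \<gamma> T" "Z2 \<in> CT \<theta> \<gamma> T"
      using D by (auto simp: data_on_def)
    have CC': "V' \<in> CT \<theta> (1 - \<kappa>) T" "Z0' \<in> CT \<theta> \<gamma> T" "Z1' \<in> CT \<theta> \<gamma> T" "Z2' \<in> CT \<theta> \<gamma> T"
      using Z' k unfolding e' zspace_def by auto
    have t0: "0 \<in> {0..T}" using T by simp
    note nn = besov_CT_diff(2)[OF CC'(1) CC(1) t0] besov_CT_diff(2)[OF CC'(2) CC(2) t0] besov_CT_diff(2)[OF CC'(3) CC(3) t0] besov_CT_diff(2)[OF CC'(4) CC(4) t0]
    have zs: "CT_norm \<theta> (1 - \<kappa>) T (\<lambda>t. V' t - V t) + CT_norm \<theta> \<gamma> T (\<lambda>t. Z0' t - Z0 t) + CT_norm \<theta> \<gamma> T (\<lambda>t. Z1' t - Z1 t) + CT_norm \<theta> \<gamma> T (\<lambda>t. Z2' t - Z2 t) < q"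
      using zd unfolding e e' zdist.simps .
    have zdiff: "data_bound q (V' t - V t) (Z0' t - Z0 t) (Z1' t - Z1 t) (Z2' t - Z2 t)" if t: "t \<in> {0..T}" for t
      unfolding data_bound_def
      by (intro conjI besov_mono[OF besov_CT_diff(1)[OF CC'(1) CC(1) t]] besov_mono[OF besov_CT_diff(1)[OF CC'(2) CC(2) t]]
          besov_mono[OF besov_CT_diff(1)[OF CC'(3) CC(3) t]] besov_mono[OF besov_CT_diff(1)[OF CC'(4) CC(4) t]]) (use nn zs in linarith)+
    have "data_bound A (V' t) (Z0' t) (Z1' t) (Z2' t)" if t: "t \<in> {0..T}" for t
    proof -
      have "data_bound A0 (V t) (Z0 t) (Z1 t) (Z2 t)" using D0 t by (simp add: data_on_def)
      then have "data_bound (q + A0) (V' t) (Z0' t) (Z1' t) (Z2' t)"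
        using zdiff[OF t] unfolding data_bound_def by (auto intro: besov_from_diff)
      then show ?thesis by (rule data_bound_mono) (use q in \<open>simp add: A_def\<close>)
    qed
    then have D': "data_on T A V' Z0' Z1' Z2'" using CC' by (simp add: data_on_def)
    obtain u' where u': "trunc_sol M T V' Z0' Z1' Z2' \<phi>' u'" using trunc_exists[OF M D' phi' T0] by blast
    have uc: "u' \<in> CT \<theta> \<beta> T" using u' by (simp add: trunc_sol_def)
    have bp: "besov \<beta> q (\<phi>' - \<phi>)" using besov_mono[OF finite_norm_besov[OF finite_norm_diff[OF Hoelder_fin[OF phi'] Hoelder_fin[OF phi]]]] pd by (meson less_imp_le)
    have diff: "besov \<beta> (C * (q + q)) (u' t - u t)" if "t \<in> {0..T}" for t
      using C(2)[rule_format, OF D' D zdiff _ bp u' tu that] q by simp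
    have half: "hnorm \<theta> \<beta> (u' t - u t) \<le> min 1 \<delta> / 2" if "t \<in> {0..T}" for t
      using hnorm_le[OF diff[OF that]] Cq by linarith
    have hu': "hnorm \<theta> \<beta> (u' t) \<le> M" if t: "t \<in> {0..T}" for t
    proof -
      have "hnorm \<theta> \<beta> (u' t) \<le> hnorm \<theta> \<beta> (u' t - u t) + hnorm \<theta> \<beta> (u t)"
        by (rule hnorm_diff_le[OF CT_fin[OF uc t] CT_fin[OF solution_CT[OF s] t]])
      then show ?thesis using half[OF t] hnorm_le[OF M0(2)[OF t]] unfolding M_def by linarith
    qed
    have s': "solution \<theta> \<epsilon> T \<Z>' \<phi>' u'" unfolding e' using solution_iff_trunc[where u = u', OF D' M T0 hu'] u' by blast
    have "unique_solution \<theta> \<epsilon> T \<Z>' \<phi>' u'"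
      unfolding unique_solution_def using s' solution_unique[OF Z' _ s'] by blast
    moreover have "CT_norm \<theta> \<beta> T (\<lambda>t. u' t - u t) \<le> min 1 \<delta> / 2" by (rule CT_norm_le[OF T0 half])
    then have "CT_norm \<theta> \<beta> T (\<lambda>t. u' t - u t) < \<delta>" using d by linarith
    ultimately show "\<exists>u'. unique_solution \<theta> \<epsilon> T \<Z>' \<phi>' u' \<and> CT_norm \<theta> \<beta> T (\<lambda>t. u' t - u t) < \<delta>" by blast
  qed
qed

section \<open>The maximal solution\<close>

definition Tmax :: "zdata \<Rightarrow> coeffs \<Rightarrow> ereal" where
  "Tmax \<Z> \<phi> = Sup {ereal T |T. 0 < T \<and> (\<exists>u. solution \<theta> \<epsilon> T \<Z> \<phi> u)}"

text \<open>Any solution that reaches \<open>t\<close> may be used, by uniqueness.\<close>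
definition msol :: "zdata \<Rightarrow> coeffs \<Rightarrow> real \<Rightarrow> coeffs" where
  "msol \<Z> \<phi> t = (SOME x. \<exists>T u. t \<le> T \<and> solution \<theta> \<epsilon> T \<Z> \<phi> u \<and> x = u t)"

lemma Tmax_upper: "solution \<theta> \<epsilon> T \<Z> \<phi> u \<Longrightarrow> 0 < T \<Longrightarrow> ereal T \<le> Tmax \<Z> \<phi>"
  unfolding Tmax_def by (rule Sup_upper) blast

lemma below_Tmax: assumes "ereal T < Tmax \<Z> \<phi>" shows "\<exists>u. solution \<theta> \<epsilon> T \<Z> \<phi> u"
proof -
  obtain x where x: "x \<in> {ereal T |T. 0 < T \<and> (\<exists>u. solution \<theta> \<epsilon> T \<Z> \<phi> u)}" "ereal T < x"
    using assms unfolding Tmax_def less_Sup_iff by blast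
  then obtain T' u where "T < T'" "solution \<theta> \<epsilon> T' \<Z> \<phi> u" by auto
  then show ?thesis using solution_restrict[of T' \<Z> \<phi> u T] by auto
qed

lemma msol_eq:
  assumes Z: "\<Z> \<in> (\<Inter>T\<in>{0<..}. zspace \<theta> T)" and s: "solution \<theta> \<epsilon> T \<Z> \<phi> u" and t: "t \<in> {0..T}" and T: "0 < T"
  shows "msol \<Z> \<phi> t = u t"
proof -
  have "\<exists>T u. t \<le> T \<and> solution \<theta> \<epsilon> T \<Z> \<phi> u \<and> msol \<Z> \<phi> t = u t"
  proof -
    have "\<exists>x T u. t \<le> T \<and> solution \<theta> \<epsilon> T \<Z> \<phi> u \<and> x = u t" using s t by auto
    from someI_ex[OF this] show ?thesis unfolding msol_def .
  qed
  then obtain T' v where v: "t \<le> T'" "solution \<theta> \<epsilon> T' \<Z> \<phi> v" "msol \<Z> \<phi> t = v t" by blast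
  show ?thesis
  proof (cases "t = 0")
    case True
    have "v 0 = \<phi>" "u 0 = \<phi>" using v(2) s by (cases \<Z>; simp)+
    then show ?thesis using v(3) True by simp
  next
    case False
    then have tp: "0 < t" using t by auto
    then have "\<Z> \<in> zspace \<theta> t" using Z by auto
    then have "v t = u t"
      by (rule solution_unique[OF _ solution_restrict[OF v(2,1)] solution_restrict[OF s, of t]]) (use t in auto)
    then show ?thesis using v by simp
  qed
qed

lemma msol_solution:
  assumes Z: "\<Z> \<in> (\<Inter>T\<in>{0<..}. zspace \<theta> T)" and T: "0 < T" "ereal T < Tmax \<Z> \<phi>"
  shows "solution \<theta> \<epsilon> T \<Z> \<phi> (msol \<Z> \<phi>)" "unique_solution \<theta> \<epsilon> T \<Z> \<phi> (msol \<Z> \<phi>)"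
proof -
  obtain u where u: "solution \<theta> \<epsilon> T \<Z> \<phi> u" using below_Tmax[OF T(2)] by blast
  show s: "solution \<theta> \<epsilon> T \<Z> \<phi> (msol \<Z> \<phi>)"
    by (rule solution_cong[OF _ u]) (use msol_eq[OF Z u _ T(1)] T in auto)
  have "\<Z> \<in> zspace \<theta> T" using Z T by auto
  then show "unique_solution \<theta> \<epsilon> T \<Z> \<phi> (msol \<Z> \<phi>)"
    unfolding unique_solution_def using s solution_unique[of \<Z> T \<phi> _ "msol \<Z> \<phi>"] by blast
qed

lemma Tmax_pos:
  assumes Z: "\<Z> \<in> (\<Inter>T\<in>{0<..}. zspace \<theta> T)" and phi: "\<phi> \<in> Hoelder \<theta> \<beta>"
  shows "0 < Tmax \<Z> \<phi>"
proof -
  have "\<Z> \<in> zspace \<theta> 1" using Z by auto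
  then obtain \<tau> u where "\<tau> > 0" "solution \<theta> \<epsilon> \<tau> \<Z> \<phi> u" using local_existence[OF _ phi zero_less_one] by blast
  then show ?thesis using Tmax_upper[of \<tau> \<Z> \<phi> u] by (metis ereal_less(2) order_less_le_trans)
qed

text \<open>The semigroup property of Duhamel's formula.\<close>
lemma restart:
  assumes D: "data_on T A V Z0 Z1 Z2" and M: "0 < M" and u: "trunc_sol M T V Z0 Z1 Z2 \<phi> u" and st: "0 \<le> s" "s \<le> t" "t \<le> T"
  shows "u t = (\<lambda>k. heat (t - s) (u s) k + duhamel (\<lambda>\<tau>. clipped_rhs M V Z0 Z1 Z2 u (s + \<tau>)) (t - s) k)"
proof
  fix k
  let ?F = "clipped_rhs M V Z0 Z1 Z2 u"
  have uc: "u \<in> CT \<theta> \<beta> T" using u by (simp add: trunc_sol_def)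
  have c: "continuous_on {0..T} (\<lambda>\<tau>. ?F \<tau> k)" by (rule clipped_rhs_coeff_cont[OF D M uc])
  have ct: "continuous_on {0..t} (\<lambda>\<tau>. heat (t - \<tau>) (?F \<tau>) k)"
    by (rule heat_integrand_cont, rule cont_sub[OF c]) (use st in auto)
  have ut: "u t k = heat t \<phi> k + duhamel ?F t k" and us: "u s k = heat s \<phi> k + duhamel ?F s k"
    using u st by (auto simp: trunc_sol_def step_def dest!: bspec[where x = t] bspec[where x = s])
  have "integral {0..s} (\<lambda>\<tau>. heat (t - \<tau>) (?F \<tau>) k) + integral {s..t} (\<lambda>\<tau>. heat (t - \<tau>) (?F \<tau>) k) = duhamel ?F t k"
    unfolding duhamel_def by (rule Henstock_Kurzweil_Integration.integral_combine) (use st ct integrable_continuous_interval in auto)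
  moreover have "integral {0..s} (\<lambda>\<tau>. heat (t - \<tau>) (?F \<tau>) k) = heat (t - s) (duhamel ?F s) k"
  proof -
    have "heat (t - \<tau>) (?F \<tau>) k = of_real (exp (- (t - s) * (1 + 4 * pi\<^sup>2 * (norm (freq k))\<^sup>2))) * heat (s - \<tau>) (?F \<tau>) k" for \<tau>
    proof -
      have "exp (- (t - \<tau>) * m) = exp (- (t - s) * m) * exp (- (s - \<tau>) * m)" for m :: real
        by (simp add: exp_add[symmetric] algebra_simps)
      then show ?thesis by (simp add: heat_def)
    qed
    then show ?thesis unfolding duhamel_def heat_def[of "t - s"] by (simp only: integral_mult_right)
  qed
  moreover have "integral {s..t} (\<lambda>\<tau>. heat (t - \<tau>) (?F \<tau>) k) = duhamel (\<lambda>\<tau>. ?F (s + \<tau>)) (t - s) k"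
    using integral_shift_Icc_real[of 0 "t - s" "\<lambda>\<tau>. heat (t - \<tau>) (?F \<tau>) k" s]
    by (simp add: duhamel_def o_def diff_diff_eq)
  moreover have "heat (t - s) (u s) k = heat t \<phi> k + heat (t - s) (duhamel ?F s) k"
  proof -
    have "exp (- (t - s) * m) * exp (- s * m) = exp (- t * m)" for m :: real
      by (simp add: exp_add[symmetric] algebra_simps)
    then have "heat (t - s) (heat s \<phi>) k = heat t \<phi> k"
      unfolding heat_def mult.assoc[symmetric] of_real_mult[symmetric] by (simp only:)
    moreover have "heat (t - s) (u s) k = heat (t - s) (heat s \<phi>) k + heat (t - s) (duhamel ?F s) k"
      unfolding heat_def[of "t - s"] us by (simp add: algebra_simps)
    ultimately show ?thesis by simp
  qed
  ultimately show "u t k = heat (t - s) (u s) k + duhamel (\<lambda>\<tau>. ?F (s + \<tau>)) (t - s) k" using ut by simp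
qed

text \<open>As long as the norm stays below \<open>M\<close>, it cannot grow by more than \<open>1/4\<close> during a time \<open>h\<close> that depends
  only on \<open>M\<close> and on the size of the data.\<close>
lemma slow_growth:
  assumes M: "0 < M"
  shows "\<exists>h>0. \<forall>T V Z0 Z1 Z2 \<phi> u s t M'. data_on T A V Z0 Z1 Z2 \<longrightarrow> trunc_sol M' T V Z0 Z1 Z2 \<phi> u \<longrightarrow> M \<le> M' \<longrightarrow>
     0 \<le> s \<longrightarrow> s \<le> t \<longrightarrow> t \<le> T \<longrightarrow> t - s \<le> h \<longrightarrow> (\<forall>\<tau>\<in>{s..t}. hnorm \<theta> \<beta> (u \<tau>) \<le> M) \<longrightarrow>
     hnorm \<theta> \<beta> (u t) \<le> hnorm \<theta> \<beta> (u s) + 1/4"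
proof -
  define B where "B = max A M"
  have B: "B > 0" using M by (simp add: B_def)
  have cB: "clip_const B * B \<ge> 0" using clip_const_nonneg[of B] B by simp
  have cBe: "clip_const B * B * exp 1 \<ge> 0" by (intro mult_nonneg_nonneg[OF cB]) simp
  (* The choice of mu makes the integral term at most 1/4 during the time 1 / mu. *)
  obtain \<mu> where mu: "\<mu> > 0" "duhamel_const \<sigma> * \<mu> powr (- (1 - \<sigma>)) * (clip_const B * B * exp 1) \<le> 1/4"
    using small_weight[OF cBe] by blast
  have main: "hnorm \<theta> \<beta> (u t) \<le> hnorm \<theta> \<beta> (u s) + 1/4"
    if D: "data_on T A V Z0 Z1 Z2" and u: "trunc_sol M' T V Z0 Z1 Z2 \<phi> u" and MM: "M \<le> M'" and st: "0 \<le> s" "s \<le> t" "t \<le> T"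
      and h: "t - s \<le> 1 / \<mu>" and le: "\<forall>\<tau>\<in>{s..t}. hnorm \<theta> \<beta> (u \<tau>) \<le> M"
    for T V Z0 Z1 Z2 \<phi> u s t M'
  proof -
    let ?F = "\<lambda>\<tau>. clipped_rhs M' V Z0 Z1 Z2 u (s + \<tau>)"
    have M': "0 < M'" using M MM by linarith
    have uc: "u \<in> CT \<theta> \<beta> T" using u by (simp add: trunc_sol_def)
    have "besov (\<gamma> + 2 * \<sigma>) (duhamel_const \<sigma> * \<mu> powr (- (1 - \<sigma>)) * (clip_const B * B) * exp (\<mu> * (t - s))) (duhamel ?F (t - s))"
    proof (rule besov_duhamel)
      show "continuous_on {0..t - s} (\<lambda>\<tau>. ?F \<tau> k)" for k
        by (rule continuous_on_compose2[OF clipped_rhs_coeff_cont[OF D M' uc, of k]]) (use st in \<open>auto intro!: continuous_intros\<close>)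
      show "besov \<gamma> (clip_const B * B * exp (\<mu> * \<tau>)) (?F \<tau>)" if t': "\<tau> \<in> {0..t - s}" for \<tau>
      proof (rule besov_mono)
        have i: "s + \<tau> \<in> {s..t}" "s + \<tau> \<in> {0..T}" using t' st by auto
        have b: "hnorm \<theta> \<beta> (u (s + \<tau>)) \<le> M" using le i(1) by blast
        have F: "?F \<tau> = rhs \<theta> (V (s + \<tau>)) (Z0 (s + \<tau>)) (Z1 (s + \<tau>)) (Z2 (s + \<tau>)) (u (s + \<tau>))"
          by (rule clipped_rhs_same) (use b MM in linarith)
        show "besov \<gamma> (clip_const B * B) (?F \<tau>)" unfolding F
        proof (rule rhs_bound)
          show "data_bound B (V (s + \<tau>)) (Z0 (s + \<tau>)) (Z1 (s + \<tau>)) (Z2 (s + \<tau>))"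
          proof (rule data_bound_mono)
            show "data_bound A (V (s + \<tau>)) (Z0 (s + \<tau>)) (Z1 (s + \<tau>)) (Z2 (s + \<tau>))" using D i(2) by (simp add: data_on_def)
          qed (simp add: B_def)
          show "besov \<beta> B (u (s + \<tau>))" by (rule besov_mono[OF finite_norm_besov[OF CT_fin[OF uc i(2)]]]) (use b in \<open>simp add: B_def\<close>)
        qed
        have "(clip_const B * B) * 1 \<le> (clip_const B * B) * exp (\<mu> * \<tau>)"
          using t' mu cB by (intro mult_left_mono) auto
        then show "clip_const B * B \<le> clip_const B * B * exp (\<mu> * \<tau>)" by simp
      qed
    qed (use st mu sigma in auto)
    then have b: "besov \<beta> (duhamel_const \<sigma> * \<mu> powr (- (1 - \<sigma>)) * (clip_const B * B) * exp (\<mu> * (t - s))) (duhamel ?F (t - s))"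
      unfolding sigma(1) .
    have "duhamel_const \<sigma> * \<mu> powr (- (1 - \<sigma>)) * (clip_const B * B) * exp (\<mu> * (t - s)) \<le> duhamel_const \<sigma> * \<mu> powr (- (1 - \<sigma>)) * (clip_const B * B) * exp 1"
    proof (rule mult_left_mono)
      have "\<mu> * (t - s) \<le> 1" using h mu by (simp add: pos_le_divide_eq mult.commute)
      then show "exp (\<mu> * (t - s)) \<le> exp 1" by simp
      show "0 \<le> duhamel_const \<sigma> * \<mu> powr (- (1 - \<sigma>)) * (clip_const B * B)"
        by (intro mult_nonneg_nonneg[OF _ cB] mult_nonneg_nonneg[OF duhamel_const_nonneg]) simp
    qed
    also have "\<dots> \<le> 1/4" using mu(2) by (simp only: mult.assoc)
    finally have b2: "besov \<beta> (1/4) (duhamel ?F (t - s))" by (rule besov_mono[OF b])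
    have b1: "besov \<beta> (hnorm \<theta> \<beta> (u s)) (heat (t - s) (u s))"
      by (rule besov_heat[OF finite_norm_besov[OF CT_fin[OF uc]]]) (use st in auto)
    have "besov \<beta> (hnorm \<theta> \<beta> (u s) + 1/4) (u t)"
      by (subst restart[OF D M' u st]) (rule besov_add[OF b1 b2])
    then show ?thesis by (rule hnorm_le)
  qed
  have "1 / \<mu> > 0" using mu by simp
  then show ?thesis using main by blast
qed

text \<open>If the norm does not tend to infinity, it is below some \<open>R\<close> at a time \<open>s\<close> closer to the lifetime than
  the time \<open>h\<close> of slow growth. It then stays below \<open>R + 1/2\<close> until the lifetime, and the solution of the
  equation clipped above this level is a solution beyond the lifetime.\<close>
lemma blow_up:
  assumes Z: "\<Z> \<in> (\<Inter>T\<in>{0<..}. zspace \<theta> T)" and phi: "\<phi> \<in> Hoelder \<theta> \<beta>" and finite_norm: "Tmax \<Z> \<phi> < \<infinity>"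
  shows "filterlim (\<lambda>t. hnorm \<theta> \<beta> (msol \<Z> \<phi> t)) at_top (at_left (real_of_ereal (Tmax \<Z> \<phi>)))"
proof (rule ccontr)
  define T0 where "T0 = real_of_ereal (Tmax \<Z> \<phi>)"
  let ?u = "msol \<Z> \<phi>"
  let ?g = "\<lambda>t. hnorm \<theta> \<beta> (?u t)"
  assume "\<not> filterlim ?g at_top (at_left (real_of_ereal (Tmax \<Z> \<phi>)))"
  then obtain R0 where R0: "\<not> (\<forall>\<^sub>F t in at_left T0. R0 \<le> ?g t)" unfolding filterlim_at_top T0_def by blast
  have pos: "0 < Tmax \<Z> \<phi>" by (rule Tmax_pos[OF Z phi])
  have Te: "Tmax \<Z> \<phi> = ereal T0" using pos finite_norm unfolding T0_def by (cases "Tmax \<Z> \<phi>") auto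
  have T0: "0 < T0" using pos unfolding Te by simp
  obtain V Z0 Z1 Z2 where e: "\<Z> = (V, Z0, Z1, Z2)" by (cases \<Z>) auto
  have "(V, Z0, Z1, Z2) \<in> zspace \<theta> (T0 + 1)" using Z T0 unfolding e by auto
  then obtain A where D: "data_on (T0 + 1) A V Z0 Z1 Z2" using zspace_data T0 by fastforce
  have sol: "solution \<theta> \<epsilon> T \<Z> \<phi> ?u" if "0 < T" "T < T0" for T using msol_solution(1)[OF Z that(1)] that(2) Te by simp
  have uCT: "?u \<in> CT \<theta> \<beta> T" if "0 < T" "T < T0" for T by (rule solution_CT[OF sol[OF that]])
  have g0: "?g t \<ge> 0" if "0 \<le> t" "t < T0" for t
  proof -
    have "0 < (t + T0) / 2" "(t + T0) / 2 < T0" using that T0 by auto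
    from hnorm_ge0[OF CT_fin[OF uCT[OF this], of t]] show ?thesis using that by auto
  qed
  define R where "R = max R0 0"
  define M where "M = R + 1"
  have M: "0 < M" by (simp add: M_def R_def)
  obtain h where h: "h > 0" "\<forall>T V Z0 Z1 Z2 \<phi> u s t M'. data_on T A V Z0 Z1 Z2 \<longrightarrow> trunc_sol M' T V Z0 Z1 Z2 \<phi> u \<longrightarrow> M \<le> M' \<longrightarrow>
     0 \<le> s \<longrightarrow> s \<le> t \<longrightarrow> t \<le> T \<longrightarrow> t - s \<le> h \<longrightarrow> (\<forall>\<tau>\<in>{s..t}. hnorm \<theta> \<beta> (u \<tau>) \<le> M) \<longrightarrow>
     hnorm \<theta> \<beta> (u t) \<le> hnorm \<theta> \<beta> (u s) + 1/4"
    using slow_growth[OF M, of A] by blast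
  have "\<exists>s. max (T0 - h) (T0 / 2) < s \<and> s < T0 \<and> ?g s < R0"
  proof (rule ccontr)
    assume "\<nexists>s. max (T0 - h) (T0 / 2) < s \<and> s < T0 \<and> ?g s < R0"
    then have "\<forall>t>max (T0 - h) (T0 / 2). t < T0 \<longrightarrow> R0 \<le> ?g t" by (meson not_less)
    moreover have "max (T0 - h) (T0 / 2) < T0" using h T0 by auto
    ultimately have "\<forall>\<^sub>F t in at_left T0. R0 \<le> ?g t" unfolding eventually_at_left[OF \<open>max (T0 - h) (T0 / 2) < T0\<close>] by blast
    then show False using R0 by blast
  qed
  then obtain s where s: "T0 - h < s" "T0 / 2 < s" "s < T0" "?g s < R0" by auto
  have s0: "0 < s" using s T0 by linarith
  have sR: "?g s < R + 1/4" using s(4) by (simp add: R_def)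
  (* Otherwise consider the first time at which the norm equals R + 1/2: up to then slow growth applies. *)
  have stay: "?g t < R + 1/2" if t: "s \<le> t" "t < T0" for t
  proof (rule ccontr)
    assume "\<not> ?g t < R + 1/2"
    then have big: "R + 1/2 \<le> ?g t" by simp
    have cont: "continuous_on {s..t} ?g"
      by (rule continuous_on_subset[OF CT_hnorm_cont[OF uCT[of t]]]) (use t s0 in auto)
    let ?S = "{\<tau> \<in> {s..t}. ?g \<tau> = R + 1/2}"
    have "closed ?S" by (rule continuous_closed_preimage_constant[OF cont]) simp
    moreover have "bounded ?S" by (rule bounded_subset[of "{s..t}"]) auto
    ultimately have cS: "compact ?S" by (simp add: compact_eq_bounded_closed)
    have ivt: "\<exists>x\<ge>s. x \<le> t' \<and> ?g x = R + 1/2" if "s \<le> t'" "t' \<le> t" "R + 1/2 \<le> ?g t'" for t'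
      by (rule IVT'[of ?g s "R + 1/2" t']) (use that sR continuous_on_subset[OF cont] in auto)
    have "?S \<noteq> {}" using ivt[OF t(1) order_refl big] by auto
    then obtain t1 where t1: "t1 \<in> ?S" "\<And>x. x \<in> ?S \<Longrightarrow> t1 \<le> x" using compact_attains_inf[OF cS] by blast
    have le: "?g x \<le> R + 1/2" if x: "s \<le> x" "x \<le> t1" for x
    proof (rule ccontr)
      assume a: "\<not> ?g x \<le> R + 1/2"
      then obtain y where y: "s \<le> y" "y \<le> x" "?g y = R + 1/2" using ivt[of x] x t1 by auto
      then have "t1 \<le> y" using t1(2)[of y] x t1(1) by auto
      then have "y = x" using y x by simp
      then show False using y a by simp
    qed
    have b: "0 < t1" "t1 < T0" using t1 s0 t by auto
    have b': "0 \<le> t1" using b by simp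
    obtain C0 where C0: "C0 \<ge> 0" "\<And>x. x \<in> {0..t1} \<Longrightarrow> besov \<beta> C0 (?u x)" using CT_hnorm_bound[OF uCT[OF b] b'] by blast
    define M' where "M' = max M C0"
    have M': "0 < M'" "M \<le> M'" using M by (auto simp: M'_def)
    have D1: "data_on t1 A V Z0 Z1 Z2" by (rule data_on_subset[OF D]) (use b in simp)
    have "hnorm \<theta> \<beta> (?u x) \<le> M'" if "x \<in> {0..t1}" for x using hnorm_le[OF C0(2)[OF that]] by (simp add: M'_def)
    then have tr: "trunc_sol M' t1 V Z0 Z1 Z2 \<phi> ?u"
      using solution_iff_trunc[where u = ?u, OF D1 M'(1) b'] sol[OF b] unfolding e by blast
    have "?g t1 \<le> ?g s + 1/4"
    proof (rule h(2)[rule_format, OF D1 tr M'(2)])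
      show "?g \<tau> \<le> M" if "\<tau> \<in> {s..t1}" for \<tau> using le[of \<tau>] that by (simp add: M_def)
    qed (use s s0 t t1(1) in auto)
    moreover have "?g t1 = R + 1/2" using t1(1) by simp
    ultimately show False using sR by linarith
  qed
  obtain C1 where C1: "C1 \<ge> 0" "\<And>x. x \<in> {0..s} \<Longrightarrow> besov \<beta> C1 (?u x)"
    using CT_hnorm_bound[OF uCT[OF s0 s(3)]] s0 by auto
  define M1 where "M1 = max C1 (R + 1/2)"
  have gM: "?g t \<le> M1" if "0 \<le> t" "t < T0" for t
  proof (cases "t \<le> s")
    case True then show ?thesis using hnorm_le[OF C1(2)[of t]] that by (simp add: M1_def)
  next
    case False then show ?thesis using stay[of t] that by (simp add: M1_def)
  qed
  define M2 where "M2 = M1 + 1"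
  have M2: "0 < M2" using C1 by (simp add: M2_def M1_def)
  (* The continuation across the lifetime. *)
  obtain w where w: "trunc_sol M2 (T0 + 1) V Z0 Z1 Z2 \<phi> w" using trunc_exists[OF M2 D phi] T0 by auto
  have wc: "w \<in> CT \<theta> \<beta> (T0 + 1)" using w by (simp add: trunc_sol_def)
  have wu: "w t = ?u t" if t: "0 \<le> t" "t < T0" for t
  proof -
    define t' where "t' = (t + T0) / 2"
    have t': "0 < t'" "t' < T0" "t \<in> {0..t'}" "0 \<le> t'" "t' \<le> T0 + 1" using t T0 by (auto simp: t'_def)
    have D1: "data_on t' A V Z0 Z1 Z2" by (rule data_on_subset[OF D t'(5)])
    have "hnorm \<theta> \<beta> (?u x) \<le> M2" if "x \<in> {0..t'}" for x using gM[of x] that t' by (simp add: M2_def)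
    then have "trunc_sol M2 t' V Z0 Z1 Z2 \<phi> ?u"
      using solution_iff_trunc[where u = ?u, OF D1 M2 t'(4)] sol[OF t'(1,2)] unfolding e by blast
    moreover have "trunc_sol M2 t' V Z0 Z1 Z2 \<phi> w" using w CT_subset[OF wc t'(5)] t' by (auto simp: trunc_sol_def)
    ultimately show ?thesis using trunc_unique[OF M2 D1 _ _ t'(3)] by blast
  qed
  have T0i: "T0 \<in> {0..T0 + 1}" using T0 by simp
  have lim: "((\<lambda>t. hnorm \<theta> \<beta> (w t)) \<longlongrightarrow> hnorm \<theta> \<beta> (w T0)) (at T0 within {0..T0 + 1})"
    using CT_hnorm_cont[OF wc] T0i unfolding continuous_on_def by blast
  have wT: "hnorm \<theta> \<beta> (w T0) \<le> M1"
  proof (rule tendsto_upperbound)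
    show "((\<lambda>t. hnorm \<theta> \<beta> (w t)) \<longlongrightarrow> hnorm \<theta> \<beta> (w T0)) (at T0 within {0..<T0})"
      by (rule tendsto_within_subset[OF lim]) auto
    show "\<forall>\<^sub>F t in at T0 within {0..<T0}. hnorm \<theta> \<beta> (w t) \<le> M1"
      unfolding eventually_at_filter by (rule always_eventually) (use gM wu in auto)
    have "at T0 within {0..<T0} = at_left T0"
      by (rule at_within_nhd[of _ "{0<..}"]) (use T0 in auto)
    then show "at T0 within {0..<T0} \<noteq> bot" by simp
  qed
  have "\<forall>\<^sub>F t in at T0 within {0..T0 + 1}. hnorm \<theta> \<beta> (w t) < M2"
    by (rule order_tendstoD(2)[OF lim]) (use wT in \<open>simp add: M2_def\<close>)
  then obtain d where d: "d > 0" "\<And>t. t \<in> {0..T0 + 1} \<Longrightarrow> t \<noteq> T0 \<Longrightarrow> dist t T0 < d \<Longrightarrow> hnorm \<theta> \<beta> (w t) < M2"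
    unfolding eventually_at by blast
  define T1 where "T1 = T0 + min 1 (d / 2)"
  have T1: "T0 < T1" "T1 \<le> T0 + 1" "0 \<le> T1" "0 < T1" using d T0 by (auto simp: T1_def)
  have wM: "hnorm \<theta> \<beta> (w t) \<le> M2" if t: "t \<in> {0..T1}" for t
  proof -
    consider "t < T0" | "t = T0" | "T0 < t" by linarith
    then show ?thesis
    proof cases
      case 1 then show ?thesis using gM[of t] wu[of t] t by (simp add: M2_def)
    next
      case 2 then show ?thesis using wT by (simp add: M2_def)
    next
      case 3
      have "dist t T0 < d" using 3 t d(1) by (auto simp: T1_def dist_real_def)
      then show ?thesis using d(2)[of t] 3 t T1 by auto
    qed
  qed
  have "trunc_sol M2 T1 V Z0 Z1 Z2 \<phi> w" using w CT_subset[OF wc T1(2)] T1 by (auto simp: trunc_sol_def)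
  then have "solution \<theta> \<epsilon> T1 \<Z> \<phi> w"
    unfolding e using solution_iff_trunc[where u = w, OF data_on_subset[OF D T1(2)] M2 T1(3) wM] by blast
  then have "ereal T1 \<le> Tmax \<Z> \<phi>" by (rule Tmax_upper) (rule T1(4))
  then show False using T1(1) unfolding Te by simp
qed

end

section \<open>The equation driven by smooth noise\<close>

lemma fcoef_arith:
  assumes "continuous_on UNIV f" "continuous_on UNIV g"
  shows "fcoef (\<lambda>x. f x + g x) k = fcoef f k + fcoef g k" "fcoef (\<lambda>x. f x - g x) k = fcoef f k - fcoef g k"
  using assms by (auto simp: fcoef_eq_cfc intro!: cfc_add cfc_diff continuous_intros)

lemma fcoef_scale: "fcoef (\<lambda>x. a * f x) k = of_real a * fcoef f k"
  by (simp add: fcoef_eq_cfc cfc_scale)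

lemma fcoef_sum:
  assumes "\<And>i. i \<in> I \<Longrightarrow> continuous_on UNIV (f i)" "finite I"
  shows "fcoef (\<lambda>x. \<Sum>i\<in>I. f i x) k = (\<Sum>i\<in>I. fcoef (f i) k)"
  unfolding fcoef_eq_cfc of_real_sum by (rule cfc_sum) (use assms in \<open>auto intro!: continuous_intros\<close>)

definition cper :: "(real^3 \<Rightarrow> real) \<Rightarrow> bool" where
  "cper f \<longleftrightarrow> continuous_on UNIV f \<and> per f"

lemma cper_arith:
  "cper f \<Longrightarrow> cper g \<Longrightarrow> cper (\<lambda>x. f x + g x)"
  "cper f \<Longrightarrow> cper g \<Longrightarrow> cper (\<lambda>x. f x - g x)"
  "cper f \<Longrightarrow> cper g \<Longrightarrow> cper (\<lambda>x. f x * g x)"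
  "cper f \<Longrightarrow> cper (\<lambda>x. f x ^ n)"
  "cper f \<Longrightarrow> cper (\<lambda>x. exp (f x))"
  "cper (\<lambda>x. c)"
  "(\<And>i. cper (h i)) \<Longrightarrow> cper (\<lambda>x. \<Sum>i\<in>(UNIV :: 3 set). h i x)"
  unfolding cper_def per_def by (auto intro!: continuous_intros)

lemma cper_smooth: assumes "smooth_torus f" shows "cper f" "cper (\<lambda>x. grad f x $ i)"
  using smooth_torusD[OF assms] smooth_torusD(1,2)[OF smooth_torusD(4)[OF assms]] by (auto simp: cper_def grad_def)

lemma grad_inner: "grad f x \<bullet> grad g x = (\<Sum>i\<in>UNIV. grad f x $ i * grad g x $ i)"
  by (simp add: inner_vec_def)

lemma cper_coefficients:
  assumes "smooth_torus Z" "smooth_torus V" "smooth_torus W" "smooth_torus Y"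
  shows "cper (Z0fun b Z V W Y)" "cper (Z1fun b Z V W Y)" "cper (Z2fun Z V W Y)"
proof -
  note c = cper_smooth[OF assms(1)] cper_smooth[OF assms(2)] cper_smooth[OF assms(3)] cper_smooth[OF assms(4)]
  show "cper (Z0fun b Z V W Y)" unfolding Z0fun_def[abs_def] pfun_def grad_inner by (intro cper_arith c)
  show "cper (Z1fun b Z V W Y)" unfolding Z1fun_def[abs_def] pfun_def grad_inner by (intro cper_arith c)
  show "cper (Z2fun Z V W Y)" unfolding Z2fun_def[abs_def] pfun_def grad_inner by (intro cper_arith c)
qed

text \<open>Substitute \<open>e\<^sup>-\<^sup>3\<^sup>V (u + Y) - W = e\<^sup>-\<^sup>3\<^sup>V u + p\<close> and expand in powers of \<open>u\<close>.\<close>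
lemma nonlinearity_expansion:
  fixes z v w y q m g h b s :: real
  shows "(- 3 * v + 9 * (g - b / 3)) * (q + y) - 6 * s - 6 * (h - b * exp (3 * v) * w)
     - exp (3 * v) * (3 * z * (exp (- 3 * v) * (q + y) - w)\<^sup>2 + (exp (- 3 * v) * (q + y) - w) ^ 3)
   = - 6 * s - exp (- 6 * v) * q ^ 3 + (- 3 * exp (- 3 * v) * (z + (exp (- 3 * v) * y - w))) * q\<^sup>2
     + (- 3 * v + 9 * (g - b / 3) - 6 * z * (exp (- 3 * v) * y - w) - 3 * (exp (- 3 * v) * y - w)\<^sup>2) * q
     + ((- 3 * v + 9 * (g - b / 3)) * y - 6 * (h - b * exp (3 * v) * w)
       - exp (3 * v) * (3 * z * (exp (- 3 * v) * y - w)\<^sup>2 + (exp (- 3 * v) * y - w) ^ 3))"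
proof -
  define E F p where "E = exp (3 * v)" and "F = exp (- 3 * v)" and "p = F * y - w"
  have EF: "E * F = 1" by (simp add: E_def F_def exp_add[symmetric])
  have F2: "exp (- 6 * v) = F * F" by (simp add: F_def exp_add[symmetric])
  have p: "F * (q + y) - w = F * q + p" by (simp add: p_def algebra_simps)
  have "E * (3 * z * (F * q + p)\<^sup>2 + (F * q + p) ^ 3)
      = 3 * z * ((E * F) * F * q\<^sup>2 + 2 * (E * F) * p * q + E * p\<^sup>2)
        + ((E * F) * F\<^sup>2 * q ^ 3 + 3 * (E * F) * F * p * q\<^sup>2 + 3 * (E * F) * p\<^sup>2 * q + E * p ^ 3)"
    by (simp add: power2_eq_square power3_eq_cube algebra_simps)
  then have "E * (3 * z * (F * q + p)\<^sup>2 + (F * q + p) ^ 3)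
      = 3 * z * (F * q\<^sup>2 + 2 * p * q + E * p\<^sup>2) + (F\<^sup>2 * q ^ 3 + 3 * F * p * q\<^sup>2 + 3 * p\<^sup>2 * q + E * p ^ 3)"
    unfolding EF by simp
  then show ?thesis unfolding F2 E_def[symmetric] F_def[symmetric] p p_def[symmetric]
    by (simp add: power2_eq_square algebra_simps)
qed

context equation_frame
begin

lemma pval_coef: "cper f \<Longrightarrow> pval \<theta> (fcoef f) = f"
  unfolding cper_def by (rule pval_fcoef) auto

lemma dprod_coef: "cper f \<Longrightarrow> cper g \<Longrightarrow> dprod \<theta> (fcoef f) (fcoef g) = fcoef (\<lambda>x. f x * g x)"
  unfolding cper_def by (rule dprod_cont) auto

text \<open>For smooth noise all products are pointwise products of continuous functions.\<close>
lemma rhs_expand: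
  assumes sm: "smooth_torus Z" "smooth_torus V" "smooth_torus W" "smooth_torus Y" and u: "u \<in> Hoelder \<theta> \<beta>"
  shows "rhs \<theta> (fcoef V) (fcoef (Z0fun b Z V W Y)) (fcoef (Z1fun b Z V W Y)) (fcoef (Z2fun Z V W Y)) u
    = fcoef (rhs_unexpanded \<theta> b Z V W Y u)"
proof
  fix k
  have bu: "besov \<beta> (hnorm \<theta> \<beta> u) u" by (rule finite_norm_besov[OF Hoelder_fin[OF u]])
  have b0: "\<beta> > 0" and b1: "\<beta> - 1 > 0" using eps by auto
  define q where "q = pval \<theta> u"
  define dq where "dq i = pval \<theta> (dpartial i u)" for i
  have q: "cper q" "fcoef q = u"
    unfolding q_def cper_def using pval_cont[OF bu b0] pval_per[OF bu b0] fcoef_pval[OF bu b0] by auto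
  have dq: "cper (dq i)" "fcoef (dq i) = dpartial i u" for i
    unfolding dq_def cper_def using pval_cont[OF besov_dpartial[OF bu] b1] pval_per[OF besov_dpartial[OF bu] b1]
      fcoef_pval[OF besov_dpartial[OF bu] b1] by auto
  note cs = cper_smooth[OF sm(1)] cper_smooth[OF sm(2)] cper_smooth[OF sm(3)] cper_smooth[OF sm(4)]
  note cz = cper_coefficients[OF sm]
  have dV: "dpartial i (fcoef V) = fcoef (\<lambda>x. grad V x $ i)" for i
    unfolding fcoef_partial[OF sm(2), symmetric] by (simp add: grad_def)
  have cc: "continuous_on UNIV f" if "cper f" for f using that by (simp add: cper_def)
  let ?A = "\<lambda>x. \<Sum>i\<in>UNIV. grad V x $ i * dq i x"
  let ?B = "\<lambda>x. exp (- 6 * V x) * q x ^ 3"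
  let ?C = "\<lambda>x. Z2fun Z V W Y x * (q x)\<^sup>2"
  let ?D = "\<lambda>x. Z1fun b Z V W Y x * q x"
  let ?E = "Z0fun b Z V W Y"
  have pA: "cper ?A" and pB: "cper ?B" and pC: "cper ?C" and pD: "cper ?D"
    by (intro cper_arith cs cz q dq)+
  have pA6: "cper (\<lambda>x. - 6 * ?A x)" by (intro cper_arith pA)
  have 1: "(\<Sum>i\<in>UNIV. dprod \<theta> (dpartial i (fcoef V)) (dpartial i u) k) = fcoef ?A k"
  proof -
    have "dprod \<theta> (dpartial i (fcoef V)) (dpartial i u) k = fcoef (\<lambda>x. grad V x $ i * dq i x) k" for i
      unfolding dV dq(2)[symmetric] by (rule fun_cong[OF dprod_coef[OF cs(4) dq(1)]])
    then show ?thesis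
      by (subst fcoef_sum) (auto intro!: cc cper_arith cs dq)
  qed
  have 2: "dprod \<theta> (fcoef (Z2fun Z V W Y)) (fcoef (\<lambda>x. (q x)\<^sup>2)) k = fcoef ?C k"
    by (rule fun_cong[OF dprod_coef[OF cz(3) cper_arith(4)[OF q(1)]]])
  have 3: "dprod \<theta> (fcoef (Z1fun b Z V W Y)) u k = fcoef ?D k"
    using fun_cong[OF dprod_coef[OF cz(2) q(1)]] unfolding q(2) .
  have 4: "pval \<theta> (fcoef V) = V" by (rule pval_coef[OF cs(3)])
  have "rhs \<theta> (fcoef V) (fcoef ?E) (fcoef (Z1fun b Z V W Y)) (fcoef (Z2fun Z V W Y)) u k
      = - 6 * fcoef ?A k - fcoef ?B k + fcoef ?C k + fcoef ?D k + fcoef ?E k"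
    unfolding rhs_def 4 q_def[symmetric] 1 2 3 ..
  also have "\<dots> = fcoef (\<lambda>x. - 6 * ?A x - ?B x + ?C x + ?D x + ?E x) k"
  proof -
    have a: "fcoef (\<lambda>x. - 6 * ?A x) k = - 6 * fcoef ?A k" using fcoef_scale[of "-6" ?A k] by simp
    have p1: "cper (\<lambda>x. - 6 * ?A x - ?B x)" by (rule cper_arith(2)[OF pA6 pB])
    have p2: "cper (\<lambda>x. - 6 * ?A x - ?B x + ?C x)" by (rule cper_arith(1)[OF p1 pC])
    have p3: "cper (\<lambda>x. - 6 * ?A x - ?B x + ?C x + ?D x)" by (rule cper_arith(1)[OF p2 pD])
    show ?thesis
      unfolding fcoef_arith(1)[OF cc[OF p3] cc[OF cz(1)]] fcoef_arith(1)[OF cc[OF p2] cc[OF pD]]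
        fcoef_arith(1)[OF cc[OF p1] cc[OF pC]] fcoef_arith(2)[OF cc[OF pA6] cc[OF pB]] a ..
  qed
  also have "(\<lambda>x. - 6 * ?A x - ?B x + ?C x + ?D x + ?E x) = rhs_unexpanded \<theta> b Z V W Y u"
    unfolding rhs_unexpanded_def Z0fun_def Z1fun_def Z2fun_def pfun_def q_def dq_def
    by (rule ext) (rule nonlinearity_expansion[symmetric])
  finally show "rhs \<theta> (fcoef V) (fcoef ?E) (fcoef (Z1fun b Z V W Y)) (fcoef (Z2fun Z V W Y)) u k
      = fcoef (rhs_unexpanded \<theta> b Z V W Y u) k" .
qed

lemma scheme_equation:
  assumes S: "noise_scheme M \<xi> S" and w: "\<omega> \<in> space M" and h: "\<eta> > 0"
  shows "solution_unexpanded \<theta> \<epsilon> T (cb S \<eta>) (fZ S \<eta> \<omega>) (fV S \<eta> \<omega>) (fW S \<eta> \<omega>) (fY S \<eta> \<omega>) \<phi> u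
    \<longleftrightarrow> solution \<theta> \<epsilon> T (scheme_zdata S \<eta> \<omega>) \<phi> u"
proof -
  have Z: "smooth_torus (fZ S \<eta> \<omega> t)" for t
    using S w h unfolding noise_scheme_def stationary_solution_def by blast
  have "tree_equations (ca S \<eta>) (cb S \<eta>) (fZ S \<eta> \<omega>) (fV S \<eta> \<omega>) (fW S \<eta> \<omega>) (fY S \<eta> \<omega>)"
    using S w h unfolding noise_scheme_def by blast
  then have VWY: "smooth_torus (fV S \<eta> \<omega> t)" "smooth_torus (fW S \<eta> \<omega> t)" "smooth_torus (fY S \<eta> \<omega> t)" if "t \<ge> 0" for t
    using that unfolding tree_equations_def by blast+
  have "mild T \<phi> (\<lambda>t. rhs \<theta> (fcoef (fV S \<eta> \<omega> t)) (scheme_Z0 S \<eta> \<omega> t) (scheme_Z1 S \<eta> \<omega> t) (scheme_Z2 S \<eta> \<omega> t) (u t)) u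
      \<longleftrightarrow> mild T \<phi> (\<lambda>t. fcoef (rhs_unexpanded \<theta> (cb S \<eta>) (fZ S \<eta> \<omega> t) (fV S \<eta> \<omega> t) (fW S \<eta> \<omega> t) (fY S \<eta> \<omega> t) (u t))) u"
    if u: "u \<in> CT \<theta> \<beta> T"
  proof (rule mild_cong)
    fix t assume t: "t \<in> {0..T}"
    then have t0: "t \<ge> 0" by simp
    show "rhs \<theta> (fcoef (fV S \<eta> \<omega> t)) (scheme_Z0 S \<eta> \<omega> t) (scheme_Z1 S \<eta> \<omega> t) (scheme_Z2 S \<eta> \<omega> t) (u t) =
      fcoef (rhs_unexpanded \<theta> (cb S \<eta>) (fZ S \<eta> \<omega> t) (fV S \<eta> \<omega> t) (fW S \<eta> \<omega> t) (fY S \<eta> \<omega> t) (u t))"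
      unfolding scheme_Z0_def scheme_Z1_def scheme_Z2_def
      by (rule rhs_expand[OF Z VWY[OF t0] CT_Hoelder[OF u t]])
  qed
  then show ?thesis unfolding solution_unexpanded_def scheme_zdata_def solution.simps by blast
qed

lemma realization_converges:
  assumes "convergent_realization \<theta> S \<omega> L"
  shows "converges \<theta> 1 (\<lambda>\<eta> t. fcoef (fV S \<eta> \<omega> t)) (lV L)" "converges \<theta> (- 1/2) (\<lambda>\<eta>. scheme_Z0 S \<eta> \<omega>) (lZ0 L)"
    "converges \<theta> (- 1/2) (\<lambda>\<eta>. scheme_Z1 S \<eta> \<omega>) (lZ1 L)" "converges \<theta> (- 1/2) (\<lambda>\<eta>. scheme_Z2 S \<eta> \<omega>) (lZ2 L)"
  using assms unfolding convergent_realization_def Let_def by blast+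

lemma convergesD:
  assumes "converges \<theta> \<alpha> f g" "\<epsilon>' > 0" "T > 0"
  shows "\<And>\<eta>. \<eta> > 0 \<Longrightarrow> f \<eta> \<in> CT \<theta> (\<alpha> - \<epsilon>') T" "g \<in> CT \<theta> (\<alpha> - \<epsilon>') T"
    "((\<lambda>\<eta>. CT_norm \<theta> (\<alpha> - \<epsilon>') T (\<lambda>t. f \<eta> t - g t)) \<longlongrightarrow> 0) (at_right 0)"
  using assms unfolding converges_def by blast+

lemma scheme_in_zspace:
  assumes "convergent_realization \<theta> S \<omega> L" "\<eta> > 0" shows "scheme_zdata S \<eta> \<omega> \<in> (\<Inter>T\<in>{0<..}. zspace \<theta> T)"
  unfolding scheme_zdata_def zspace_def
  using convergesD(1)[OF realization_converges(1)[OF assms(1)]] convergesD(1)[OF realization_converges(2)[OF assms(1)]]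
    convergesD(1)[OF realization_converges(3)[OF assms(1)]] convergesD(1)[OF realization_converges(4)[OF assms(1)]] assms(2)
  by simp

lemma limit_in_zspace:
  assumes "convergent_realization \<theta> S \<omega> L" shows "limit_zdata L \<in> (\<Inter>T\<in>{0<..}. zspace \<theta> T)"
  unfolding limit_zdata_def zspace_def
  using convergesD(2)[OF realization_converges(1)[OF assms(1)]] convergesD(2)[OF realization_converges(2)[OF assms(1)]]
    convergesD(2)[OF realization_converges(3)[OF assms(1)]] convergesD(2)[OF realization_converges(4)[OF assms(1)]]
  by simp

lemma zdist_tendsto:
  assumes S: "convergent_realization \<theta> S \<omega> L" and e: "\<epsilon>' > 0" and T: "T > 0"
  shows "((\<lambda>\<eta>. zdist \<theta> \<epsilon>' T (scheme_zdata S \<eta> \<omega>) (limit_zdata L)) \<longlongrightarrow> 0) (at_right 0)"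
  using tendsto_add[OF tendsto_add[OF tendsto_add[OF
      convergesD(3)[OF realization_converges(1)[OF S] e T] convergesD(3)[OF realization_converges(2)[OF S] e T]]
      convergesD(3)[OF realization_converges(3)[OF S] e T]] convergesD(3)[OF realization_converges(4)[OF S] e T]]
  unfolding scheme_zdata_def limit_zdata_def zdist.simps by simp

text \<open>Continuous dependence is applied at a time \<open>T'\<close> strictly between \<open>T\<close> and the lifetime of the limit, in order
  that the lifetimes of the approximations exceed \<open>T\<close> strictly.\<close>
lemma convergence:
  assumes S: "convergent_realization \<theta> S \<omega> L" and phi: "\<phi> \<in> Hoelder \<theta> \<beta>" and T: "0 < T" "ereal T < Tmax (limit_zdata L) \<phi>"
  shows "\<forall>\<^sub>F \<eta> in at_right 0. ereal T < Tmax (scheme_zdata S \<eta> \<omega>) \<phi>"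
    "((\<lambda>\<eta>. CT_norm \<theta> \<beta> T (\<lambda>t. msol (scheme_zdata S \<eta> \<omega>) \<phi> t - msol (limit_zdata L) \<phi> t)) \<longlongrightarrow> 0) (at_right 0)"
proof -
  let ?L = "limit_zdata L" and ?Z = "\<lambda>\<eta>. scheme_zdata S \<eta> \<omega>"
  have k: "\<kappa> > 0" using eps by simp
  (* Some room above T is needed for the strict inequality between T and the lifetimes. *)
  obtain T' where T': "T < T'" "ereal T' < Tmax ?L \<phi>"
    using ereal_dense2[OF T(2)] by auto
  have T'0: "0 < T'" using T T' by linarith
  have LZ: "?L \<in> zspace \<theta> T'" using limit_in_zspace[OF S] T'0 by blast
  have Ls: "solution \<theta> \<epsilon> T' ?L \<phi> (msol ?L \<phi>)" by (rule msol_solution(1)[OF limit_in_zspace[OF S] T'0 T'(2)])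
  have "\<phi> - \<phi> = (\<lambda>k. 0)" by (simp add: fun_eq_iff)
  then have h0: "hnorm \<theta> \<beta> (\<phi> - \<phi>) \<le> 0" using hnorm_le[OF besov_zero[of \<beta>]] by simp
  have main: "\<forall>\<^sub>F \<eta> in at_right 0. ereal T < Tmax (?Z \<eta>) \<phi> \<and>
      0 \<le> CT_norm \<theta> \<beta> T (\<lambda>t. msol (?Z \<eta>) \<phi> t - msol ?L \<phi> t) \<and> CT_norm \<theta> \<beta> T (\<lambda>t. msol (?Z \<eta>) \<phi> t - msol ?L \<phi> t) < \<delta>"
    if d: "\<delta> > 0" for \<delta>
  proof -
    obtain q where q: "q > 0" "\<And>\<Z>'. \<Z>' \<in> zspace \<theta> T' \<Longrightarrow> zdist \<theta> \<kappa> T' \<Z>' ?L < q \<Longrightarrow>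
        \<exists>u'. unique_solution \<theta> \<epsilon> T' \<Z>' \<phi> u' \<and> CT_norm \<theta> \<beta> T' (\<lambda>t. u' t - msol ?L \<phi> t) < \<delta>"
      using dependence[OF LZ phi T'0 Ls d] phi h0 by (meson le_less_trans)
    have "\<forall>\<^sub>F \<eta> in at_right 0. zdist \<theta> \<kappa> T' (?Z \<eta>) ?L < q"
      by (rule order_tendstoD(2)[OF zdist_tendsto[OF S k T'0] q(1)])
    moreover have "\<forall>\<^sub>F \<eta> in at_right (0::real). 0 < \<eta>" by (rule eventually_at_right_less)
    ultimately show ?thesis
    proof eventually_elim
      case (elim \<eta>)
      note ZZ = scheme_in_zspace[OF S elim(2)]
      have "?Z \<eta> \<in> zspace \<theta> T'" using ZZ T'0 by blast
      then obtain u' where u': "unique_solution \<theta> \<epsilon> T' (?Z \<eta>) \<phi> u'" "CT_norm \<theta> \<beta> T' (\<lambda>t. u' t - msol ?L \<phi> t) < \<delta>"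
        using q(2) elim(1) by blast
      then have s: "solution \<theta> \<epsilon> T' (?Z \<eta>) \<phi> u'" by (simp add: unique_solution_def)
      have le: "ereal T' \<le> Tmax (?Z \<eta>) \<phi>" by (rule Tmax_upper[OF s T'0])
      have "ereal T < ereal T'" using T' by simp
      then have 1: "ereal T < Tmax (?Z \<eta>) \<phi>" using le by (rule less_le_trans)
      have m: "msol (?Z \<eta>) \<phi> t = u' t" if "t \<in> {0..T'}" for t by (rule msol_eq[OF ZZ s that T'0])
      have C: "(\<lambda>t. u' t - msol ?L \<phi> t) \<in> CT \<theta> \<beta> T'" by (rule CT_diff[OF solution_CT[OF s] solution_CT[OF Ls]])
      have "CT_norm \<theta> \<beta> T (\<lambda>t. msol (?Z \<eta>) \<phi> t - msol ?L \<phi> t) \<le> CT_norm \<theta> \<beta> T' (\<lambda>t. u' t - msol ?L \<phi> t)"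
      proof (rule CT_norm_le)
        fix t assume "t \<in> {0..T}"
        then have t: "t \<in> {0..T'}" using T' by auto
        show "hnorm \<theta> \<beta> (msol (?Z \<eta>) \<phi> t - msol ?L \<phi> t) \<le> CT_norm \<theta> \<beta> T' (\<lambda>t. u' t - msol ?L \<phi> t)"
          unfolding m[OF t] by (rule hnorm_le_CT_norm[OF C t])
      qed (use T in simp)
      moreover have "0 \<le> CT_norm \<theta> \<beta> T (\<lambda>t. msol (?Z \<eta>) \<phi> t - msol ?L \<phi> t)"
        by (rule besov_CT_diff(2)[of _ _ _ _ 0])
          (use solution_CT[OF msol_solution(1)[OF ZZ T(1) 1]] solution_CT[OF msol_solution(1)[OF limit_in_zspace[OF S] T]] T in auto)
      ultimately show ?case using 1 u'(2) by linarith
    qed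
  qed
  show "\<forall>\<^sub>F \<eta> in at_right 0. ereal T < Tmax (?Z \<eta>) \<phi>"
    using main[OF zero_less_one] by (rule eventually_mono) blast
  show "((\<lambda>\<eta>. CT_norm \<theta> \<beta> T (\<lambda>t. msol (?Z \<eta>) \<phi> t - msol ?L \<phi> t)) \<longlongrightarrow> 0) (at_right 0)"
  proof (rule tendstoI)
    fix e :: real assume "e > 0"
    from main[OF this] show "\<forall>\<^sub>F \<eta> in at_right 0. dist (CT_norm \<theta> \<beta> T (\<lambda>t. msol (?Z \<eta>) \<phi> t - msol ?L \<phi> t)) 0 < e"
      by (rule eventually_mono) (simp add: dist_real_def)
  qed
qed

end

theorem theorem2p1:
  fixes \<epsilon> :: real
    and \<theta> :: "int \<Rightarrow> real^3 \<Rightarrow> real"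
    and M :: "'w measure"
    and \<xi> :: "'w \<Rightarrow> (real \<times> (real^3) \<Rightarrow> real) \<Rightarrow> real"
    and \<omega> :: 'w
    and \<S> :: "'w scheme set"
    and L :: limit_terms
  assumes eps: "0 < \<epsilon>" "\<epsilon> < 1/6"
    and partition: "dyadic_partition \<theta>"
    and noise: "prob_space M" "white_noise M \<xi>" "\<omega> \<in> space M"
    and schemes: "\<And>S. S \<in> \<S> \<Longrightarrow> noise_scheme M \<xi> S"
    and realization: "\<And>S. S \<in> \<S> \<Longrightarrow> convergent_realization \<theta> S \<omega> L"
  shows "\<exists>(Tstar :: zdata \<Rightarrow> coeffs \<Rightarrow> ereal) (sol :: zdata \<Rightarrow> coeffs \<Rightarrow> real \<Rightarrow> coeffs).
    (\<forall>\<Z>\<in>(\<Inter>T\<in>{0<..}. zspace \<theta> T). \<forall>\<phi>\<in>Hoelder \<theta> (3/2 - \<epsilon>).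
        0 < Tstar \<Z> \<phi> \<and>
        (\<forall>T>0. ereal T < Tstar \<Z> \<phi> \<longrightarrow>
           unique_solution \<theta> \<epsilon> T \<Z> \<phi> (sol \<Z> \<phi>) \<and>
           (\<forall>\<delta>>0. \<exists>\<epsilon>'>0. \<exists>r>0. \<forall>\<Z>'\<in>zspace \<theta> T. \<forall>\<phi>'\<in>Hoelder \<theta> (3/2 - \<epsilon>).
              zdist \<theta> \<epsilon>' T \<Z>' \<Z> < r \<longrightarrow> hnorm \<theta> (3/2 - \<epsilon>) (\<phi>' - \<phi>) < r \<longrightarrow>
              (\<exists>u'. unique_solution \<theta> \<epsilon> T \<Z>' \<phi>' u' \<and>
                 CT_norm \<theta> (3/2 - \<epsilon>) T (\<lambda>t. u' t - sol \<Z> \<phi> t) < \<delta>))) \<and>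
        (Tstar \<Z> \<phi> < \<infinity> \<longrightarrow>
           filterlim (\<lambda>t. hnorm \<theta> (3/2 - \<epsilon>) (sol \<Z> \<phi> t)) at_top
             (at_left (real_of_ereal (Tstar \<Z> \<phi>))))) \<and>
    (\<forall>S\<in>\<S>. \<forall>\<phi>\<in>Hoelder \<theta> (3/2 - \<epsilon>).
        (\<forall>\<eta>>0. scheme_zdata S \<eta> \<omega> \<in> (\<Inter>T\<in>{0<..}. zspace \<theta> T) \<and>
           (\<forall>T>0. \<forall>u.
              solution_unexpanded \<theta> \<epsilon> T (cb S \<eta>) (fZ S \<eta> \<omega>) (fV S \<eta> \<omega>) (fW S \<eta> \<omega>) (fY S \<eta> \<omega>) \<phi> u
              \<longleftrightarrow> solution \<theta> \<epsilon> T (scheme_zdata S \<eta> \<omega>) \<phi> u)) \<and>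
        limit_zdata L \<in> (\<Inter>T\<in>{0<..}. zspace \<theta> T) \<and>
        (\<forall>T>0. ereal T < Tstar (limit_zdata L) \<phi> \<longrightarrow>
           (\<forall>\<^sub>F \<eta> in at_right 0. ereal T < Tstar (scheme_zdata S \<eta> \<omega>) \<phi>) \<and>
           ((\<lambda>\<eta>. CT_norm \<theta> (3/2 - \<epsilon>) T
               (\<lambda>t. sol (scheme_zdata S \<eta> \<omega>) \<phi> t - sol (limit_zdata L) \<phi> t)) \<longlongrightarrow> 0) (at_right 0)))"
proof -
  obtain r R K where "lp_frame \<theta> r R K" using dyadic_partition_lp_frame[OF partition] by blast
  then interpret lp_frame \<theta> r R K .
  interpret equation_frame \<theta> r R K \<epsilon> by unfold_locales (rule eps)+
  have k: "\<kappa> > 0" using eps by simp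
  show ?thesis
  proof (intro exI[of _ Tmax] exI[of _ msol] conjI ballI allI impI)
    fix \<Z> \<phi> assume Z: "\<Z> \<in> (\<Inter>T\<in>{0<..}. zspace \<theta> T)" and phi: "\<phi> \<in> Hoelder \<theta> (3/2 - \<epsilon>)"
    show "0 < Tmax \<Z> \<phi>" by (rule Tmax_pos[OF Z phi])
    show "filterlim (\<lambda>t. hnorm \<theta> (3/2 - \<epsilon>) (msol \<Z> \<phi> t)) at_top (at_left (real_of_ereal (Tmax \<Z> \<phi>)))"
      if "Tmax \<Z> \<phi> < \<infinity>" by (rule blow_up[OF Z phi that])
    fix T :: real assume T: "0 < T" "ereal T < Tmax \<Z> \<phi>"
    show "unique_solution \<theta> \<epsilon> T \<Z> \<phi> (msol \<Z> \<phi>)" by (rule msol_solution(2)[OF Z T])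
    fix \<delta> :: real assume d: "\<delta> > 0"
    have "\<Z> \<in> zspace \<theta> T" using Z T by blast
    from k dependence[OF this phi T(1) msol_solution(1)[OF Z T] d]
    show "\<exists>\<epsilon>'>0. \<exists>r>0. \<forall>\<Z>'\<in>zspace \<theta> T. \<forall>\<phi>'\<in>Hoelder \<theta> (3/2 - \<epsilon>).
        zdist \<theta> \<epsilon>' T \<Z>' \<Z> < r \<longrightarrow> hnorm \<theta> (3/2 - \<epsilon>) (\<phi>' - \<phi>) < r \<longrightarrow>
        (\<exists>u'. unique_solution \<theta> \<epsilon> T \<Z>' \<phi>' u' \<and> CT_norm \<theta> (3/2 - \<epsilon>) T (\<lambda>t. u' t - msol \<Z> \<phi> t) < \<delta>)"
      by blast
  next
    fix S \<phi> assume S: "S \<in> \<S>" and phi: "\<phi> \<in> Hoelder \<theta> (3/2 - \<epsilon>)"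
    note conv = realization[OF S]
    show "scheme_zdata S \<eta> \<omega> \<in> (\<Inter>T\<in>{0<..}. zspace \<theta> T)" if "\<eta> > 0" for \<eta> by (rule scheme_in_zspace[OF conv that])
    show "limit_zdata L \<in> (\<Inter>T\<in>{0<..}. zspace \<theta> T)" by (rule limit_in_zspace[OF conv])
    show "solution_unexpanded \<theta> \<epsilon> T (cb S \<eta>) (fZ S \<eta> \<omega>) (fV S \<eta> \<omega>) (fW S \<eta> \<omega>) (fY S \<eta> \<omega>) \<phi> u
        \<longleftrightarrow> solution \<theta> \<epsilon> T (scheme_zdata S \<eta> \<omega>) \<phi> u" if "\<eta> > 0" for \<eta> T u
      by (rule scheme_equation[OF schemes[OF S] noise(3) that])
    fix T :: real assume T: "0 < T" "ereal T < Tmax (limit_zdata L) \<phi>"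
    show "\<forall>\<^sub>F \<eta> in at_right 0. ereal T < Tmax (scheme_zdata S \<eta> \<omega>) \<phi>"
      "((\<lambda>\<eta>. CT_norm \<theta> (3/2 - \<epsilon>) T (\<lambda>t. msol (scheme_zdata S \<eta> \<omega>) \<phi> t - msol (limit_zdata L) \<phi> t)) \<longlongrightarrow> 0) (at_right 0)"
      by (rule convergence[OF conv phi T])+
  qed
qed

end
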